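(* Let $K = \mathbb{Q}(\sqrt{d})$ be a real quadratic number field with $d = q_1q_2q_3q_4$, where $q_{1}, q_{2}, q_{3}, q_{4}$ are distinct primes with $q_1 \equiv 7 \pmod 8$ and $q_2 \equiv q_3 \equiv q_4 \equiv 3 \pmod 8$. Let $K' = \mathbb{Q}(\sqrt{2d})$ and $K_{1} = \mathbb{Q}(\sqrt{2},\sqrt{d})$. Then $A(K) \simeq \mathbb{Z}/2\mathbb{Z} \oplus \mathbb{Z}/2\mathbb{Z}$, $A(K') \simeq \mathbb{Z}/2\mathbb{Z} \oplus \mathbb{Z}/2\mathbb{Z} \oplus \mathbb{Z}/2\mathbb{Z}$ and $A(K_1) \simeq \mathbb{Z}/2\mathbb{Z} \oplus \mathbb{Z}/4\mathbb{Z}$ if one of the following choices of Legendre symbols holds: \begin{enumerate} \item $\left( \dfrac{q_1}{q_3}\right)=\left( \dfrac{q_2}{q_3}\right)=\left( \dfrac{q_4}{q_2}\right)=\left( \dfrac{q_4}{q_1}\right)=1$, $\left( \dfrac{q_4}{q_3}\right) =-1$; \item $\left( \dfrac{q_1}{q_3}\right)=\left( \dfrac{q_2}{q_3}\right)=\left( \dfrac{q_4}{q_2}\right)=\left( \dfrac{q_4}{q_1}\right)=-1$, $\left( \dfrac{q_4}{q_3}\right) =1$; \item $\left( \dfrac{q_1q_2}{q_3}\right)=-1$, $\left( \dfrac{q_1q_2}{q_4}\right)=-1$, $\left( \dfrac{q_2}{q_3}\right) = \left( \dfrac{q_1}{q_4}\right)= \left( \dfrac{q_3}{q_4}\right)$;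 \item $\left( \dfrac{q_1q_2}{q_3}\right)=1$, $\left( \dfrac{q_1q_2}{q_4}\right)=-1$, $\left( \dfrac{q_2}{q_3}\right) = \left( \dfrac{q_2}{q_4}\right)$, $\left( \dfrac{q_1}{q_2}\right)=\left( \dfrac{q_4}{q_3}\right)$; \item $\left( \dfrac{q_1q_2}{q_3}\right)=-1$, $\left( \dfrac{q_1q_2}{q_4}\right)=1$, $\left( \dfrac{q_2}{q_3}\right) = \left( \dfrac{q_1}{q_4}\right)$, $\left( \dfrac{q_1}{q_2}\right) = \left( \dfrac{q_3}{q_4}\right)$; \item $\left( \dfrac{q_1}{q_3}\right)=\left( \dfrac{q_2}{q_3}\right)= 1$, $\left( \dfrac{q_1}{q_4}\right)=1$, $\left( \dfrac{q_2}{q_4}\right)=-1$, $\left( \dfrac{q_1}{q_2}\right)=-1$; \item $\left( \dfrac{q_1}{q_3}\right)=\left( \dfrac{q_2}{q_3}\right)= -1$, $\left( \dfrac{q_1}{q_4}\right)=-1$, $\left( \dfrac{q_2}{q_4}\right)=1$, $\left( \dfrac{q_1}{q_2}\right)=1$, $\left( \dfrac{q_3}{q_4}\right)=1$; \item $\left( \dfrac{q_1}{q_3}\right)= 1$, $\left( \dfrac{q_2}{q_3}\right)= -1$, $\left( \dfrac{q_1}{q_4}\right)=1$, $\left( \dfrac{q_2}{q_4}\right)=1$, $\left( \dfrac{q_1}{q_2}\right)=-1$; \item $\left( \dfrac{q_1}{q_3}\right)= -1$, $\left( \dfrac{q_2}{q_3}\right)= 1$, $\left( \dfrac{q_1}{q_4}\right)=-1$,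 $\left( \dfrac{q_2}{q_4}\right)=-1$, $\left( \dfrac{q_1}{q_2}\right)=1$, $\left( \dfrac{q_3}{q_4}\right)=-1$. \end{enumerate}
   Context: For a number field $F$, $A(F)$ denotes the $2$-Sylow subgroup of the ideal class group of $F$. $\left(\dfrac{a}{p}\right)$ denotes the Legendre symbol for an odd prime $p$. *)

theory Defs
  imports
    "HOL-Algebra.Algebra"
    "HOL-Algebra.Algebraic_Closure_Type"
    "HOL-Number_Theory.Number_Theory"
    Complex_Main
begin

(* Number fields are subfields of the complex numbers. A subfield contains the rationals,
   so complex_adjoin S is the field Q(S). *)
definition complex_adjoin :: "complex set \<Rightarrow> complex set" where
  "complex_adjoin S = generate_field ring_of_type_algebra S"

definition ring_of_integers :: "complex set \<Rightarrow> complex set" where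
  "ring_of_integers F = {x \<in> F. algebraic_int x}"

(* The zero module is excluded. Closure under negation follows from closure under
   multiplication by -1, which is an integer of F. *)
definition fractional_ideal :: "complex set \<Rightarrow> complex set \<Rightarrow> bool" where
  "fractional_ideal F I \<longleftrightarrow>
     I \<subseteq> F \<and> 0 \<in> I \<and> I \<noteq> {0} \<and>
     (\<forall>x\<in>I. \<forall>y\<in>I. x + y \<in> I) \<and>
     (\<forall>r\<in>ring_of_integers F. \<forall>x\<in>I. r * x \<in> I) \<and>
     (\<exists>r\<in>ring_of_integers F. r \<noteq> 0 \<and> (\<forall>x\<in>I. r * x \<in> ring_of_integers F))"

(* ideal_prod I J consists of the finite sums of products x * y with x in I and y in J;
   nothing in its definition requires I and J to be contained in the ring of integers. *)
definition fractional_ideal_group :: "complex set \<Rightarrow> complex set monoid" where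
  "fractional_ideal_group F =
     \<lparr>carrier = {I. fractional_ideal F I},
      monoid.mult = ideal_prod ring_of_type_algebra,
      one = ring_of_integers F\<rparr>"

definition principal_fractional_ideals :: "complex set \<Rightarrow> complex set set" where
  "principal_fractional_ideals F = {(\<lambda>x. a * x) ` ring_of_integers F | a. a \<in> F \<and> a \<noteq> 0}"

definition ideal_class_group :: "complex set \<Rightarrow> complex set set monoid" where
  "ideal_class_group F = fractional_ideal_group F Mod principal_fractional_ideals F"

(* HOL-Algebra proves that Sylow subgroups exist but has no predicate for them. *)
definition is_sylow_subgroup :: "nat \<Rightarrow> ('a, 'b) monoid_scheme \<Rightarrow> 'a set \<Rightarrow> bool" where
  "is_sylow_subgroup p G H \<longleftrightarrow> subgroup H G \<and> card H = p ^ multiplicity p (Coset.order G)"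

(* The definite description is justified because the class group of a number field is finite
   and abelian, so its Sylow subgroups are unique. *)
definition two_class_group :: "complex set \<Rightarrow> complex set set monoid" where
  "two_class_group F =
     (ideal_class_group F)\<lparr>carrier := (THE H. is_sylow_subgroup 2 (ideal_class_group F) H)\<rparr>"

end

theory Submission
  imports Defs "Jordan_Normal_Form.Char_Poly"
begin

text \<open>
  The theorem is proved with ambiguous ideals instead of genus theory and without factoring ideals into primes. In a
  quadratic extension of a principal ideal domain whose unit norms are squares, Hilbert 90 shows that each
  class of order two contains an ideal \<open>J\<close> with \<open>J\<^sup>2 = (g)\<close>, where \<open>g\<close> divides the discriminant. For \<open>\<rat>(\<surd>d)\<close> and
  \<open>\<rat>(\<surd>(2d))\<close> this gives a class for every set of ramified primes. A principal or square class forces \<open>\<plusminus>\<close> the product of the set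
  to be a norm, hence conditions on Legendre symbols, and a fundamental solution of Pell's equation supplies one
  nontrivial relation. In the nine cases the symbols leave no room for further relations or for classes of order four.

  For \<open>K\<^sub>1 = \<rat>(\<surd>2, \<surd>d)\<close> with base \<open>\<rat>(\<surd>2)\<close>, the square of a class is a product of classes coming from \<open>K\<close> and \<open>K'\<close>,
  so the class group is finite and its 2-part has exponent dividing four. The relations in \<open>K\<close> and \<open>K'\<close> leave at most two
  ambiguous classes from rational integers, and a prime \<open>\<pi>\<close> of \<open>\<rat>(\<surd>2)\<close> above \<open>q\<^sub>1\<close> contributes one more generator, which is not a square
  since \<open>\<plusminus>q\<^sub>1\<close> is not a norm from \<open>K\<close>. Finally an ideal above a prime \<open>r\<close> with suitable Legendre symbols shows that the 2-part
  is not elementary. Such an \<open>r\<close> exists by Mertens' argument for real characters, which needs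
  \<open>L(1, \<chi>) \<noteq> 0\<close>.
\<close>

subsection \<open>Closure properties of algebraic integers\<close>

text \<open>For the biquadratic field the ambiguous classes are only bounded from above: at most
  four classes of order dividing two, and a 2-part of exponent dividing four. One involution that is
  not a square and one element of order four then leave a single group. Both are detected by one
  invariant of a class, the rational norm of an ideal up to sign and up to norms from
  \<open>K\<close>.

  The obstacle is to speak of ramified primes without prime ideals. Squarefree generators become
  elements generating a radical ideal, the absence of unramified primes becomes the divisibility of
  \<open>(w - gal w) ^ 2\<close> by the generator, and ideals are identified by cancelling squares.

  The congruences have two roles. Modulo 4 they make -1 a nonresidue, so -1 is not a norm from
  either quadratic field; over \<open>Q(sqrt 2)\<close> one also needs -2 to be a nonresidue modulo
  \<open>q1\<close>. Modulo 8 they make \<open>q1\<close> the only one of the four primes that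
  splits in \<open>Q(sqrt 2)\<close>, whence a single further ambiguous generator.\<close>

definition int_span :: "complex set \<Rightarrow> complex set" where
  "int_span B = {\<Sum>b\<in>B. of_int (c b) * b | c. True}"

lemma int_span_0: "0 \<in> int_span B"
  unfolding int_span_def by (rule CollectI, rule exI[of _ "\<lambda>_. 0"]) simp

lemma int_span_base: "finite B \<Longrightarrow> b \<in> B \<Longrightarrow> b \<in> int_span B"
  unfolding int_span_def by (rule CollectI, rule exI[of _ "\<lambda>x. if x = b then 1 else 0"])
    (auto simp: if_distrib[of "\<lambda>x. of_int x * _"] cong: if_cong)

lemma int_span_add: "x \<in> int_span B \<Longrightarrow> y \<in> int_span B \<Longrightarrow> x + y \<in> int_span B"
  unfolding int_span_def
proof clarsimp
  fix c d :: "complex \<Rightarrow> int"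
  show "\<exists>e. (\<Sum>b\<in>B. of_int (c b) * b) + (\<Sum>b\<in>B. of_int (d b) * b) = (\<Sum>b\<in>B. of_int (e b) * b)"
    by (rule exI[of _ "\<lambda>b. c b + d b"]) (simp add: algebra_simps sum.distrib)
qed

lemma int_span_of_int: "x \<in> int_span B \<Longrightarrow> of_int k * x \<in> int_span B"
  unfolding int_span_def
proof clarsimp
  fix c :: "complex \<Rightarrow> int"
  show "\<exists>e. of_int k * (\<Sum>b\<in>B. of_int (c b) * b) = (\<Sum>b\<in>B. of_int (e b) * b)"
    by (rule exI[of _ "\<lambda>b. k * c b"]) (simp add: algebra_simps sum_distrib_left)
qed

lemma int_span_sum: "(\<And>i. i \<in> I \<Longrightarrow> f i \<in> int_span B) \<Longrightarrow> sum f I \<in> int_span B"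
  by (induction I rule: infinite_finite_induct) (auto simp: int_span_0 int_span_add)

text \<open>A number is integral iff it maps some nonzero finitely generated additive group into
  itself. In this form closure under sums and products is immediate once both numbers act on a
  common group.\<close>

definition stabilises :: "complex \<Rightarrow> complex set \<Rightarrow> bool" where
  "stabilises x B \<longleftrightarrow> (\<forall>y\<in>int_span B. x * y \<in> int_span B)"

lemma stabilisesI:
  assumes "\<And>b. b \<in> B \<Longrightarrow> x * b \<in> int_span B"
  shows "stabilises x B"
  unfolding stabilises_def
proof
  fix y assume "y \<in> int_span B"
  then obtain c where y: "y = (\<Sum>b\<in>B. of_int (c b) * b)" by (auto simp: int_span_def)
  have "x * y = (\<Sum>b\<in>B. of_int (c b) * (x * b))" by (simp add: y sum_distrib_left algebra_simps)
  also have "\<dots> \<in> int_span B" by (intro int_span_sum int_span_of_int assms)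
  finally show "x * y \<in> int_span B" .
qed

lemma stabilises_add: "stabilises x B \<Longrightarrow> stabilises y B \<Longrightarrow> stabilises (x + y) B"
  by (auto simp: stabilises_def ring_distribs intro: int_span_add)

lemma stabilises_mult: "stabilises x B \<Longrightarrow> stabilises y B \<Longrightarrow> stabilises (x * y) B"
  by (auto simp: stabilises_def mult.assoc)

lemma stabilises_of_int: "stabilises (of_int k) B"
  by (auto simp: stabilises_def int_span_of_int)

text \<open>The vector \<open>v\<close> of generators is an eigenvector, with eigenvalue
  \<open>x\<close>, of the integer matrix \<open>A\<close> that expresses multiplication by
  \<open>x\<close>; hence \<open>x\<close> is a root of the monic \<open>char_poly A\<close>. The
  generators may be linearly dependent, as only \<open>v \<noteq> 0\<close> matters.\<close>

lemma stabilises_imp_algebraic_int: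
  assumes fin: "finite B" and nz: "b0 \<in> B" "b0 \<noteq> 0" and st: "stabilises x B"
  shows "algebraic_int x"
proof -
  obtain bs where bs: "set bs = B" "distinct bs" using fin finite_distinct_list by blast
  define n where "n = length bs"
  have "\<exists>c. x * b = (\<Sum>b\<in>B. of_int (c b) * b)" if "b \<in> B" for b
    using st int_span_base[OF fin that] by (auto simp: stabilises_def int_span_def)
  then obtain c where c: "\<And>b. b \<in> B \<Longrightarrow> x * b = (\<Sum>b'\<in>B. of_int (c b b') * b')" by metis
  define A :: "int mat" where "A = mat n n (\<lambda>(i,j). c (bs ! i) (bs ! j))"
  define v :: "complex vec" where "v = vec n (\<lambda>i. bs ! i)"
  have A: "A \<in> carrier_mat n n" by (simp add: A_def)
  have sum_bs: "(\<Sum>j<n. f (bs ! j)) = sum f B" for f :: "complex \<Rightarrow> complex"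
    using bs sum.reindex_bij_betw[OF bij_betw_nth[of bs "{..<n}" B], of f] by (simp add: n_def)
  let ?A = "map_mat of_int A :: complex mat"
  have "?A *\<^sub>v v = x \<cdot>\<^sub>v v"
  proof (rule eq_vecI)
    fix i assume i: "i < dim_vec (x \<cdot>\<^sub>v v)"
    then have i: "i < n" by (simp add: v_def)
    have "(?A *\<^sub>v v) $ i = (\<Sum>j<n. of_int (c (bs ! i) (bs ! j)) * bs ! j)"
      using i by (simp add: A_def v_def scalar_prod_def atLeast0LessThan)
    also have "\<dots> = x * bs ! i"
      unfolding sum_bs[of "\<lambda>b'. of_int (c (bs ! i) b') * b'"]
      using bs i by (intro c[symmetric]) (auto simp: n_def)
    finally show "(?A *\<^sub>v v) $ i = (x \<cdot>\<^sub>v v) $ i" using i by (simp add: v_def)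
  qed (simp add: A_def v_def)
  moreover have "v \<noteq> 0\<^sub>v n"
  proof
    assume "v = 0\<^sub>v n"
    obtain i where "i < n" "bs ! i = b0" using nz bs by (metis in_set_conv_nth n_def)
    then have "v $ i = b0" by (simp add: v_def)
    then show False using \<open>v = 0\<^sub>v n\<close> nz \<open>i < n\<close> by simp
  qed
  ultimately have "eigenvalue ?A x"
    using A unfolding eigenvalue_def eigenvector_def
    by (intro exI[of _ v]) (auto simp: v_def)
  then have "poly (char_poly ?A) x = 0"
    using eigenvalue_root_char_poly[of ?A n x] A by simp
  moreover have "char_poly ?A = map_poly of_int (char_poly A)"
    by (rule of_int_hom.char_poly_hom[OF A])
  ultimately have "poly (map_poly of_int (char_poly A)) x = 0"
    by simp
  then show ?thesis
    using degree_monic_char_poly[OF A] algebraic_int_altdef_ipoly[of x] by auto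
qed

text \<open>Multiplying \<open>B\<close> by the powers of \<open>x\<close> below \<open>m\<close>
  works because \<open>rel\<close> rewrites the only overflowing power \<open>x ^ m\<close>. Letting
  the coefficients be any numbers that stabilise \<open>B\<close>, and not just integers, also
  yields transitivity of integrality.\<close>

lemma stabilises_adjoin:
  assumes fin: "finite B" and m: "m > 0" and rel: "x ^ m = (\<Sum>i<m. a i * x ^ i)"
    and a: "\<And>i. i < m \<Longrightarrow> stabilises (a i) B"
  defines "B' \<equiv> (\<lambda>(i, b). x ^ i * b) ` ({..<m} \<times> B)"
  shows "finite B'" "B \<subseteq> B'" "stabilises x B'" "\<And>y. stabilises y B \<Longrightarrow> stabilises y B'"
proof -
  show fin': "finite B'" using fin by (simp add: B'_def)
  show "B \<subseteq> B'" using m by (force simp: B'_def)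
  have mono: "x ^ i * y \<in> int_span B'" if "i < m" "y \<in> int_span B" for i y
  proof -
    obtain c where y: "y = (\<Sum>b\<in>B. of_int (c b) * b)" using \<open>y \<in> _\<close> by (auto simp: int_span_def)
    have "x ^ i * y = (\<Sum>b\<in>B. of_int (c b) * (x ^ i * b))" by (simp add: y sum_distrib_left algebra_simps)
    also have "\<dots> \<in> int_span B'"
      using that by (intro int_span_sum int_span_of_int int_span_base fin') (auto simp: B'_def)
    finally show ?thesis .
  qed
  show "stabilises x B'"
  proof (rule stabilisesI)
    fix b assume "b \<in> B'"
    then obtain i b0 where b: "b = x ^ i * b0" "i < m" "b0 \<in> B" by (auto simp: B'_def)
    show "x * b \<in> int_span B'"
    proof (cases "Suc i < m")
      case True
      then show ?thesis using mono[OF True int_span_base[OF fin b(3)]] b by (simp add: mult.assoc)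
    next
      case False
      then have "m = Suc i" using b by simp
      then have "x * b = x ^ m * b0" by (simp add: b)
      also have "\<dots> = (\<Sum>i<m. x ^ i * (a i * b0))" by (simp add: rel sum_distrib_right mult.assoc mult.left_commute)
      also have "\<dots> \<in> int_span B'"
        using a int_span_base[OF fin b(3)] by (intro int_span_sum mono) (auto simp: stabilises_def)
      finally show ?thesis .
    qed
  qed
  show "stabilises y B'" if "stabilises y B" for y
  proof (rule stabilisesI)
    fix b assume "b \<in> B'"
    then obtain i b0 where b: "b = x ^ i * b0" "i < m" "b0 \<in> B" by (auto simp: B'_def)
    have "y * b = x ^ i * (y * b0)" by (simp add: b)
    also have "\<dots> \<in> int_span B'"
      using that int_span_base[OF fin b(3)] b by (intro mono) (auto simp: stabilises_def)
    finally show "y * b \<in> int_span B'" .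
  qed
qed

lemma algebraic_int_relation:
  fixes x :: complex
  assumes "algebraic_int x"
  obtains m and a :: "nat \<Rightarrow> int" where "m > 0" "x ^ m = (\<Sum>i<m. of_int (a i) * x ^ i)"
proof -
  obtain p :: "int poly" where p: "poly (map_poly of_int p) x = 0" "lead_coeff p = 1"
    using assms by (auto simp: algebraic_int_altdef_ipoly)
  have deg: "degree p > 0"
  proof (rule ccontr)
    assume "\<not> degree p > 0"
    then obtain c where "p = [:c:]" using degree_eq_zeroE by blast
    then show False using p by simp
  qed
  have "0 = (\<Sum>i\<le>degree p. of_int (coeff p i) * x ^ i)"
    using p(1) by (simp add: poly_altdef)
  also have "\<dots> = x ^ degree p + (\<Sum>i<degree p. of_int (coeff p i) * x ^ i)"
    using p(2) by (simp flip: lessThan_Suc_atMost)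
  finally have "x ^ degree p + (\<Sum>i<degree p. of_int (coeff p i) * x ^ i) = 0" by (rule sym)
  then have "x ^ degree p = - (\<Sum>i<degree p. of_int (coeff p i) * x ^ i)"
    by (rule eq_neg_iff_add_eq_0[THEN iffD2])
  also have "\<dots> = (\<Sum>i<degree p. of_int (- coeff p i) * x ^ i)"
    by (simp add: sum_negf)
  finally have "x ^ degree p = (\<Sum>i<degree p. of_int (- coeff p i) * x ^ i)" .
  then show thesis by (rule that[OF deg])
qed

lemma algebraic_int_stabilises:
  assumes "algebraic_int x" "finite B" "b0 \<in> B"
  obtains B' where "finite B'" "b0 \<in> B'" "stabilises x B'" "\<And>y. stabilises y B \<Longrightarrow> stabilises y B'"
proof -
  obtain m a where m: "m > 0" "x ^ m = (\<Sum>i<m. of_int (a i) * x ^ i)"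
    using algebraic_int_relation[OF assms(1)] .
  show thesis
    by (rule that[OF stabilises_adjoin(1)[OF assms(2) m stabilises_of_int]
          subsetD[OF stabilises_adjoin(2)[OF assms(2) m stabilises_of_int] assms(3)]
          stabilises_adjoin(3)[OF assms(2) m stabilises_of_int]
          stabilises_adjoin(4)[OF assms(2) m stabilises_of_int]])
qed

lemma algebraic_int_stabilises2:
  assumes "algebraic_int y" "algebraic_int z"
  obtains B where "finite B" "1 \<in> B" "stabilises y B" "stabilises z B"
proof -
  obtain B where B: "finite B" "1 \<in> B" "stabilises y B"
    using algebraic_int_stabilises[OF assms(1), of "{1}" 1] by auto
  then show thesis
    using algebraic_int_stabilises[OF assms(2) B(1,2)] that by metis
qed

lemma algebraic_int_add [intro]:
  fixes x y :: complex
  assumes "algebraic_int x" "algebraic_int y"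
  shows "algebraic_int (x + y)"
proof -
  obtain B where "finite B" "1 \<in> B" "stabilises x B" "stabilises y B"
    using algebraic_int_stabilises2[OF assms] .
  then show ?thesis using stabilises_imp_algebraic_int[of B 1] stabilises_add by simp
qed

lemma algebraic_int_mult [intro]:
  fixes x y :: complex
  assumes "algebraic_int x" "algebraic_int y"
  shows "algebraic_int (x * y)"
proof -
  obtain B where "finite B" "1 \<in> B" "stabilises x B" "stabilises y B"
    using algebraic_int_stabilises2[OF assms] .
  then show ?thesis using stabilises_imp_algebraic_int[of B 1] stabilises_mult by simp
qed

text \<open>Adjoins the root to a group that is stable under both coefficients. This is how an
  element of a quadratic extension is recognised as integral from its trace and norm.\<close>

lemma algebraic_int_monic_quadratic:
  fixes x y z :: complex
  assumes y: "algebraic_int y" and z: "algebraic_int z" and root: "x ^ 2 = y * x + z"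
  shows "algebraic_int x"
proof -
  obtain C where C: "finite C" "1 \<in> C" "stabilises y C" "stabilises z C"
    using algebraic_int_stabilises2[OF y z] .
  define a where "a i = (if i = 0 then z else y)" for i :: nat
  have rel: "x ^ 2 = (\<Sum>i<2. a i * x ^ i)"
    using root by (simp add: a_def eval_nat_numeral)
  have a: "\<And>i. i < 2 \<Longrightarrow> stabilises (a i) C" using C by (simp add: a_def)
  note D = stabilises_adjoin[OF C(1) pos2 rel a]
  show ?thesis
    using C(2) D(2) by (intro stabilises_imp_algebraic_int[OF D(1) _ _ D(3), of 1]) auto
qed

lemma algebraic_int_diff [intro]:
  "algebraic_int (x :: complex) \<Longrightarrow> algebraic_int y \<Longrightarrow> algebraic_int (x - y)"
  using algebraic_int_add[of x "- y"] by auto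

lemma algebraic_int_of_int [intro, simp]: "algebraic_int (of_int k :: complex)"
  by (intro int_imp_algebraic_int) auto

lemma algebraic_int_power [intro]: "algebraic_int (x :: complex) \<Longrightarrow> algebraic_int (x ^ n)"
  by (induction n) (auto intro: int_imp_algebraic_int)

lemma algebraic_int_of_square: "algebraic_int ((x :: complex) ^ 2) \<Longrightarrow> algebraic_int x"
  using algebraic_int_monic_quadratic(1)[of 0 "x ^ 2" x] by simp

subsection \<open>Fractional ideals and the class group\<close>

abbreviation iprod :: "complex set \<Rightarrow> complex set \<Rightarrow> complex set" (infixl "\<star>" 70) where
  "I \<star> J \<equiv> ideal_prod ring_of_type_algebra I J"

lemma iprod_mult: "x \<in> I \<Longrightarrow> y \<in> J \<Longrightarrow> x * y \<in> I \<star> J"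
  using ideal_prod.prod[of x I y J ring_of_type_algebra] by (simp add: ring_of_type_algebra_def)

lemma iprod_add: "x \<in> I \<star> J \<Longrightarrow> y \<in> I \<star> J \<Longrightarrow> x + y \<in> I \<star> J"
  using ideal_prod.sum[of x ring_of_type_algebra I J y] by (simp add: ring_of_type_algebra_def)

lemma iprod_induct [consumes 1, case_names mult add]:
  assumes "z \<in> I \<star> J" and "\<And>x y. x \<in> I \<Longrightarrow> y \<in> J \<Longrightarrow> P (x * y)"
    and "\<And>x y. x \<in> I \<star> J \<Longrightarrow> y \<in> I \<star> J \<Longrightarrow> P x \<Longrightarrow> P y \<Longrightarrow> P (x + y)"
  shows "P z"
  using assms(1)
  by (induction rule: ideal_prod.induct)
    (use assms(2,3) in \<open>auto simp: ring_of_type_algebra_def\<close>)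

lemma iprod_subsetI:
  assumes "\<And>x y. x \<in> I \<Longrightarrow> y \<in> J \<Longrightarrow> x * y \<in> M" "\<And>x y. x \<in> M \<Longrightarrow> y \<in> M \<Longrightarrow> x + y \<in> M"
  shows "I \<star> J \<subseteq> M"
proof
  fix z assume "z \<in> I \<star> J"
  then show "z \<in> M" by (induction rule: iprod_induct) (use assms in auto)
qed

lemma iprod_mono: "I \<subseteq> I' \<Longrightarrow> J \<subseteq> J' \<Longrightarrow> I \<star> J \<subseteq> I' \<star> J'"
  by (intro iprod_subsetI iprod_mult iprod_add) auto

lemma iprod_commute: "I \<star> J = J \<star> I"
proof -
  have "I \<star> J \<subseteq> J \<star> I" for I J
  proof (intro iprod_subsetI iprod_add)
    fix x y assume "x \<in> I" "y \<in> J"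
    then show "x * y \<in> J \<star> I" using iprod_mult[of y J x I] by (simp add: mult.commute)
  qed
  then show ?thesis by blast
qed

lemma iprod_assoc: "(I \<star> J) \<star> K = I \<star> (J \<star> K)"
proof -
  have *: "x * z \<in> I \<star> (J \<star> K)" if "x \<in> I \<star> J" "z \<in> K" for x z I J K
    using that(1)
  proof (induction rule: iprod_induct)
    case (mult x y)
    then show ?case using iprod_mult[OF mult(1) iprod_mult[OF mult(2) that(2)]] by (simp add: mult.assoc)
  qed (auto simp: ring_distribs intro: iprod_add)
  have le: "(I \<star> J) \<star> K \<subseteq> I \<star> (J \<star> K)" for I J K
    by (intro iprod_subsetI iprod_add) (use * in auto)
  show ?thesis
    using le[of I J K] le[of K J I] by (metis iprod_commute subset_antisym)
qed

lemma iprod_left_commute: "I \<star> (J \<star> K) = J \<star> (I \<star> K)"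
  by (metis iprod_assoc iprod_commute)

lemmas iprod_ac = iprod_assoc iprod_commute iprod_left_commute

text \<open>The homomorphism laws are asked only where they are applied, because the intended map,
  conjugation, is meaningful only on its own field.\<close>

lemma iprod_image_hom:
  assumes "\<And>x y. x \<in> I \<Longrightarrow> y \<in> J \<Longrightarrow> f (x * y) = f x * f y"
    and "\<And>x y. x \<in> I \<star> J \<Longrightarrow> y \<in> I \<star> J \<Longrightarrow> f (x + y) = f x + f y"
  shows "f ` (I \<star> J) = f ` I \<star> f ` J"
proof
  show "f ` (I \<star> J) \<subseteq> f ` I \<star> f ` J"
  proof clarify
    fix z assume "z \<in> I \<star> J"
    then show "f z \<in> f ` I \<star> f ` J"
      by (induction rule: iprod_induct) (auto simp: assms intro: iprod_mult iprod_add)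
  qed
  show "f ` I \<star> f ` J \<subseteq> f ` (I \<star> J)"
  proof (rule iprod_subsetI)
    fix x y assume "x \<in> f ` I" "y \<in> f ` J"
    then show "x * y \<in> f ` (I \<star> J)"
      using assms(1) by (auto intro!: image_eqI[OF _ iprod_mult])
  next
    fix x y assume "x \<in> f ` (I \<star> J)" "y \<in> f ` (I \<star> J)"
    then obtain u v where uv: "u \<in> I \<star> J" "x = f u" "v \<in> I \<star> J" "y = f v" by blast
    then have "x + y = f (u + v)" using assms(2) by simp
    then show "x + y \<in> f ` (I \<star> J)" using uv by (blast intro: iprod_add)
  qed
qed

lemma mem_image_mult_iff:
  fixes a :: complex
  assumes "a \<noteq> 0"
  shows "x \<in> (\<lambda>x. a * x) ` A \<longleftrightarrow> x / a \<in> A"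
proof
  assume "x / a \<in> A"
  then show "x \<in> (\<lambda>x. a * x) ` A" using assms by (intro image_eqI[of _ _ "x / a"]) auto
qed (use assms in auto)

text \<open>The condition \<open>denom\<close> makes the field algebraic over the rationals without
  mentioning a degree. It supplies the common denominators that make principal ideals fractional
  ideals.\<close>

locale complex_subfield =
  fixes F :: "complex set"
  assumes one_mem [simp, intro]: "1 \<in> F"
    and diff_mem [intro]: "x \<in> F \<Longrightarrow> y \<in> F \<Longrightarrow> x - y \<in> F"
    and mult_mem [intro]: "x \<in> F \<Longrightarrow> y \<in> F \<Longrightarrow> x * y \<in> F"
    and inverse_mem [intro]: "x \<in> F \<Longrightarrow> inverse x \<in> F"
    and denom: "x \<in> F \<Longrightarrow> \<exists>n::int. n \<noteq> 0 \<and> algebraic_int (of_int n * x)"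
begin

abbreviation ints ("\<O>") where "\<O> \<equiv> ring_of_integers F"

lemma zero_mem [simp, intro]: "0 \<in> F" using diff_mem[of 1 1] by simp
lemma uminus_mem [intro]: "x \<in> F \<Longrightarrow> - x \<in> F" using diff_mem[of 0 x] by simp
lemma add_mem [intro]: "x \<in> F \<Longrightarrow> y \<in> F \<Longrightarrow> x + y \<in> F" using diff_mem[of x "- y"] by auto
lemma divide_mem [intro]: "x \<in> F \<Longrightarrow> y \<in> F \<Longrightarrow> x / y \<in> F"
  by (auto simp: divide_inverse)
lemma power_mem [intro]: "x \<in> F \<Longrightarrow> x ^ n \<in> F" by (induction n) auto
lemma of_nat_mem [simp, intro]: "of_nat n \<in> F" by (induction n) auto
lemma of_int_mem [simp, intro]: "of_int n \<in> F" by (cases n) auto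
lemma numeral_mem [simp, intro]: "numeral n \<in> F" using of_nat_mem[of "numeral n"] by simp
lemma Rats_mem [intro]: "x \<in> \<rat> \<Longrightarrow> x \<in> F"
  by (cases x rule: Rats_cases') auto

lemma ints_iff: "x \<in> \<O> \<longleftrightarrow> x \<in> F \<and> algebraic_int x" by (simp add: ring_of_integers_def)
lemma ints_mem: "x \<in> \<O> \<Longrightarrow> x \<in> F" by (simp add: ints_iff)
lemma ints_0 [simp, intro]: "0 \<in> \<O>" by (simp add: ints_iff)
lemma ints_1 [simp, intro]: "1 \<in> \<O>" using algebraic_int_of_int[of 1] by (simp add: ints_iff)
lemma ints_of_int [simp, intro]: "of_int n \<in> \<O>" by (simp add: ints_iff)
lemma ints_numeral [simp, intro]: "numeral n \<in> \<O>" using ints_of_int[of "numeral n"] by simp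
lemma ints_add [intro]: "x \<in> \<O> \<Longrightarrow> y \<in> \<O> \<Longrightarrow> x + y \<in> \<O>" by (auto simp: ints_iff)
lemma ints_diff [intro]: "x \<in> \<O> \<Longrightarrow> y \<in> \<O> \<Longrightarrow> x - y \<in> \<O>" by (auto simp: ints_iff)
lemma ints_mult [intro]: "x \<in> \<O> \<Longrightarrow> y \<in> \<O> \<Longrightarrow> x * y \<in> \<O>" by (auto simp: ints_iff)
lemma ints_uminus [intro]: "x \<in> \<O> \<Longrightarrow> - x \<in> \<O>" by (auto simp: ints_iff)
lemma ints_power [intro]: "x \<in> \<O> \<Longrightarrow> x ^ n \<in> \<O>" by (auto simp: ints_iff)

lemma frac_mem: "fractional_ideal F I \<Longrightarrow> x \<in> I \<Longrightarrow> x \<in> F" by (auto simp: fractional_ideal_def)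
lemma frac_0: "fractional_ideal F I \<Longrightarrow> 0 \<in> I" by (auto simp: fractional_ideal_def)
lemma frac_add: "fractional_ideal F I \<Longrightarrow> x \<in> I \<Longrightarrow> y \<in> I \<Longrightarrow> x + y \<in> I"
  by (auto simp: fractional_ideal_def)
lemma frac_mult: "fractional_ideal F I \<Longrightarrow> r \<in> \<O> \<Longrightarrow> x \<in> I \<Longrightarrow> r * x \<in> I"
  by (auto simp: fractional_ideal_def)
lemma frac_uminus: "fractional_ideal F I \<Longrightarrow> x \<in> I \<Longrightarrow> - x \<in> I"
  using frac_mult[of I "-1" x] by auto
lemma frac_diff: "fractional_ideal F I \<Longrightarrow> x \<in> I \<Longrightarrow> y \<in> I \<Longrightarrow> x - y \<in> I"
  using frac_add[of I x "- y"] by (auto intro: frac_uminus)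
lemma frac_nonzero: "fractional_ideal F I \<Longrightarrow> \<exists>x\<in>I. x \<noteq> 0"
  by (auto simp: fractional_ideal_def)
lemma frac_denom:
  "fractional_ideal F I \<Longrightarrow> \<exists>r\<in>\<O>. r \<noteq> 0 \<and> (\<forall>x\<in>I. r * x \<in> \<O>)"
  by (auto simp: fractional_ideal_def)

lemma frac_intro:
  assumes "I \<subseteq> F" "0 \<in> I" "\<exists>x\<in>I. x \<noteq> 0" "\<And>x y. x \<in> I \<Longrightarrow> y \<in> I \<Longrightarrow> x + y \<in> I"
    "\<And>r x. r \<in> \<O> \<Longrightarrow> x \<in> I \<Longrightarrow> r * x \<in> I" "r \<in> \<O>" "r \<noteq> 0" "\<And>x. x \<in> I \<Longrightarrow> r * x \<in> \<O>"
  shows "fractional_ideal F I"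
proof -
  have "I \<noteq> {0}" using assms(3) by blast
  then show ?thesis
    unfolding fractional_ideal_def
    by (intro conjI ballI bexI[of _ r] assms(1,2,4-8)) auto
qed

lemma frac_ints [simp, intro]: "fractional_ideal F \<O>"
  by (rule frac_intro[of _ 1]) (auto simp: ints_mem intro: bexI[of _ 1])

lemma frac_iprod [intro]:
  assumes I: "fractional_ideal F I" and J: "fractional_ideal F J"
  shows "fractional_ideal F (I \<star> J)"
proof -
  obtain r where r: "r \<in> \<O>" "r \<noteq> 0" "\<And>x. x \<in> I \<Longrightarrow> r * x \<in> \<O>" using frac_denom[OF I] by blast
  obtain s where s: "s \<in> \<O>" "s \<noteq> 0" "\<And>x. x \<in> J \<Longrightarrow> s * x \<in> \<O>" using frac_denom[OF J] by blast
  obtain a where a: "a \<in> I" "a \<noteq> 0" using frac_nonzero[OF I] by blast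
  obtain b where b: "b \<in> J" "b \<noteq> 0" using frac_nonzero[OF J] by blast
  show ?thesis
  proof (rule frac_intro[of _ "r * s"])
    show "I \<star> J \<subseteq> F" 
      by (intro iprod_subsetI) (simp_all add: add_mem mult_mem frac_mem[OF I] frac_mem[OF J])
    show "0 \<in> I \<star> J" using iprod_mult[OF frac_0[OF I] frac_0[OF J]] by simp
    show "\<exists>x\<in>I \<star> J. x \<noteq> 0" using a b by (intro bexI[OF _ iprod_mult[OF a(1) b(1)]]) simp
    show "t * x \<in> I \<star> J" if "t \<in> \<O>" "x \<in> I \<star> J" for t x
      using that(2)
    proof (induction rule: iprod_induct)
      case (mult x y)
      then show ?case
        using iprod_mult[OF frac_mult[OF I that(1) mult(1)] mult(2)] by (simp add: mult.assoc)
    next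
      case (add x y)
      then show ?case by (simp add: distrib_left iprod_add)
    qed
    show "r * s * x \<in> \<O>" if "x \<in> I \<star> J" for x
      using that
    proof (induction rule: iprod_induct)
      case (mult x y)
      then show ?case using ints_mult[OF r(3) s(3), of x y] by (simp add: mult_ac)
    qed (simp add: distrib_left ints_add)
  qed (use r s in \<open>auto intro: iprod_add\<close>)
qed

lemma iprod_ints [simp]: assumes "fractional_ideal F I" shows "I \<star> \<O> = I" "\<O> \<star> I = I"
proof -
  have "I \<star> \<O> \<subseteq> I"
  proof (rule iprod_subsetI)
    fix x y assume "x \<in> I" "y \<in> \<O>"
    then show "x * y \<in> I" using frac_mult[OF assms, of y x] by (simp add: mult.commute)
  qed (rule frac_add[OF assms])
  moreover have "I \<subseteq> I \<star> \<O>" using iprod_mult[of _ I 1 \<O>] by auto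
  ultimately show "I \<star> \<O> = I" by blast
  then show "\<O> \<star> I = I" by (simp add: iprod_commute)
qed

section \<open>Principal ideals\<close>

definition pideal :: "complex \<Rightarrow> complex set" where "pideal a = (\<lambda>x. a * x) ` \<O>"

lemma pideal_1 [simp]: "pideal 1 = \<O>" by (simp add: pideal_def)

lemma mem_pideal_iff: "a \<noteq> 0 \<Longrightarrow> x \<in> pideal a \<longleftrightarrow> x / a \<in> \<O>"
  unfolding pideal_def by (rule mem_image_mult_iff)

lemma self_mem_pideal: "a \<in> pideal a" by (auto simp: pideal_def intro: image_eqI[of _ _ 1])

lemma frac_pideal [intro]:
  assumes "a \<in> F" "a \<noteq> 0"
  shows "fractional_ideal F (pideal a)"
proof -
  obtain n :: int where "n \<noteq> 0" "algebraic_int (of_int n * a)" using denom[OF assms(1)] by blast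
  then obtain r where r: "r \<in> \<O>" "r \<noteq> 0" "r * a \<in> \<O>"
    using assms(1) by (intro that[of "of_int n"]) (auto simp: ints_iff)
  have r': "\<And>x. x \<in> pideal a \<Longrightarrow> r * x \<in> \<O>"
    using r(3) by (auto simp: pideal_def mult.assoc[symmetric])
  have add: "\<And>x y. x \<in> pideal a \<Longrightarrow> y \<in> pideal a \<Longrightarrow> x + y \<in> pideal a"
    by (auto simp: pideal_def simp flip: distrib_left)
  have mult: "\<And>t x. t \<in> \<O> \<Longrightarrow> x \<in> pideal a \<Longrightarrow> t * x \<in> pideal a"
    by (auto simp: pideal_def mult.left_commute)
  show ?thesis
  proof (rule frac_intro[OF _ _ _ add mult r(1,2) r'])
    show "pideal a \<subseteq> F" using assms by (auto simp: pideal_def ints_mem mult_mem)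
    show "0 \<in> pideal a" by (auto simp: pideal_def intro: image_eqI[of _ _ 0])
    show "\<exists>x\<in>pideal a. x \<noteq> 0" using self_mem_pideal assms by blast
  qed
qed

lemma pideal_iprod: 
  assumes "fractional_ideal F I"
  shows "pideal a \<star> I = (\<lambda>x. a * x) ` I"
proof -
  have "pideal a \<star> I = (\<lambda>x. a * x) ` (\<O> \<star> I)"
  proof
    show "pideal a \<star> I \<subseteq> (\<lambda>x. a * x) ` (\<O> \<star> I)"
    proof (rule iprod_subsetI)
      fix x y assume "x \<in> pideal a" "y \<in> I"
      then obtain u where "u \<in> \<O>" "x = a * u" by (auto simp: pideal_def)
      then show "x * y \<in> (\<lambda>x. a * x) ` (\<O> \<star> I)"
        using \<open>y \<in> I\<close> by (intro image_eqI[of _ _ "u * y"] iprod_mult) auto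
    next
      fix x y assume "x \<in> (\<lambda>x. a * x) ` (\<O> \<star> I)" "y \<in> (\<lambda>x. a * x) ` (\<O> \<star> I)"
      then obtain u v where "u \<in> \<O> \<star> I" "v \<in> \<O> \<star> I" "x = a * u" "y = a * v" by auto
      then show "x + y \<in> (\<lambda>x. a * x) ` (\<O> \<star> I)"
        by (intro image_eqI[of _ _ "u + v"] iprod_add) (auto simp: distrib_left)
    qed
    have "a * z \<in> pideal a \<star> I" if "z \<in> \<O> \<star> I" for z
      using that
    proof (induction rule: iprod_induct)
      case (mult x y)
      then show ?case
        using iprod_mult[of "a * x" "pideal a" y I] by (auto simp: pideal_def mult.assoc)
    qed (auto simp: distrib_left intro: iprod_add)
    then show "(\<lambda>x. a * x) ` (\<O> \<star> I) \<subseteq> pideal a \<star> I" by blast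
  qed
  then show ?thesis using assms by simp
qed

lemma mem_pideal_iprod_iff:
  "fractional_ideal F I \<Longrightarrow> a \<noteq> 0 \<Longrightarrow> x \<in> pideal a \<star> I \<longleftrightarrow> x / a \<in> I"
  by (simp add: pideal_iprod mem_image_mult_iff)

lemma pideal_mult: "a \<in> F \<Longrightarrow> b \<in> F \<Longrightarrow> pideal a \<star> pideal b = pideal (a * b)"
proof (cases "b = 0")
  case True
  have "pideal a \<star> {0} = {0}"
  proof -
    have "pideal a \<star> {0} \<subseteq> {0}" by (intro iprod_subsetI) auto
    then show ?thesis using iprod_mult[OF self_mem_pideal[of a], of 0 "{0}"] by auto
  qed
  moreover have "pideal 0 = {0}" by (auto simp: pideal_def)
  ultimately show ?thesis using True by simp
next
  case False
  assume "a \<in> F" "b \<in> F"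
  then have "pideal a \<star> pideal b = (\<lambda>x. a * x) ` pideal b" using False by (intro pideal_iprod frac_pideal)
  then show ?thesis by (auto simp: pideal_def image_image mult.assoc)
qed

lemma pideal_subset_iff: "a \<noteq> 0 \<Longrightarrow> b \<in> pideal a \<longleftrightarrow> pideal b \<subseteq> pideal a"
  using self_mem_pideal[of b] by (auto simp: pideal_def mult.assoc)

lemma pideal_eq_iff:
  assumes "a \<in> F" "a \<noteq> 0" "b \<in> F" "b \<noteq> 0"
  shows "pideal a = pideal b \<longleftrightarrow> a / b \<in> \<O> \<and> b / a \<in> \<O>"
  using assms pideal_subset_iff[of a b] pideal_subset_iff[of b a] mem_pideal_iff[of a b] mem_pideal_iff[of b a]
  by blast

lemma pideal_inverse: "a \<in> F \<Longrightarrow> a \<noteq> 0 \<Longrightarrow> pideal (inverse a) \<star> pideal a = \<O>"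
  by (simp add: pideal_mult inverse_mem)

end

text \<open>Invertibility of ideals is the interface that replaces the theory of Dedekind domains:
  it is trivial over a principal ideal domain and \<open>relative_norm_ideal\<close> passes it on to
  quadratic extensions.\<close>

locale invertible_subfield = complex_subfield +
  assumes invertible: "fractional_ideal F I \<Longrightarrow> \<exists>J. fractional_ideal F J \<and> I \<star> J = \<O>"
begin

abbreviation G where "G \<equiv> fractional_ideal_group F"
abbreviation P where "P \<equiv> principal_fractional_ideals F"
abbreviation C where "C \<equiv> ideal_class_group F"

lemma principal_iff: "I \<in> P \<longleftrightarrow> (\<exists>a\<in>F. a \<noteq> 0 \<and> I = pideal a)"
  by (auto simp: principal_fractional_ideals_def pideal_def)

lemma carrier_G [simp]: "I \<in> carrier G \<longleftrightarrow> fractional_ideal F I"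
  and mult_G [simp]: "I \<otimes>\<^bsub>G\<^esub> J = I \<star> J"
  and one_G [simp]: "\<one>\<^bsub>G\<^esub> = \<O>"
  by (auto simp: fractional_ideal_group_def)

sublocale G: comm_group G
proof (rule comm_groupI)
  fix I assume "I \<in> carrier G"
  then show "\<exists>J\<in>carrier G. J \<otimes>\<^bsub>G\<^esub> I = \<one>\<^bsub>G\<^esub>"
    using invertible[of I] by (auto simp: iprod_commute)
qed (simp_all add: frac_iprod iprod_assoc, simp add: iprod_commute)

lemma subgroup_P: "subgroup P G"
proof (rule G.subgroupI)
  show "P \<subseteq> carrier G" by (auto simp: principal_iff)
  have "\<O> \<in> P" unfolding principal_iff by (intro bexI[of _ 1]) simp_all
  then show "P \<noteq> {}" by blast
  fix I J assume I: "I \<in> P" and J: "J \<in> P"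
  then obtain a b where ab: "a \<in> F" "a \<noteq> 0" "I = pideal a" "b \<in> F" "b \<noteq> 0" "J = pideal b"
    by (auto simp: principal_iff)
  then show "I \<otimes>\<^bsub>G\<^esub> J \<in> P"
    unfolding principal_iff by (intro bexI[of _ "a * b"]) (simp_all add: pideal_mult mult_mem)
  have "inv\<^bsub>G\<^esub> I = pideal (inverse a)"
    using ab by (intro G.inv_equality) (simp_all add: pideal_inverse frac_pideal inverse_mem)
  then show "inv\<^bsub>G\<^esub> I \<in> P"
    unfolding principal_iff using ab by (intro bexI[of _ "inverse a"]) (simp_all add: inverse_mem)
qed

lemma normal_P: "P \<lhd> G"
  by (rule G.subgroup_imp_normal[OF subgroup_P])

sublocale C: comm_group C
  using G.abelian_FactGroup[OF subgroup_P] by (simp add: ideal_class_group_def)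

definition cl :: "complex set \<Rightarrow> complex set set" where "cl I = P #>\<^bsub>G\<^esub> I"

lemma cl_hom: "group_hom G C cl"
  using normal.r_coset_hom_Mod[OF normal_P] normal.factorgroup_is_group[OF normal_P]
  unfolding group_hom_def group_hom_axioms_def ideal_class_group_def cl_def
  by (auto simp: G.is_group)

sublocale cl: group_hom G C cl by (rule cl_hom)

lemma cl_mem [simp, intro]: "fractional_ideal F I \<Longrightarrow> cl I \<in> carrier C"
  using cl.hom_closed by simp

lemma cl_mult: "fractional_ideal F I \<Longrightarrow> fractional_ideal F J \<Longrightarrow> cl (I \<star> J) = cl I \<otimes>\<^bsub>C\<^esub> cl J"
  using cl.hom_mult by simp

lemma cl_surj: "c \<in> carrier C \<Longrightarrow> \<exists>I. fractional_ideal F I \<and> c = cl I"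
  by (auto simp: ideal_class_group_def carrier_FactGroup cl_def)

lemma cl_one_iff:
  assumes "fractional_ideal F I"
  shows "cl I = \<one>\<^bsub>C\<^esub> \<longleftrightarrow> (\<exists>a\<in>F. a \<noteq> 0 \<and> I = pideal a)"
proof -
  have "cl I = \<one>\<^bsub>C\<^esub> \<longleftrightarrow> I \<in> P"
    using assms subgroup_P G.coset_join1[of P I] G.coset_join2[of I P] subgroup.subset[OF subgroup_P]
    by (auto simp: cl_def ideal_class_group_def)
  then show ?thesis by (simp add: principal_iff)
qed

lemma cl_pideal: "a \<in> F \<Longrightarrow> a \<noteq> 0 \<Longrightarrow> cl (pideal a) = \<one>\<^bsub>C\<^esub>"
  by (auto simp: cl_one_iff frac_pideal)

lemma cl_eqI: 
  assumes "fractional_ideal F I" "a \<in> F" "a \<noteq> 0"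
  shows "cl (pideal a \<star> I) = cl I"
  using assms by (simp add: cl_mult cl_pideal frac_pideal)

end

subsection \<open>Quadratic extensions\<close>

locale sqrt_ext = F: complex_subfield F for F +
  fixes s :: complex
  assumes s2 [simp, intro]: "s ^ 2 \<in> F" and s_notin: "s \<notin> F"
begin

definition L :: "complex set" where "L = {a + b * s | a b. a \<in> F \<and> b \<in> F}"

text \<open>The nontrivial automorphism of \<open>L\<close> over \<open>F\<close>. Outside
  \<open>L\<close> its value is unspecified, hence the membership hypotheses in the rules about
  it.\<close>

definition gal :: "complex \<Rightarrow> complex" where
  "gal x = (THE y. \<exists>a\<in>F. \<exists>b\<in>F. x = a + b * s \<and> y = a - b * s)"

lemma L_I [intro]: "a \<in> F \<Longrightarrow> b \<in> F \<Longrightarrow> a + b * s \<in> L" by (auto simp: L_def)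

lemma L_cases [elim?]: assumes "x \<in> L" obtains a b where "a \<in> F" "b \<in> F" "x = a + b * s"
  using assms by (auto simp: L_def)

lemma F_subset_L: "F \<subseteq> L" using L_I[OF _ F.zero_mem] by auto

lemma F_mem_L [intro]: "x \<in> F \<Longrightarrow> x \<in> L" using F_subset_L by blast

lemma s_mem_L [simp, intro]: "s \<in> L" using L_I[OF F.zero_mem F.one_mem] by simp

lemma coords_unique:
  assumes "a \<in> F" "b \<in> F" "a' \<in> F" "b' \<in> F" "a + b * s = a' + b' * s"
  shows "a = a' \<and> b = b'"
proof -
  have "b = b'"
  proof (rule ccontr)
    assume "b \<noteq> b'"
    have "(b - b') * s = a' - a" using assms(5) by (simp add: algebra_simps)
    then have "s = (a' - a) / (b - b')" using \<open>b \<noteq> b'\<close> by (simp add: field_simps)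
    also have "\<dots> \<in> F" using assms by (intro F.divide_mem F.diff_mem)
    finally show False using s_notin by simp
  qed
  then show ?thesis using assms(5) by simp
qed

lemma gal_eq: 
  assumes "a \<in> F" "b \<in> F"
  shows "gal (a + b * s) = a - b * s"
  unfolding gal_def
proof (rule the_equality)
  fix y assume "\<exists>a'\<in>F. \<exists>b'\<in>F. a + b * s = a' + b' * s \<and> y = a' - b' * s"
  then obtain a' b' where ab: "a' \<in> F" "b' \<in> F" "a + b * s = a' + b' * s" "y = a' - b' * s" by blast
  then show "y = a - b * s" using coords_unique[OF assms ab(1-3)] by simp
qed (use assms in blast)

lemma gal_F [simp]: "x \<in> F \<Longrightarrow> gal x = x" using gal_eq[of x 0] by simp

lemma gal_s [simp]: "gal s = - s" using gal_eq[of 0 1] by simp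

lemma gal_mem [intro]: "x \<in> L \<Longrightarrow> gal x \<in> L"
proof (elim L_cases)
  fix a b assume "a \<in> F" "b \<in> F" "x = a + b * s"
  then show ?thesis using L_I[of a "- b"] by (simp add: gal_eq F.uminus_mem)
qed

lemma gal_gal [simp]: "x \<in> L \<Longrightarrow> gal (gal x) = x"
proof (elim L_cases)
  fix a b assume ab: "a \<in> F" "b \<in> F" "x = a + b * s"
  then have "gal x = a + (- b) * s" by (simp add: gal_eq)
  also have "gal \<dots> = x" using ab by (subst gal_eq) auto
  finally show ?thesis .
qed

lemma gal_add: "x \<in> L \<Longrightarrow> y \<in> L \<Longrightarrow> gal (x + y) = gal x + gal y"
proof (elim L_cases)
  fix a b c d assume ab: "a \<in> F" "b \<in> F" "x = a + b * s" "c \<in> F" "d \<in> F" "y = c + d * s"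
  have "x + y = (a + c) + (b + d) * s" by (simp add: ab algebra_simps)
  moreover have "gal ((a + c) + (b + d) * s) = (a + c) - (b + d) * s"
    using ab by (intro gal_eq F.add_mem)
  ultimately show ?thesis using ab by (simp add: gal_eq algebra_simps)
qed

lemma L_mult_eq: "(a + b * s) * (c + d * s) = (a * c + b * d * s ^ 2) + (a * d + b * c) * s"
  by (simp add: algebra_simps power2_eq_square)

lemma gal_mult: "x \<in> L \<Longrightarrow> y \<in> L \<Longrightarrow> gal (x * y) = gal x * gal y"
proof (elim L_cases)
  fix a b c d assume ab: "a \<in> F" "b \<in> F" "x = a + b * s" "c \<in> F" "d \<in> F" "y = c + d * s"
  have "gal (x * y) = (a * c + b * d * s ^ 2) - (a * d + b * c) * s"
    unfolding ab L_mult_eq using ab by (intro gal_eq F.add_mem F.mult_mem s2)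
  also have "\<dots> = (a - b * s) * (c - d * s)" by (simp add: algebra_simps power2_eq_square)
  finally show ?thesis using ab by (simp add: gal_eq)
qed

lemma gal_fixed_iff: "x \<in> L \<Longrightarrow> gal x = x \<longleftrightarrow> x \<in> F"
proof (elim L_cases)
  fix a b assume ab: "a \<in> F" "b \<in> F" "x = a + b * s"
  have "s \<noteq> 0" using s_notin by auto
  then show ?thesis using ab by (auto simp: gal_eq)
    (metis F.divide_mem F.diff_mem add_diff_cancel_left' nonzero_mult_div_cancel_left s_notin)
qed

lemma L_subfield: "complex_subfield L"
proof
  fix x y assume "x \<in> L" "y \<in> L"
  then obtain a b c d where ab: "a \<in> F" "b \<in> F" "x = a + b * s" "c \<in> F" "d \<in> F" "y = c + d * s"
    by (auto elim!: L_cases)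
  have "x - y = (a - c) + (b - d) * s" by (simp add: ab algebra_simps)
  moreover have "(a - c) + (b - d) * s \<in> L" using ab by auto
  ultimately show "x - y \<in> L" by (simp only:)
  show "x * y \<in> L" unfolding ab L_mult_eq using ab by (intro L_I F.add_mem F.mult_mem s2)
next
  fix x assume "x \<in> L"
  then obtain a b where ab: "a \<in> F" "b \<in> F" "x = a + b * s" by (auto elim!: L_cases)
  define n where "n = a ^ 2 - b ^ 2 * s ^ 2"
  have n: "n \<in> F" using ab by (auto simp: n_def)
  show "inverse x \<in> L"
  proof (cases "x = 0")
    case False
    have nx: "n = x * (a - b * s)" by (simp add: ab n_def algebra_simps power2_eq_square)
    \<comment> \<open>If the norm of a nonzero \<open>x\<close> vanished, so would its conjugate,
      and uniqueness of coordinates would give \<open>x = 0\<close>.\<close>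
    have "n \<noteq> 0"
    proof
      assume "n = 0"
      then have "a - b * s = 0" using nx False by simp
      then have "a + (- b) * s = 0 + 0 * s" by simp
      then have "a = 0 \<and> - b = 0"
        using coords_unique[of a "- b" 0 0] F.uminus_mem[OF ab(2)] ab(1) by blast
      then show False using ab False by simp
    qed
    then have "inverse x = (a - b * s) / n" using nx False by (simp add: divide_simps)
    also have "\<dots> = a / n + (- b / n) * s" by (simp add: diff_divide_distrib)
    finally have "inverse x = a / n + (- b / n) * s" .
    moreover have "a / n + (- b / n) * s \<in> L" using ab n by (intro L_I F.divide_mem F.uminus_mem)
    ultimately show ?thesis by (simp only:)
  qed auto
  obtain k where k: "k \<noteq> 0" "algebraic_int (of_int k * a)" using F.denom[OF ab(1)] by blast
  obtain l where l: "l \<noteq> 0" "algebraic_int (of_int l * b)" using F.denom[OF ab(2)] by blast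
  obtain m where m: "m \<noteq> 0" "algebraic_int (of_int m * s ^ 2)" using F.denom[OF s2] by blast
  \<comment> \<open>A denominator is known for \<open>s ^ 2\<close> only; \<open>m * s\<close> is
    integral because its square is.\<close>
  have "algebraic_int ((of_int m * s) ^ 2)"
    using algebraic_int_mult[OF algebraic_int_of_int[of m] m(2)]
    by (simp add: power2_eq_square mult_ac)
  then have "algebraic_int (of_int m * s)" by (rule algebraic_int_of_square)
  then have "algebraic_int (of_int (l * m) * (of_int k * a) + of_int k * ((of_int l * b) * (of_int m * s)))"
    by (rule algebraic_int_add[OF algebraic_int_mult[OF algebraic_int_of_int k(2)]
          algebraic_int_mult[OF algebraic_int_of_int algebraic_int_mult[OF l(2)]]])
  moreover have "of_int (l * m) * (of_int k * a) + of_int k * ((of_int l * b) * (of_int m * s))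
      = of_int (k * l * m) * x"
    by (simp add: ab algebra_simps)
  ultimately show "\<exists>n. n \<noteq> 0 \<and> algebraic_int (of_int n * x)"
    using k l m by (intro exI[of _ "k * l * m"]) (simp only: mult_eq_0_iff, simp)
qed auto

sublocale L: complex_subfield L by (rule L_subfield)

lemma gal_0 [simp]: "gal 0 = 0" by simp
lemma gal_of_int [simp]: "gal (of_int n) = of_int n" by simp

lemma gal_uminus: "x \<in> L \<Longrightarrow> gal (- x) = - gal x"
  using gal_mult[of "-1" x] L.uminus_mem[OF L.one_mem] by (simp add: F.uminus_mem)

lemma gal_diff: "x \<in> L \<Longrightarrow> y \<in> L \<Longrightarrow> gal (x - y) = gal x - gal y"
  using gal_add[of x "- y"] by (simp add: gal_uminus L.uminus_mem)

lemma gal_power: "x \<in> L \<Longrightarrow> gal (x ^ n) = gal x ^ n"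
  by (induction n) (simp_all add: gal_mult L.power_mem)

lemma gal_eq_0_iff [simp]: "x \<in> L \<Longrightarrow> gal x = 0 \<longleftrightarrow> x = 0"
  using gal_gal[of x] by (metis gal_0)

lemma gal_inverse: "x \<in> L \<Longrightarrow> gal (inverse x) = inverse (gal x)"
proof (cases "x = 0")
  case False
  assume x: "x \<in> L"
  have "gal x * gal (inverse x) = 1"
    using gal_mult[OF x L.inverse_mem[OF x]] False by simp
  then show ?thesis using False x by (metis inverse_unique)
qed simp

lemma gal_divide: "x \<in> L \<Longrightarrow> y \<in> L \<Longrightarrow> gal (x / y) = gal x / gal y"
  by (simp add: divide_inverse gal_mult gal_inverse L.inverse_mem)

text \<open>Conjugation commutes with integer polynomials, so the conjugate is a root of the same
  monic polynomial.\<close>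

lemma gal_algebraic_int: 
  assumes x: "x \<in> L" and alg: "algebraic_int x"
  shows "algebraic_int (gal x)"
proof -
  obtain p :: "int poly" where p: "poly (map_poly of_int p) x = 0" "lead_coeff p = 1"
    using alg by (auto simp: algebraic_int_altdef_ipoly)
  have "poly (map_poly of_int q) x \<in> L \<and> gal (poly (map_poly of_int q) x) = poly (map_poly of_int q) (gal x)"
    for q :: "int poly"
    using x by (induction q) (auto simp: map_poly_pCons gal_add gal_mult L.mult_mem L.add_mem)
  from this[of p] have "poly (map_poly of_int p) (gal x) = 0" using p(1) by simp
  then show ?thesis using p(2) by (auto simp: algebraic_int_altdef_ipoly)
qed

lemma gal_ints [intro]: "x \<in> L.ints \<Longrightarrow> gal x \<in> L.ints"
  by (auto simp: L.ints_iff gal_algebraic_int)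

lemma ints_F_L [intro]: "x \<in> ring_of_integers F \<Longrightarrow> x \<in> L.ints"
  by (auto simp: L.ints_iff F.ints_iff)

lemma ints_L_F: "x \<in> L.ints \<Longrightarrow> x \<in> F \<Longrightarrow> x \<in> ring_of_integers F"
  by (auto simp: L.ints_iff F.ints_iff)

section \<open>Relative trace and norm, conjugate ideals\<close>

definition tr where "tr x = x + gal x"
definition nm where "nm x = x * gal x"

lemma tr_mem [intro]: "x \<in> L \<Longrightarrow> tr x \<in> F"
  using gal_fixed_iff[of "tr x"] by (auto simp: tr_def gal_add add.commute L.add_mem gal_mem)

lemma nm_mem [intro]: "x \<in> L \<Longrightarrow> nm x \<in> F"
  using gal_fixed_iff[of "nm x"] by (auto simp: nm_def gal_mult mult.commute L.mult_mem gal_mem)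

lemma tr_ints [intro]: "x \<in> L.ints \<Longrightarrow> tr x \<in> ring_of_integers F"
  by (rule ints_L_F, simp add: tr_def L.ints_add gal_ints, simp add: tr_mem L.ints_mem)

lemma nm_ints [intro]: "x \<in> L.ints \<Longrightarrow> nm x \<in> ring_of_integers F"
  by (rule ints_L_F, simp add: nm_def L.ints_mult gal_ints, simp add: nm_mem L.ints_mem)

lemma nm_mult: "x \<in> L \<Longrightarrow> y \<in> L \<Longrightarrow> nm (x * y) = nm x * nm y"
  by (simp add: nm_def gal_mult)

lemma nm_F: "x \<in> F \<Longrightarrow> nm x = x ^ 2" by (simp add: nm_def power2_eq_square)

lemma nm_eq_0_iff [simp]: "x \<in> L \<Longrightarrow> nm x = 0 \<longleftrightarrow> x = 0" by (simp add: nm_def)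

lemma nm_coords: "a \<in> F \<Longrightarrow> b \<in> F \<Longrightarrow> nm (a + b * s) = a ^ 2 - s ^ 2 * b ^ 2"
  by (simp add: nm_def gal_eq algebra_simps power2_eq_square)

lemma nm_inverse: "x \<in> L \<Longrightarrow> nm (inverse x) = inverse (nm x)"
  by (simp add: nm_def gal_inverse)

lemma nm_divide: "x \<in> L \<Longrightarrow> y \<in> L \<Longrightarrow> nm (x / y) = nm x / nm y"
  by (simp add: nm_def gal_divide)

lemma nm_gal: "x \<in> L \<Longrightarrow> nm (gal x) = nm x" by (simp add: nm_def mult.commute)

lemma quadratic_equation: "x \<in> L \<Longrightarrow> x ^ 2 = tr x * x + (- nm x)"
  by (simp add: tr_def nm_def power2_eq_square algebra_simps)

lemma ints_by_tr_nm:
  assumes "x \<in> L" "tr x \<in> ring_of_integers F" "nm x \<in> ring_of_integers F"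
  shows "x \<in> L.ints"
proof -
  have "algebraic_int x"
    by (rule algebraic_int_monic_quadratic[OF _ _ quadratic_equation]) (use assms in \<open>auto simp: F.ints_iff\<close>)
  then show ?thesis using assms by (simp add: L.ints_iff)
qed

lemma gal_image_frac:
  assumes I: "fractional_ideal L I"
  shows "fractional_ideal L (gal ` I)"
proof -
  obtain r where r: "r \<in> L.ints" "r \<noteq> 0" "\<And>x. x \<in> I \<Longrightarrow> r * x \<in> L.ints"
    using L.frac_denom[OF I] by blast
  note [simp] = L.frac_mem[OF I]
  show ?thesis
  proof (rule L.frac_intro[of _ "gal r"])
    show "gal ` I \<subseteq> L" by auto
    show "0 \<in> gal ` I" using L.frac_0[OF I] by (intro image_eqI[of _ _ 0]) auto
    show "\<exists>x\<in>gal ` I. x \<noteq> 0" using L.frac_nonzero[OF I] by auto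
    show "x + y \<in> gal ` I" if xy: "x \<in> gal ` I" "y \<in> gal ` I" for x y
    proof -
      obtain u v where "u \<in> I" "x = gal u" "v \<in> I" "y = gal v" using xy by blast
      then show ?thesis by (intro image_eqI[of _ _ "u + v"] L.frac_add[OF I]) (simp_all add: gal_add)
    qed
    show "t * x \<in> gal ` I" if tx: "t \<in> L.ints" "x \<in> gal ` I" for t x
    proof -
      obtain u where "u \<in> I" "x = gal u" using tx by blast
      then show ?thesis
        using tx by (intro image_eqI[of _ _ "gal t * u"] L.frac_mult[OF I])
          (simp_all add: gal_mult gal_mem gal_ints L.ints_mem)
    qed
    show "gal r * x \<in> L.ints" if x: "x \<in> gal ` I" for x
    proof -
      obtain u where u: "u \<in> I" "x = gal u" using x by blast
      then have "gal r * x = gal (r * u)" using r by (simp add: gal_mult L.ints_mem)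
      then show ?thesis using r u by (simp add: gal_ints)
    qed
  qed (use r in \<open>auto simp: L.ints_mem\<close>)
qed

lemma gal_image_iprod:
  assumes "I \<subseteq> L" "J \<subseteq> L"
  shows "gal ` (I \<star> J) = gal ` I \<star> gal ` J"
proof -
  have "I \<star> J \<subseteq> L" using assms by (intro iprod_subsetI) (auto simp: L.mult_mem L.add_mem subset_iff)
  then show ?thesis using assms by (intro iprod_image_hom) (auto simp: gal_mult gal_add subset_iff)
qed

lemma gal_image_gal: "I \<subseteq> L \<Longrightarrow> gal ` gal ` I = I"
  by (force simp: image_image subset_iff)

lemma gal_image_ints [simp]: "gal ` L.ints = L.ints"
proof -
  have "gal ` L.ints \<subseteq> L.ints" by auto
  moreover from this have "gal ` gal ` L.ints \<subseteq> gal ` L.ints" by blast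
  moreover have "gal ` gal ` L.ints = L.ints"
    by (rule gal_image_gal) (auto simp: L.ints_mem)
  ultimately show ?thesis by simp
qed

lemma gal_image_pideal: "a \<in> L \<Longrightarrow> gal ` L.pideal a = L.pideal (gal a)"
proof -
  assume a: "a \<in> L"
  have "gal ` L.pideal a = (\<lambda>x. gal a * x) ` gal ` L.ints"
    unfolding L.pideal_def image_image
    using a by (intro image_cong) (simp_all add: gal_mult L.ints_mem)
  then show ?thesis by (simp add: L.pideal_def)
qed

section \<open>Extension of ideals from the base field\<close>

definition ext :: "complex set \<Rightarrow> complex set" where "ext J = J \<star> L.ints"

lemma ext_frac [intro]:
  assumes J: "fractional_ideal F J"
  shows "fractional_ideal L (ext J)"
proof -
  obtain r where r: "r \<in> ring_of_integers F" "r \<noteq> 0" "\<And>x. x \<in> J \<Longrightarrow> r * x \<in> ring_of_integers F"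
    using F.frac_denom[OF J] by blast
  obtain a where a: "a \<in> J" "a \<noteq> 0" using F.frac_nonzero[OF J] by blast
  show ?thesis
  proof (rule L.frac_intro[of _ r])
    show "ext J \<subseteq> L" unfolding ext_def
      by (intro iprod_subsetI) (simp_all add: L.mult_mem L.add_mem L.ints_mem F.frac_mem[OF J] F_mem_L)
    show "0 \<in> ext J" using iprod_mult[of 0 J 0 "L.ints"] F.frac_0[OF J] by (simp add: ext_def)
    show "\<exists>x\<in>ext J. x \<noteq> 0" using iprod_mult[of a J 1 "L.ints"] a by (auto simp: ext_def)
    show "t * x \<in> ext J" if "t \<in> L.ints" "x \<in> ext J" for t x
      using that(2) unfolding ext_def
    proof (induction rule: iprod_induct)
      case (mult x y)
      then show ?case
        using iprod_mult[OF mult(1) L.ints_mult[OF that(1) mult(2)]] by (simp add: mult_ac)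
    qed (simp add: distrib_left iprod_add)
    show "r * x \<in> L.ints" if "x \<in> ext J" for x
      using that unfolding ext_def
    proof (induction rule: iprod_induct)
      case (mult x y)
      then show ?case
        using L.ints_mult[OF ints_F_L[OF r(3)], of x y] by (simp add: mult_ac)
    qed (simp add: distrib_left L.ints_add)
  qed (use r in \<open>auto simp: ext_def intro: iprod_add\<close>)
qed

lemma ext_iprod:  "ext (J \<star> K) = ext J \<star> ext K"
proof -
  have "L.ints \<star> L.ints = L.ints" by simp
  then show ?thesis unfolding ext_def by (metis iprod_assoc iprod_commute)
qed

lemma ext_pideal: "a \<in> F \<Longrightarrow> a \<noteq> 0 \<Longrightarrow> ext (F.pideal a) = L.pideal a"
proof
  assume a: "a \<in> F" "a \<noteq> 0"
  show "ext (F.pideal a) \<subseteq> L.pideal a"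
    unfolding ext_def
  proof (rule iprod_subsetI)
    fix x y assume "x \<in> F.pideal a" "y \<in> L.ints"
    then obtain u where "u \<in> ring_of_integers F" "x = a * u" by (auto simp: F.pideal_def)
    then show "x * y \<in> L.pideal a"
      using \<open>y \<in> _\<close> by (auto simp: L.pideal_def mult.assoc intro!: image_eqI[of _ _ "u * y"])
  next
    fix x y assume "x \<in> L.pideal a" "y \<in> L.pideal a"
    then show "x + y \<in> L.pideal a" using L.frac_add[OF L.frac_pideal, of a] a by auto
  qed
  show "L.pideal a \<subseteq> ext (F.pideal a)"
    using iprod_mult[OF F.self_mem_pideal[of a], of _ "L.ints"]
    by (auto simp: ext_def L.pideal_def)
qed

lemma ext_ints [simp]: "ext (ring_of_integers F) = L.ints"
  using ext_pideal[of 1] by simp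

end

locale inv_sqrt_ext = sqrt_ext F s + F: invertible_subfield F for F s
begin

text \<open>The relative norm ideal is \<open>J = (I \<star> gal I) \<inter> F\<close>. For \<open>a, b \<in> I\<close> and \<open>u \<in> J\<inverse>\<close>, the element
  \<open>u a gal b\<close> is a root of \<open>X\<^sup>2 - u tr (a gal b) X + u\<^sup>2 nm a nm b\<close>, whose coefficients are integral.\<close>

lemma relative_norm_ideal:
  assumes I: "fractional_ideal L I"
  shows "\<exists>J. fractional_ideal F J \<and> I \<star> gal ` I = ext J"
proof -
  define M where "M = I \<star> gal ` I"
  have M: "fractional_ideal L M" using I by (auto simp: M_def intro: gal_image_frac)
  define J where "J = M \<inter> F"
  note memI = L.frac_mem[OF I]
  obtain a where a: "a \<in> I" "a \<noteq> 0" using L.frac_nonzero[OF I] by blast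
  obtain r where r: "r \<in> L.ints" "r \<noteq> 0" "\<And>x. x \<in> M \<Longrightarrow> r * x \<in> L.ints"
    using L.frac_denom[OF M] by blast
  have nmJ: "nm x \<in> J" if "x \<in> I" for x
  proof -
    have "x * gal x \<in> M" using that unfolding M_def by (intro iprod_mult) auto
    then show ?thesis using nm_mem[OF memI[OF that]] by (simp add: J_def nm_def)
  qed
  have trJ: "tr (x * gal y) \<in> J" if "x \<in> I" "y \<in> I" for x y
  proof -
    have "tr (x * gal y) = x * gal y + y * gal x"
      using that memI by (simp add: tr_def gal_mult gal_mem)
    moreover have "x * gal y + y * gal x \<in> M"
      using that unfolding M_def by (intro iprod_add iprod_mult) auto
    moreover have "tr (x * gal y) \<in> F" using that memI by (auto intro: L.mult_mem)
    ultimately show ?thesis by (simp add: J_def)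
  qed
  have J: "fractional_ideal F J"
  proof (rule F.frac_intro[of _ "nm r"])
    show "0 \<in> J" using L.frac_0[OF M] by (simp add: J_def)
    show "\<exists>x\<in>J. x \<noteq> 0" using nmJ[OF a(1)] a memI by (intro bexI[of _ "nm a"]) auto
    show "nm r * x \<in> ring_of_integers F" if "x \<in> J" for x
    proof (rule ints_L_F)
      have "r * x \<in> L.ints" using r that by (simp add: J_def)
      then have "gal r * (r * x) \<in> L.ints" using r(1) by (rule L.ints_mult[OF gal_ints, rotated])
      then show "nm r * x \<in> L.ints" by (simp add: nm_def mult_ac)
      show "nm r * x \<in> F" using that r(1) by (auto simp: J_def intro!: F.mult_mem nm_mem L.ints_mem)
    qed
    show "t * x \<in> J" if "t \<in> ring_of_integers F" "x \<in> J" for t x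
      using that L.frac_mult[OF M, of t x] by (auto simp: J_def F.ints_mem)
    show "x + y \<in> J" if "x \<in> J" "y \<in> J" for x y
      using that L.frac_add[OF M, of x y] by (auto simp: J_def)
    show "nm r \<in> ring_of_integers F" using r by auto
    show "nm r \<noteq> 0" using r by (simp add: L.ints_mem)
  qed (auto simp: J_def)
  obtain K where K: "fractional_ideal F K" "J \<star> K = ring_of_integers F"
    using F.invertible[OF J] by blast
  have JK: "x * u \<in> ring_of_integers F" if "x \<in> J" "u \<in> K" for x u
    using iprod_mult[OF that] K by simp
  have int: "u * (x * gal y) \<in> L.ints" if "u \<in> K" "x \<in> I" "y \<in> I" for u x y
  proof (rule ints_by_tr_nm)
    have u: "u \<in> F" using F.frac_mem[OF K(1) that(1)] .
    have xy: "x \<in> L" "y \<in> L" using that memI by auto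
    then have z: "x * gal y \<in> L" by auto
    show "u * (x * gal y) \<in> L" using u z by auto
    have "tr (u * (x * gal y)) = tr (x * gal y) * u"
      using u z by (simp add: tr_def gal_mult F_mem_L distrib_left mult.commute)
    then show "tr (u * (x * gal y)) \<in> ring_of_integers F" using JK trJ that by simp
    have "nm (u * (x * gal y)) = (nm x * u) * (nm y * u)"
      using u xy by (simp add: nm_mult nm_F nm_gal F_mem_L L.mult_mem gal_mem power2_eq_square)
    then show "nm (u * (x * gal y)) \<in> ring_of_integers F" using JK nmJ that by (simp add: F.ints_mult)
  qed
  \<comment> \<open>As \<open>K\<close> is the inverse of \<open>J\<close>, multiplying this
    inclusion by \<open>J\<close> turns it into \<open>M \<subseteq> ext J\<close>. The other
    inclusion holds because \<open>J\<close> is contained in \<open>M\<close>.\<close>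
  have "K \<star> M \<subseteq> L.ints"
  proof (rule iprod_subsetI)
    fix u z assume u: "u \<in> K" and "z \<in> M"
    from this(2) show "u * z \<in> L.ints"
      unfolding M_def
    proof (induction rule: iprod_induct)
      case (mult x y)
      then show ?case using int[OF u] by auto
    qed (simp add: distrib_left L.ints_add)
  qed auto
  then have "J \<star> (K \<star> M) \<subseteq> ext J" unfolding ext_def by (intro iprod_mono) auto
  moreover have "J \<star> (K \<star> M) = M"
  proof -
    have "J \<star> (K \<star> M) = ring_of_integers F \<star> (L.ints \<star> M)"
      using M by (simp add: K(2) flip: iprod_assoc)
    also have "\<dots> = ext (ring_of_integers F) \<star> M"
      by (simp add: ext_def iprod_assoc del: ext_ints)
    finally show ?thesis using M by simp
  qed
  moreover have "ext J \<subseteq> M"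
    unfolding ext_def
  proof (rule iprod_subsetI)
    fix x y assume "x \<in> J" "y \<in> L.ints"
    then show "x * y \<in> M" using L.frac_mult[OF M, of y x] by (simp add: J_def mult.commute)
  qed (rule L.frac_add[OF M])
  ultimately show ?thesis using J by (auto simp: M_def)
qed

text \<open>The relative norm of \<open>I\<close> is an ideal of the base field. Its inverse,
  extended to \<open>L\<close> and multiplied by the conjugate of \<open>I\<close>, inverts
  \<open>I\<close>.\<close>

lemma L_invertible: "invertible_subfield L"
proof
  fix I assume I: "fractional_ideal L I"
  obtain J where J: "fractional_ideal F J" "I \<star> gal ` I = ext J"
    using relative_norm_ideal[OF I] by blast
  obtain K where K: "fractional_ideal F K" "J \<star> K = ring_of_integers F"
    using F.invertible[OF J(1)] by blast
  have "I \<star> (gal ` I \<star> ext K) = L.ints"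
    by (simp add: J(2) K(2) flip: iprod_assoc ext_iprod)
  then show "\<exists>J. fractional_ideal L J \<and> I \<star> J = L.ints"
    using I K by (blast intro: L.frac_iprod gal_image_frac ext_frac)
qed

sublocale L: invertible_subfield L by (rule L_invertible)

lemma cl_ext_hom: "(\<lambda>J. L.cl (ext J)) \<in> hom F.G L.C"
  by (auto simp: hom_def ext_frac ext_iprod L.cl_mult)

end

subsection \<open>Divisibility in rings of integers and ideals with two generators\<close>

context complex_subfield
begin

definition idvd :: "complex \<Rightarrow> complex \<Rightarrow> bool" (infix "idvd" 50) where
  "a idvd b \<longleftrightarrow> (\<exists>c\<in>\<O>. b = a * c)"

lemma idvd_iff: "a \<noteq> 0 \<Longrightarrow> a idvd b \<longleftrightarrow> b / a \<in> \<O>"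
  unfolding idvd_def by (auto simp: field_simps intro: bexI[of _ "b / a"])

lemma idvd_pideal_iff: "a idvd b \<longleftrightarrow> b \<in> pideal a"
  by (auto simp: idvd_def pideal_def)

lemma idvdI [intro]: "c \<in> \<O> \<Longrightarrow> b = a * c \<Longrightarrow> a idvd b" by (auto simp: idvd_def)
lemma idvd_0 [simp]: "a idvd 0" by (rule idvdI[of 0]) auto
lemma idvd_refl [simp]: "a idvd a" by (rule idvdI[of 1]) auto
lemma idvd_add: "a idvd b \<Longrightarrow> a idvd c \<Longrightarrow> a idvd b + c"
  unfolding idvd_def by (metis distrib_left ints_add)
lemma idvd_mult: "a idvd b \<Longrightarrow> c \<in> \<O> \<Longrightarrow> a idvd c * b"
  unfolding idvd_def by (metis mult.left_commute ints_mult)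
lemma idvd_trans: "a idvd b \<Longrightarrow> b idvd c \<Longrightarrow> a idvd c"
  unfolding idvd_def by (metis mult.assoc ints_mult)

definition gen2 :: "complex \<Rightarrow> complex \<Rightarrow> complex set" where
  "gen2 a b = {u * a + v * b | u v. u \<in> \<O> \<and> v \<in> \<O>}"

lemma gen2_I: "u \<in> \<O> \<Longrightarrow> v \<in> \<O> \<Longrightarrow> u * a + v * b \<in> gen2 a b" by (auto simp: gen2_def)

lemma gen2_left: "a \<in> gen2 a b" using gen2_I[of 1 0 a b] by simp
lemma gen2_right: "b \<in> gen2 a b" using gen2_I[of 0 1 a b] by simp

lemma frac_gen2 [intro]:
  assumes "a \<in> F" "b \<in> F" "a \<noteq> 0"
  shows "fractional_ideal F (gen2 a b)"
proof -
  obtain r where r: "r \<in> \<O>" "r \<noteq> 0" "\<And>x. x \<in> pideal a \<Longrightarrow> r * x \<in> \<O>"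
    using frac_denom[OF frac_pideal[OF assms(1,3)]] by blast
  obtain n :: int where n: "n \<noteq> 0" "algebraic_int (of_int n * b)" using denom[OF assms(2)] by blast
  have nb: "of_int n * b \<in> \<O>" using n assms(2) by (auto simp: ints_iff)
  have ra: "r * a \<in> \<O>" using r self_mem_pideal by blast
  show ?thesis
  proof (rule frac_intro[of _ "of_int n * r"])
    show "gen2 a b \<subseteq> F" using assms by (auto simp: gen2_def ints_mem intro!: add_mem mult_mem)
    show "0 \<in> gen2 a b" using gen2_I[of 0 0 a b] by simp
    show "\<exists>x\<in>gen2 a b. x \<noteq> 0" using gen2_left assms(3) by blast
    show "x + y \<in> gen2 a b" if xy: "x \<in> gen2 a b" "y \<in> gen2 a b" for x y
    proof -
      obtain u v u' v' where "u \<in> \<O>" "v \<in> \<O>" "x = u * a + v * b" "u' \<in> \<O>" "v' \<in> \<O>" "y = u' * a + v' * b"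
        using xy by (auto simp: gen2_def)
      moreover from this have "x + y = (u + u') * a + (v + v') * b" by (simp add: algebra_simps)
      ultimately show ?thesis using gen2_I[of "u + u'" "v + v'" a b] by auto
    qed
    show "t * x \<in> gen2 a b" if tx: "t \<in> \<O>" "x \<in> gen2 a b" for t x
    proof -
      obtain u v where "u \<in> \<O>" "v \<in> \<O>" "x = u * a + v * b"
        using tx by (auto simp: gen2_def)
      moreover from this have "t * x = (t * u) * a + (t * v) * b" by (simp add: algebra_simps)
      ultimately show ?thesis using gen2_I[of "t * u" "t * v" a b] tx by auto
    qed
    show "of_int n * r * x \<in> \<O>" if x: "x \<in> gen2 a b" for x
    proof -
      obtain u v where uv: "u \<in> \<O>" "v \<in> \<O>" "x = u * a + v * b"
        using x by (auto simp: gen2_def)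
      then have "of_int n * r * x = of_int n * (u * (r * a)) + v * (r * (of_int n * b))"
        by (simp add: algebra_simps)
      moreover have "of_int n * (u * (r * a)) + v * (r * (of_int n * b)) \<in> \<O>"
        by (rule ints_add[OF ints_mult[OF ints_of_int ints_mult[OF uv(1) ra]]
              ints_mult[OF uv(2) ints_mult[OF r(1) nb]]])
      ultimately show ?thesis by simp
    qed
  qed (use n r in auto)
qed

lemma gen2_iprod_subset:
  assumes "r \<in> F" "r \<noteq> 0" "r idvd a * c" "r idvd a * d" "r idvd b * c" "r idvd b * d"
  shows "gen2 a b \<star> gen2 c d \<subseteq> pideal r"
proof (rule iprod_subsetI)
  fix x y assume "x \<in> gen2 a b" "y \<in> gen2 c d"
  then obtain u v u' v' where uv: "u \<in> \<O>" "v \<in> \<O>" "x = u * a + v * b" "u' \<in> \<O>" "v' \<in> \<O>" "y = u' * c + v' * d"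
    by (auto simp: gen2_def)
  have "x * y = (u * u') * (a * c) + (u * v') * (a * d) + (v * u') * (b * c) + (v * v') * (b * d)"
    by (simp add: uv algebra_simps)
  moreover have "r idvd \<dots>" using uv(1,2,4,5) assms by (simp add: idvd_add idvd_mult ints_mult)
  ultimately show "x * y \<in> pideal r" by (simp only: idvd_pideal_iff)
next
  fix x y assume "x \<in> pideal r" "y \<in> pideal r"
  then show "x + y \<in> pideal r" by (simp add: idvd_add flip: idvd_pideal_iff)
qed

lemma pideal_subsetI:
  assumes "fractional_ideal F I" "r \<in> I"
  shows "pideal r \<subseteq> I"
  using frac_mult[OF assms(1) _ assms(2)] by (auto simp: pideal_def mult.commute)

text \<open>The square of (p, t) is generated by \<open>p ^ 2\<close>, \<open>p * t\<close> and
  \<open>t ^ 2 = p * m\<close>. It is therefore \<open>p\<close> times (p, t, m), and the latter is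
  the whole ring since \<open>p\<close> and \<open>m\<close> are coprime.\<close>

lemma gen2_square:
  assumes "p \<in> \<O>" "p \<noteq> 0" "t \<in> \<O>" "m \<in> \<O>" "u \<in> \<O>" "v \<in> \<O>" "t ^ 2 = p * m" "u * p + v * m = 1"
  shows "gen2 p t \<star> gen2 p t = pideal p"
proof
  show "gen2 p t \<star> gen2 p t \<subseteq> pideal p"
    by (rule gen2_iprod_subset[OF ints_mem[OF assms(1)] assms(2) idvdI[OF assms(1)] idvdI[OF assms(3)]
          idvdI[OF assms(3)] idvdI[OF assms(4)]])
      (use assms(7) in \<open>simp_all add: power2_eq_square mult.commute\<close>)
  have I: "fractional_ideal F (gen2 p t \<star> gen2 p t)"
    using assms(1-3) by (simp add: frac_iprod frac_gen2 ints_mem)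
  have "u * (p * p) + v * (t * t) \<in> gen2 p t \<star> gen2 p t"
    by (rule frac_add[OF I frac_mult[OF I assms(5) iprod_mult[OF gen2_left gen2_left]]
          frac_mult[OF I assms(6) iprod_mult[OF gen2_right gen2_right]]])
  also have "u * (p * p) + v * (t * t)
     = p * (u * p + v * m)"
    using assms(7) by (simp add: power2_eq_square algebra_simps)
  finally show "pideal p \<subseteq> gen2 p t \<star> gen2 p t" using I assms(8) by (intro pideal_subsetI) auto
qed

text \<open>The product of (p, b) and (p, c) lies in (p) because \<open>p\<close> divides
  \<open>b * c\<close>, and it contains \<open>p\<close> times (p, b + c), which is (p) by the last
  hypothesis.\<close>

lemma gen2_conjugate:
  assumes "p \<in> \<O>" "p \<noteq> 0" "b \<in> \<O>" "c \<in> \<O>" "u \<in> \<O>" "v \<in> \<O>" "p idvd b * c" "u * p + v * (b + c) = 1"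
  shows "gen2 p b \<star> gen2 p c = pideal p"
proof
  show "gen2 p b \<star> gen2 p c \<subseteq> pideal p"
    by (rule gen2_iprod_subset[OF ints_mem[OF assms(1)] assms(2) idvdI[OF assms(1)] idvdI[OF assms(4)]
          idvdI[OF assms(3)] assms(7)])
      (simp_all add: mult.commute)
  have I: "fractional_ideal F (gen2 p b \<star> gen2 p c)"
    using assms(1-4) by (simp add: frac_iprod frac_gen2 ints_mem)
  have "u * (p * p) + v * (b * p + p * c) \<in> gen2 p b \<star> gen2 p c"
    by (rule frac_add[OF I frac_mult[OF I assms(5) iprod_mult[OF gen2_left gen2_left]]
          frac_mult[OF I assms(6) iprod_add[OF iprod_mult[OF gen2_right gen2_left]
            iprod_mult[OF gen2_left gen2_right]]]])
  also have "u * (p * p) + v * (b * p + p * c)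
     = p * (u * p + v * (b + c))"
    by (simp add: algebra_simps)
  finally show "pideal p \<subseteq> gen2 p b \<star> gen2 p c" using I assms(8) by (intro pideal_subsetI) auto
qed

text \<open>Primality of \<open>p\<close> is stated in Bezout form: every integer is a multiple of
  \<open>p\<close> or coprime to it. Removing one such factor at a time determines the divisors of a
  product without unique factorisation.\<close>

lemma idvd_peel:
  assumes p: "p \<in> \<O>" "p \<noteq> 0" "\<And>x. x \<in> \<O> \<Longrightarrow> p idvd x \<or> (\<exists>u\<in>\<O>. \<exists>v\<in>\<O>. u * p + v * x = 1)"
    and g: "g \<in> \<O>" and h: "h \<in> \<O>" and dvd: "g idvd p * h"
  shows "g idvd h \<or> (\<exists>g'\<in>\<O>. g = p * g' \<and> g' idvd h)"
  using p(3)[OF g]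
proof
  assume "p idvd g"
  then obtain g' where g': "g' \<in> \<O>" "g = p * g'" by (auto simp: idvd_def)
  moreover obtain w where "w \<in> \<O>" "p * h = g * w" using dvd by (auto simp: idvd_def)
  ultimately show ?thesis using p(2) by (auto simp: idvd_def)
next
  assume "\<exists>u\<in>\<O>. \<exists>v\<in>\<O>. u * p + v * g = 1"
  then obtain u v where uv: "u \<in> \<O>" "v \<in> \<O>" "u * p + v * g = 1" by blast
  have "h = u * (p * h) + (v * h) * g" using arg_cong[OF uv(3), of "\<lambda>x. x * h"] by (simp add: algebra_simps)
  moreover have "g idvd u * (p * h) + (v * h) * g"
    by (rule idvd_add[OF idvd_mult[OF dvd uv(1)] idvd_mult[OF idvd_refl ints_mult[OF uv(2) h]]])
  ultimately have "g idvd h" by metis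
  then show ?thesis ..
qed

end

context invertible_subfield
begin

text \<open>The quotient \<open>M\<close> of the two ideals satisfies
  \<open>M \<star> M = \<O>\<close>. Every element of \<open>M\<close> then has an integral square,
  so it is integral itself; thus \<open>M \<subseteq> \<O>\<close>, and
  \<open>\<O> = M \<star> M \<subseteq> M\<close>.\<close>

lemma iprod_square_cancel:
  assumes J: "fractional_ideal F J" and K: "fractional_ideal F K" and eq: "J \<star> J = K \<star> K"
  shows "J = K"
proof -
  obtain K' where K': "fractional_ideal F K'" "K \<star> K' = \<O>" using invertible[OF K] by blast
  define M where "M = J \<star> K'"
  have M: "fractional_ideal F M" using J K' by (auto simp: M_def)
  have "M \<star> M = (J \<star> J) \<star> (K' \<star> K')" unfolding M_def by (simp only: iprod_ac)
  also have "\<dots> = (K \<star> K') \<star> (K \<star> K')" unfolding eq by (simp only: iprod_ac)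
  finally have MM: "M \<star> M = \<O>" by (simp add: K')
  have sub: "M \<subseteq> \<O>"
  proof
    fix x assume x: "x \<in> M"
    then have "x ^ 2 \<in> \<O>" using iprod_mult[OF x x] MM by (simp add: power2_eq_square)
    then show "x \<in> \<O>" using frac_mem[OF M x] algebraic_int_of_square by (auto simp: ints_iff)
  qed
  then have "M \<star> M \<subseteq> M \<star> \<O>" by (intro iprod_mono) auto
  then have "M = \<O>" using sub MM M by auto
  have "J = J \<star> (K' \<star> K)" using J K' by (simp add: iprod_commute[of K'])
  also have "\<dots> = M \<star> K" by (simp add: M_def iprod_assoc)
  finally show "J = K" using \<open>M = \<O>\<close> K by simp
qed

end

locale pid_subfield = complex_subfield +
  assumes principal: "fractional_ideal F I \<Longrightarrow> \<exists>a\<in>F. a \<noteq> 0 \<and> I = pideal a"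
begin

lemma gcd_exists:
  assumes "a \<in> \<O>" "b \<in> \<O>" "a \<noteq> 0"
  shows "\<exists>h\<in>\<O>. h \<noteq> 0 \<and> h idvd a \<and> h idvd b \<and> (\<exists>u\<in>\<O>. \<exists>v\<in>\<O>. h = u * a + v * b)"
proof -
  obtain h where h: "h \<in> F" "h \<noteq> 0" "gen2 a b = pideal h"
    using principal[of "gen2 a b"] frac_gen2[of a b] assms ints_mem by blast
  have "h \<in> gen2 a b" using self_mem_pideal h by simp
  moreover have "gen2 a b \<subseteq> \<O>" using assms by (auto simp: gen2_def)
  moreover have "a \<in> pideal h" "b \<in> pideal h" using gen2_left[of a b] gen2_right[of b a] h by simp_all
  ultimately show ?thesis using h(2) unfolding idvd_pideal_iff by (auto simp: gen2_def)
qed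

sublocale invertible_subfield
proof
  fix I assume I: "fractional_ideal F I"
  then obtain a where a: "a \<in> F" "a \<noteq> 0" "I = pideal a" using principal by blast
  then show "\<exists>J. fractional_ideal F J \<and> I \<star> J = \<O>"
    by (intro exI[of _ "pideal (inverse a)"]) (simp add: frac_pideal inverse_mem pideal_mult)
qed

end

text \<open>In both instances \<open>sz\<close> is the absolute value of the norm to the rationals.
  It serves as a measure for descent and recognises units.\<close>

locale normed_pid_subfield = pid_subfield +
  fixes sz :: "complex \<Rightarrow> nat"
  assumes sz_pos: "a \<in> \<O> \<Longrightarrow> a \<noteq> 0 \<Longrightarrow> sz a > 0"
    and sz_mult: "a \<in> \<O> \<Longrightarrow> b \<in> \<O> \<Longrightarrow> sz (a * b) = sz a * sz b"
    and sz_unit: "a \<in> \<O> \<Longrightarrow> sz a = 1 \<Longrightarrow> inverse a \<in> \<O>"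
begin

text \<open>The element generates a radical ideal, in other words it is squarefree; this version
  does not mention primes.\<close>

definition radical :: "complex \<Rightarrow> bool" where
  "radical g \<longleftrightarrow> g \<in> \<O> \<and> g \<noteq> 0 \<and> (\<forall>t\<in>\<O>. g idvd t ^ 2 \<longrightarrow> g idvd t)"

text \<open>A multiplier \<open>c\<close> for which \<open>c ^ 2 * g\<close> is integral of least
  size has removed every square factor.\<close>

lemma radical_multiple:
  assumes g: "g \<in> F" "g \<noteq> 0"
  shows "\<exists>c\<in>F. c \<noteq> 0 \<and> radical (c ^ 2 * g)"
proof -
  define S where "S = {c \<in> F. c \<noteq> 0 \<and> c ^ 2 * g \<in> \<O>}"
  obtain n :: int where n: "n \<noteq> 0" "algebraic_int (of_int n * g)" using denom[OF g(1)] by blast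
  have "algebraic_int (of_int n * (of_int n * g))"
    by (rule algebraic_int_mult[OF algebraic_int_of_int n(2)])
  then have "of_int n \<in> S" using n g by (auto simp: S_def ints_iff power2_eq_square mult.assoc)
  then obtain c where c: "c \<in> S" and min: "\<And>c'. c' \<in> S \<Longrightarrow> sz (c ^ 2 * g) \<le> sz (c' ^ 2 * g)"
    using ex_has_least_nat[of "\<lambda>c. c \<in> S" _ "\<lambda>c. sz (c ^ 2 * g)"] by blast
  define h where "h = c ^ 2 * g"
  have h: "h \<in> \<O>" "h \<noteq> 0" "c \<in> F" "c \<noteq> 0" using c g by (auto simp: S_def h_def)
  have "h idvd t" if t: "t \<in> \<O>" "h idvd t ^ 2" for t
  proof (cases "t = 0")
    case False
    obtain f u v where f: "f \<in> \<O>" "f \<noteq> 0" "f idvd h" "f idvd t" "u \<in> \<O>" "v \<in> \<O>" "f = u * h + v * t"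
      using gcd_exists[OF h(1) t(1) h(2)] by blast
    obtain a where a: "a \<in> \<O>" "h = f * a" using f(3) unfolding idvd_def by blast
    obtain b where b: "b \<in> \<O>" "t = f * b" using f(4) unfolding idvd_def by blast
    note ab = a(1) b(1) a(2) b(2)
    have "f * (u * a + v * b) = u * h + v * t" by (simp add: a(2) b(2) algebra_simps)
    also have "\<dots> = f * 1" by (simp flip: f(7))
    finally have uv: "u * a + v * b = 1" using f(2) by simp
    obtain w where w: "w \<in> \<O>" "t ^ 2 = h * w" using t(2) unfolding idvd_def by blast
    have "f * (a * w) = t ^ 2" by (simp add: w(2) a(2))
    also have "\<dots> = f * (f * b ^ 2)" by (simp add: b(2) power2_eq_square)
    finally have aw: "a * w = f * b ^ 2" using f(2) by simp
    \<comment> \<open>Squaring the Bezout relation shows that \<open>a\<close> divides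
      \<open>f\<close>, so \<open>a ^ 2\<close> divides \<open>h\<close>. Passing from
      \<open>c\<close> to \<open>c / a\<close> would lower the size unless \<open>a\<close> is a
      unit, and then \<open>h\<close> divides \<open>t\<close> along with \<open>f\<close>.\<close>
    have "f = f * (u * a + v * b) ^ 2" by (simp add: uv)
    also have "\<dots> = a * (f * u ^ 2 * a + 2 * f * u * v * b) + v ^ 2 * (f * b ^ 2)"
      by (simp add: power2_eq_square algebra_simps)
    also have "\<dots> = a * (f * u ^ 2 * a + 2 * f * u * v * b + v ^ 2 * w)"
      by (simp add: algebra_simps flip: aw)
    finally have fk: "f = a * (f * u ^ 2 * a + 2 * f * u * v * b + v ^ 2 * w)" .
    moreover have "f * u ^ 2 * a + 2 * f * u * v * b + v ^ 2 * w \<in> \<O>"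
      using f(1,5,6) ab(1,2) w(1) by (simp add: ints_add ints_mult ints_power)
    ultimately obtain k where k: "k \<in> \<O>" "f = a * k" by metis
    have a0: "a \<noteq> 0" using h(2) a(2) by auto
    have hk: "h = a ^ 2 * k" by (subst a(2), subst k(2)) (simp add: power2_eq_square)
    have "(c / a) ^ 2 * g = h / a ^ 2" by (simp add: h_def power_divide)
    also have "\<dots> = k" using a0 by (simp add: hk)
    finally have ck: "(c / a) ^ 2 * g = k" .
    have "c / a \<in> F" using h(3) ints_mem[OF ab(1)] by (rule divide_mem)
    then have "c / a \<in> S" using h(4) a0 k(1) by (simp add: S_def ck del: power_divide)
    then have "sz h \<le> sz k" using min[of "c / a"] by (simp add: ck h_def[symmetric] del: power_divide)
    moreover have "sz h = sz a * (sz a * sz k)"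
      using ab(1) k(1) by (simp add: hk power2_eq_square mult.assoc sz_mult ints_mult)
    moreover have "k \<noteq> 0" using f(2) k(2) by auto
    then have "sz k > 0" "sz a > 0" using sz_pos k(1) ab(1) a0 by auto
    ultimately have "(sz a * sz a) * sz k \<le> 1 * sz k" by (simp add: mult.assoc)
    then have "sz a * sz a \<le> 1" using \<open>sz k > 0\<close> by (simp only: mult_le_cancel2)
    moreover have "sz a \<le> sz a * sz a" using \<open>sz a > 0\<close> by simp
    ultimately have "sz a = 1" using \<open>sz a > 0\<close> by linarith
    then have "inverse a \<in> \<O>" using sz_unit ab by blast
    then show ?thesis using a0 b(1) by (intro idvdI[of "inverse a * b"]) (auto simp: a(2) b(2))
  qed simp
  then show ?thesis using h by (intro bexI[of _ c]) (auto simp: radical_def h_def)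
qed

end

subsection \<open>Ambiguous ideal classes over a principal ideal domain\<close>

context invertible_subfield
begin

lemma cl_eqD:
  assumes J: "fractional_ideal F J" and I: "fractional_ideal F I" and eq: "cl J = cl I"
  shows "\<exists>b\<in>F. b \<noteq> 0 \<and> J = pideal b \<star> I"
proof -
  obtain K where K: "fractional_ideal F K" "I \<star> K = \<O>" using invertible[OF I] by blast
  have "cl (J \<star> K) = cl (I \<star> K)" unfolding cl_mult[OF J K(1)] cl_mult[OF I K(1)] eq ..
  also have "\<dots> = \<one>\<^bsub>C\<^esub>" using cl_pideal[of 1] by (simp add: K)
  finally obtain b where b: "b \<in> F" "b \<noteq> 0" "J \<star> K = pideal b"
    using cl_one_iff[of "J \<star> K"] J K by auto
  have "J = J \<star> (K \<star> I)" using J K by (simp add: iprod_commute[of K])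
  then have "J = pideal b \<star> I" by (simp add: b(3) flip: iprod_assoc)
  then show ?thesis using b by blast
qed

end

locale pid_sqrt_ext = inv_sqrt_ext F s + F: normed_pid_subfield F sz for F s sz
begin

text \<open>The generator has to lie in the base field. Such an ideal is invariant under conjugation
  and determined by \<open>g\<close>, so classes of order two can be listed by generators.\<close>

definition sq_ideal :: "complex set \<Rightarrow> complex \<Rightarrow> bool" where
  "sq_ideal J g \<longleftrightarrow> fractional_ideal L J \<and> g \<in> F \<and> g \<noteq> 0 \<and> J \<star> J = L.pideal g"

lemma sq_idealD:
  assumes "sq_ideal J g"
  shows "fractional_ideal L J" "g \<in> F" "g \<noteq> 0" "J \<star> J = L.pideal g" "g \<in> L"
  using assms by (auto simp: sq_ideal_def)

lemma relative_norm_principal: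
  assumes "fractional_ideal L I"
  shows "\<exists>g\<in>F. g \<noteq> 0 \<and> I \<star> gal ` I = L.pideal g"
proof -
  obtain J where J: "fractional_ideal F J" "I \<star> gal ` I = ext J" using relative_norm_ideal[OF assms] by blast
  then obtain g where "g \<in> F" "g \<noteq> 0" "J = F.pideal g" using F.principal by blast
  then show ?thesis using J by (auto simp: ext_pideal)
qed

text \<open>Conjugation fixes \<open>g\<close>, so the conjugate ideal has the same square, and
  squares of ideals can be cancelled.\<close>

lemma sq_ideal_gal:
  assumes "sq_ideal J g"
  shows "gal ` J = J"
proof (rule L.iprod_square_cancel)
  note sq = sq_idealD[OF assms]
  show "fractional_ideal L (gal ` J)" "fractional_ideal L J" using sq gal_image_frac by auto
  have "gal ` J \<star> gal ` J = gal ` (J \<star> J)" using L.frac_mem[OF sq(1)] by (intro gal_image_iprod[symmetric]) auto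
  then show "gal ` J \<star> gal ` J = J \<star> J" using sq by (simp add: gal_image_pideal)
qed

lemma sq_ideal_unique: "sq_ideal J g \<Longrightarrow> sq_ideal K g \<Longrightarrow> J = K"
  using L.iprod_square_cancel[of J K] by (auto simp: sq_ideal_def)

lemma sq_ideal_scale:
  assumes "sq_ideal J g" "c \<in> F" "c \<noteq> 0"
  shows "sq_ideal (L.pideal c \<star> J) (c ^ 2 * g)"
proof -
  note sq = sq_idealD[OF assms(1)]
  have "(L.pideal c \<star> J) \<star> (L.pideal c \<star> J) = (L.pideal c \<star> L.pideal c) \<star> (J \<star> J)"
    by (simp only: iprod_ac)
  also have "\<dots> = L.pideal (c ^ 2 * g)"
    using sq assms by (simp add: L.pideal_mult power2_eq_square F_mem_L L.mult_mem)
  finally show ?thesis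
    using sq assms by (auto simp: sq_ideal_def F_mem_L)
qed

lemma sq_ideal_mult:
  assumes "sq_ideal J g" "sq_ideal K h"
  shows "sq_ideal (J \<star> K) (g * h)"
proof -
  note sq = sq_idealD[OF assms(1)] sq_idealD[OF assms(2)]
  have "(J \<star> K) \<star> (J \<star> K) = (J \<star> J) \<star> (K \<star> K)" by (simp only: iprod_ac)
  then show ?thesis using sq by (auto simp: sq_ideal_def L.pideal_mult)
qed

lemma sq_ideal_cong:
  assumes "sq_ideal J g" "h \<in> F" "h \<noteq> 0" "g / h \<in> L.ints" "h / g \<in> L.ints"
  shows "sq_ideal J h"
  using assms L.pideal_eq_iff[of g h] by (auto simp: sq_ideal_def)

text \<open>The element \<open>1 + gal x\<close> solves the equation unless it vanishes; this
  happens only for \<open>x = -1\<close>, where \<open>s\<close> does.\<close>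

lemma hilbert90:
  assumes x: "x \<in> L" and nm: "nm x = 1"
  shows "\<exists>b\<in>L. b \<noteq> 0 \<and> x * b = gal b"
proof (cases "x = -1")
  case True
  have "s \<noteq> 0" using s_notin by auto
  then show ?thesis using True by (intro bexI[of _ s]) auto
next
  case False
  have "1 + gal x \<noteq> 0"
  proof
    assume "1 + gal x = 0"
    then have "gal x = -1" by (simp add: eq_neg_iff_add_eq_0 add.commute)
    then have "gal (gal x) = -1" by (simp add: F.uminus_mem)
    then show False using False x by simp
  qed
  moreover have "x * (1 + gal x) = gal (1 + gal x)"
    using x nm by (simp add: gal_add gal_mem nm_def distrib_left)
  ultimately show ?thesis using x by (intro bexI[of _ "1 + gal x"]) auto
qed

text \<open>If \<open>I\<^sup>2 = (\<gamma>)\<close> and \<open>I \<star> gal ` I = (g)\<close>, then \<open>nm (\<gamma> / g)\<close> is a unit of the base field, and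
  after removing a square root of it Hilbert 90 rescales \<open>I\<close> to an ideal whose square is generated by an
  element of the base field.\<close>

lemma two_torsion_sq_ideal:
  assumes I: "fractional_ideal L I" and tors: "L.cl I \<otimes>\<^bsub>L.C\<^esub> L.cl I = \<one>\<^bsub>L.C\<^esub>"
    and units: "\<And>x. x \<in> L \<Longrightarrow> nm x \<in> ring_of_integers F \<Longrightarrow> inverse (nm x) \<in> ring_of_integers F
      \<Longrightarrow> \<exists>v\<in>F. nm x = v ^ 2"
  shows "\<exists>J g. sq_ideal J g \<and> L.cl J = L.cl I"
proof -
  have "L.cl (I \<star> I) = \<one>\<^bsub>L.C\<^esub>" using I tors by (simp add: L.cl_mult)
  then obtain c where c: "c \<in> L" "c \<noteq> 0" "I \<star> I = L.pideal c"
    using L.cl_one_iff[of "I \<star> I"] I by auto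
  obtain g where g: "g \<in> F" "g \<noteq> 0" "I \<star> gal ` I = L.pideal g" using relative_norm_principal[OF I] by blast
  have sub: "I \<subseteq> L" using L.frac_mem[OF I] by auto
  have gL: "g \<in> L" using g by auto
  have "gal ` I \<star> gal ` I = L.pideal (gal c)"
    using gal_image_iprod[OF sub sub] c gal_image_pideal[of c] by simp
  then have "L.pideal (nm c) = (I \<star> I) \<star> (gal ` I \<star> gal ` I)"
    using c by (simp add: L.pideal_mult nm_def gal_mem)
  also have "\<dots> = (I \<star> gal ` I) \<star> (I \<star> gal ` I)" by (simp only: iprod_ac)
  also have "\<dots> = L.pideal (g ^ 2)" using g gL by (simp add: L.pideal_mult power2_eq_square)
  finally have eq: "nm c / g ^ 2 \<in> L.ints" "g ^ 2 / nm c \<in> L.ints"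
    using L.pideal_eq_iff[of "nm c" "g ^ 2"] c g gL by (auto simp: F_mem_L nm_mem L.power_mem)
  have nmcg: "nm (c / g) = nm c / g ^ 2"
    using c gL g by (simp add: nm_divide nm_F)
  have "c / g \<in> L" using c gL by auto
  moreover have "nm (c / g) \<in> ring_of_integers F" "inverse (nm (c / g)) \<in> ring_of_integers F"
    using eq nm_mem[OF \<open>c / g \<in> L\<close>] F.inverse_mem[OF nm_mem[OF \<open>c / g \<in> L\<close>]]
    by (auto simp: nmcg intro!: ints_L_F)
  ultimately obtain v where v: "v \<in> F" "nm (c / g) = v ^ 2" using units by blast
  have v0: "v \<noteq> 0"
  proof
    assume "v = 0"
    then have "nm (c / g) = 0" using v by simp
    then show False using c g nm_eq_0_iff[OF \<open>c / g \<in> L\<close>] by simp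
  qed
  have vL: "v \<in> L" using v by auto
  define x where "x = c / g / v"
  have xL: "x \<in> L" unfolding x_def using \<open>c / g \<in> L\<close> vL by (rule L.divide_mem)
  have "nm x = nm (c / g) / nm v" unfolding x_def using \<open>c / g \<in> L\<close> vL by (rule nm_divide)
  then have "nm x = 1" using v v0 by (simp add: nm_F)
  then obtain b where b: "b \<in> L" "b \<noteq> 0" "x * b = gal b" using hilbert90[OF xL] by blast
  have "sq_ideal (L.pideal b \<star> I) (nm b * (g * v))"
    unfolding sq_ideal_def
  proof (intro conjI)
    show "fractional_ideal L (L.pideal b \<star> I)" using b I by auto
    show "nm b * (g * v) \<in> F" using b g v by auto
    show "nm b * (g * v) \<noteq> 0" using b g v0 by simp
    have "(L.pideal b \<star> I) \<star> (L.pideal b \<star> I) = (L.pideal b \<star> L.pideal b) \<star> (I \<star> I)"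
      by (simp only: iprod_ac)
    also have "\<dots> = L.pideal (b * b * c)" using b c by (simp add: L.pideal_mult L.mult_mem)
    also have "b * b * c = b * (x * b) * (g * v)" using g v0 by (simp add: x_def)
    also have "\<dots> = nm b * (g * v)" by (simp add: b(3) nm_def)
    finally show "(L.pideal b \<star> I) \<star> (L.pideal b \<star> I) = L.pideal (nm b * (g * v))" .
  qed
  moreover have "L.cl (L.pideal b \<star> I) = L.cl I" using L.cl_eqI[OF I b(1,2)] .
  ultimately show ?thesis by blast
qed

lemma sq_ideal_radical:
  assumes "sq_ideal J g"
  shows "\<exists>K h. sq_ideal K h \<and> F.radical h \<and> L.cl K = L.cl J"
proof -
  note sq = sq_idealD[OF assms]
  obtain c where c: "c \<in> F" "c \<noteq> 0" "F.radical (c ^ 2 * g)" using F.radical_multiple[OF sq(2,3)] by blast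
  then show ?thesis
    using sq_ideal_scale[OF assms c(1,2)] L.cl_eqI[OF sq(1) F_mem_L[OF c(1)] c(2)] by blast
qed

text \<open>Only ramified primes can occur in a radical \<open>g\<close>. Write \<open>D\<close> for
  the square of \<open>w - gal w\<close>. The crux is that \<open>g\<close> divides
  \<open>D * a\<close> for every \<open>a\<close> in \<open>J\<close>: then \<open>D\<close> times
  \<open>J\<close> lies in \<open>J \<star> J\<close>, so \<open>D\<close> lies in \<open>J\<close>,
  so \<open>g\<close> divides \<open>D ^ 2\<close> and, being radical, \<open>D\<close>.\<close>

lemma sq_ideal_dvd_discriminant:
  assumes J: "sq_ideal J g" and rad: "F.radical g"
    and w: "w \<in> L.ints" "w \<notin> F"
  shows "F.idvd g ((w - gal w) ^ 2)"
proof -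
  note sq = sq_idealD[OF J]
  have wL: "w \<in> L" using w by (simp add: L.ints_mem)
  define D where "D = (w - gal w) ^ 2"
  have galD: "gal (w - gal w) = - (w - gal w)" using wL by (simp add: gal_diff gal_mem)
  have D0: "D \<noteq> 0" using w wL gal_fixed_iff[OF wL] by (auto simp: D_def)
  have wwL: "w - gal w \<in> L" using wL by auto
  have "gal D = (- (w - gal w)) ^ 2" unfolding D_def gal_power[OF wwL] galD ..
  then have "gal D = D" by (simp only: power2_minus D_def)
  then have DF: "D \<in> F" using gal_fixed_iff[of D] wwL by (simp add: D_def L.power_mem)
  have DO: "D \<in> ring_of_integers F"
    using w DF by (intro ints_L_F) (auto simp: D_def)
  have dvdF: "F.idvd g t" if "t \<in> ring_of_integers F" "t ^ 2 / g \<in> L.ints" for t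
  proof -
    have "t ^ 2 / g \<in> F" using F.ints_mem[OF that(1)] sq(2) by (intro F.divide_mem F.power_mem)
    then have "t ^ 2 / g \<in> ring_of_integers F" using that by (intro ints_L_F)
    then show ?thesis using rad that F.idvd_iff[OF sq(3)] unfolding F.radical_def by blast
  qed
  have JJ: "x * y / g \<in> L.ints" if "x \<in> J" "y \<in> J" for x y
    using iprod_mult[OF that] sq(3,4) L.mem_pideal_iff[of g "x * y"] by simp
  have gO: "g \<in> L.ints" using rad by (auto simp: F.radical_def)
  have key: "D * a / g \<in> L.ints" if a: "a \<in> J" for a
  proof -
    have aL: "a \<in> L" using L.frac_mem[OF sq(1) a] .
    have ga: "gal a \<in> J" using sq_ideal_gal[OF J] a by blast
    have a2: "a ^ 2 / g \<in> L.ints" using JJ[OF a a] by (simp add: power2_eq_square)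
    have aO: "a \<in> L.ints"
    proof -
      have "a ^ 2 = a ^ 2 / g * g" using sq by simp
      then have "algebraic_int (a ^ 2)" using L.ints_mult[OF a2 gO] by (simp add: L.ints_iff)
      then show ?thesis using aL algebraic_int_of_square by (simp add: L.ints_iff)
    qed
    have T: "tr a \<in> ring_of_integers F" and N: "nm a \<in> ring_of_integers F" using aO by auto
    have tJ: "tr a \<in> J" using L.frac_add[OF sq(1) a ga] by (simp add: tr_def)
    \<comment> \<open>The numbers \<open>x\<close> and \<open>z\<close> are the coordinates of
      \<open>D * a\<close> with respect to 1 and \<open>w\<close>. Both are integers of the base
      field whose squares are divisible by \<open>g\<close>, hence they are divisible by
      \<open>g\<close> themselves.\<close>
    define z where "z = (a - gal a) * (w - gal w)"
    have diffs: "a - gal a \<in> L" "w - gal w \<in> L" using aL wL by auto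
    have zL: "z \<in> L" unfolding z_def using diffs by (rule L.mult_mem)
    have "gal z = (gal a - a) * (gal w - w)"
      using aL wL diffs by (simp add: z_def gal_mult gal_diff gal_mem)
    also have "\<dots> = z" by (simp add: z_def algebra_simps)
    finally have zF: "z \<in> F" using gal_fixed_iff[OF zL] by simp
    have zO: "z \<in> ring_of_integers F"
      using aO w by (intro ints_L_F zF) (auto simp: z_def)
    have "(a - gal a) \<in> J" using L.frac_diff[OF sq(1) a ga] .
    then have "(a - gal a) * (a - gal a) / g \<in> L.ints" by (rule JJ[OF _ \<open>(a - gal a) \<in> J\<close>])
    then have "(a - gal a) * (a - gal a) / g * D \<in> L.ints" using DO by (intro L.ints_mult) auto
    then have z2: "z ^ 2 / g \<in> L.ints" by (simp add: z_def D_def power2_eq_square mult_ac)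
    have gz: "z / g \<in> L.ints" using dvdF[OF zO z2] F.idvd_iff[OF sq(3)] by auto
    define x where "x = D * a - z * w"
    have xF: "x \<in> F"
    proof -
      have "x - gal x = D * (a - gal a) - z * (w - gal w)"
        using aL wL DF zF by (simp add: x_def gal_diff gal_mult L.mult_mem F_mem_L algebra_simps)
      also have "\<dots> = 0" by (simp add: z_def D_def power2_eq_square)
      finally have "gal x = x" by simp
      moreover have "x \<in> L" using aL wL F_mem_L[OF DF] zL unfolding x_def by (intro L.diff_mem L.mult_mem)
      ultimately show ?thesis using gal_fixed_iff by blast
    qed
    have xO: "x \<in> ring_of_integers F"
      using aO w zO DO by (intro ints_L_F xF) (auto simp: x_def)
    have "x ^ 2 / g = D ^ 2 * (a ^ 2 / g) - 2 * (D * a * w) * (z / g) + (z * w ^ 2) * (z / g)"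
      using sq(3) by (simp add: x_def power2_eq_square field_simps)
    also have "\<dots> \<in> L.ints"
      using DO aO w zO by (intro L.ints_add L.ints_diff L.ints_mult[OF _ a2] L.ints_mult[OF _ gz]) auto
    finally have "x / g \<in> L.ints" using dvdF[OF xO] F.idvd_iff[OF sq(3)] by auto
    then have "x / g + (z / g) * w \<in> L.ints" using gz w(1) by (intro L.ints_add L.ints_mult)
    then show ?thesis by (simp add: x_def diff_divide_distrib)
  qed
  have DJ: "L.pideal D \<star> J \<subseteq> J \<star> J"
  proof (rule iprod_subsetI)
    fix x y assume "x \<in> L.pideal D" "y \<in> J"
    then obtain u where u: "u \<in> L.ints" "x = D * u" by (auto simp: L.pideal_def)
    have "u * (D * y / g) \<in> L.ints" by (rule L.ints_mult[OF u(1) key[OF \<open>y \<in> J\<close>]])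
    then have "x * y / g \<in> L.ints" by (simp add: u mult_ac)
    then show "x * y \<in> J \<star> J" using sq(3,4) L.mem_pideal_iff by simp
  qed (rule iprod_add)
  obtain K where K: "fractional_ideal L K" "J \<star> K = L.ints" using L.invertible[OF sq(1)] by blast
  have "L.pideal D = (L.pideal D \<star> J) \<star> K"
    using DF D0 by (simp add: iprod_assoc K L.frac_pideal F_mem_L)
  also have "\<dots> \<subseteq> (J \<star> J) \<star> K" by (rule iprod_mono[OF DJ subset_refl])
  also have "\<dots> = J" using sq(1) by (simp add: iprod_assoc K)
  finally have "D \<in> J" using L.self_mem_pideal by blast
  then have "D * D / g \<in> L.ints" using JJ by blast
  then show ?thesis using dvdF[OF DO] by (simp add: D_def power2_eq_square)
qed

lemma pideal_L_eq_iff: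
  assumes "a \<in> F" "a \<noteq> 0" "b \<in> F" "b \<noteq> 0"
  shows "L.pideal a = L.pideal b \<longleftrightarrow> F.pideal a = F.pideal b"
proof -
  have "a / b \<in> F" "b / a \<in> F" using assms by auto
  then show ?thesis
    using assms L.pideal_eq_iff[of a b] F.pideal_eq_iff[of a b] by (auto simp: F_mem_L ints_L_F ints_F_L)
qed

text \<open>If \<open>J\<close> is \<open>b\<close> times \<open>I\<close>, multiply both sides by
  their conjugates. Since \<open>J\<close> is invariant, the left side becomes its square (g), and
  the right side is generated by \<open>r * nm b\<close>.\<close>

lemma sq_ideal_norm_eq:
  assumes J: "sq_ideal J g" and I: "fractional_ideal L I" and r: "r \<in> F" "r \<noteq> 0" "I \<star> gal ` I = L.pideal r"
    and eq: "L.cl J = L.cl I"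
  shows "\<exists>b\<in>L. b \<noteq> 0 \<and> F.pideal g = F.pideal (r * nm b)"
proof -
  note sq = sq_idealD[OF J]
  obtain b where b: "b \<in> L" "b \<noteq> 0" "J = L.pideal b \<star> I" using L.cl_eqD[OF sq(1) I eq] by blast
  have sub: "L.pideal b \<subseteq> L" "I \<subseteq> L" using L.frac_mem[OF I] L.frac_mem[OF L.frac_pideal[OF b(1,2)]] by auto
  have "L.pideal g = J \<star> gal ` J" using sq_ideal_gal[OF J] sq(4) by simp
  also have "\<dots> = (L.pideal b \<star> L.pideal (gal b)) \<star> (I \<star> gal ` I)"
    using b sub by (simp add: gal_image_iprod gal_image_pideal iprod_ac)
  also have "\<dots> = L.pideal (nm b * r)" using b r by (simp add: L.pideal_mult nm_def gal_mem L.mult_mem F_mem_L)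
  finally have "L.pideal g = L.pideal (r * nm b)" by (simp add: mult.commute)
  moreover have "r * nm b \<in> F" "r * nm b \<noteq> 0" using b r by auto
  ultimately show ?thesis using b sq pideal_L_eq_iff by blast
qed

text \<open>An ideal is determined by its square, so \<open>J\<close> equals (b) as soon as the
  squares agree.\<close>

lemma sq_ideal_principal_iff:
  assumes J: "sq_ideal J g"
  shows "L.cl J = \<one>\<^bsub>L.C\<^esub> \<longleftrightarrow> (\<exists>b\<in>L. b \<noteq> 0 \<and> L.pideal (b ^ 2) = L.pideal g)"
proof -
  note sq = sq_idealD[OF J]
  have "J = L.pideal b \<longleftrightarrow> L.pideal (b ^ 2) = L.pideal g" if "b \<in> L" "b \<noteq> 0" for b
  proof -
    have "J = L.pideal b \<longleftrightarrow> J \<star> J = L.pideal b \<star> L.pideal b"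
      using L.iprod_square_cancel[OF sq(1) L.frac_pideal[OF that]] by blast
    also have "\<dots> \<longleftrightarrow> L.pideal (b ^ 2) = L.pideal g"
      unfolding L.pideal_mult[OF that(1,1)] sq(4) power2_eq_square by (rule eq_commute)
    finally show ?thesis .
  qed
  then show ?thesis using L.cl_one_iff[OF sq(1)] by blast
qed

end

subsection \<open>The rational numbers, real quadratic fields and \<open>\<rat>(\<surd>2)\<close>\<close>

lemma (in complex_subfield) euclidean_imp_principal:
  fixes sz :: "complex \<Rightarrow> nat"
  assumes euclid: "\<And>a b. a \<in> \<O> \<Longrightarrow> b \<in> \<O> \<Longrightarrow> b \<noteq> 0 \<Longrightarrow> \<exists>q\<in>\<O>. a - q * b = 0 \<or> sz (a - q * b) < sz b"
    and I: "fractional_ideal F I"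
  shows "\<exists>a\<in>F. a \<noteq> 0 \<and> I = pideal a"
proof -
  obtain r where r: "r \<in> \<O>" "r \<noteq> 0" "\<And>x. x \<in> I \<Longrightarrow> r * x \<in> \<O>" using frac_denom[OF I] by blast
  obtain a where "a \<in> I" "a \<noteq> 0" using frac_nonzero[OF I] by blast
  \<comment> \<open>Sizes are compared after multiplication by the common denominator
    \<open>r\<close>, because the division property concerns integers only.\<close>
  then obtain b where b: "b \<in> I \<and> b \<noteq> 0" and min: "\<And>c. c \<in> I \<and> c \<noteq> 0 \<Longrightarrow> sz (r * b) \<le> sz (r * c)"
    using ex_has_least_nat[of "\<lambda>b. b \<in> I \<and> b \<noteq> 0" a "\<lambda>b. sz (r * b)"] by blast
  have "x \<in> pideal b" if x: "x \<in> I" for x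
  proof -
    obtain q where q: "q \<in> \<O>" "r * x - q * (r * b) = 0 \<or> sz (r * x - q * (r * b)) < sz (r * b)"
      using euclid[OF r(3)[OF x] r(3)[OF conjunct1[OF b]]] r(2) b by auto
    have eq: "r * x - q * (r * b) = r * (x - q * b)" by (simp add: algebra_simps)
    have mem: "x - q * b \<in> I" using b q(1) by (intro frac_diff[OF I x] frac_mult[OF I]) auto
    have "x - q * b = 0"
    proof (rule ccontr)
      assume nz: "x - q * b \<noteq> 0"
      then have "sz (r * b) \<le> sz (r * (x - q * b))" using min mem by blast
      then show False using q(2) r(2) nz unfolding eq by simp
    qed
    then show ?thesis using q(1) by (auto simp: pideal_def)
  qed
  then have "I = pideal b" using pideal_subsetI[OF I] b by blast
  then show ?thesis using b frac_mem[OF I] by blast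
qed

interpretation Rat: complex_subfield "\<rat>"
proof
  fix x :: complex assume "x \<in> \<rat>"
  then obtain a b :: int where "b > 0" "x = of_int a / of_int b"
    by (elim Rats_cases') auto
  then show "\<exists>n. n \<noteq> 0 \<and> algebraic_int (of_int n * x)"
    by (intro exI[of _ b]) auto
qed auto

lemma ints_Rats: "ring_of_integers \<rat> = \<int>"
  using rational_algebraic_int_is_int Ints_subset_Rats
  by (auto simp: ring_of_integers_def intro: int_imp_algebraic_int)

definition rat_size :: "complex \<Rightarrow> nat" where "rat_size x = nat \<lfloor>cmod x\<rfloor>"

lemma rat_size_of_int [simp]: "rat_size (of_int n) = nat \<bar>n\<bar>"
proof -
  have "cmod (of_int n) = of_int \<bar>n\<bar>" by (simp flip: of_int_abs)
  then show ?thesis by (simp only: rat_size_def floor_of_int)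
qed

interpretation Rat: normed_pid_subfield "\<rat>" rat_size
proof
  fix I assume I: "fractional_ideal \<rat> I"
  show "\<exists>a\<in>\<rat>. a \<noteq> 0 \<and> I = Rat.pideal a"
  proof (rule Rat.euclidean_imp_principal[OF _ I])
    fix a b :: complex assume "a \<in> ring_of_integers \<rat>" "b \<in> ring_of_integers \<rat>" "b \<noteq> 0"
    then obtain m n where mn: "a = of_int m" "b = of_int n" "n \<noteq> 0" by (auto simp: ints_Rats elim!: Ints_cases)
    have "a - of_int (m div n) * b = of_int (m mod n)" by (simp add: mn minus_div_mult_eq_mod flip: of_int_mult of_int_diff)
    then have "rat_size (a - of_int (m div n) * b) < rat_size b"
      using mn abs_mod_less[of n m] by simp
    then show "\<exists>q\<in>ring_of_integers \<rat>. a - q * b = 0 \<or> rat_size (a - q * b) < rat_size b" 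
      by (intro bexI[of _ "of_int (m div n)"]) (auto simp: ints_Rats)
  qed
next
  fix a :: complex assume "a \<in> ring_of_integers \<rat>" "rat_size a = 1"
  then obtain n :: int where n: "a = of_int n" "nat \<bar>n\<bar> = 1" by (auto simp: ints_Rats elim!: Ints_cases)
  then have "n = 1 \<or> n = -1" by auto
  then show "inverse a \<in> ring_of_integers \<rat>" using n by (auto simp: ints_Rats)
qed (auto simp: ints_Rats elim!: Ints_cases simp flip: of_int_mult simp: abs_mult nat_mult_distrib)

locale real_quadratic =
  fixes D :: int and rt :: complex
  assumes D_pos: "D > 0" and nonsquare: "D \<noteq> n ^ 2"
    and rt_def: "rt = complex_of_real (sqrt (real_of_int D))"
begin

lemma rt_square: "rt ^ 2 = of_int D"
  using D_pos by (simp add: rt_def flip: of_real_power)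

lemma rt_irrational: "rt \<notin> \<rat>"
proof
  assume rat: "rt \<in> \<rat>"
  have "algebraic_int (rt ^ 2)" by (simp only: rt_square algebraic_int_of_int)
  then have "rt \<in> \<int>" using rational_algebraic_int_is_int rat algebraic_int_of_square by blast
  then obtain n where "rt = of_int n" by (elim Ints_cases)
  then have "of_int (n ^ 2) = (of_int D :: complex)" using rt_square by simp
  then show False using nonsquare[of n] by (simp only: of_int_eq_iff)
qed

lemma rt_sqrt_ext: "sqrt_ext \<rat> rt"
proof
  show "rt ^ 2 \<in> \<rat>" by (simp only: rt_square Rats_of_int)
qed (rule rt_irrational)

sublocale pid_sqrt_ext "\<rat>" rt rat_size
  by (intro pid_sqrt_ext.intro inv_sqrt_ext.intro rt_sqrt_ext Rat.invertible_subfield_axioms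
      Rat.normed_pid_subfield_axioms)

lemma nm_rat: "a \<in> \<rat> \<Longrightarrow> b \<in> \<rat> \<Longrightarrow> nm (a + b * rt) = a ^ 2 - of_int D * b ^ 2"
  using nm_coords[of a b] by (simp only: rt_square)

lemma nm_int: "x \<in> L.ints \<Longrightarrow> \<exists>n::int. nm x = of_int n"
  using nm_ints[of x] by (auto simp: ints_Rats elim: Ints_cases)

definition size_nm :: "complex \<Rightarrow> nat" where "size_nm x = rat_size (nm x)"

lemma size_nm_mult:
  "x \<in> L.ints \<Longrightarrow> y \<in> L.ints \<Longrightarrow> size_nm (x * y) = size_nm x * size_nm y"
  using nm_int[of x] nm_int[of y]
  by (auto simp: size_nm_def nm_mult L.ints_mem abs_mult nat_mult_distrib simp flip: of_int_mult)

lemma size_nm_pos: "x \<in> L.ints \<Longrightarrow> x \<noteq> 0 \<Longrightarrow> size_nm x > 0"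
  using nm_int[of x] nm_eq_0_iff[of x] by (auto simp: size_nm_def L.ints_mem)

lemma size_nm_unit:
  assumes x: "x \<in> L.ints" and 1: "size_nm x = 1"
  shows "inverse x \<in> L.ints"
proof -
  obtain n where n: "nm x = of_int n" using nm_int[OF x] by blast
  then have n1: "n = 1 \<or> n = - 1" using 1 by (auto simp: size_nm_def nat_eq_iff split: if_splits)
  then have "x \<noteq> 0" using n by (auto simp: nm_def)
  moreover have "x * gal x = of_int n" using n by (simp add: nm_def)
  moreover have "of_int (n * n) = (1 :: complex)" using n1 by auto
  ultimately have "x * (of_int n * gal x) = 1"
    by (metis mult.left_commute of_int_mult)
  then have "inverse x = of_int n * gal x" by (rule inverse_unique)
  then show ?thesis using x by auto
qed

lemma D_ints [simp]: "rt \<in> L.ints"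
proof -
  have "algebraic_int (rt ^ 2)" by (simp only: rt_square algebraic_int_of_int)
  then show ?thesis using algebraic_int_of_square by (auto simp: L.ints_iff)
qed

end

definition sqrt2 :: complex where "sqrt2 = complex_of_real (sqrt 2)"

interpretation k: real_quadratic 2 sqrt2
proof
  fix n :: int
  show "2 \<noteq> n ^ 2"
  proof
    assume *: "2 = n ^ 2"
    then have "\<bar>n\<bar> < 2" using power_mono[of 2 "\<bar>n\<bar>" 2] by (cases "\<bar>n\<bar> < 2") auto
    then have "n = -1 \<or> n = 0 \<or> n = 1" by auto
    then show False using * by auto
  qed
qed (simp_all add: sqrt2_def)

text \<open>The field \<open>Q(sqrt 2)\<close> is norm-Euclidean. Rounding both coordinates of
  \<open>a / b\<close> leaves errors x and y of absolute value at most 1/2, and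
  \<open>x ^ 2 - 2 * y ^ 2\<close> then lies between -1/2 and 1/4.\<close>

interpretation kk: normed_pid_subfield k.L k.size_nm
proof
  fix I assume I: "fractional_ideal k.L I"
  show "\<exists>a\<in>k.L. a \<noteq> 0 \<and> I = k.L.pideal a"
  proof (rule k.L.euclidean_imp_principal[OF _ I])
    fix a b :: complex assume ab: "a \<in> k.L.ints" "b \<in> k.L.ints" "b \<noteq> 0"
    have abL: "a \<in> k.L" "b \<in> k.L" using ab by (auto simp: k.L.ints_mem)
    then have "a / b \<in> k.L" by auto
    then obtain x y where xy: "x \<in> \<rat>" "y \<in> \<rat>" "a / b = x + y * sqrt2" by (rule k.L_cases)
    obtain x' y' :: rat where xy': "x = of_rat x'" "y = of_rat y'" using xy by (auto elim!: Rats_cases)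
    define m where "m = round x'"
    define n where "n = round y'"
    define q where "q = of_int m + of_int n * sqrt2"
    have q: "q \<in> k.L.ints"
      unfolding q_def by (intro k.L.ints_add k.L.ints_mult k.L.ints_of_int k.D_ints)
    have qL: "q \<in> k.L" using q by (simp add: k.L.ints_mem)
    have "a / b - q = of_rat (x' - of_int m) + of_rat (y' - of_int n) * sqrt2"
      by (simp add: xy xy' q_def of_rat_diff algebra_simps)
    then have "k.nm (a / b - q) = of_rat (x' - of_int m) ^ 2 - of_int 2 * of_rat (y' - of_int n) ^ 2"
      using k.nm_rat[of "of_rat (x' - of_int m)" "of_rat (y' - of_int n)"] by simp
    also have "\<dots> = of_rat ((x' - of_int m) ^ 2 - 2 * (y' - of_int n) ^ 2)"
      by (simp add: of_rat_diff of_rat_mult of_rat_power)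
    finally have nm: "k.nm (a / b - q) = of_rat ((x' - of_int m) ^ 2 - 2 * (y' - of_int n) ^ 2)" .
    have half: "\<bar>z\<bar> \<le> 1/2 \<Longrightarrow> z ^ 2 \<le> 1/4" for z :: rat
      using power_mono[of "\<bar>z\<bar>" "1/2" 2] by (simp add: power2_eq_square)
    have sq: "(x' - of_int m) ^ 2 \<le> 1/4" "(y' - of_int n) ^ 2 \<le> 1/4"
      unfolding m_def n_def
      by (rule half, subst abs_minus_commute, rule of_int_round_abs_le)+
    then have lt: "\<bar>(x' - of_int m) ^ 2 - 2 * (y' - of_int n) ^ 2\<bar> < 1"
      using zero_le_power2[of "x' - of_int m"] zero_le_power2[of "y' - of_int n"]
      by (intro abs_less_iff[THEN iffD2] conjI) linarith+
    define c where "c = (x' - of_int m) ^ 2 - 2 * (y' - of_int n) ^ 2"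
    have "a - q * b = (a / b - q) * b" using ab(3) by (simp add: field_simps)
    then have nmeq: "k.nm (a - q * b) = of_rat c * k.nm b"
      using abL qL nm by (simp add: k.nm_mult k.L.diff_mem k.L.divide_mem c_def)
    have "a - q * b \<in> k.L.ints" using ab q by auto
    then obtain u v where uv: "k.nm (a - q * b) = of_int u" "k.nm b = of_int v"
      using k.nm_int ab(2) by blast
    have "v \<noteq> 0" using uv(2) k.nm_eq_0_iff[OF abL(2)] ab(3) by auto
    have "of_rat (of_int u) = (of_rat (c * of_int v) :: complex)"
      using nmeq uv by (simp add: of_rat_mult)
    then have "of_int u = c * of_int v" by (simp only: of_rat_eq_iff)
    then have "\<bar>of_int u\<bar> = \<bar>c\<bar> * \<bar>of_int v :: rat\<bar>" by (simp add: abs_mult)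
    also have "\<dots> < 1 * \<bar>of_int v\<bar>" using lt \<open>v \<noteq> 0\<close> by (intro mult_strict_right_mono) (auto simp: c_def)
    finally have "\<bar>u\<bar> < \<bar>v\<bar>" by (simp flip: of_int_abs)
    then have "k.size_nm (a - q * b) < k.size_nm b" by (simp add: k.size_nm_def uv)
    then show "\<exists>q\<in>ring_of_integers k.L. a - q * b = 0 \<or> k.size_nm (a - q * b) < k.size_nm b"
      using q by blast
  qed
qed (auto simp: k.size_nm_mult k.size_nm_pos intro: k.size_nm_unit)

section \<open>Generated fields as quadratic extensions\<close>

lemma adjoin_subset:
  assumes "complex_subfield F" "S \<subseteq> F"
  shows "complex_adjoin S \<subseteq> F"
proof
  interpret complex_subfield F by fact
  interpret R: Ring.field "ring_of_type_algebra :: complex ring" by (rule field_from_type_algebra)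
  have carrier: "x \<in> carrier ring_of_type_algebra" for x :: complex
    by (simp add: ring_of_type_algebra_def)
  fix x assume "x \<in> complex_adjoin S"
  then have "x \<in> generate_field ring_of_type_algebra S" by (simp add: complex_adjoin_def)
  then show "x \<in> F"
  proof (induction rule: generate_field.induct)
    case (a_inv h)
    have "\<ominus>\<^bsub>ring_of_type_algebra\<^esub> h = - h"
      by (rule R.minus_equality) (simp_all add: ring_of_type_algebra_def)
    then show ?case using a_inv by auto
  next
    case (m_inv h)
    then have "inv\<^bsub>ring_of_type_algebra\<^esub> h = inverse h"
      by (intro R.comm_inv_char carrier) (auto simp: ring_of_type_algebra_def)
    then show ?case using m_inv by auto
  qed (use assms in \<open>auto simp: ring_of_type_algebra_def\<close>)
qed

lemma adjoin_mem: "x \<in> S \<Longrightarrow> x \<in> complex_adjoin S"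
  by (simp add: complex_adjoin_def generate_field.incl)

lemma adjoin_add: "x \<in> complex_adjoin S \<Longrightarrow> y \<in> complex_adjoin S \<Longrightarrow> x + y \<in> complex_adjoin S"
  using generate_field.eng_add[of x ring_of_type_algebra S y]
  by (simp add: complex_adjoin_def ring_of_type_algebra_def)

lemma adjoin_mult: "x \<in> complex_adjoin S \<Longrightarrow> y \<in> complex_adjoin S \<Longrightarrow> x * y \<in> complex_adjoin S"
  using generate_field.eng_mult[of x ring_of_type_algebra S y]
  by (simp add: complex_adjoin_def ring_of_type_algebra_def)

lemma adjoin_uminus: "x \<in> complex_adjoin S \<Longrightarrow> - x \<in> complex_adjoin S"
proof -
  interpret R: Ring.field "ring_of_type_algebra :: complex ring" by (rule field_from_type_algebra)
  assume "x \<in> complex_adjoin S"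
  moreover have "\<ominus>\<^bsub>ring_of_type_algebra\<^esub> x = - x"
    by (rule R.minus_equality) (simp_all add: ring_of_type_algebra_def)
  ultimately show ?thesis
    using generate_field.a_inv[of x ring_of_type_algebra S] by (simp add: complex_adjoin_def)
qed

lemma adjoin_one: "1 \<in> complex_adjoin S"
  using generate_field.one[of ring_of_type_algebra S] by (simp add: complex_adjoin_def ring_of_type_algebra_def)

lemma adjoin_inverse: "x \<in> complex_adjoin S \<Longrightarrow> inverse x \<in> complex_adjoin S"
proof (cases "x = 0")
  case False
  interpret R: Ring.field "ring_of_type_algebra :: complex ring" by (rule field_from_type_algebra)
  assume "x \<in> complex_adjoin S"
  moreover have "inv\<^bsub>ring_of_type_algebra\<^esub> x = inverse x"
    using False by (intro R.comm_inv_char) (auto simp: ring_of_type_algebra_def)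
  ultimately show ?thesis
    using generate_field.m_inv[of x ring_of_type_algebra S] False
    by (simp add: complex_adjoin_def ring_of_type_algebra_def)
qed simp

lemma adjoin_Rats: "x \<in> \<rat> \<Longrightarrow> x \<in> complex_adjoin S"
proof -
  have 0: "0 \<in> complex_adjoin S" using adjoin_add[OF adjoin_one adjoin_uminus[OF adjoin_one]] by simp
  have nat: "of_nat n \<in> complex_adjoin S" for n
    by (induction n) (auto intro: adjoin_add adjoin_one 0)
  have int: "of_int n \<in> complex_adjoin S" for n
    by (cases n) (auto intro: nat adjoin_uminus simp del: of_nat_Suc)
  assume "x \<in> \<rat>"
  then obtain a b where "x = of_int a / of_int b" by (elim Rats_cases') auto
  then show ?thesis by (auto simp: divide_inverse intro: adjoin_mult adjoin_inverse int)
qed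

lemma (in sqrt_ext) adjoin_eq_L:
  assumes "F = complex_adjoin S"
  shows "complex_adjoin (insert s S) = L"
proof
  have "S \<subseteq> F" using adjoin_mem assms by blast
  then show "complex_adjoin (insert s S) \<subseteq> L" using F_subset_L by (intro adjoin_subset L_subfield) auto
  have "complex_subfield (complex_adjoin (insert s S))"
  proof
    fix x assume "x \<in> complex_adjoin (insert s S)"
    then have "x \<in> L" using \<open>complex_adjoin (insert s S) \<subseteq> L\<close> by blast
    then show "\<exists>n. n \<noteq> 0 \<and> algebraic_int (of_int n * x)" by (rule L.denom)
  next
    fix x y assume "x \<in> complex_adjoin (insert s S)" "y \<in> complex_adjoin (insert s S)"
    then show "x - y \<in> complex_adjoin (insert s S)" using adjoin_add[of x _ "- y"] by (simp add: adjoin_uminus)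
  qed (auto intro: adjoin_one adjoin_mult adjoin_inverse)
  then interpret A: complex_subfield "complex_adjoin (insert s S)" .
  have "F \<subseteq> complex_adjoin (insert s S)"
    unfolding assms by (intro adjoin_subset A.complex_subfield_axioms) (auto intro: adjoin_mem)
  moreover have "s \<in> complex_adjoin (insert s S)" by (rule adjoin_mem) simp
  ultimately show "L \<subseteq> complex_adjoin (insert s S)"
    by (auto simp: L_def intro!: A.add_mem A.mult_mem)
qed

lemma adjoin_empty: "complex_adjoin {} = \<rat>"
  using adjoin_subset[OF Rat.complex_subfield_axioms, of "{}"] adjoin_Rats by blast

subsection \<open>Finiteness of the class group and units of real quadratic fields\<close>

lemma dirichlet_pigeonhole:
  fixes x :: real and N :: nat
  assumes N: "N > 0"
  shows "\<exists>m\<in>{1..N}. \<exists>n::int. \<bar>real m * x - of_int n\<bar> < 1 / real N"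
proof -
  \<comment> \<open>The \<open>N + 1\<close> multiples of \<open>x\<close> by 0, ...,
    \<open>N\<close> are sorted into \<open>N\<close> boxes of width \<open>1 / N\<close> by their
    fractional parts.\<close>
  define f where "f i = nat \<lfloor>real N * frac (real i * x)\<rfloor>" for i :: nat
  have f: "f i \<in> {..<N}" for i
  proof -
    have "real N * frac (real i * x) < real N * 1" using N frac_lt_1 by (intro mult_strict_left_mono) auto
    then show ?thesis using N by (simp add: f_def nat_less_iff floor_less_iff)
  qed
  have "card (f ` {..N}) \<le> card {..<N}" using f by (intro card_mono) auto
  then have "\<not> inj_on f {..N}" by (intro pigeonhole) simp
  then obtain i j where ij: "i \<le> N" "j \<le> N" "i < j" "f i = f j"
    unfolding inj_on_def by (metis atMost_iff linorder_neqE_nat)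
  have fl: "\<lfloor>real N * frac (real i * x)\<rfloor> = \<lfloor>real N * frac (real j * x)\<rfloor>"
    using ij(4) by (simp add: f_def eq_nat_nat_iff)
  have "\<bar>real N * frac (real j * x) - real N * frac (real i * x)\<bar> < 1" using fl by linarith
  then have "real N * \<bar>frac (real j * x) - frac (real i * x)\<bar> < 1"
    by (simp add: abs_mult flip: right_diff_distrib)
  then have "\<bar>frac (real j * x) - frac (real i * x)\<bar> < 1 / real N"
    using N by (simp add: field_simps)
  moreover have "frac (real j * x) - frac (real i * x) = real (j - i) * x - of_int (\<lfloor>real j * x\<rfloor> - \<lfloor>real i * x\<rfloor>)"
    using ij by (simp add: frac_def of_nat_diff algebra_simps)
  ultimately have "\<bar>real (j - i) * x - of_int (\<lfloor>real j * x\<rfloor> - \<lfloor>real i * x\<rfloor>)\<bar> < 1 / real N" by (simp only:)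
  moreover have "j - i \<in> {1..N}" using ij by auto
  ultimately show ?thesis by blast
qed

lemma add_inverse_minus_two:
  fixes r :: real
  assumes "r > 0"
  shows "r + inverse r - 2 = (r - 1) ^ 2 / r"
proof -
  have "(r - 1) ^ 2 / r = (r * r - 2 * r + 1) / r" by (simp add: power2_eq_square algebra_simps)
  also have "\<dots> = r + inverse r - 2" using assms by (simp add: add_divide_distrib diff_divide_distrib inverse_eq_divide)
  finally show ?thesis by simp
qed

lemma of_real_of_rat: "complex_of_real (of_rat q) = of_rat q"
  by (cases q) (simp add: of_rat_rat)

section \<open>Finiteness of the class group\<close>

context real_quadratic
begin

lemma rt_real: "rt = complex_of_real (Re rt)" by (simp add: rt_def)

lemma Re_rt: "Re rt > 0" "(Re rt) ^ 2 = of_int D"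
  using D_pos by (auto simp: rt_def)

lemma L_real:
  assumes "x \<in> L"
  shows "x = complex_of_real (Re x)"
  using assms
proof (rule L_cases)
  fix a b assume ab: "a \<in> \<rat>" "b \<in> \<rat>" "x = a + b * rt"
  have "Im a = 0" "Im b = 0" using ab(1,2) by (auto elim!: Rats_cases')
  then show ?thesis using ab(3) by (simp add: complex_eq_iff rt_def)
qed

text \<open>Writing \<open>x = (u + v rt / D) / 2\<close>, two integers with the same \<open>u\<close> and \<open>v\<close> modulo \<open>2 D c\<close>
  are congruent modulo \<open>c\<close>.\<close>

lemma finite_residues:
  fixes c :: int
  assumes c: "c \<noteq> 0"
  shows "\<exists>(f :: complex \<Rightarrow> int \<times> int) A. finite A \<and> (\<forall>x\<in>ring_of_integers L. f x \<in> A) \<and>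
    (\<forall>x\<in>ring_of_integers L. \<forall>y\<in>ring_of_integers L. f x = f y \<longrightarrow> (x - y) / of_int c \<in> L.ints)"
proof -
  have "\<exists>u v::int. tr x = of_int u \<and> (x - gal x) * rt = of_int v" if x: "x \<in> L.ints" for x
  proof -
    have xL: "x \<in> L" using x by (simp add: L.ints_mem)
    have z: "(x - gal x) * rt \<in> L.ints" by (intro L.ints_mult L.ints_diff gal_ints D_ints x)
    have "gal ((x - gal x) * rt) = (gal x - x) * (- rt)"
      using xL by (simp add: gal_mult gal_diff gal_mem L.diff_mem)
    also have "\<dots> = (x - gal x) * rt" by (simp add: algebra_simps)
    finally have "(x - gal x) * rt \<in> \<rat>" using gal_fixed_iff[of "(x - gal x) * rt"] z by (auto simp: L.ints_mem)
    then have "(x - gal x) * rt \<in> \<int>" using ints_L_F[OF z] by (simp add: ints_Rats)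
    moreover have "tr x \<in> \<int>" using tr_ints[OF x] by (simp add: ints_Rats)
    ultimately show ?thesis by (auto elim!: Ints_cases)
  qed
  then obtain u v where uv: "\<And>x. x \<in> L.ints \<Longrightarrow> tr x = of_int (u x) \<and> (x - gal x) * rt = of_int (v x)"
    by metis
  define M where "M = 2 * D * \<bar>c\<bar>"
  have M: "M > 0" using c D_pos by (simp add: M_def)
  define f where "f x = (u x mod M, v x mod M)" for x
  have "finite ({0..<M} \<times> {0..<M})" by simp
  moreover have "\<forall>x\<in>ring_of_integers L. f x \<in> {0..<M} \<times> {0..<M}" using M by (simp add: f_def)
  moreover have "(x - y) / of_int c \<in> L.ints"
    if xy: "x \<in> L.ints" "y \<in> L.ints" "f x = f y" for x y
  proof -
    have "2 * D * c dvd M" by (simp add: M_def)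
    moreover have "M dvd u x - u y" "M dvd v x - v y" using xy(3) by (auto simp: f_def mod_eq_dvd_iff)
    ultimately have "2 * D * c dvd u x - u y" "2 * D * c dvd v x - v y" by (auto intro: dvd_trans)
    then obtain k l where kl: "u x - u y = 2 * D * c * k" "v x - v y = 2 * D * c * l" by (auto elim!: dvdE)
    have u: "tr x - tr y = of_int (2 * D * c * k)"
      using uv[OF xy(1)] uv[OF xy(2)] by (simp flip: kl(1))
    have v: "(x - gal x) * rt - (y - gal y) * rt = of_int (2 * D * c * l)"
      using uv[OF xy(1)] uv[OF xy(2)] by (simp flip: kl(2))
    have "2 * of_int D * (x - y) = of_int D * (tr x - tr y) + ((x - gal x) * rt - (y - gal y) * rt) * rt"
    proof -
      have "((x - gal x) * rt - (y - gal y) * rt) * rt = ((x - gal x) - (y - gal y)) * rt ^ 2"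
        by (simp add: power2_eq_square algebra_simps)
      then show ?thesis unfolding rt_square by (simp add: tr_def algebra_simps)
    qed
    also have "\<dots> = 2 * of_int D * (of_int c * (of_int (D * k) + of_int l * rt))"
      unfolding u v by (simp add: algebra_simps)
    finally have "x - y = of_int c * (of_int (D * k) + of_int l * rt)"
      using D_pos by (simp only: mult_cancel_left) auto
    then have "(x - y) / of_int c = of_int (D * k) + of_int l * rt" using c by simp
    moreover have "of_int (D * k) + of_int l * rt \<in> L.ints"
      by (intro L.ints_add L.ints_mult L.ints_of_int D_ints)
    ultimately show ?thesis by (simp only:)
  qed
  ultimately show ?thesis by blast
qed

text \<open>The pigeonhole principle is spent on the coefficient of \<open>rt\<close>; the rational
  coefficient is merely rounded. With errors \<open>e\<close> and \<open>g\<close> the norm is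
  \<open>e ^ 2 - D * g ^ 2\<close>, where \<open>e ^ 2 \<le> 1/4\<close>.\<close>

lemma approx_by_int:
  "\<exists>N>0. \<forall>x\<in>L. \<exists>m\<in>{1..N}. \<exists>r\<in>ring_of_integers L. cmod (nm (of_nat m * x - r)) < 1"
proof -
  \<comment> \<open>Any \<open>N\<close> with \<open>N ^ 2 > D\<close> would do: it keeps
    \<open>D * g ^ 2\<close> below 1 when \<open>\<bar>g\<bar> < 1 / N\<close>.\<close>
  define N where "N = Suc (nat D)"
  have N2: "of_int D < (real N) ^ 2"
  proof -
    have "of_int D < real N" using D_pos by (simp add: N_def)
    also have "\<dots> \<le> real N ^ 2" by (simp add: N_def power2_eq_square)
    finally show ?thesis .
  qed
  have "\<exists>m\<in>{1..N}. \<exists>r\<in>ring_of_integers L. cmod (nm (of_nat m * x - r)) < 1" if "x \<in> L" for x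
    using that
  proof (rule L_cases)
    fix a b assume ab: "a \<in> \<rat>" "b \<in> \<rat>" "x = a + b * rt"
    obtain a' b' :: rat where ab': "a = of_rat a'" "b = of_rat b'" using ab(1,2) by (auto elim!: Rats_cases)
    obtain m n where mn: "m \<in> {1..N}" "\<bar>real m * of_rat b' - of_int n\<bar> < 1 / real N"
      using dirichlet_pigeonhole[of N "of_rat b'"] by (auto simp: N_def)
    define k where "k = round (real m * of_rat a')"
    define r where "r = of_int k + of_int n * rt"
    have r: "r \<in> L.ints"
      unfolding r_def by (intro L.ints_add L.ints_mult L.ints_of_int D_ints)
    define e where "e = real m * of_rat a' - of_int k"
    define g where "g = real m * of_rat b' - of_int n"
    have "of_nat m * x - r = (of_nat m * a - of_int k) + (of_nat m * b - of_int n) * rt"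
      by (simp add: ab r_def algebra_simps)
    then have "nm (of_nat m * x - r) = (of_nat m * a - of_int k) ^ 2 - of_int D * (of_nat m * b - of_int n) ^ 2"
      using nm_rat[of "of_nat m * a - of_int k" "of_nat m * b - of_int n"] ab(1,2) by simp
    also have "\<dots> = complex_of_real (e ^ 2 - of_int D * g ^ 2)"
      by (simp add: e_def g_def ab' of_real_of_rat)
    finally have nm: "cmod (nm (of_nat m * x - r)) = \<bar>e ^ 2 - of_int D * g ^ 2\<bar>"
      by (simp only: norm_of_real)
    have "\<bar>e\<bar> \<le> 1 / 2"
      unfolding e_def k_def using of_int_round_abs_le[of "real m * of_rat a'"] by (subst abs_minus_commute)
    then have e2: "e ^ 2 \<le> 1 / 4" using power_mono[of "\<bar>e\<bar>" "1/2" 2] by (simp add: power2_eq_square)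
    have "\<bar>g\<bar> ^ 2 \<le> (1 / real N) ^ 2" using mn(2) by (intro power_mono) (auto simp: g_def)
    then have "of_int D * g ^ 2 \<le> of_int D * (1 / real N) ^ 2"
      using D_pos by (intro mult_left_mono) auto
    also have "\<dots> < 1" using N2 by (simp add: power_divide N_def)
    finally have "of_int D * g ^ 2 < 1" .
    moreover have "0 \<le> of_int D * g ^ 2" using D_pos by simp
    moreover have "0 \<le> e ^ 2" by simp
    ultimately have "\<bar>e ^ 2 - of_int D * g ^ 2\<bar> < 1" using e2 unfolding abs_less_iff by linarith
    then show ?thesis using mn(1) r nm by (metis (no_types, lifting))
  qed
  then show ?thesis by (intro exI[of _ N]) (auto simp: N_def)
qed

text \<open>Hurwitz's argument. Let \<open>b\<close> be a nonzero element of least norm in an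
  integral ideal \<open>I\<close>. For \<open>x\<close> in \<open>I\<close> some
  \<open>m * x - q * b\<close> with \<open>m \<le> N\<close> has smaller norm, hence is 0, so
  \<open>b\<close> divides \<open>fact N * x\<close>. Scaling \<open>I\<close> by
  \<open>fact N / b\<close> gives an integral ideal containing \<open>fact N\<close>, and there are
  finitely many of those.\<close>

lemma finite_class_group: "finite (carrier L.C)"
proof -
  obtain N where N: "N > 0" "\<And>x. x \<in> L \<Longrightarrow> \<exists>m\<in>{1..N}. \<exists>r\<in>ring_of_integers L. cmod (nm (of_nat m * x - r)) < 1"
    using approx_by_int by blast
  define c :: int where "c = fact N"
  have c0: "c \<noteq> 0" by (simp add: c_def)
  define JS where "JS = {J. fractional_ideal L J \<and> of_int c \<in> J \<and> J \<subseteq> L.ints}"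
  obtain f :: "complex \<Rightarrow> int \<times> int" and A where f: "finite A" "\<And>x. x \<in> L.ints \<Longrightarrow> f x \<in> A"
    "\<And>x y. x \<in> L.ints \<Longrightarrow> y \<in> L.ints \<Longrightarrow> f x = f y \<Longrightarrow> (x - y) / of_int c \<in> L.ints"
    using finite_residues[OF c0] by blast
  \<comment> \<open>An ideal that contains \<open>c\<close> is determined by its residues modulo
    \<open>c\<close>, which \<open>f\<close> records.\<close>
  have sub: "J \<subseteq> J'" if J: "J \<in> JS" "J' \<in> JS" "f ` J = f ` J'" for J J'
  proof
    fix x assume x: "x \<in> J"
    then have "f x \<in> f ` J'" using J(3) by blast
    then obtain y where y: "y \<in> J'" "f x = f y" by auto
    have "x \<in> L.ints" "y \<in> L.ints" using x y J by (auto simp: JS_def)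
    then have q: "(x - y) / of_int c \<in> L.ints" using f(3) y(2) by blast
    have J': "fractional_ideal L J'" "of_int c \<in> J'" using J(2) by (auto simp: JS_def)
    have "(x - y) / of_int c * of_int c + y \<in> J'"
      by (rule L.frac_add[OF J'(1) L.frac_mult[OF J'(1) q J'(2)] y(1)])
    then show "x \<in> J'" using c0 by simp
  qed
  have "inj_on (\<lambda>J. f ` J) JS"
    using sub by (intro inj_onI) (simp add: subset_antisym)
  moreover have "(\<lambda>J. f ` J) ` JS \<subseteq> Pow A" using f(2) by (auto simp: JS_def)
  ultimately have finX: "finite JS" using f(1) by (meson finite_Pow_iff finite_imageD finite_subset)
  have "carrier L.C \<subseteq> L.cl ` JS"
  proof
    fix C0 assume "C0 \<in> carrier L.C"
    then obtain I0 where I0: "fractional_ideal L I0" "C0 = L.cl I0" using L.cl_surj by blast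
    obtain r where r: "r \<in> L.ints" "r \<noteq> 0" "\<And>x. x \<in> I0 \<Longrightarrow> r * x \<in> L.ints"
      using L.frac_denom[OF I0(1)] by blast
    have rL: "r \<in> L" using r by (simp add: L.ints_mem)
    define I where "I = L.pideal r \<star> I0"
    have I: "fractional_ideal L I" "L.cl I = C0"
      using I0 r rL L.cl_eqI[of I0 r] by (auto simp: I_def)
    have IO: "I \<subseteq> L.ints"
      using r(3) L.pideal_iprod[OF I0(1)] by (auto simp: I_def)
    obtain b0 where "b0 \<in> I" "b0 \<noteq> 0" using L.frac_nonzero[OF I(1)] by blast
    then obtain b where b: "b \<in> I \<and> b \<noteq> 0" and min: "\<And>x. x \<in> I \<and> x \<noteq> 0 \<Longrightarrow> size_nm b \<le> size_nm x"
      using ex_has_least_nat[of "\<lambda>b. b \<in> I \<and> b \<noteq> 0" b0 size_nm] by blast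
    have bO: "b \<in> L.ints" and bL: "b \<in> L" using b IO by (auto simp: L.ints_mem)
    have key: "of_int c * x / b \<in> L.ints" if x: "x \<in> I" for x
    proof -
      have xL: "x \<in> L" "x \<in> L.ints" using x IO by (auto simp: L.ints_mem)
      then obtain m q where mq: "m \<in> {1..N}" "q \<in> L.ints" "cmod (nm (of_nat m * (x / b) - q)) < 1"
        using N(2)[of "x / b"] bL by blast
      define y where "y = of_nat m * x - q * b"
      have "of_int (int m) * x \<in> I" by (rule L.frac_mult[OF I(1) L.ints_of_int x])
      then have mx: "of_nat m * x \<in> I" by simp
      have yI: "y \<in> I" unfolding y_def
        by (rule L.frac_diff[OF I(1) mx L.frac_mult[OF I(1) mq(2) conjunct1[OF b]]])
      have yb: "y = (of_nat m * (x / b) - q) * b" using b by (simp add: y_def field_simps)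
      have zL: "of_nat m * (x / b) - q \<in> L"
        using L.divide_mem[OF xL(1) bL] L.ints_mem[OF mq(2)] by (intro L.diff_mem L.mult_mem L.of_nat_mem)
      have "y = 0"
      proof (rule ccontr)
        assume "y \<noteq> 0"
        obtain k l where kl: "nm y = of_int k" "nm b = of_int l"
          using nm_int[of y] nm_int[OF bO] yI IO by blast
        have "l \<noteq> 0" using kl(2) nm_eq_0_iff[OF bL] b by auto
        have "nm y = nm (of_nat m * (x / b) - q) * nm b" unfolding yb by (rule nm_mult[OF zL bL])
        then have "cmod (nm y) = cmod (nm (of_nat m * (x / b) - q)) * cmod (nm b)" by (simp add: norm_mult)
        also have "\<dots> < 1 * cmod (nm b)" using mq(3) \<open>l \<noteq> 0\<close> kl by (intro mult_strict_right_mono) auto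
        finally have "\<bar>real_of_int k\<bar> < \<bar>real_of_int l\<bar>" by (simp add: kl)
        then have "size_nm y < size_nm b" by (simp add: size_nm_def kl flip: of_int_abs)
        moreover have "size_nm b \<le> size_nm y" using min yI \<open>y \<noteq> 0\<close> by blast
        ultimately show False by simp
      qed
      then have xb: "of_nat m * (x / b) = q" using yb b by simp
      have "int m dvd c" using mq(1) dvd_fact[of m N] unfolding c_def
        by (metis atLeastAtMost_iff int_dvd_int_iff of_nat_fact)
      then obtain d where "c = int m * d" by blast
      then have "of_int c * x / b = of_int d * q" using xb by (simp flip: xb)
      then show ?thesis using mq(2) by auto
    qed
    define J where "J = L.pideal (of_int c / b) \<star> I"
    have cb: "of_int c / b \<in> L" "of_int c / b \<noteq> 0" using bL b c0 by auto
    have "fractional_ideal L J" unfolding J_def by (intro L.frac_iprod L.frac_pideal cb I(1))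
    moreover have "L.cl J = C0" using I L.cl_eqI[OF I(1) cb] by (simp add: J_def)
    moreover have "J \<subseteq> L.ints"
      using key L.pideal_iprod[OF I(1)] by (auto simp: J_def)
    moreover have "of_int c \<in> J"
      using b L.mem_pideal_iprod_iff[OF I(1) cb(2)] c0 by (simp add: J_def)
    ultimately show "C0 \<in> L.cl ` JS" unfolding JS_def by blast
  qed
  then show ?thesis using finX finite_surj by blast
qed

section \<open>Units and Pell's equation\<close>

definition unit :: "complex \<Rightarrow> bool" where
  "unit x \<longleftrightarrow> x \<noteq> 0 \<and> x \<in> L.ints \<and> inverse x \<in> L.ints"

lemma unit_mult: "unit x \<Longrightarrow> unit y \<Longrightarrow> unit (x * y)"
  by (auto simp: unit_def)

lemma unit_inverse: "unit x \<Longrightarrow> unit (inverse x)"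
  by (auto simp: unit_def)

lemma unit_uminus: "unit x \<Longrightarrow> unit (- x)"
  using unit_mult[of "-1" x] L.ints_uminus[OF L.ints_1] by (auto simp: unit_def)

lemma unit_mem: "unit x \<Longrightarrow> x \<in> L"
  by (simp add: unit_def L.ints_mem)

text \<open>If \<open>p / q\<close> approximates \<open>rt\<close> with error below
  \<open>1 / q ^ 2\<close>, the norm of \<open>p + q * rt\<close> is a product of a factor below
  \<open>1 / q\<close> and one of size about \<open>2 * q * rt\<close>. There are infinitely many
  such pairs, as the error is never 0 but can be made arbitrarily small.\<close>

lemma infinite_small_norms: "infinite {x \<in> ring_of_integers L. cmod (nm x) \<le> 2 * Re rt + 1}"
proof -
  define A where "A = {(q, p) :: nat \<times> int | q p. q > 0 \<and> \<bar>real q * Re rt - of_int p\<bar> < 1 / real q}"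
  have irr: "real q * Re rt - of_int p \<noteq> 0" if "q > 0" for q and p :: int
  proof
    assume "real q * Re rt - of_int p = 0"
    then have "Re rt = of_int p / of_nat q" using that by (simp add: field_simps)
    then have "rt = of_int p / of_nat q" by (subst rt_real) simp
    moreover have "(of_int p / of_nat q :: complex) \<in> \<rat>" by simp
    ultimately show False using rt_irrational by simp
  qed
  have "infinite A"
  proof
    assume fin: "finite A"
    define B where "B = insert 1 ((\<lambda>(q, p). \<bar>real q * Re rt - of_int p\<bar>) ` A)"
    have B: "finite B" "B \<noteq> {}" using fin by (auto simp: B_def)
    have "Min B > 0" using B irr by (subst Min_gr_iff) (auto simp: B_def A_def)
    then obtain n :: nat where n: "n > 0" "1 / real n < Min B"
      using ex_inverse_of_nat_less[of "Min B"] by (auto simp: inverse_eq_divide)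
    obtain m p where mp: "m \<in> {1..n}" "\<bar>real m * Re rt - of_int p\<bar> < 1 / real n"
      using dirichlet_pigeonhole[of n "Re rt"] n by auto
    have "1 / real n \<le> 1 / real m" using mp(1) by (intro divide_left_mono) auto
    then have "(m, p) \<in> A" using mp by (auto simp: A_def)
    then have "\<bar>real m * Re rt - of_int p\<bar> \<in> B" unfolding B_def by (intro insertI2 image_eqI[of _ _ "(m, p)"]) auto
    then have "Min B \<le> \<bar>real m * Re rt - of_int p\<bar>" using B(1) by (rule Min_le[rotated])
    then show False using mp(2) n(2) by linarith
  qed
  define g where "g = (\<lambda>(q :: nat, p :: int). of_int p + of_nat q * rt)"
  have "inj_on g A"
  proof (rule inj_onI, clarify)
    fix q p q' p' assume "g (q, p) = g (q', p')"
    then have eq: "of_int p + of_nat q * rt = of_int p' + of_nat q' * rt" by (simp add: g_def)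
    have "of_int p = (of_int p' :: complex) \<and> of_nat q = (of_nat q' :: complex)"
      by (rule coords_unique[OF _ _ _ _ eq]) auto
    then show "q = q' \<and> p = p'" by simp
  qed
  then have "infinite (g ` A)" using \<open>infinite A\<close> finite_imageD by blast
  moreover have "g ` A \<subseteq> {x \<in> ring_of_integers L. cmod (nm x) \<le> 2 * Re rt + 1}"
  proof (clarsimp simp: A_def)
    fix q :: nat and p :: int assume q: "q > 0" "\<bar>real q * Re rt - of_int p\<bar> < 1 / real q"
    have q1: "1 / real q \<le> 1" using q(1) by simp
    have int: "of_int p + of_int (int q) * rt \<in> L.ints"
      by (intro L.ints_add L.ints_mult L.ints_of_int D_ints)
    have "nm (of_int p + of_nat q * rt) = of_int p ^ 2 - of_int D * of_nat q ^ 2"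
      by (intro nm_rat) auto
    then have "nm (of_int p + of_nat q * rt) = complex_of_real (of_int p ^ 2 - of_int D * real q ^ 2)"
      by simp
    then have "cmod (nm (of_int p + of_nat q * rt)) = \<bar>of_int p ^ 2 - of_int D * real q ^ 2\<bar>"
      by (simp only: norm_of_real)
    also have "of_int p ^ 2 - of_int D * real q ^ 2 = (of_int p - real q * Re rt) * (of_int p + real q * Re rt)"
      using Re_rt(2) by (simp add: power2_eq_square algebra_simps)
    also have "\<bar>\<dots>\<bar> = \<bar>real q * Re rt - of_int p\<bar> * \<bar>of_int p + real q * Re rt\<bar>"
      by (simp add: abs_mult abs_minus_commute)
    also have "\<bar>of_int p + real q * Re rt\<bar> \<le> 2 * real q * Re rt + 1"
    proof -
      define a where "a = real q * Re rt"
      have a: "a \<ge> 0" using Re_rt(1) by (simp add: a_def)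
      have "\<bar>a - of_int p\<bar> < 1" using q(2) q1 by (simp add: a_def)
      then have "\<bar>of_int p + a\<bar> \<le> 2 * a + 1" using a by linarith
      then show ?thesis by (simp add: a_def mult.assoc)
    qed
    also have "\<bar>real q * Re rt - of_int p\<bar> * (2 * real q * Re rt + 1) \<le> 1 / real q * (2 * real q * Re rt + 1)"
      using q Re_rt(1) by (intro mult_right_mono) auto
    also have "\<dots> = 2 * Re rt + 1 / real q" using q(1) by (simp add: field_simps)
    also have "\<dots> \<le> 2 * Re rt + 1" using q1 by simp
    finally have "cmod (nm (of_int p + of_nat q * rt)) \<le> 2 * Re rt + 1"
      by (simp add: mult_left_mono)
    then show "g (q, p) \<in> L.ints \<and> cmod (nm (g (q, p))) \<le> 2 * Re rt + 1"
      using int by (simp add: g_def)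
  qed
  ultimately show ?thesis using finite_subset by blast
qed

text \<open>Infinitely many integers share one norm \<open>c\<close>, and infinitely many of these
  are congruent modulo \<open>c\<close>. The quotient of two of them is integral, since
  \<open>x / y = 1 + (x - y) / c * gal y\<close>, and the same holds for its inverse.\<close>

lemma unit_exists: "\<exists>e. unit e \<and> e \<noteq> 1 \<and> e \<noteq> - 1"
proof -
  define B where "B = {x \<in> ring_of_integers L. cmod (nm x) \<le> 2 * Re rt + 1}"
  define M where "M = \<lceil>2 * Re rt + 1\<rceil>"
  have "\<forall>x\<in>ring_of_integers L. \<exists>n. nm x = of_int n" using nm_int by blast
  then obtain n where n: "\<And>x. x \<in> L.ints \<Longrightarrow> nm x = of_int (n x)" by metis
  have "n x \<in> {-M..M}" if "x \<in> B" for x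
  proof -
    have "real_of_int \<bar>n x\<bar> \<le> 2 * Re rt + 1" using that n[of x] by (simp add: B_def)
    then have "real_of_int \<bar>n x\<bar> \<le> of_int M" unfolding M_def by linarith
    then have "\<bar>n x\<bar> \<le> M" by (simp only: of_int_le_iff)
    then show ?thesis by auto
  qed
  then have "finite (n ` B)" using finite_subset[of "n ` B" "{-M..M}"] by blast
  moreover have "infinite B" using infinite_small_norms by (simp add: B_def)
  ultimately obtain x0 where x0: "x0 \<in> B" "infinite {x \<in> B. n x = n x0}"
    using pigeonhole_infinite[of B n] by blast
  define c where "c = n x0"
  define E where "E = {x \<in> B. n x = c}"
  have E: "infinite E" using x0 by (simp add: E_def c_def)
  have "infinite (E - {0})" using E by simp
  then have "E - {0} \<noteq> {}" by (metis finite.emptyI)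
  then obtain y where y: "y \<in> E" "y \<noteq> 0" by blast
  then have c0: "c \<noteq> 0" using n[of y] nm_eq_0_iff[of y] by (auto simp: E_def B_def L.ints_mem)
  obtain f :: "complex \<Rightarrow> int \<times> int" and A where f: "finite A" "\<And>x. x \<in> L.ints \<Longrightarrow> f x \<in> A"
    "\<And>x y. x \<in> L.ints \<Longrightarrow> y \<in> L.ints \<Longrightarrow> f x = f y \<Longrightarrow> (x - y) / of_int c \<in> L.ints"
    using finite_residues[OF c0] by blast
  have EO: "E \<subseteq> L.ints" by (auto simp: E_def B_def)
  then have "f ` E \<subseteq> A" using f(2) by blast
  then have "finite (f ` E)" using f(1) finite_subset by blast
  then obtain b where b: "b \<in> E" "infinite {x \<in> E. f x = f b}"
    using pigeonhole_infinite[OF E] by blast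
  \<comment> \<open>Excluding \<open>b\<close> and \<open>- b\<close> keeps the quotient away from 1
    and -1.\<close>
  then have "infinite ({x \<in> E. f x = f b} - {b, - b})" by simp
  then have "{x \<in> E. f x = f b} - {b, - b} \<noteq> {}" by (metis finite.emptyI)
  then obtain a where a: "a \<in> E" "f a = f b" "a \<noteq> b" "a \<noteq> - b" by blast
  have nmE: "x * gal x = of_int c" if "x \<in> E" for x
    using n[of x] EO that by (auto simp: E_def nm_def)
  have nz: "x \<noteq> 0" if "x \<in> E" for x
    using nmE[OF that] c0 by auto
  have quot: "x / y \<in> L.ints" if xy: "x \<in> E" "y \<in> E" "f x = f y" for x y
  proof -
    have O: "x \<in> L.ints" "y \<in> L.ints" using xy EO by auto
    have "gal y \<noteq> 0" using nmE[OF xy(2)] c0 by auto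
    then have "(x - y) / of_int c * gal y = (x - y) / y"
      by (simp flip: nmE[OF xy(2)])
    then have "x / y = 1 + (x - y) / of_int c * gal y"
      using nz[OF xy(2)] by (simp add: diff_divide_distrib)
    also have "\<dots> \<in> L.ints"
      using f(3)[OF O xy(3)] O(2) by (intro L.ints_add L.ints_mult gal_ints) auto
    finally show ?thesis .
  qed
  have "unit (a / b)" using quot[of a b] quot[of b a] a b nz by (simp add: unit_def)
  moreover have "a / b \<noteq> 1" "a / b \<noteq> -1" using a nz[OF b(1)] by (auto simp: divide_eq_eq)
  ultimately show ?thesis by blast
qed

text \<open>Take a unit \<open>e > 1\<close> of least trace; traces of units \<open>x > 1\<close> of
  norm 1 are the natural numbers \<open>x + 1 / x > 2\<close>. If \<open>e\<close> is a square up to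
  sign, some \<open>y > 1\<close> among \<open>x\<close>, \<open>- x\<close> and their inverses has
  \<open>T e = T y ^ 2 - 2 > T y\<close>, against minimality.\<close>

lemma unit_not_square:
  assumes norm1: "\<And>x. unit x \<Longrightarrow> nm x = 1"
  shows "\<exists>e. unit e \<and> (\<forall>x. unit x \<longrightarrow> e \<noteq> x ^ 2 \<and> e \<noteq> - (x ^ 2))"
proof -
  define U where "U = {x. unit x \<and> Re x > 1}"
  have large: "\<exists>y\<in>U. y = x \<or> y = - x \<or> y = inverse x \<or> y = - inverse x" if x: "unit x" "x \<noteq> 1" "x \<noteq> - 1" for x
  proof -
    have xr: "x = complex_of_real (Re x)" using L_real[OF unit_mem[OF x(1)]] .
    have x0: "x \<noteq> 0" using x(1) by (simp add: unit_def)
    then have "Re x \<noteq> 0" using xr by (metis of_real_0)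
    moreover have "Re x \<noteq> 1" "Re x \<noteq> -1" using x xr by (metis of_real_1, metis of_real_1 of_real_minus)
    ultimately consider "Re x > 1" | "Re x < -1" | "0 < Re x" "Re x < 1" | "-1 < Re x" "Re x < 0" by linarith
    then show ?thesis
    proof cases
      case 3
      have "inverse x = complex_of_real (inverse (Re x))" by (subst xr) simp
      then have "Re (inverse x) = inverse (Re x)" by (simp only: Re_complex_of_real)
      also have "\<dots> > 1" using 3 by (intro one_less_inverse) auto
      finally show ?thesis using unit_inverse[OF x(1)] by (auto simp: U_def)
    next
      case 4
      have "- inverse x = complex_of_real (inverse (- Re x))" by (subst xr) simp
      then have "Re (- inverse x) = inverse (- Re x)" by (simp only: Re_complex_of_real)
      also have "\<dots> > 1" using 4 by (intro one_less_inverse) auto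
      finally have "- inverse x \<in> U" using unit_uminus[OF unit_inverse[OF x(1)]] by (simp add: U_def)
      then show ?thesis by blast
    next
      case 1
      then show ?thesis using x by (auto simp: U_def)
    next
      case 2
      then have "- x \<in> U" using unit_uminus[OF x(1)] by (simp add: U_def)
      then show ?thesis by blast
    qed
  qed
  have trU: "\<exists>t::nat. Re (tr x) = real t \<and> t > 2 \<and> Re x + inverse (Re x) = real t" if x: "x \<in> U" for x
  proof -
    have u: "unit x" "Re x > 1" using x by (auto simp: U_def)
    have xr: "x = complex_of_real (Re x)" using L_real[OF unit_mem[OF u(1)]] .
    have "x * gal x = 1" using norm1[OF u(1)] by (simp add: nm_def)
    then have "gal x = inverse x" by (rule inverse_unique[symmetric])
    also have "\<dots> = complex_of_real (inverse (Re x))" by (subst xr) simp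
    finally have "Re (gal x) = inverse (Re x)" by (simp only: Re_complex_of_real)
    then have Re: "Re (tr x) = Re x + inverse (Re x)" by (simp only: tr_def plus_complex.sel)
    obtain t :: int where t: "tr x = of_int t"
      using tr_ints[of x] u(1) by (auto simp: unit_def ints_Rats elim: Ints_cases)
    have "(Re x - 1) ^ 2 > 0" using u(2) by simp
    then have "(Re x - 1) ^ 2 / Re x > 0" using u(2) by simp
    also have "(Re x - 1) ^ 2 / Re x = Re x + inverse (Re x) - 2"
      using u(2) by (intro add_inverse_minus_two[symmetric]) simp
    finally have "real_of_int t > 2" using Re t by simp
    then have "t > 2" by linarith
    then show ?thesis using Re t by (intro exI[of _ "nat t"]) auto
  qed
  define T where "T x = nat \<lfloor>Re (tr x)\<rfloor>" for x
  have T: "T x > 2 \<and> Re x + inverse (Re x) = real (T x)" if "x \<in> U" for x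
    using trU[OF that] by (auto simp: T_def)
  obtain e0 where "unit e0" "e0 \<noteq> 1" "e0 \<noteq> -1" using unit_exists by blast
  then obtain e1 where "e1 \<in> U" using large by blast
  then obtain e where e: "e \<in> U" and min: "\<And>x. x \<in> U \<Longrightarrow> T e \<le> T x"
    using ex_has_least_nat[of "\<lambda>x. x \<in> U" e1 T] by blast
  have "e \<noteq> x ^ 2 \<and> e \<noteq> - (x ^ 2)" if x: "unit x" for x
  proof (rule ccontr)
    assume neg: "\<not> ?thesis"
    have xr: "x = complex_of_real (Re x)" using L_real[OF unit_mem[OF x(1)]] .
    have x2: "x ^ 2 = complex_of_real ((Re x) ^ 2)" by (subst xr) simp
    have "Re e > 1" using e by (simp add: U_def)
    moreover have "Re (- (x ^ 2)) \<le> 0" unfolding x2 by simp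
    ultimately have ex: "e = x ^ 2" using neg by auto
    have "x \<noteq> 1" "x \<noteq> -1" using ex \<open>Re e > 1\<close> by auto
    then obtain y where y: "y \<in> U" "y = x \<or> y = - x \<or> y = inverse x \<or> y = - inverse x"
      using large[OF x] by blast
    have yr: "y = complex_of_real (Re y)" using y L_real unit_mem by (auto simp: U_def)
    have y1: "Re y > 1" using y by (simp add: U_def)
    have "y ^ 2 = e \<or> y ^ 2 = inverse e" using y(2) ex by (auto simp: power_inverse)
    then have Ry: "(Re y) ^ 2 + inverse ((Re y) ^ 2) = Re e + inverse (Re e)"
    proof
      have y2: "y ^ 2 = complex_of_real ((Re y) ^ 2)" by (subst yr) simp
      { assume "y ^ 2 = e"
        then have "e = complex_of_real ((Re y) ^ 2)" using y2 by simp
        then have "Re e = (Re y) ^ 2" by (simp only: Re_complex_of_real)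
        then show ?thesis by simp }
      { assume "y ^ 2 = inverse e"
        have "e \<in> L" using e unit_mem by (simp add: U_def)
        then have "inverse e = complex_of_real (inverse (Re e))" by (subst L_real) simp_all
        then have "complex_of_real ((Re y) ^ 2) = complex_of_real (inverse (Re e))"
          using y2 \<open>y ^ 2 = inverse e\<close> by simp
        then have "(Re y) ^ 2 = inverse (Re e)" by (simp only: of_real_eq_iff)
        then show ?thesis by simp }
    qed
    have "real (T y) ^ 2 = (Re y + inverse (Re y)) ^ 2" using T[OF y(1)] by simp
    also have "\<dots> = (Re y) ^ 2 + inverse ((Re y) ^ 2) + 2"
      using y1 by (simp add: power2_sum power_inverse)
    also have "\<dots> = real (T e) + 2" using Ry T[OF e] by simp
    finally have "real (T e) = real (T y) ^ 2 - 2" by simp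
    moreover have "real (T y) > 2" using T[OF y(1)] by simp
    then have "real (T y) ^ 2 > 2 * real (T y)" by (simp add: power2_eq_square)
    ultimately have "real (T e) > real (T y)" using \<open>real (T y) > 2\<close> by linarith
    then show False using min[OF y(1)] by simp
  qed
  then show ?thesis using e by (auto simp: U_def)
qed

end

subsection \<open>Two-torsion of the class group of a real quadratic field\<close>

lemma dvd_prod_primes:
  fixes a :: int
  assumes "finite P" "\<And>p. p \<in> P \<Longrightarrow> Factorial_Ring.prime p" "a dvd \<Prod>P"
  shows "\<bar>a\<bar> = \<Prod>{p \<in> P. p dvd a}"
  using assms
proof (induction P arbitrary: a rule: finite_induct)
  case empty
  then show ?case by simp
next
  case (insert p Q)
  have p: "Factorial_Ring.prime p" using insert.prems by simp
  show ?case
  proof (cases "p dvd a")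
    case True
    then obtain b where b: "a = p * b" by (elim dvdE)
    have p0: "p > 0" using p by (rule prime_gt_0_int)
    have "p * b dvd p * \<Prod>Q" using insert b by simp
    then have "b dvd \<Prod>Q" using p0 by simp
    then have "\<bar>b\<bar> = \<Prod>{q \<in> Q. q dvd b}" using insert by simp
    also have "{q \<in> Q. q dvd b} = {q \<in> Q. q dvd a}"
    proof -
      have "q dvd b" if "q \<in> Q" "q dvd p * b" for q
      proof -
        have q: "Factorial_Ring.prime q" using insert.prems that by simp
        then have "q dvd p \<or> q dvd b" using that by (simp add: prime_dvd_mult_iff)
        moreover have "\<not> q dvd p" using primes_dvd_imp_eq[OF q p] that insert.hyps by auto
        ultimately show ?thesis by simp
      qed
      then show ?thesis by (auto simp: b)
    qed
    finally have "\<bar>a\<bar> = p * \<Prod>{q \<in> Q. q dvd a}" using p0 by (simp add: b abs_mult)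
    moreover have "{q \<in> insert p Q. q dvd a} = insert p {q \<in> Q. q dvd a}" using True by auto
    ultimately show ?thesis using insert.hyps by simp
  next
    case False
    then have "coprime a p" using p prime_imp_coprime[of p a] by (simp add: coprime_commute)
    then have "a dvd \<Prod>Q" using insert.prems insert.hyps by (simp add: coprime_dvd_mult_right_iff)
    moreover have "{q \<in> insert p Q. q dvd a} = {q \<in> Q. q dvd a}" using False by auto
    ultimately show ?thesis using insert by simp
  qed
qed

lemma Rat_idvd_of_int: "Rat.idvd (of_int a) (of_int b) \<longleftrightarrow> a dvd b"
proof
  assume "Rat.idvd (of_int a) (of_int b)"
  then obtain c where "of_int b = (of_int a * of_int c :: complex)" unfolding Rat.idvd_def ints_Rats
    by (auto elim: Ints_cases)
  then have "b = a * c" by (simp only: of_int_mult[symmetric] of_int_eq_iff)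
  then show "a dvd b" by simp
qed (auto simp: Rat.idvd_def ints_Rats elim!: dvdE intro!: bexI[of _ "of_int _"])

lemma card_fibres:
  assumes "finite A" "\<And>x. x \<in> A \<Longrightarrow> card {y \<in> A. f y = f x} = k"
  shows "card A = k * card (f ` A)"
proof -
  have "card A = (\<Sum>z\<in>f ` A. card {y \<in> A. f y = z})"
    using sum.image_gen[OF assms(1), of "\<lambda>_. 1 :: nat" f] by simp
  also have "\<dots> = (\<Sum>z\<in>f ` A. k)" using assms(2) by (intro sum.cong) auto
  finally show ?thesis by simp
qed

text \<open>Symmetric difference is the group law on sets of ramified primes, since common primes
  contribute principal ideals.\<close>

definition sdiff :: "'a set \<Rightarrow> 'a set \<Rightarrow> 'a set" where "sdiff S T = (S - T) \<union> (T - S)"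

lemma sdiff_simps [simp]: "sdiff S S = {}" "sdiff S {} = S" "sdiff {} S = S" "sdiff S (sdiff S T) = T"
  by (auto simp: sdiff_def)

lemma sdiff_subset: "S \<subseteq> P \<Longrightarrow> T \<subseteq> P \<Longrightarrow> sdiff S T \<subseteq> P" by (auto simp: sdiff_def)

text \<open>The number \<open>disc\<close> need only have its prime factors among those of
  \<open>D\<close>, because it is used to bound radical divisors. The fourth power leaves room for
  \<open>8 * d\<close> when \<open>D = 2 * d\<close>. The last condition forces all units to have
  norm 1.\<close>

locale ramified_quadratic = real_quadratic D rt for D rt +
  fixes Pr :: "int set" and w :: complex and disc :: int
  assumes fin: "finite Pr" and prime_Pr: "p \<in> Pr \<Longrightarrow> Factorial_Ring.prime p" and D_eq: "D = \<Prod>Pr"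
    and w: "w \<in> L.ints" "w \<notin> \<rat>" "(w - gal w) ^ 2 = of_int disc"
    and disc: "disc dvd D ^ 4"
    and norm_not_minus_one: "x \<in> L \<Longrightarrow> nm x \<noteq> - 1"
begin

lemma Pr_pos: "p \<in> Pr \<Longrightarrow> p > 0" using prime_Pr prime_gt_0_int by blast

lemma prod_pos: "S \<subseteq> Pr \<Longrightarrow> \<Prod>S > 0" using Pr_pos by (intro Groups_Big.prod_pos) auto

lemma nm_unit_base:
  assumes x: "x \<in> L" "x \<noteq> 0" and nm: "nm x \<in> ring_of_integers \<rat>" "inverse (nm x) \<in> ring_of_integers \<rat>"
  shows "nm x = 1"
proof -
  obtain m n where mn: "nm x = of_int m" "inverse (nm x) = of_int n"
    using nm by (auto simp: ints_Rats elim!: Ints_cases)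
  have "of_int m \<noteq> (-1 :: complex)" using norm_not_minus_one[OF x(1)] mn by simp
  then have m1: "m \<noteq> - 1" by auto
  have "nm x \<noteq> 0" using x by simp
  then have "nm x * inverse (nm x) = 1" by simp
  then have "of_int (m * n) = (1 :: complex)" by (simp only: of_int_mult flip: mn)
  then have "m * n = 1" by (simp only: of_int_eq_1_iff)
  then have "m = 1 \<or> m = -1" using zmult_eq_1_iff by blast
  then show ?thesis using m1 mn by simp
qed

lemma nm_unit: "unit x \<Longrightarrow> nm x = 1"
  using nm_unit_base[of x] nm_ints[of x] nm_ints[of "inverse x"]
  by (simp add: unit_def L.ints_mem nm_inverse)

text \<open>The product of the ramified prime ideals above \<open>S\<close>, given by two
  generators; its square is generated by \<open>\<Prod>S\<close> because \<open>D\<close> is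
  squarefree.\<close>

definition am :: "int set \<Rightarrow> complex set" where "am S = L.gen2 (of_int (\<Prod>S)) rt"

lemma sq_ideal_am:
  assumes S: "S \<subseteq> Pr"
  shows "sq_ideal (am S) (of_int (\<Prod>S))"
proof -
  have pos: "\<Prod>S > 0" using prod_pos[OF S] .
  have split: "D = \<Prod>S * \<Prod>(Pr - S)"
    unfolding D_eq using prod.subset_diff[OF S fin, of "\<lambda>x. x"] by (simp add: mult.commute)
  have "coprime (\<Prod>S) (\<Prod>(Pr - S))"
  proof (intro prod_coprime_left prod_coprime_right)
    fix p q assume "p \<in> S" "q \<in> Pr - S"
    then show "coprime p q" using S prime_Pr by (intro primes_coprime) auto
  qed
  then obtain u v where uv: "u * \<Prod>S + v * \<Prod>(Pr - S) = 1" using bezout_int[of "\<Prod>S" "\<Prod>(Pr - S)"] by auto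
  have "am S \<star> am S = L.pideal (of_int (\<Prod>S))"
    unfolding am_def
  proof (rule L.gen2_square[where m = "of_int (\<Prod>(Pr - S))" and u = "of_int u" and v = "of_int v"])
    show "rt ^ 2 = of_int (\<Prod>S) * of_int (\<Prod>(Pr - S))" unfolding rt_square by (subst split) (rule of_int_mult)
    show "of_int u * of_int (\<Prod>S) + of_int v * of_int (\<Prod>(Pr - S)) = (1 :: complex)"
      using arg_cong[OF uv, of "of_int :: int \<Rightarrow> complex"] by (simp only: of_int_add of_int_mult of_int_1)
    show "of_int (\<Prod>S) \<noteq> (0 :: complex)" using pos by (simp only: of_int_eq_0_iff)
  qed (rule L.ints_of_int D_ints)+
  moreover have "fractional_ideal L (am S)"
    unfolding am_def using pos by (intro L.frac_gen2 L.of_int_mem L.ints_mem D_ints) (simp only: of_int_eq_0_iff)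
  ultimately show ?thesis
    unfolding sq_ideal_def using pos by (intro conjI Rats_of_int) (simp_all only: of_int_eq_0_iff)
qed

definition cls :: "int set \<Rightarrow> complex set set" where "cls S = L.cl (am S)"

lemma cls_mem [simp, intro]: "S \<subseteq> Pr \<Longrightarrow> cls S \<in> carrier L.C"
  using sq_idealD(1)[OF sq_ideal_am] by (simp add: cls_def)

text \<open>A radical \<open>g\<close> divides \<open>disc\<close>, hence \<open>D ^ 4\<close>, and
  by radicality used twice \<open>D\<close> itself. As \<open>D\<close> is squarefree,
  \<open>g\<close> is a product of ramified primes up to sign, and the sign is a unit.\<close>

lemma sq_ideal_radical_am:
  assumes J: "sq_ideal J g" and rad: "Rat.radical g"
  shows "\<exists>S\<subseteq>Pr. J = am S \<and> (g = of_int (\<Prod>S) \<or> g = - of_int (\<Prod>S))"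
proof -
  obtain a where a: "g = of_int a" using rad by (auto simp: Rat.radical_def ints_Rats elim: Ints_cases)
  have radical: "a dvd t" if t: "a dvd t ^ 2" for t
  proof -
    have "Rat.idvd (of_int a) (of_int (t ^ 2))" using t by (simp only: Rat_idvd_of_int)
    then have "Rat.idvd (of_int a) (of_int t ^ 2)" by (simp only: of_int_power)
    moreover have "Rat.idvd g (of_int t ^ 2) \<longrightarrow> Rat.idvd g (of_int t)"
      using rad Rat.ints_of_int[of t] unfolding Rat.radical_def by blast
    ultimately have "Rat.idvd (of_int a) (of_int t)" unfolding a by blast
    then show ?thesis by (simp only: Rat_idvd_of_int)
  qed
  have "a dvd disc" using sq_ideal_dvd_discriminant[OF J rad w(1,2)] unfolding w(3) a Rat_idvd_of_int .
  then have "a dvd D ^ 4" using disc by (rule dvd_trans)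
  also have "D ^ 4 = (D ^ 2) ^ 2" by simp
  finally have "a dvd (D ^ 2) ^ 2" .
  then have "a dvd D" using radical by blast
  then have "\<bar>a\<bar> = \<Prod>{p \<in> Pr. p dvd a}" unfolding D_eq by (intro dvd_prod_primes fin prime_Pr)
  then obtain S where S: "S \<subseteq> Pr" "\<bar>a\<bar> = \<Prod>S"
    by (intro that[of "{p \<in> Pr. p dvd a}"]) auto
  have "a = \<Prod>S \<or> a = - \<Prod>S" using S(2) by linarith
  then have g: "g = of_int (\<Prod>S) \<or> g = - of_int (\<Prod>S)"
    unfolding a by (metis of_int_minus)
  have pos: "(of_int (\<Prod>S) :: complex) \<noteq> 0" using prod_pos[OF S(1)] by (simp only: of_int_eq_0_iff)
  have "sq_ideal J (of_int (\<Prod>S))"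
  proof (rule sq_ideal_cong[OF J Rats_of_int pos])
    show "g / of_int (\<Prod>S) \<in> L.ints" "of_int (\<Prod>S) / g \<in> L.ints"
      using g pos L.ints_uminus[OF L.ints_1] by (elim disjE; simp del: of_int_prod)+
  qed
  then show ?thesis using sq_ideal_unique[OF _ sq_ideal_am[OF S(1)]] S(1) g by blast
qed

text \<open>Since -1 is not a norm, a norm that is a unit equals 1 and is a square, which is the
  condition of \<open>two_torsion_sq_ideal\<close>.\<close>

lemma two_torsion_cls:
  assumes c: "c \<in> carrier L.C" "c \<otimes>\<^bsub>L.C\<^esub> c = \<one>\<^bsub>L.C\<^esub>"
  shows "\<exists>S\<subseteq>Pr. c = cls S"
proof -
  obtain I where I: "fractional_ideal L I" "c = L.cl I" using L.cl_surj[OF c(1)] by blast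
  have "\<exists>v\<in>\<rat>. nm x = v ^ 2"
    if "x \<in> L" "nm x \<in> ring_of_integers \<rat>" "inverse (nm x) \<in> ring_of_integers \<rat>" for x
    using nm_unit_base[OF that(1) _ that(2,3)] by (cases "x = 0") (auto simp: nm_def intro: bexI[of _ 0] bexI[of _ 1])
  then obtain J g where "sq_ideal J g" "L.cl J = c"
    using two_torsion_sq_ideal[OF I(1)] c I(2) by blast
  then obtain K h where K: "sq_ideal K h" "Rat.radical h" "L.cl K = c" using sq_ideal_radical by metis
  then show ?thesis using sq_ideal_radical_am[OF K(1,2)] by (auto simp: cls_def)
qed

text \<open>The primes common to both sets contribute the square of their product \<open>m\<close>,
  which scaling by \<open>1 / m\<close> removes.\<close>

lemma cls_mult:
  assumes S: "S \<subseteq> Pr" and T: "T \<subseteq> Pr"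
  shows "cls S \<otimes>\<^bsub>L.C\<^esub> cls T = cls (sdiff S T)"
proof -
  have fin': "finite S" "finite T" using S T fin finite_subset by auto
  define m where "m = \<Prod>(S \<inter> T)"
  have m: "m > 0" unfolding m_def using S by (intro prod_pos) auto
  have sd: "sdiff S T \<subseteq> Pr" using S T by (rule sdiff_subset)
  have "\<Prod>S = m * \<Prod>(S - T)" unfolding m_def using prod.Int_Diff[OF fin'(1), of "\<lambda>x. x" T] by simp
  moreover have "\<Prod>T = m * \<Prod>(T - S)"
    unfolding m_def using prod.Int_Diff[OF fin'(2), of "\<lambda>x. x" S] by (simp add: Int_commute)
  moreover have "\<Prod>(sdiff S T) = \<Prod>(S - T) * \<Prod>(T - S)"
    unfolding sdiff_def using fin' by (intro prod.union_disjoint) auto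
  ultimately have prod: "\<Prod>S * \<Prod>T = m ^ 2 * \<Prod>(sdiff S T)" by (simp add: power2_eq_square)
  have m0: "inverse (of_int m) \<in> \<rat>" "inverse (of_int m) \<noteq> (0 :: complex)" using m by auto
  have sq: "sq_ideal (L.pideal (inverse (of_int m)) \<star> (am S \<star> am T))
      (inverse (of_int m) ^ 2 * (of_int (\<Prod>S) * of_int (\<Prod>T)))"
    by (intro sq_ideal_scale sq_ideal_mult sq_ideal_am S T m0)
  have "of_int (\<Prod>S) * of_int (\<Prod>T) = (of_int m ^ 2 * of_int (\<Prod>(sdiff S T)) :: complex)"
    using arg_cong[OF prod, of "of_int :: int \<Rightarrow> complex"] by (simp only: of_int_mult of_int_power)
  then have "inverse (of_int m) ^ 2 * (of_int (\<Prod>S) * of_int (\<Prod>T)) = (of_int (\<Prod>(sdiff S T)) :: complex)"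
    using m by (simp add: power_inverse del: of_int_prod)
  then have "L.pideal (inverse (of_int m)) \<star> (am S \<star> am T) = am (sdiff S T)"
    using sq sq_ideal_unique[OF _ sq_ideal_am[OF sd]] by simp
  moreover have fr: "fractional_ideal L (am S)" "fractional_ideal L (am T)"
    using sq_ideal_am S T sq_idealD(1) by blast+
  ultimately show ?thesis
    using L.cl_eqI[of "am S \<star> am T" "inverse (of_int m)"] m0 by (simp add: cls_def L.cl_mult L.frac_iprod F_mem_L)
qed

lemma cls_empty: "cls {} = \<one>\<^bsub>L.C\<^esub>"
  using cls_mult[of "{}" "{}"] L.C.r_cancel_one[of "cls {}" "cls {}"] by simp

lemma cls_square: "S \<subseteq> Pr \<Longrightarrow> cls S \<otimes>\<^bsub>L.C\<^esub> cls S = \<one>\<^bsub>L.C\<^esub>"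
  by (simp add: cls_mult cls_empty)

lemma cls_one_iff:
  "S \<subseteq> Pr \<Longrightarrow> cls S = \<one>\<^bsub>L.C\<^esub> \<longleftrightarrow> (\<exists>b\<in>L. b \<noteq> 0 \<and> L.pideal (b ^ 2) = L.pideal (of_int (\<Prod>S)))"
  unfolding cls_def by (rule sq_ideal_principal_iff[OF sq_ideal_am])

lemma cls_Pr: "cls Pr = \<one>\<^bsub>L.C\<^esub>"
proof -
  have "rt \<noteq> 0" using rt_irrational by auto
  moreover have "L.pideal (rt ^ 2) = L.pideal (of_int (\<Prod>Pr))" unfolding rt_square D_eq ..
  moreover have "rt \<in> L" by (simp add: L.ints_mem)
  ultimately show ?thesis by (subst cls_one_iff) auto
qed

section \<open>Norms, relations and squares of classes\<close>

definition norm_set :: "int set \<Rightarrow> bool" where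
  "norm_set S \<longleftrightarrow> (\<exists>x\<in>L. nm x = of_int (\<Prod>S) \<or> nm x = - of_int (\<Prod>S))"

lemma pideal_Rat_eq:
  assumes "a \<in> \<rat>" "a \<noteq> 0" "b \<in> \<rat>" "b \<noteq> 0" "Rat.pideal a = Rat.pideal b"
  shows "a = b \<or> a = - b"
proof -
  have "a / b \<in> \<int>" "b / a \<in> \<int>" using Rat.pideal_eq_iff[OF assms(1-4)] assms(5) by (auto simp: ints_Rats)
  then obtain m n where mn: "a / b = of_int m" "b / a = of_int n" by (auto elim!: Ints_cases)
  have "of_int (m * n) = (a / b) * (b / a)" by (simp only: of_int_mult mn)
  also have "\<dots> = 1" using assms by simp
  finally have "m * n = 1" by (simp only: of_int_eq_1_iff)
  then have "m = 1 \<or> m = -1" using zmult_eq_1_iff by blast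
  then show ?thesis using mn(1) assms(4) by (auto simp: field_simps)
qed

text \<open>Let \<open>c\<close> be the class of \<open>I\<close>, and let \<open>g\<close> generate
  the relative norm of \<open>I\<close>. The square of \<open>I\<close> has relative norm generated
  by \<open>g ^ 2\<close>, so \<open>\<Prod>S\<close> equals \<open>g ^ 2 * nm b\<close>, that is
  \<open>nm (g * b)\<close>, up to sign.\<close>

lemma cls_square_norm_set:
  assumes S: "S \<subseteq> Pr" and c: "c \<in> carrier L.C" "cls S = c \<otimes>\<^bsub>L.C\<^esub> c"
  shows "norm_set S"
proof -
  obtain I where I: "fractional_ideal L I" "c = L.cl I" using L.cl_surj[OF c(1)] by blast
  obtain g where g: "g \<in> \<rat>" "g \<noteq> 0" "I \<star> gal ` I = L.pideal g" using relative_norm_principal[OF I(1)] by blast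
  have sub: "I \<subseteq> L" using L.frac_mem[OF I(1)] by auto
  have "(I \<star> I) \<star> gal ` (I \<star> I) = (I \<star> gal ` I) \<star> (I \<star> gal ` I)"
    unfolding gal_image_iprod[OF sub sub] by (simp only: iprod_ac)
  also have "\<dots> = L.pideal (g ^ 2)" using g by (simp add: L.pideal_mult power2_eq_square F_mem_L)
  finally obtain b where b: "b \<in> L" "b \<noteq> 0" "Rat.pideal (of_int (\<Prod>S)) = Rat.pideal (g ^ 2 * nm b)"
    using sq_ideal_norm_eq[OF sq_ideal_am[OF S], of "I \<star> I" "g ^ 2"] I g c
    by (auto simp: cls_def L.cl_mult)
  have "g * b \<in> L" using g b by auto
  have nmgb: "nm (g * b) = g ^ 2 * nm b" using g b by (simp add: nm_mult F_mem_L nm_F)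
  have "of_int (\<Prod>S) \<noteq> (0 :: complex)" using prod_pos[OF S] by (simp only: of_int_eq_0_iff)
  moreover have "g ^ 2 * nm b \<in> \<rat>" "g ^ 2 * nm b \<noteq> 0" using g b by auto
  ultimately have "of_int (\<Prod>S) = g ^ 2 * nm b \<or> of_int (\<Prod>S) = - (g ^ 2 * nm b)"
    using pideal_Rat_eq[OF Rats_of_int _ _ _ b(3)] by blast
  then show ?thesis
    unfolding norm_set_def using \<open>g * b \<in> L\<close> nmgb by (intro bexI[of _ "g * b"]) auto
qed

lemma cls_one_norm_set: "S \<subseteq> Pr \<Longrightarrow> cls S = \<one>\<^bsub>L.C\<^esub> \<Longrightarrow> norm_set S"
  using cls_square_norm_set[of S "\<one>\<^bsub>L.C\<^esub>"] by simp

text \<open>For a unit \<open>e\<close> of norm one, \<open>b = 1 + e\<close> satisfies \<open>b\<^sup>2 = e nm b\<close>, so \<open>(b)\<close> is ambiguous.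
  The resulting relation is trivial only if \<open>\<plusminus>e\<close> is a square.\<close>

lemma nontrivial_relation: "\<exists>S\<subseteq>Pr. S \<noteq> {} \<and> S \<noteq> Pr \<and> cls S = \<one>\<^bsub>L.C\<^esub>"
proof -
  obtain e where e: "unit e" "\<And>x. unit x \<Longrightarrow> e \<noteq> x ^ 2 \<and> e \<noteq> - (x ^ 2)"
    using unit_not_square[OF nm_unit] by blast
  have eL: "e \<in> L" using unit_mem[OF e(1)] .
  have ee: "e * gal e = 1" using nm_unit[OF e(1)] by (simp add: nm_def)
  have unit1: "unit 1" by (simp add: unit_def)
  define b where "b = 1 + e"
  have b0: "b \<noteq> 0" using e(2)[OF unit1] by (auto simp: b_def add_eq_0_iff)
  have bL: "b \<in> L" using eL by (auto simp: b_def)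
  have galb: "gal b = 1 + gal e" using eL by (simp add: b_def gal_add)
  have b2: "b ^ 2 = e * nm b"
  proof -
    have "e * nm b = b * (e + e * gal e)" by (simp add: nm_def galb algebra_simps)
    then show ?thesis by (simp add: ee b_def power2_eq_square algebra_simps)
  qed
  have nmb: "nm b \<in> \<rat>" "nm b \<noteq> 0" using bL b0 by auto
  \<comment> \<open>Scaling by a rational number makes the generator radical, which places the ideal
    among the \<open>am S\<close>.\<close>
  obtain c where c: "c \<in> \<rat>" "c \<noteq> 0" "Rat.radical (c ^ 2 * nm b)" using Rat.radical_multiple[OF nmb] by blast
  define y where "y = c * b"
  have y: "y \<in> L" "y \<noteq> 0" using c b0 bL by (auto simp: y_def)
  have y2: "y ^ 2 = e * (c ^ 2 * nm b)" by (simp add: y_def b2 power_mult_distrib)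
  have g: "c ^ 2 * nm b \<in> \<rat>" "c ^ 2 * nm b \<noteq> 0" using c nmb by auto
  have e0: "e \<noteq> 0" using ee by auto
  have "L.pideal y \<star> L.pideal y = L.pideal (c ^ 2 * nm b)"
  proof -
    have "L.pideal y \<star> L.pideal y = L.pideal (e * (c ^ 2 * nm b))" using y y2 by (simp add: L.pideal_mult power2_eq_square)
    also have "\<dots> = L.pideal (c ^ 2 * nm b)"
      using g e0 e(1) eL by (subst L.pideal_eq_iff) (auto simp: unit_def inverse_eq_divide)
    finally show ?thesis .
  qed
  then have "sq_ideal (L.pideal y) (c ^ 2 * nm b)" using y g by (auto simp: sq_ideal_def)
  then obtain S where S: "S \<subseteq> Pr" "L.pideal y = am S" "c ^ 2 * nm b = of_int (\<Prod>S) \<or> c ^ 2 * nm b = - of_int (\<Prod>S)"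
    using sq_ideal_radical_am c(3) by blast
  have "cls S = \<one>\<^bsub>L.C\<^esub>" using L.cl_pideal[OF y] S(2) by (simp add: cls_def)
  \<comment> \<open>A root of \<open>e\<close> or \<open>- e\<close> in \<open>L\<close> would be
    integral together with its inverse, hence a unit. The cases \<open>S = {}\<close> and
    \<open>S = Pr\<close> would produce such roots, namely \<open>y\<close> and
    \<open>y / rt\<close>.\<close>
  moreover have no_root: False if z: "z \<in> L" "z ^ 2 = e \<or> z ^ 2 = - e" for z
  proof -
    have "z \<noteq> 0" using z e0 by auto
    have "algebraic_int (z ^ 2)" "algebraic_int (inverse z ^ 2)"
      using z(2) e(1) by (auto simp: unit_def L.ints_iff power_inverse)
    then have "unit z" using z(1) algebraic_int_of_square \<open>z \<noteq> 0\<close> by (auto simp: unit_def L.ints_iff)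
    then show False using e(2)[of z] z(2) by auto
  qed
  have "S \<noteq> {}"
  proof
    assume "S = {}"
    then have "y ^ 2 = e \<or> y ^ 2 = - e" using S(3) y2 by auto
    then show False using no_root y(1) by blast
  qed
  moreover have "S \<noteq> Pr"
  proof
    assume "S = Pr"
    then have "c ^ 2 * nm b = rt ^ 2 \<or> c ^ 2 * nm b = - (rt ^ 2)" using S(3) D_eq rt_square by simp
    then have "y ^ 2 = e * rt ^ 2 \<or> y ^ 2 = - e * rt ^ 2" using y2 by auto
    moreover have "rt \<noteq> 0" using rt_irrational by auto
    ultimately have "(y / rt) ^ 2 = e \<or> (y / rt) ^ 2 = - e" by (auto simp: power_divide)
    moreover have "y / rt \<in> L" using y(1) D_ints by (auto simp: L.ints_mem)
    ultimately show False using no_root by blast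
  qed
  ultimately show ?thesis using S(1) by blast
qed

text \<open>There is one nontrivial relation \<open>S1\<close>, and \<open>rank\<close> leaves no
  norm set besides the empty set, \<open>Pr\<close>, \<open>S1\<close> and its complement. So the
  norm sets are exactly the relations, and every class has four representations. If \<open>c\<close>
  has order dividing four, its square is some \<open>cls S\<close> and a square, so \<open>S\<close>
  is a norm set and the class is trivial.\<close>

theorem two_torsion_count:
  assumes rank: "\<And>S T. S \<subseteq> Pr \<Longrightarrow> T \<subseteq> Pr \<Longrightarrow> S \<noteq> {} \<Longrightarrow> S \<noteq> Pr \<Longrightarrow> T \<noteq> {} \<Longrightarrow> T \<noteq> Pr \<Longrightarrow>
      norm_set S \<Longrightarrow> norm_set T \<Longrightarrow> T = S \<or> T = Pr - S"
  shows "4 * card {c \<in> carrier L.C. c \<otimes>\<^bsub>L.C\<^esub> c = \<one>\<^bsub>L.C\<^esub>} = 2 ^ card Pr"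
    and "\<And>S. S \<subseteq> Pr \<Longrightarrow> norm_set S \<Longrightarrow> cls S = \<one>\<^bsub>L.C\<^esub>"
    and "\<And>c. c \<in> carrier L.C \<Longrightarrow> (c \<otimes>\<^bsub>L.C\<^esub> c) \<otimes>\<^bsub>L.C\<^esub> (c \<otimes>\<^bsub>L.C\<^esub> c) = \<one>\<^bsub>L.C\<^esub> \<Longrightarrow> c \<otimes>\<^bsub>L.C\<^esub> c = \<one>\<^bsub>L.C\<^esub>"
proof -
  obtain S1 where S1: "S1 \<subseteq> Pr" "S1 \<noteq> {}" "S1 \<noteq> Pr" "cls S1 = \<one>\<^bsub>L.C\<^esub>" using nontrivial_relation by blast
  have compl: "sdiff Pr S1 = Pr - S1" using S1(1) by (auto simp: sdiff_def)
  have "cls (Pr - S1) = \<one>\<^bsub>L.C\<^esub>" using cls_mult[of Pr S1] S1 cls_Pr by (simp add: compl)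
  then have rel: "cls S = \<one>\<^bsub>L.C\<^esub>" if "S \<in> {{}, Pr, S1, Pr - S1}" for S using that S1 cls_empty cls_Pr by auto
  have norm: "S \<in> {{}, Pr, S1, Pr - S1}" if "S \<subseteq> Pr" "norm_set S" for S
    using rank[OF S1(1) that(1) S1(2,3)] that cls_one_norm_set[OF S1(1,4)] by auto
  show 2: "\<And>S. S \<subseteq> Pr \<Longrightarrow> norm_set S \<Longrightarrow> cls S = \<one>\<^bsub>L.C\<^esub>" using rel norm by blast
  have fibre: "card {T \<in> Pow Pr. cls T = cls S} = 4" if "S \<in> Pow Pr" for S
  proof -
    have S: "S \<subseteq> Pr" using that by simp
    have "{T \<in> Pow Pr. cls T = cls S} = sdiff S ` {{}, Pr, S1, Pr - S1}"
    proof (intro equalityI subsetI)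
      fix T assume "T \<in> {T \<in> Pow Pr. cls T = cls S}"
      then have T: "T \<subseteq> Pr" "cls T = cls S" by auto
      have "cls (sdiff S T) = \<one>\<^bsub>L.C\<^esub>" using cls_mult[OF S T(1)] T(2) cls_square[OF S] by simp
      then have "sdiff S T \<in> {{}, Pr, S1, Pr - S1}" using norm cls_one_norm_set sdiff_subset[OF S T(1)] by blast
      then show "T \<in> sdiff S ` {{}, Pr, S1, Pr - S1}" by (intro image_eqI[of _ _ "sdiff S T"]) simp_all
    next
      fix T assume "T \<in> sdiff S ` {{}, Pr, S1, Pr - S1}"
      then obtain R where R: "R \<in> {{}, Pr, S1, Pr - S1}" "T = sdiff S R" by blast
      then have RP: "R \<subseteq> Pr" using S1(1) by auto
      have "cls T = cls S \<otimes>\<^bsub>L.C\<^esub> cls R" using cls_mult[OF S RP] R(2) by simp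
      then have "cls T = cls S" using rel[OF R(1)] S by simp
      then show "T \<in> {T \<in> Pow Pr. cls T = cls S}" using R(2) sdiff_subset[OF S RP] by simp
    qed
    moreover have "inj (sdiff S)" by (rule inj_on_inverseI[of _ "sdiff S"]) simp
    ultimately have "card {T \<in> Pow Pr. cls T = cls S} = card {{}, Pr, S1, Pr - S1}"
      by (simp only: card_image[OF inj_on_subset[OF _ subset_UNIV]])
    also have "\<dots> = 4"
    proof -
      have "Pr - S1 \<noteq> {}" "Pr - S1 \<noteq> Pr" "Pr - S1 \<noteq> S1" "Pr \<noteq> {}" using S1 by auto
      then show ?thesis using S1(2,3) by auto
    qed
    finally show ?thesis .
  qed
  have "{c \<in> carrier L.C. c \<otimes>\<^bsub>L.C\<^esub> c = \<one>\<^bsub>L.C\<^esub>} = cls ` Pow Pr"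
    using two_torsion_cls cls_square by auto
  then show "4 * card {c \<in> carrier L.C. c \<otimes>\<^bsub>L.C\<^esub> c = \<one>\<^bsub>L.C\<^esub>} = 2 ^ card Pr"
    using card_fibres[of "Pow Pr" cls 4] fibre fin by (simp add: card_Pow)
  fix c assume c: "c \<in> carrier L.C" "(c \<otimes>\<^bsub>L.C\<^esub> c) \<otimes>\<^bsub>L.C\<^esub> (c \<otimes>\<^bsub>L.C\<^esub> c) = \<one>\<^bsub>L.C\<^esub>"
  then obtain S where S: "S \<subseteq> Pr" "c \<otimes>\<^bsub>L.C\<^esub> c = cls S" using two_torsion_cls[of "c \<otimes>\<^bsub>L.C\<^esub> c"] by auto
  then show "c \<otimes>\<^bsub>L.C\<^esub> c = \<one>\<^bsub>L.C\<^esub>" using 2[OF S(1)] cls_square_norm_set[OF S(1) c(1)] by simp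
qed

end

subsection \<open>Legendre symbols and norms\<close>

lemma Legendre_values:
  assumes "\<not> p dvd a"
  shows "Legendre a p = 1 \<or> Legendre a p = -1"
  using assms by (auto simp: Legendre_def cong_0_iff)

lemma Legendre_cong: "[a = b] (mod p) \<Longrightarrow> Legendre a p = Legendre b p"
  unfolding Legendre_def QuadRes_def cong_def by simp

lemma euler_criterion_int:
  fixes p :: int
  assumes "Factorial_Ring.prime p" "p > 2"
  shows "[Legendre a p = a ^ nat ((p - 1) div 2)] (mod p)"
proof -
  have "Factorial_Ring.prime (nat p)" "2 < nat p" using assms by auto
  then have "[Legendre a (int (nat p)) = a ^ ((nat p - 1) div 2)] (mod int (nat p))" by (rule euler_criterion)
  moreover have "int (nat p) = p" "(nat p - 1) div 2 = nat ((p - 1) div 2)" using assms by auto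
  ultimately show ?thesis by simp
qed

lemma small_cong_eq:
  fixes p x y :: int
  assumes "p > 2" "[x = y] (mod p)" "\<bar>x\<bar> \<le> 1" "\<bar>y\<bar> \<le> 1"
  shows "x = y"
proof (rule ccontr)
  assume "x \<noteq> y"
  moreover have "p dvd x - y" using assms(2) by (simp add: cong_iff_dvd_diff)
  ultimately have "\<bar>p\<bar> \<le> \<bar>x - y\<bar>" by (intro dvd_imp_le_int) auto
  then show False using assms by linarith
qed

lemma abs_Legendre_le: "\<bar>Legendre a p\<bar> \<le> 1" by (simp add: Legendre_def)

lemma Legendre_mult:
  fixes p :: int
  assumes p: "Factorial_Ring.prime p" "p > 2"
  shows "Legendre (a * b) p = Legendre a p * Legendre b p"
proof (rule small_cong_eq[OF p(2)])
  have "[Legendre (a * b) p = a ^ nat ((p - 1) div 2) * b ^ nat ((p - 1) div 2)] (mod p)"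
    using euler_criterion_int[OF p, of "a * b"] by (simp add: power_mult_distrib)
  moreover have "[Legendre a p * Legendre b p = a ^ nat ((p - 1) div 2) * b ^ nat ((p - 1) div 2)] (mod p)"
    by (intro cong_mult euler_criterion_int p)
  ultimately show "[Legendre (a * b) p = Legendre a p * Legendre b p] (mod p)" by (metis cong_sym cong_trans)
  show "\<bar>Legendre (a * b) p\<bar> \<le> 1" by (rule abs_Legendre_le)
  show "\<bar>Legendre a p * Legendre b p\<bar> \<le> 1"
    using mult_mono[OF abs_Legendre_le[of a p] abs_Legendre_le[of b p]] by (simp add: abs_mult)
qed

lemma Legendre_1 [simp]: "p > 1 \<Longrightarrow> Legendre 1 p = 1"
  unfolding Legendre_def QuadRes_def cong_0_iff by (auto intro: exI[of _ 1] dest: zdvd_imp_le)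

lemma Legendre_prod:
  fixes p :: int
  assumes p: "Factorial_Ring.prime p" "p > 2"
  shows "Legendre (prod f S) p = (\<Prod>x\<in>S. Legendre (f x) p)"
  using p by (induction S rule: infinite_finite_induct) (auto simp: Legendre_mult)

lemma Legendre_minus_one:
  fixes p :: int
  assumes p: "Factorial_Ring.prime p" "p > 2" "p mod 4 = 3"
  shows "Legendre (-1) p = -1"
proof (rule small_cong_eq[OF p(2)])
  have "odd ((p - 1) div 2)" using p(3) by presburger
  then have "odd (nat ((p - 1) div 2))" using p(2) by (simp add: even_nat_iff)
  then show "[Legendre (- 1) p = - 1] (mod p)"
    using euler_criterion_int[OF p(1,2), of "-1"] by simp
qed (auto simp: abs_Legendre_le)

text \<open>Gauss's lemma with multiplier 2, where only the parity of one cardinality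
  matters.\<close>

lemma Legendre_two:
  fixes p :: int
  assumes p: "Factorial_Ring.prime p" "p > 2"
  shows "Legendre 2 p = (if p mod 8 = 1 \<or> p mod 8 = 7 then 1 else -1)"
proof -
  define n where "n = nat p"
  have n: "int n = p" using p by (simp add: n_def)
  interpret GAUSS n 2
  proof
    show "Factorial_Ring.prime n" "2 < n" using p n by (auto simp: n_def)
    show "[2 \<noteq> 0] (mod int n)" using p n by (auto simp: cong_0_iff dest: zdvd_imp_le)
  qed simp
  define h where "h = (p - 1) div 2"
  have odd: "odd p" using odd_p n by presburger
  have ph: "p = 2 * h + 1" using odd by (auto simp: h_def elim!: oddE)
  \<comment> \<open>The doubles of 1, ..., \<open>h\<close> stay below \<open>p\<close>, so
    reduction modulo \<open>p\<close> does not change them; those exceeding \<open>h\<close> come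
    from the \<open>x\<close> above \<open>h div 2\<close>.\<close>
  have "C = (\<lambda>x. x * 2) ` {0<..h}"
  proof -
    have "(\<lambda>x. x mod int n) ` (\<lambda>x. x * 2) ` {0<..h} = (\<lambda>x. x) ` (\<lambda>x. x * 2) ` {0<..h}"
      by (rule image_cong) (auto simp: n ph)
    then show ?thesis by (simp add: C_def B_def A_def n h_def)
  qed
  then have "E = (\<lambda>x. x * 2) ` {h div 2<..h}" by (auto simp: E_def n h_def[symmetric])
  moreover have "inj_on (\<lambda>x::int. x * 2) {h div 2<..h}" by (auto intro: inj_onI)
  ultimately have "card E = nat (h - h div 2)" by (simp add: card_image)
  then have L: "Legendre 2 p = (-1) ^ nat (h - h div 2)" using gauss_lemma n by simp
  have "odd (p mod 8)" using odd by presburger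
  have h0: "h - h div 2 \<ge> 0" using p ph by linarith
  show ?thesis
  proof (cases "p mod 8 = 1 \<or> p mod 8 = 7")
    case True
    then have "even (h - h div 2)" using ph by presburger
    then show ?thesis using L True h0 by (simp add: even_nat_iff)
  next
    case False
    then have "odd (h - h div 2)" using ph odd by presburger
    then show ?thesis using L False h0 by (simp add: even_nat_iff)
  qed
qed

lemma Legendre_reciprocity:
  fixes p q :: int
  assumes p: "Factorial_Ring.prime p" "p > 2" and q: "Factorial_Ring.prime q" "q > 2" and ne: "p \<noteq> q"
  shows "Legendre p q * Legendre q p = (if p mod 4 = 3 \<and> q mod 4 = 3 then -1 else 1)"
proof -
  have "Factorial_Ring.prime (nat p)" "Factorial_Ring.prime (nat q)" using p q by auto
  then have L: "Legendre p q * Legendre q p = (-1) ^ nat ((p - 1) div 2 * ((q - 1) div 2))"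
    using Quadratic_Reciprocity_int p(2) q(2) ne by blast
  have odd: "odd p" "odd q" using p q prime_odd_int by auto
  have "p mod 4 = 3 \<longleftrightarrow> odd ((p - 1) div 2)" "q mod 4 = 3 \<longleftrightarrow> odd ((q - 1) div 2)"
    using odd by presburger+
  moreover have "(p - 1) div 2 * ((q - 1) div 2) \<ge> 0" using p q by simp
  ultimately show ?thesis unfolding L by (auto simp: even_nat_iff minus_one_power_iff)
qed

lemma Legendre_flip:
  fixes p q :: int
  assumes p: "Factorial_Ring.prime p" "p > 2" "p mod 4 = 3" and q: "Factorial_Ring.prime q" "q > 2" "q mod 4 = 3"
    and ne: "p \<noteq> q"
  shows "Legendre q p = - Legendre p q"
proof -
  have "\<not> q dvd p" using primes_dvd_imp_eq[OF q(1) p(1)] ne by auto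
  then show ?thesis
    using Legendre_reciprocity[OF p(1,2) q(1,2) ne] Legendre_values[of q p] p(3) q(3) by auto
qed

text \<open>If \<open>q\<close> does not divide \<open>zz\<close>, the equation modulo
  \<open>q\<close> exhibits \<open>m\<close> as the square of \<open>xx / zz\<close>. Otherwise
  \<open>q\<close> divides \<open>xx\<close> and then \<open>yy\<close>, and cancelling
  \<open>q ^ 2\<close> gives a smaller solution.\<close>

lemma norm_form_Legendre:
  fixes q D' xx yy zz m :: int
  assumes q: "Factorial_Ring.prime q" "\<not> q dvd D'" "\<not> q dvd m"
    and eq: "xx ^ 2 - q * D' * yy ^ 2 = m * zz ^ 2" and zz: "zz \<noteq> 0"
  shows "Legendre m q = 1"
  using eq zz
proof (induction "nat \<bar>zz\<bar>" arbitrary: xx yy zz rule: less_induct)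
  case less
  have q1: "q > 1" using q(1) prime_gt_1_int by blast
  show ?case
  proof (cases "q dvd zz")
    case True
    then obtain zz1 where zz1: "zz = q * zz1" by (elim dvdE)
    have "xx ^ 2 = q * (D' * yy ^ 2 + m * q * zz1 ^ 2)" using less.prems(1) zz1 by (simp add: algebra_simps power2_eq_square)
    then have "q dvd xx ^ 2" by simp
    then have "q dvd xx" using q(1) prime_dvd_power_int by blast
    then obtain xx1 where xx1: "xx = q * xx1" by (elim dvdE)
    have "q * (q * (xx1 ^ 2 - m * zz1 ^ 2)) = q * (D' * yy ^ 2)"
      using less.prems(1) zz1 xx1 by (simp add: algebra_simps power2_eq_square)
    then have "q * (xx1 ^ 2 - m * zz1 ^ 2) = D' * yy ^ 2" using q1 by simp
    then have "q dvd D' * yy ^ 2" by (metis dvd_triv_left)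
    then have "q dvd yy ^ 2" using q(1,2) by (simp add: prime_dvd_mult_iff)
    then have "q dvd yy" using q(1) prime_dvd_power_int by blast
    then obtain yy1 where yy1: "yy = q * yy1" by (elim dvdE)
    have "q ^ 2 * (xx1 ^ 2 - q * D' * yy1 ^ 2) = q ^ 2 * (m * zz1 ^ 2)"
      using less.prems(1) zz1 xx1 yy1 by (simp add: algebra_simps power2_eq_square)
    then have "xx1 ^ 2 - q * D' * yy1 ^ 2 = m * zz1 ^ 2" using q1 by simp
    moreover have "zz1 \<noteq> 0" using less.prems(2) zz1 by simp
    moreover have "nat \<bar>zz1\<bar> < nat \<bar>zz\<bar>" using \<open>zz1 \<noteq> 0\<close> q1 by (simp add: zz1 abs_mult)
    ultimately show ?thesis using less.hyps by blast
  next
    case False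
    then have "coprime zz q" using prime_imp_coprime[OF q(1)] coprime_commute by blast
    then obtain W where W: "[zz * W = 1] (mod q)" using cong_solve_coprime_int by blast
    have "q dvd m * zz ^ 2 - xx ^ 2" by (rule dvdI[of _ _ "- (D' * yy ^ 2)"]) (use less.prems(1) in \<open>simp add: algebra_simps\<close>)
    then have "[xx ^ 2 = m * zz ^ 2] (mod q)" by (metis cong_iff_dvd_diff cong_sym)
    then have "[xx ^ 2 * W ^ 2 = m * zz ^ 2 * W ^ 2] (mod q)" by (rule cong_scalar_right)
    moreover have "[(zz * W) ^ 2 * m = 1 ^ 2 * m] (mod q)" using W by (intro cong_scalar_right cong_pow)
    ultimately have "[(xx * W) ^ 2 = m] (mod q)"
      by (simp add: power_mult_distrib mult_ac) (metis cong_trans)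
    then have "QuadRes q m" unfolding QuadRes_def by blast
    then show ?thesis using q(3) by (simp add: Legendre_def cong_0_iff)
  qed
qed

context real_quadratic
begin

lemma norm_integers:
  assumes x: "x \<in> L" and nm: "nm x = of_int m"
  shows "\<exists>xx yy zz :: int. zz \<noteq> 0 \<and> xx ^ 2 - D * yy ^ 2 = m * zz ^ 2"
  using x
proof (rule L_cases)
  fix a b assume ab: "a \<in> \<rat>" "b \<in> \<rat>" "x = a + b * rt"
  obtain k l where kl: "l > 0" "a = of_int k / of_int l" using ab(1) by (elim Rats_cases') auto
  obtain u v where uv: "v > 0" "b = of_int u / of_int v" using ab(2) by (elim Rats_cases') auto
  have "a ^ 2 - of_int D * b ^ 2 = of_int m" using nm_rat[OF ab(1,2)] ab(3) nm by simp
  then have "of_int ((k * v) ^ 2 - D * (u * l) ^ 2) = (of_int (m * (l * v) ^ 2) :: complex)"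
    using kl uv by (simp add: field_simps power2_eq_square)
  then have "(k * v) ^ 2 - D * (u * l) ^ 2 = m * (l * v) ^ 2" by (simp only: of_int_eq_iff)
  then show ?thesis using kl uv by (intro exI[of _ "k * v"] exI[of _ "u * l"] exI[of _ "l * v"]) simp
qed

end

context ramified_quadratic
begin

lemma prod_dvd_iff:
  assumes "q \<in> Pr" "S \<subseteq> Pr"
  shows "q dvd \<Prod>S \<longleftrightarrow> q \<in> S"
proof
  assume "q dvd \<Prod>S"
  then obtain p where "p \<in> S" "q dvd p"
    using prime_dvd_prod_iff[of S q "\<lambda>x. x"] finite_subset[OF assms(2) fin] prime_Pr[OF assms(1)] by auto
  then show "q \<in> S" using primes_dvd_imp_eq[of q p] prime_Pr assms by auto
next
  assume "q \<in> S"
  then show "q dvd \<Prod>S" using finite_subset[OF assms(2) fin] by (intro dvd_prod_eqI) auto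
qed

lemma norm_Legendre:
  assumes q: "q \<in> Pr" and x: "x \<in> L" "nm x = of_int m" and m: "\<not> q dvd m"
  shows "Legendre m q = 1"
proof -
  have D: "D = q * \<Prod>(Pr - {q})" unfolding D_eq using q fin by (simp add: prod.remove)
  have "\<not> q dvd \<Prod>(Pr - {q})" using prod_dvd_iff[OF q, of "Pr - {q}"] by auto
  moreover obtain xx yy zz where "zz \<noteq> 0" "xx ^ 2 - D * yy ^ 2 = m * zz ^ 2" using norm_integers[OF x] by blast
  ultimately show ?thesis using norm_form_Legendre[OF prime_Pr[OF q] _ m] D by metis
qed

text \<open>For \<open>q\<close> outside \<open>S\<close> the norm \<open>e * \<Prod>S\<close> is
  prime to \<open>q\<close> and \<open>norm_Legendre\<close> applies. For \<open>q\<close> in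
  \<open>S\<close> one first multiplies by \<open>rt / \<Prod>S\<close>, which changes the norm into
  \<open>- e * \<Prod>(Pr - S)\<close>, again prime to \<open>q\<close>.\<close>

lemma norm_set_Legendre:
  assumes S: "S \<subseteq> Pr" and norm: "norm_set S"
  shows "\<exists>e\<in>{1, -1}. \<forall>q\<in>Pr. (q \<notin> S \<longrightarrow> Legendre (e * \<Prod>S) q = 1) \<and> (q \<in> S \<longrightarrow> Legendre (- e * \<Prod>(Pr - S)) q = 1)"
proof -
  obtain x where x: "x \<in> L" "nm x = of_int (\<Prod>S) \<or> nm x = - of_int (\<Prod>S)" using norm by (auto simp: norm_set_def)
  then obtain e :: int where e: "e \<in> {1, -1}" "nm x = of_int (e * \<Prod>S)"
    by (metis insertCI mult_1 mult_minus1 of_int_minus)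
  have not_dvd: "\<not> q dvd e * \<Prod>T" if "q \<in> Pr" "T \<subseteq> Pr" "q \<notin> T" "e \<in> {1, -1}" for q T and e :: int
    using prod_dvd_iff[OF that(1,2)] that(3,4) by auto
  have pos: "\<Prod>S \<noteq> 0" using prod_pos[OF S] by simp
  define y where "y = rt * x / of_int (\<Prod>S)"
  have yL: "y \<in> L" using x(1) D_ints unfolding y_def by (intro L.divide_mem L.mult_mem L.of_int_mem) (simp_all add: L.ints_mem)
  have split: "D = \<Prod>S * \<Prod>(Pr - S)"
    unfolding D_eq using prod.subset_diff[OF S fin, of "\<lambda>x. x"] by (simp add: mult.commute)
  have "nm y = nm (rt * x) / nm (of_int (\<Prod>S))"
    unfolding y_def using x(1) by (intro nm_divide L.mult_mem L.of_int_mem) (simp_all add: L.ints_mem)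
  also have "\<dots> = (- of_int D) * of_int (e * \<Prod>S) / of_int (\<Prod>S) ^ 2"
  proof -
    have "nm rt = - of_int D" using rt_square by (simp add: nm_def power2_eq_square)
    then show ?thesis using nm_mult[of rt x] x(1) e(2) nm_F[of "of_int (\<Prod>S)"] by (simp add: L.ints_mem del: of_int_prod)
  qed
  also have "\<dots> = of_int (- e * \<Prod>(Pr - S))"
  proof -
    have "of_int D = (of_int (\<Prod>S) * of_int (\<Prod>(Pr - S)) :: complex)" unfolding split by (rule of_int_mult)
    moreover have "(of_int (\<Prod>S) :: complex) \<noteq> 0" using pos by (simp only: of_int_eq_0_iff not_False_eq_True)
    ultimately show ?thesis by (simp add: power2_eq_square del: of_int_prod)
  qed
  finally have nmy: "nm y = of_int (- e * \<Prod>(Pr - S))" .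
  have "Legendre (e * \<Prod>S) q = 1" if "q \<in> Pr" "q \<notin> S" for q
    using norm_Legendre[OF that(1) x(1) e(2)] not_dvd[OF that(1) S that(2) e(1)] by blast
  moreover have "Legendre (- e * \<Prod>(Pr - S)) q = 1" if "q \<in> Pr" "q \<in> S" for q
    using norm_Legendre[OF that(1) yL nmy] not_dvd[OF that(1), of "Pr - S" "- e"] that e(1) by auto
  ultimately show ?thesis using e(1) by blast
qed

end

subsection \<open>Sums over real characters\<close>

text \<open>Summation by parts: bounded partial sums against a decreasing nonnegative
  weight.\<close>

lemma abel_bound:
  fixes c f :: "nat \<Rightarrow> real"
  assumes S: "\<And>m. \<bar>\<Sum>n\<in>{a<..m}. c n\<bar> \<le> K" and anti: "\<And>n. n > a \<Longrightarrow> f (Suc n) \<le> f n"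
    and nonneg: "\<And>n. n > a \<Longrightarrow> f n \<ge> 0"
  shows "\<bar>\<Sum>n\<in>{a<..b}. c n * f n\<bar> \<le> K * f (Suc a)"
proof (cases "b > a")
  case False
  then have "{a<..b} = {}" by auto
  moreover have "K \<ge> 0" using S[of a] by simp
  ultimately show ?thesis using nonneg[of "Suc a"] by simp
next
  case True
  then have "Suc a \<le> b" by simp
  \<comment> \<open>Subtracting the boundary term makes the bound telescope, so that it survives the
    induction; it is added back afterwards.\<close>
  then have "\<bar>(\<Sum>n\<in>{a<..b}. c n * f n) - (\<Sum>n\<in>{a<..b}. c n) * f b\<bar> \<le> K * (f (Suc a) - f b)"
  proof (induction b rule: dec_induct)
    case base
    have "{a<..Suc a} = {Suc a}" by auto
    then show ?case by simp
  next
    case (step b)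
    have ins: "{a<..Suc b} = insert (Suc b) {a<..b}" using step.hyps by auto
    have eq: "(\<Sum>n\<in>{a<..Suc b}. c n * f n) - (\<Sum>n\<in>{a<..Suc b}. c n) * f (Suc b)
        = ((\<Sum>n\<in>{a<..b}. c n * f n) - (\<Sum>n\<in>{a<..b}. c n) * f b) + (\<Sum>n\<in>{a<..b}. c n) * (f b - f (Suc b))"
      unfolding ins by (simp add: algebra_simps)
    have d: "f b - f (Suc b) \<ge> 0" using anti[of b] step.hyps by simp
    have "\<bar>(\<Sum>n\<in>{a<..b}. c n) * (f b - f (Suc b))\<bar> \<le> K * (f b - f (Suc b))"
      using mult_right_mono[OF S[of b] d] d by (simp add: abs_mult)
    then have "\<bar>((\<Sum>n\<in>{a<..b}. c n * f n) - (\<Sum>n\<in>{a<..b}. c n) * f b) + (\<Sum>n\<in>{a<..b}. c n) * (f b - f (Suc b))\<bar>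
      \<le> K * (f (Suc a) - f b) + K * (f b - f (Suc b))"
      by (rule order.trans[OF abs_triangle_ineq add_mono[OF step.IH]])
    then show ?case unfolding eq by (simp add: algebra_simps)
  qed
  moreover have "\<bar>(\<Sum>n\<in>{a<..b}. c n) * f b\<bar> \<le> K * f b"
    using mult_right_mono[OF S[of b] nonneg[OF True]] nonneg[OF True] by (simp add: abs_mult)
  moreover have "\<bar>\<Sum>n\<in>{a<..b}. c n * f n\<bar> \<le> \<bar>(\<Sum>n\<in>{a<..b}. c n * f n) - (\<Sum>n\<in>{a<..b}. c n) * f b\<bar>
      + \<bar>(\<Sum>n\<in>{a<..b}. c n) * f b\<bar>" by linarith
  ultimately show ?thesis unfolding right_diff_distrib by linarith
qed

lemma sum_divisors_swap:
  fixes g :: "nat \<Rightarrow> nat \<Rightarrow> 'a::comm_monoid_add"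
  shows "(\<Sum>n\<in>{0<..x}. \<Sum>d | d dvd n. g d n) = (\<Sum>d\<in>{0<..x}. \<Sum>m\<in>{0<..x div d}. g d (d * m))"
proof -
  have "(\<Sum>n\<in>{0<..x}. \<Sum>d | d dvd n. g d n) = (\<Sum>(n, d)\<in>(SIGMA n:{0<..x}. {d. d dvd n}). g d n)"
    by (intro sum.Sigma) (auto intro: finite_divisors_nat)
  also have "\<dots> = (\<Sum>(d, m)\<in>(SIGMA d:{0<..x}. {0<..x div d}). g d (d * m))"
    by (rule sum.reindex_bij_witness[of _ "\<lambda>(d, m). (d * m, d)" "\<lambda>(n, d). (d, n div d)"])
      (auto simp: less_eq_div_iff_mult_less_eq mult.commute dest: dvd_imp_le elim!: dvdE,
        metis One_nat_def Suc_leI dual_order.trans mult.right_neutral mult_le_mono2)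
  also have "\<dots> = (\<Sum>d\<in>{0<..x}. \<Sum>m\<in>{0<..x div d}. g d (d * m))"
    by (intro sum.Sigma[symmetric]) auto
  finally show ?thesis .
qed

section \<open>Partial sums of inverse square roots and harmonic sums\<close>

lemma sum_inverse_sqrt_le: "(\<Sum>n\<in>{0<..N}. 1 / sqrt (real n)) \<le> 2 * sqrt (real N)"
proof (induction N)
  case (Suc N)
  have ins: "{0<..Suc N} = insert (Suc N) {0<..N}" by auto
  define u where "u = sqrt (real N)"
  define v where "v = sqrt (real (Suc N))"
  have uv: "0 \<le> u" "u \<le> v" "0 < v" by (auto simp: u_def v_def)
  have "(v - u) * (v + u) = 1" by (simp add: u_def v_def algebra_simps)
  moreover have "(v - u) * (v + u) \<le> (v - u) * (2 * v)"
    using uv by (intro mult_left_mono) auto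
  ultimately have "1 \<le> (2 * (v - u)) * v" by (simp add: mult_ac)
  then have "1 / v \<le> 2 * (v - u)" using uv by (simp add: divide_le_eq)
  then show ?case using Suc.IH by (simp add: ins u_def v_def)
qed simp

text \<open>The error term in the asymptotics of the sum of inverse square roots. It decreases to a
  limit, and between two arguments it varies by at most \<open>1 / sqrt y\<close> at the smaller
  one.\<close>

definition sqrt_defect :: "nat \<Rightarrow> real" where
  "sqrt_defect y = (\<Sum>n\<in>{0<..y}. 1 / sqrt (real n)) - 2 * sqrt (real y)"

text \<open>For consecutive square roots \<open>u\<close> and \<open>v\<close> the difference
  \<open>v - u = 1 / (v + u)\<close> lies between \<open>1 / (2 * v)\<close> and
  \<open>1 / (2 * u)\<close>.\<close>

lemma sqrt_defect_step:
  assumes "y > 0"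
  shows "sqrt_defect (Suc y) \<le> sqrt_defect y"
    and "sqrt_defect y - sqrt_defect (Suc y) \<le> 1 / sqrt (real y) - 1 / sqrt (real (Suc y))"
proof -
  define u where "u = sqrt (real y)"
  define v where "v = sqrt (real (Suc y))"
  have uv: "0 < u" "u \<le> v" using assms by (auto simp: u_def v_def)
  have d: "(v - u) * (v + u) = 1" by (simp add: u_def v_def algebra_simps)
  then have vu: "v - u = 1 / (v + u)" using uv by (simp add: eq_divide_eq)
  have ins: "{0<..Suc y} = insert (Suc y) {0<..y}" by auto
  have diff: "sqrt_defect y - sqrt_defect (Suc y) = 2 * (v - u) - 1 / v"
    by (simp add: sqrt_defect_def ins u_def v_def)
  have "1 / (2 * v) \<le> v - u" unfolding vu using uv by (intro divide_left_mono) auto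
  then show "sqrt_defect (Suc y) \<le> sqrt_defect y" using diff by simp
  have "v - u \<le> 1 / (2 * u)" unfolding vu using uv by (intro divide_left_mono) auto
  then have "2 * (v - u) \<le> 1 / u" by simp
  then show "sqrt_defect y - sqrt_defect (Suc y) \<le> 1 / sqrt (real y) - 1 / sqrt (real (Suc y))"
    using diff by (simp add: u_def v_def)
qed

lemma sqrt_defect_diff:
  assumes "0 < y" "y \<le> z"
  shows "0 \<le> sqrt_defect y - sqrt_defect z" "sqrt_defect y - sqrt_defect z \<le> 1 / sqrt (real y)"
proof -
  have "0 \<le> sqrt_defect y - sqrt_defect z \<and> sqrt_defect y - sqrt_defect z \<le> 1 / sqrt (real y) - 1 / sqrt (real z)"
    using assms(2)
  proof (induction z rule: dec_induct)
    case (step n)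
    then show ?case using sqrt_defect_step[of n] assms(1) by (auto simp del: of_nat_Suc)
  qed simp
  moreover have "1 / sqrt (real z) \<ge> 0" by simp
  ultimately show "0 \<le> sqrt_defect y - sqrt_defect z" "sqrt_defect y - sqrt_defect z \<le> 1 / sqrt (real y)"
    by linarith+
qed

lemma abs_sqrt_defect_le: "y > 0 \<Longrightarrow> \<bar>sqrt_defect y\<bar> \<le> 2"
proof -
  assume y: "y > 0"
  have "{0<..1 :: nat} = {1}" by auto
  then have "sqrt_defect 1 = -1" by (simp add: sqrt_defect_def)
  then show ?thesis using sqrt_defect_diff[of 1 y] y by (simp add: abs_le_iff)
qed

lemma ln_le_harmonic: "ln (real N + 1) \<le> (\<Sum>m\<in>{0<..N}. 1 / real m)"
proof (induction N)
  case (Suc N)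
  have ins: "{0<..Suc N} = insert (Suc N) {0<..N}" by auto
  have "ln (real (Suc N) + 1) - ln (real N + 1) = ln ((real (Suc N) + 1) / (real N + 1))"
    by (subst ln_div) auto
  also have "(real (Suc N) + 1) / (real N + 1) = 1 + 1 / real (Suc N)" by (simp add: field_simps)
  also have "ln (1 + 1 / real (Suc N)) \<le> 1 / real (Suc N)" by (rule ln_add_one_self_le_self) simp
  finally show ?case using Suc.IH by (simp add: ins)
qed simp

text \<open>A nontrivial real Dirichlet character modulo \<open>M\<close>. That it vanishes nowhere
  on residues prime to \<open>M\<close> follows from Euler's theorem in
  \<open>chi_nonzero_iff\<close>.\<close>

locale real_character =
  fixes chi :: "nat \<Rightarrow> real" and M :: nat
  assumes M: "M > 0" and mult: "chi (a * b) = chi a * chi b" and periodic: "chi (a + M) = chi a"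
    and vals: "chi a = 1 \<or> chi a = 0 \<or> chi a = -1" and cop: "chi a \<noteq> 0 \<Longrightarrow> coprime a M"
    and one: "chi 1 = 1" and nontrivial: "\<exists>n. chi n = -1"
begin

lemma chi_mod: "chi (n mod M) = chi n"
proof (induction n rule: less_induct)
  case (less n)
  show ?case
  proof (cases "n < M")
    case False
    then have "chi (n mod M) = chi ((n - M) mod M)" by (simp add: le_mod_geq)
    also have "\<dots> = chi (n - M)" using False M by (intro less) simp
    also have "\<dots> = chi n" using periodic[of "n - M"] False by simp
    finally show ?thesis .
  qed simp
qed

lemma abs_chi_le: "\<bar>chi n\<bar> \<le> 1" using vals[of n] by auto

text \<open>Multiplication by an argument \<open>k\<close> with \<open>chi k = -1\<close> permutes
  the residues and negates the sum.\<close>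

lemma sum_period: "(\<Sum>n<M. chi n) = 0"
proof -
  obtain k where k: "chi k = -1" using nontrivial by blast
  then have "coprime k M" using cop[of k] by simp
  then have inj: "inj_on (\<lambda>n. (k * n) mod M) {..<M}"
    by (intro inj_onI) (metis cong_def cong_mult_lcancel_nat coprime_commute lessThan_iff mod_less)
  have "(\<lambda>n. (k * n) mod M) ` {..<M} \<subseteq> {..<M}" using M by auto
  then have "(\<lambda>n. (k * n) mod M) ` {..<M} = {..<M}"
    using inj by (intro card_subset_eq) (auto simp: card_image)
  then have "(\<Sum>n<M. chi n) = (\<Sum>n<M. chi ((k * n) mod M))"
    using sum.reindex[OF inj, of chi] by simp
  also have "\<dots> = - (\<Sum>n<M. chi n)" by (simp add: chi_mod mult k sum_negf)
  finally show ?thesis by simp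
qed

lemma abs_sum_lt: "\<bar>\<Sum>n<N. chi n\<bar> \<le> real M"
proof (induction N rule: less_induct)
  case (less N)
  show ?case
  proof (cases "N < M")
    case True
    have "\<bar>\<Sum>n<N. chi n\<bar> \<le> (\<Sum>n<N. \<bar>chi n\<bar>)" by (rule sum_abs)
    also have "\<dots> \<le> (\<Sum>n<N. 1)" by (intro sum_mono abs_chi_le)
    finally show ?thesis using True by simp
  next
    case False
    have "(\<Sum>n<M + (N - M). chi n) = (\<Sum>n<M. chi n) + (\<Sum>n<N - M. chi (n + M))"
      using sum.lessThan_Suc sum.atLeastLessThan_concat[of 0 M "M + (N - M)" chi]
        sum.shift_bounds_nat_ivl[of chi 0 M "N - M"]
      by (simp add: atLeast0LessThan add.commute)
    then have "(\<Sum>n<N. chi n) = (\<Sum>n<N - M. chi n)" using False by (simp add: sum_period periodic)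
    then show ?thesis using less[of "N - M"] False M by simp
  qed
qed

lemma abs_sum_le: "\<bar>\<Sum>n\<in>{a<..m}. chi n\<bar> \<le> 2 * real M"
proof (cases "a \<le> m")
  case True
  have "{..<Suc m} = {..<Suc a} \<union> {a<..m}" using True by auto
  moreover have "sum chi ({..<Suc a} \<union> {a<..m}) = (\<Sum>n<Suc a. chi n) + (\<Sum>n\<in>{a<..m}. chi n)"
    by (intro sum.union_disjoint) auto
  ultimately have "(\<Sum>n<Suc m. chi n) = (\<Sum>n<Suc a. chi n) + (\<Sum>n\<in>{a<..m}. chi n)" by metis
  then show ?thesis using abs_sum_lt[of "Suc m"] abs_sum_lt[of "Suc a"] by linarith
qed simp

lemma abs_weighted_sum_le:
  assumes "\<And>n. n > a \<Longrightarrow> f (Suc n) \<le> f n" "\<And>n. n > a \<Longrightarrow> f n \<ge> 0"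
  shows "\<bar>\<Sum>n\<in>{a<..b}. chi n * f n\<bar> \<le> 2 * real M * f (Suc a)"
proof (rule abel_bound)
  show "\<bar>\<Sum>n\<in>{a<..m}. chi n\<bar> \<le> 2 * real M" for m by (rule abs_sum_le)
qed (fact assms)+

lemma L_exists: "\<exists>L. \<forall>a. \<bar>(\<Sum>n\<in>{0<..a}. chi n / real n) - L\<bar> \<le> 2 * real M / real (Suc a)"
proof -
  define s where "s a = (\<Sum>n\<in>{0<..a}. chi n / real n)" for a
  have diff: "\<bar>s b - s a\<bar> \<le> 2 * real M / real (Suc a)" if "a \<le> b" for a b
  proof -
    have "s b = s a + (\<Sum>n\<in>{a<..b}. chi n * (1 / real n))"
    proof -
      have "{0<..b} = {0<..a} \<union> {a<..b}" using that by auto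
      moreover have "(\<Sum>n\<in>{0<..a} \<union> {a<..b}. chi n / real n) = s a + (\<Sum>n\<in>{a<..b}. chi n / real n)"
        unfolding s_def by (intro sum.union_disjoint) auto
      ultimately show ?thesis unfolding s_def by simp
    qed
    moreover have "\<bar>\<Sum>n\<in>{a<..b}. chi n * (1 / real n)\<bar> \<le> 2 * real M * (1 / real (Suc a))"
      by (intro abs_weighted_sum_le) (auto intro!: divide_left_mono)
    ultimately show ?thesis by simp
  qed
  have "Cauchy s"
  proof (rule CauchyI')
    fix e :: real assume e: "e > 0"
    obtain N where N: "2 * real M / e < real N" using reals_Archimedean2 by blast
    have "\<bar>s m - s n\<bar> < e" if "m \<ge> N" "n > m" for m n
    proof -
      have "\<bar>s m - s n\<bar> \<le> 2 * real M / real (Suc m)" using diff[of m n] that by (simp add: abs_minus_commute)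
      also have "\<dots> \<le> 2 * real M / real (Suc N)" using that by (intro divide_left_mono) auto
      also have "2 * real M < e * real (Suc N)" using N e by (simp add: divide_less_eq algebra_simps)
      then have "2 * real M / real (Suc N) < e" by (simp add: divide_less_eq)
      finally show ?thesis .
    qed
    then show "\<exists>N. \<forall>m\<ge>N. \<forall>n>m. dist (s m) (s n) < e" by (auto simp: dist_real_def)
  qed
  then obtain L where L: "s \<longlonglongrightarrow> L" using Cauchy_convergent convergent_def by blast
  have "\<bar>s a - L\<bar> \<le> 2 * real M / real (Suc a)" for a
  proof (rule tendsto_upperbound)
    show "(\<lambda>n. \<bar>s a - s n\<bar>) \<longlonglongrightarrow> \<bar>s a - L\<bar>" by (intro tendsto_intros L)
    show "\<forall>\<^sub>F n in sequentially. \<bar>s a - s n\<bar> \<le> 2 * real M / real (Suc a)"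
      using eventually_ge_at_top[of a] by eventually_elim (use diff abs_minus_commute in metis)
  qed simp
  then show ?thesis by (auto simp: s_def)
qed

text \<open>The value at 1 of the L-series of \<open>chi\<close>, specified by its rate of
  convergence.\<close>

definition L where "L = (SOME L. \<forall>a. \<bar>(\<Sum>n\<in>{0<..a}. chi n / real n) - L\<bar> \<le> 2 * real M / real (Suc a))"

lemma L_bound: "\<bar>(\<Sum>n\<in>{0<..a}. chi n / real n) - L\<bar> \<le> 2 * real M / real (Suc a)"
  using someI_ex[OF L_exists] unfolding L_def by blast

text \<open>The Dirichlet convolution of \<open>chi\<close> with the constant 1. It is nonnegative,
  and at least 1 at squares, which is what makes its sums grow.\<close>

definition r where "r n = (\<Sum>d | d dvd n. chi d)"

lemma chi_power: "chi (p ^ i) = chi p ^ i"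
  by (induction i) (use one mult in auto)

lemma r_prime_power_mult:
  assumes p: "Factorial_Ring.prime p" and m: "\<not> p dvd m" "m > 0"
  shows "r (p ^ k * m) = (\<Sum>i\<le>k. chi p ^ i) * r m"
proof -
  have cop: "coprime p m" using prime_imp_coprime p m by blast
  have p0: "p > 0" using p prime_gt_0_nat by blast
  have "{d. d dvd p ^ k * m} = (\<lambda>(i, d). p ^ i * d) ` ({..k} \<times> {d. d dvd m})"
  proof (intro equalityI subsetI)
    fix d assume "d \<in> {d. d dvd p ^ k * m}"
    then obtain a b where ab: "d = a * b" "a dvd p ^ k" "b dvd m" using division_decomp[of d "p ^ k" m] by blast
    then obtain i where "i \<le> k" "a = p ^ i" using divides_primepow_nat[OF p] by blast
    then show "d \<in> (\<lambda>(i, d). p ^ i * d) ` ({..k} \<times> {d. d dvd m})" using ab by auto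
  qed (auto intro!: mult_dvd_mono le_imp_power_dvd)
  moreover have "inj_on (\<lambda>(i, d). p ^ i * d) ({..k} \<times> {d. d dvd m})"
  proof (rule inj_onI, clarify)
    fix i d i' d' assume *: "d dvd m" "d' dvd m" "p ^ i * d = p ^ i' * d'"
    have nd: "\<not> p dvd d" "\<not> p dvd d'" using * m dvd_trans by blast+
    have "multiplicity p (p ^ i * d) = i" "multiplicity p (p ^ i' * d') = i'"
      using nd p by (simp_all add: multiplicity_prime_elem_times_other prime_elem_multiplicity_mult_distrib
          prime_elem_multiplicity_power_distrib not_dvd_imp_multiplicity_0 multiplicity_eqI)
    then have "i = i'" using *(3) by simp
    then show "i = i' \<and> d = d'" using *(3) p0 by simp
  qed
  ultimately have "r (p ^ k * m) = (\<Sum>(i, d)\<in>{..k} \<times> {d. d dvd m}. chi (p ^ i * d))"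
    unfolding r_def by (simp add: sum.reindex case_prod_unfold)
  also have "\<dots> = (\<Sum>i\<le>k. \<Sum>d | d dvd m. chi p ^ i * chi d)"
    by (simp add: sum.cartesian_product mult chi_power)
  also have "\<dots> = (\<Sum>i\<le>k. chi p ^ i) * r m" by (simp add: r_def sum_product)
  finally show ?thesis .
qed

lemma sum_powers_nonneg: "(\<Sum>i\<le>k. chi p ^ i) \<ge> 0 \<and> (even k \<longrightarrow> (\<Sum>i\<le>k. chi p ^ i) \<ge> 1)"
proof -
  consider "chi p = 1" | "chi p = 0" | "chi p = -1" using vals by blast
  then show ?thesis
  proof cases
    case 3
    have "(\<Sum>i\<le>k. (-1 :: real) ^ i) = (if even k then 1 else 0)" by (induction k) auto
    then show ?thesis using 3 by simp
  next
    case 2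
    have "(\<Sum>i\<le>k. (0 :: real) ^ i) = 1" by (induction k) auto
    then show ?thesis using 2 by simp
  qed simp
qed

text \<open>Splitting off a prime power \<open>p ^ k\<close> gives the factor
  \<open>1 + chi p + ... + chi p ^ k\<close>, which is nonnegative and, for even \<open>k\<close>,
  at least 1. In a square all exponents are even.\<close>

lemma r_nonneg: "n > 0 \<Longrightarrow> r n \<ge> 0 \<and> ((\<exists>m. n = m ^ 2) \<longrightarrow> r n \<ge> 1)"
proof (induction n rule: less_induct)
  case (less n)
  show ?case
  proof (cases "n = 1")
    case True
    then show ?thesis using one by (simp add: r_def)
  next
    case False
    then obtain p where p: "Factorial_Ring.prime p" "p dvd n" using prime_factor_nat by blast
    define k where "k = multiplicity p n"
    obtain m where m: "n = p ^ k * m" "\<not> p dvd m"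
      unfolding k_def using less.prems p multiplicity_decompose'[of n p] prime_gt_1_nat[OF p(1)] by auto
    have k0: "k > 0" unfolding k_def using p less.prems by (simp add: prime_multiplicity_gt_zero_iff)
    have m0: "m > 0" using m less.prems by (cases m) auto
    have "p ^ k > 1"
      using one_less_power[OF prime_gt_1_nat[OF p(1)] k0] .
    then have "m < n" using m(1) m0 by simp
    note IH = less.IH[OF this m0]
    have r: "r n = (\<Sum>i\<le>k. chi p ^ i) * r m" unfolding m(1) by (rule r_prime_power_mult[OF p(1) m(2) m0])
    have "r n \<ge> 1" if sq: "n = t ^ 2" for t
    proof -
      have t0: "t > 0" using sq less.prems by (cases t) auto
      define j where "j = multiplicity p t"
      obtain u where u: "t = p ^ j * u" "\<not> p dvd u"
        unfolding j_def using t0 multiplicity_decompose'[of t p] prime_gt_1_nat[OF p(1)] by auto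
      have kj: "k = 2 * j" unfolding k_def j_def sq using p(1) t0
        by (simp add: prime_elem_multiplicity_power_distrib)
      have "p ^ k * m = p ^ k * u ^ 2" using sq m(1) u(1) by (simp add: kj power_mult_distrib power_mult[symmetric] mult.commute)
      then have "m = u ^ 2" using prime_gt_0_nat[OF p(1)] by simp
      then have "r m \<ge> 1" using IH by blast
      moreover have "(\<Sum>i\<le>k. chi p ^ i) \<ge> 1" using sum_powers_nonneg[where k = k] kj by simp
      ultimately show ?thesis unfolding r using mult_mono[of 1 _ 1] by fastforce
    qed
    moreover have "r n \<ge> 0" unfolding r using IH sum_powers_nonneg by simp
    ultimately show ?thesis by blast
  qed
qed

end

context real_character
begin

lemma abs_sqrt_sum_le: "\<bar>\<Sum>d\<in>{a<..b}. chi d / sqrt (real d)\<bar> \<le> 2 * real M / sqrt (real (Suc a))"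
proof -
  have "\<bar>\<Sum>d\<in>{a<..b}. chi d * (1 / sqrt (real d))\<bar> \<le> 2 * real M * (1 / sqrt (real (Suc a)))"
    by (rule abs_weighted_sum_le) (auto intro!: divide_left_mono)
  then show ?thesis by simp
qed

lemma sum_inverse_sqrt_eq: "(\<Sum>n\<in>{0<..y}. 1 / sqrt (real n)) = 2 * sqrt (real y) + sqrt_defect y"
  by (simp add: sqrt_defect_def)

text \<open>Removes the rounding in \<open>N * N div d\<close>. For \<open>u = N / sqrt d\<close>
  and \<open>v\<close> the root of the rounded quotient, \<open>u ^ 2 - v ^ 2 \<le> 1\<close> gives
  \<open>u - v \<le> 1 / u\<close>, which costs \<open>2 / u\<close>; the change of the defect costs
  \<open>1 / v \<le> 2 / u\<close>.\<close>

lemma quotient_defect: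
  assumes d: "0 < d" "d \<le> N"
  shows "\<bar>2 * sqrt (real (N * N div d)) + sqrt_defect (N * N div d) - 2 * real N / sqrt (real d) - sqrt_defect (N * N)\<bar>
    \<le> 4 * sqrt (real d) / real N"
proof -
  define y where "y = N * N div d"
  have N: "N > 0" using d by simp
  have "d * 1 \<le> N * N" using d by (intro mult_mono) auto
  then have y1: "y \<ge> 1" unfolding y_def using d(1) by (simp add: Suc_le_eq div_greater_zero_iff)
  have "d * y \<le> N * N" by (simp add: y_def)
  then have "real d * real y \<le> real N * real N" by (metis of_nat_le_iff of_nat_mult)
  then have y_le: "real y \<le> real N * real N / real d" using d(1) by (simp add: le_divide_eq mult.commute)
  have "N * N < d * Suc y" using d(1) by (simp add: y_def dividend_less_times_div)
  then have "real N * real N < real d * real (Suc y)" by (metis of_nat_less_iff of_nat_mult)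
  then have y_gt: "real N * real N / real d < real y + 1" using d(1) by (simp add: divide_less_eq mult.commute add.commute)
  define u where "u = real N / sqrt (real d)"
  define v where "v = sqrt (real y)"
  have u2: "u ^ 2 = real N * real N / real d" using d(1) by (simp add: u_def power_divide power2_eq_square)
  have v2: "v ^ 2 = real y" by (simp add: v_def)
  have pos: "u > 0" "v > 0" using N d(1) y1 by (auto simp: u_def v_def)
  have vu: "v \<le> u" using y_le pos by (intro power2_le_imp_le[of v u]) (auto simp: u2 v2)
  have inv_u: "1 / u = sqrt (real d) / real N" by (simp add: u_def)
  have "(u - v) * u \<le> (u - v) * (u + v)" using vu pos by (intro mult_left_mono) auto
  also have "\<dots> = u ^ 2 - v ^ 2" by (simp add: power2_eq_square algebra_simps)
  also have "\<dots> \<le> 1" using y_gt u2 v2 by simp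
  finally have 1: "u - v \<le> 1 / u" using pos by (simp add: le_divide_eq)
  have "u ^ 2 \<le> (2 * v) ^ 2"
  proof -
    have "u ^ 2 \<le> real y + 1" using y_gt u2 by simp
    also have "\<dots> \<le> 4 * real y" using y1 by simp
    finally show ?thesis by (simp add: power_mult_distrib v2)
  qed
  then have "u \<le> 2 * v" by (rule power2_le_imp_le) (use pos in auto)
  then have "2 / (2 * v) \<le> 2 / u" using pos by (intro divide_left_mono) auto
  then have 2: "1 / v \<le> 2 * (1 / u)" by simp
  have "0 < y" "y \<le> N * N" using y1 by (auto simp: y_def)
  note sd = sqrt_defect_diff[OF this]
  have "1 / sqrt (real y) = 1 / v" by (simp add: v_def)
  then have "\<bar>2 * v + sqrt_defect y - 2 * u - sqrt_defect (N * N)\<bar> \<le> 4 * (1 / u)"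
    using sd 1 2 vu unfolding abs_le_iff by linarith
  then show ?thesis by (simp add: inv_u v_def y_def) (simp add: u_def)
qed

text \<open>Only the terms at squares are kept.\<close>

lemma r_sum_lower: "(\<Sum>m\<in>{0<..N}. 1 / real m) \<le> (\<Sum>n\<in>{0<..N * N}. r n / sqrt (real n))"
proof -
  have inj: "inj_on (\<lambda>m. m ^ 2) {0<..N}" by (rule inj_onI) (simp add: power2_eq_iff_nonneg)
  have "(\<Sum>m\<in>{0<..N}. 1 / real m) \<le> (\<Sum>m\<in>{0<..N}. r (m ^ 2) / sqrt (real (m ^ 2)))"
  proof (rule sum_mono)
    fix m assume "m \<in> {0<..N}"
    then have "r (m ^ 2) \<ge> 1" using r_nonneg[of "m ^ 2"] by auto
    then show "1 / real m \<le> r (m ^ 2) / sqrt (real (m ^ 2))" by (simp add: divide_right_mono)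
  qed
  also have "\<dots> = (\<Sum>n\<in>(\<lambda>m. m ^ 2) ` {0<..N}. r n / sqrt (real n))"
    by (simp add: sum.reindex[OF inj])
  also have "\<dots> \<le> (\<Sum>n\<in>{0<..N * N}. r n / sqrt (real n))"
    using r_nonneg by (intro sum_mono2) (auto simp: power2_eq_square intro: mult_mono)
  finally show ?thesis .
qed

text \<open>Dirichlet's hyperbola method. If \<open>L\<close> vanished, the sum of \<open>r n / \<surd>n\<close> over \<open>n \<le> N\<^sup>2\<close>
  would stay bounded.\<close>

lemma L_nonzero: "L \<noteq> 0"
proof
  assume L0: "L = 0"
  \<comment> \<open>The contributions are \<open>4 * M\<close> from the large divisors,
    \<open>4 * M\<close> from the main term, \<open>4 * M\<close> from the constant defect, and 4
    from rounding.\<close>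
  define C where "C = 12 * real M + 4"
  have bound: "(\<Sum>n\<in>{0<..N * N}. r n / sqrt (real n)) \<le> C" if N: "N > 0" for N
  proof -
    define x where "x = N * N"
    define T where "T y = (\<Sum>m\<in>{0<..y}. 1 / sqrt (real m))" for y :: nat
    have Nx: "N \<le> x" using N by (simp add: x_def)
    have "(\<Sum>n\<in>{0<..x}. r n / sqrt (real n)) = (\<Sum>n\<in>{0<..x}. \<Sum>d | d dvd n. chi d / sqrt (real n))"
      by (simp add: r_def sum_divide_distrib)
    also have "\<dots> = (\<Sum>d\<in>{0<..x}. \<Sum>m\<in>{0<..x div d}. chi d / sqrt (real (d * m)))"
      by (rule sum_divisors_swap)
    also have "\<dots> = (\<Sum>d\<in>{0<..x}. \<Sum>m\<in>{0<..x div d}. chi d / sqrt (real d) * (1 / sqrt (real m)))"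
      by (simp add: real_sqrt_mult)
    \<comment> \<open>The hyperbola is cut at \<open>N\<close>, the square root of \<open>x\<close>.
      For \<open>d > N\<close> the order of summation is exchanged, so that the inner sum runs over
      values of \<open>chi\<close> and is small by cancellation.\<close>
    also have "\<dots> = (\<Sum>d\<in>{0<..N} \<union> {N<..x}. \<Sum>m\<in>{0<..x div d}. chi d / sqrt (real d) * (1 / sqrt (real m)))"
      using Nx by (intro sum.cong) auto
    also have "\<dots> = (\<Sum>d\<in>{0<..N}. \<Sum>m\<in>{0<..x div d}. chi d / sqrt (real d) * (1 / sqrt (real m)))
      + (\<Sum>d\<in>{N<..x}. \<Sum>m\<in>{0<..x div d}. chi d / sqrt (real d) * (1 / sqrt (real m)))"
      (is "_ = ?A + ?B")
      by (intro sum.union_disjoint) auto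
    finally have split: "(\<Sum>n\<in>{0<..x}. r n / sqrt (real n)) = ?A + ?B" .
    have "?B = (\<Sum>(d, m)\<in>(SIGMA d:{N<..x}. {0<..x div d}). chi d / sqrt (real d) * (1 / sqrt (real m)))"
      by (intro sum.Sigma) auto
    also have "\<dots> = (\<Sum>(m, d)\<in>(SIGMA m:{0<..N}. {N<..x div m}). chi d / sqrt (real d) * (1 / sqrt (real m)))"
    proof (rule sum.reindex_bij_witness[of _ "\<lambda>(m, d). (d, m)" "\<lambda>(d, m). (m, d)"])
      fix p assume "p \<in> (SIGMA d:{N<..x}. {0<..x div d})"
      then obtain d m where p: "p = (d, m)" "N < d" "d \<le> x" "0 < m" "m \<le> x div d" by auto
      have dm: "m * d \<le> x" using p N by (simp add: less_eq_div_iff_mult_less_eq)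
      have "m \<le> N"
      proof (rule ccontr)
        assume "\<not> m \<le> N"
        then have "N * N < m * d" using p(2) N by (intro mult_strict_mono) auto
        then show False using dm by (simp add: x_def)
      qed
      then show "(case p of (d, m) \<Rightarrow> (m, d)) \<in> (SIGMA m:{0<..N}. {N<..x div m})"
        using p dm by (simp add: less_eq_div_iff_mult_less_eq mult.commute)
    next
      fix p assume "p \<in> (SIGMA m:{0<..N}. {N<..x div m})"
      then obtain d m where p: "p = (m, d)" "0 < m" "m \<le> N" "N < d" "d \<le> x div m" by auto
      have dm: "d * m \<le> x" using p by (simp add: less_eq_div_iff_mult_less_eq)
      have "d * 1 \<le> d * m" using p(2) by (intro mult_left_mono) auto
      then have "d * 1 \<le> x" using dm by (rule order_trans)
      then have "d \<le> x" by simp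
      then show "(case p of (m, d) \<Rightarrow> (d, m)) \<in> (SIGMA d:{N<..x}. {0<..x div d})"
        using p dm N by (simp add: less_eq_div_iff_mult_less_eq mult.commute)
    qed auto
    also have "\<dots> = (\<Sum>m\<in>{0<..N}. \<Sum>d\<in>{N<..x div m}. chi d / sqrt (real d) * (1 / sqrt (real m)))"
      by (intro sum.Sigma[symmetric]) auto
    also have "\<dots> = (\<Sum>m\<in>{0<..N}. (\<Sum>d\<in>{N<..x div m}. chi d / sqrt (real d)) * (1 / sqrt (real m)))"
      by (simp only: sum_distrib_right)
    finally have Beq: "?B = \<dots>" .
    have "\<bar>?B\<bar> \<le> (\<Sum>m\<in>{0<..N}. \<bar>(\<Sum>d\<in>{N<..x div m}. chi d / sqrt (real d)) * (1 / sqrt (real m))\<bar>)"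
      unfolding Beq by (rule sum_abs)
    also have "\<dots> \<le> (\<Sum>m\<in>{0<..N}. 2 * real M / sqrt (real N) * (1 / sqrt (real m)))"
    proof (rule sum_mono)
      fix m assume "m \<in> {0<..N}"
      have "\<bar>\<Sum>d\<in>{N<..x div m}. chi d / sqrt (real d)\<bar> \<le> 2 * real M / sqrt (real (Suc N))"
        by (rule abs_sqrt_sum_le)
      also have "\<dots> \<le> 2 * real M / sqrt (real N)" using N by (intro divide_left_mono) auto
      finally show "\<bar>(\<Sum>d\<in>{N<..x div m}. chi d / sqrt (real d)) * (1 / sqrt (real m))\<bar>
          \<le> 2 * real M / sqrt (real N) * (1 / sqrt (real m))"
        unfolding abs_mult by (intro mult_mono) auto
    qed
    also have "\<dots> = 2 * real M / sqrt (real N) * T N" unfolding T_def by (simp only: sum_distrib_left)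
    also have "\<dots> \<le> 2 * real M / sqrt (real N) * (2 * sqrt (real N))"
      unfolding T_def by (intro mult_left_mono sum_inverse_sqrt_le) auto
    also have "\<dots> = 4 * real M" using N by simp
    finally have B: "\<bar>?B\<bar> \<le> 4 * real M" .
    define e where "e d = 2 * sqrt (real (x div d)) + sqrt_defect (x div d) - 2 * real N / sqrt (real d) - sqrt_defect x" for d
    have "?A = (\<Sum>d\<in>{0<..N}. chi d / sqrt (real d) * T (x div d))"
      unfolding T_def by (simp only: sum_distrib_left)
    also have "\<dots> = (\<Sum>d\<in>{0<..N}. 2 * real N * (chi d / real d) + sqrt_defect x * (chi d / sqrt (real d)) + chi d / sqrt (real d) * e d)"
    proof (rule sum.cong[OF refl])
      fix d assume "d \<in> {0<..N}"
      then have "chi d / real d = chi d / sqrt (real d) * (1 / sqrt (real d))" by simp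
      moreover have "T (x div d) = 2 * real N * (1 / sqrt (real d)) + sqrt_defect x + e d"
        unfolding T_def sum_inverse_sqrt_eq e_def by simp
      ultimately show "chi d / sqrt (real d) * T (x div d)
          = 2 * real N * (chi d / real d) + sqrt_defect x * (chi d / sqrt (real d)) + chi d / sqrt (real d) * e d"
        by (simp only:) (simp only: distrib_left mult_ac)
    qed
    also have "\<dots> = 2 * real N * (\<Sum>d\<in>{0<..N}. chi d / real d) + sqrt_defect x * (\<Sum>d\<in>{0<..N}. chi d / sqrt (real d))
        + (\<Sum>d\<in>{0<..N}. chi d / sqrt (real d) * e d)"
      by (simp only: sum.distrib sum_distrib_left)
    finally have Aeq: "?A = \<dots>" .
    \<comment> \<open>The hypothesis \<open>L = 0\<close> enters here: the partial sums are then at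
      most \<open>2 * M / N\<close>, which absorbs the factor \<open>2 * N\<close>.\<close>
    have A1: "\<bar>2 * real N * (\<Sum>d\<in>{0<..N}. chi d / real d)\<bar> \<le> 4 * real M"
    proof -
      have "\<bar>\<Sum>d\<in>{0<..N}. chi d / real d\<bar> \<le> 2 * real M / real (Suc N)" using L_bound[of N] L0 by simp
      also have "\<dots> \<le> 2 * real M / real N" using N by (intro divide_left_mono) auto
      finally have "2 * real N * \<bar>\<Sum>d\<in>{0<..N}. chi d / real d\<bar> \<le> 2 * real N * (2 * real M / real N)"
        by (intro mult_left_mono) auto
      then show ?thesis using N by (simp add: abs_mult)
    qed
    have A2: "\<bar>sqrt_defect x * (\<Sum>d\<in>{0<..N}. chi d / sqrt (real d))\<bar> \<le> 2 * (2 * real M)"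
      unfolding abs_mult using abs_sqrt_defect_le[of x] abs_sqrt_sum_le[of 0 N] N Nx
      by (intro mult_mono) auto
    have "\<bar>\<Sum>d\<in>{0<..N}. chi d / sqrt (real d) * e d\<bar> \<le> (\<Sum>d\<in>{0<..N}. \<bar>chi d / sqrt (real d) * e d\<bar>)" by (rule sum_abs)
    also have "\<dots> \<le> (\<Sum>d\<in>{0<..N}. 4 / real N)"
    proof (rule sum_mono)
      fix d assume d: "d \<in> {0<..N}"
      have "\<bar>e d\<bar> \<le> 4 * sqrt (real d) / real N" unfolding e_def x_def using d by (intro quotient_defect) auto
      moreover have "\<bar>chi d / sqrt (real d)\<bar> \<le> 1 / sqrt (real d)"
        unfolding abs_divide using abs_chi_le[of d] by (intro divide_mono) (use d in auto)
      ultimately have "\<bar>chi d / sqrt (real d) * e d\<bar> \<le> 1 / sqrt (real d) * (4 * sqrt (real d) / real N)"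
        unfolding abs_mult by (intro mult_mono) auto
      then show "\<bar>chi d / sqrt (real d) * e d\<bar> \<le> 4 / real N" using d by simp
    qed
    also have "\<dots> = 4" using N by simp
    finally have "?A \<le> 8 * real M + 4" unfolding Aeq using A1 A2 unfolding abs_le_iff by linarith
    then show ?thesis using split B unfolding C_def x_def abs_le_iff by linarith
  qed
  define N where "N = Suc (nat \<lceil>exp C\<rceil>)"
  have "exp C < real N + 1" unfolding N_def by linarith
  then have "ln (exp C) < ln (real N + 1)" by (subst ln_less_cancel_iff) auto
  then have "C < ln (real N + 1)" by simp
  also have "\<dots> \<le> C" using ln_le_harmonic[of N] r_sum_lower[of N] bound[of N] by (simp add: N_def)
  finally show False by simp
qed

end

subsection \<open>Primes with prescribed quadratic characters\<close>

lemma sum_ln_eq_mangoldt: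
  "(\<Sum>n\<in>{0<..x}. ln (real n) * f n) = (\<Sum>d\<in>{0<..x}. \<Sum>m\<in>{0<..x div d}. mangoldt d * f (d * m))"
proof -
  have "(\<Sum>n\<in>{0<..x}. ln (real n) * f n) = (\<Sum>n\<in>{0<..x}. \<Sum>d | d dvd n. mangoldt d * f n)"
  proof (rule sum.cong[OF refl])
    fix n assume "n \<in> {0<..x}"
    then have "(\<Sum>d | d dvd n. mangoldt d) = ln (real n)" using mangoldt_sum[of n, where 'a = real] by simp
    then show "ln (real n) * f n = (\<Sum>d | d dvd n. mangoldt d * f n)" by (simp only: sum_distrib_right[symmetric])
  qed
  then show ?thesis by (simp only: sum_divisors_swap)
qed

lemma sum_ln_fact: "(\<Sum>n\<in>{0<..x}. ln (real n)) = ln (fact x)"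
proof (induction x)
  case (Suc x)
  have ins: "{0<..Suc x} = insert (Suc x) {0<..x}" by auto
  have "ln (fact (Suc x)) = ln (real (Suc x) * fact x)" by simp
  also have "\<dots> = ln (real (Suc x)) + ln (fact x)" by (rule ln_mult_pos) auto
  finally show ?case using Suc.IH by (simp add: ins del: of_nat_Suc fact_Suc)
qed simp

lemma ln_fact_mangoldt: "ln (fact x) = (\<Sum>d\<in>{0<..x}. mangoldt d * real (x div d))"
  using sum_ln_eq_mangoldt[of "\<lambda>_. 1" x] by (simp add: sum_ln_fact mult.commute)

definition psi :: "nat \<Rightarrow> real" where "psi x = (\<Sum>d\<in>{0<..x}. mangoldt d)"

text \<open>Chebyshev's argument. The weight \<open>2 * n div d - 2 * (n div d)\<close> is never
  negative and is at least 1 for \<open>n < d \<le> 2 * n\<close>, while its sum against the von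
  Mangoldt function is the logarithm of the central binomial coefficient.\<close>

lemma psi_double: "psi (2 * n) - psi n \<le> 2 * real n"
proof (cases "n = 0")
  case False
  have ext: "ln (fact n) = (\<Sum>d\<in>{0<..2 * n}. mangoldt d * real (n div d))"
    unfolding ln_fact_mangoldt by (intro sum.mono_neutral_left) auto
  have "psi (2 * n) - psi n = (\<Sum>d\<in>{n<..2 * n}. mangoldt d)"
  proof -
    have "{0<..2 * n} = {0<..n} \<union> {n<..2 * n}" by auto
    moreover have "sum (mangoldt :: nat \<Rightarrow> real) ({0<..n} \<union> {n<..2 * n}) = sum mangoldt {0<..n} + sum mangoldt {n<..2 * n}"
      by (intro sum.union_disjoint) auto
    ultimately show ?thesis by (simp add: psi_def)
  qed
  also have "\<dots> \<le> (\<Sum>d\<in>{n<..2 * n}. mangoldt d * (real (2 * n div d) - 2 * real (n div d)))"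
  proof (rule sum_mono)
    fix d assume d: "d \<in> {n<..2 * n}"
    then have "n div d = 0" "2 * n div d \<ge> 1" by (auto simp: Suc_le_eq div_greater_zero_iff)
    then have "1 \<le> real (2 * n div d) - 2 * real (n div d)" by simp
    then show "mangoldt d \<le> mangoldt d * (real (2 * n div d) - 2 * real (n div d))"
      using mult_left_mono[of 1 _ "mangoldt d :: real"] mangoldt_nonneg[of d] by simp
  qed
  also have "\<dots> \<le> (\<Sum>d\<in>{0<..2 * n}. mangoldt d * (real (2 * n div d) - 2 * real (n div d)))"
  proof (rule sum_mono2)
    fix d assume "d \<in> {0<..2 * n} - {n<..2 * n}"
    then have "d > 0" by simp
    then have "2 * (n div d) \<le> 2 * n div d"
      using div_times_less_eq_dividend[of n d] by (simp add: less_eq_div_iff_mult_less_eq)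
    then have "0 \<le> real (2 * n div d) - 2 * real (n div d)" by linarith
    then show "0 \<le> mangoldt d * (real (2 * n div d) - 2 * real (n div d))" by (simp add: mangoldt_nonneg)
  qed auto
  also have "\<dots> = ln (fact (2 * n)) - 2 * ln (fact n)"
    unfolding ln_fact_mangoldt[of "2 * n"] ext by (simp add: right_diff_distrib sum_subtractf sum_distrib_left mult_ac)
  also have "\<dots> = ln (real (2 * n choose n))"
  proof -
    have "fact n * fact n * (2 * n choose n) = (fact (2 * n) :: nat)"
      using binomial_fact_lemma[of n "2 * n"] by (simp add: mult_2)
    then have "(fact (2 * n) :: real) = fact n * fact n * real (2 * n choose n)"
      by (metis of_nat_fact of_nat_mult)
    moreover have "2 * n choose n > 0" by simp
    ultimately show ?thesis by (simp add: ln_mult)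
  qed
  also have "\<dots> \<le> ln (2 ^ (2 * n))"
  proof (subst ln_le_cancel_iff)
    have "real (2 * n choose n) \<le> real (2 ^ (2 * n))" by (simp only: of_nat_le_iff binomial_le_pow2)
    then show "real (2 * n choose n) \<le> 2 ^ (2 * n)" by simp
  qed auto
  also have "\<dots> = 2 * real n * ln 2" by (simp add: ln_realpow)
  also have "\<dots> \<le> 2 * real n * 1" using ln_2_less_1 by (intro mult_left_mono) auto
  finally show ?thesis by simp
qed (simp add: psi_def)

text \<open>Halving gives \<open>psi (2 * n) \<le> 6 * n + 2 * n\<close>. The constant 6 leaves room
  for the extra term of an odd argument, which is at most \<open>2 * n\<close>.\<close>

lemma psi_le: "psi x \<le> 6 * real x"
proof (induction x rule: less_induct)
  case (less x)
  show ?case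
  proof (cases "x \<le> 1")
    case True
    then have "{0<..x} \<subseteq> {1}" by auto
    then have "psi x = 0" unfolding psi_def by (intro sum.neutral) auto
    then show ?thesis by simp
  next
    case False
    define n where "n = x div 2"
    have n: "n < x" "n \<ge> 1" using False by (auto simp: n_def)
    have even: "psi (2 * n) \<le> 8 * real n" using psi_double[of n] less.IH[OF n(1)] by simp
    show ?thesis
    proof (cases "even x")
      case True
      then show ?thesis using even by (auto simp: n_def)
    next
      case False
      then have x: "x = Suc (2 * n)" by (simp add: n_def)
      have ins: "{0<..Suc (2 * n)} = insert (Suc (2 * n)) {0<..2 * n}" by auto
      have "psi x = psi (2 * n) + mangoldt x" by (simp add: psi_def x ins)
      also have "mangoldt x \<le> ln (real x)" using x by (intro mangoldt_le) simp
      also have "ln (real x) \<le> real x - 1" using x by (intro ln_le_minus_one) simp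
      finally show ?thesis using even x by simp
    qed
  qed
qed

text \<open>The logarithm of \<open>fact x\<close> is bounded below because
  \<open>x ^ x / fact x\<close> is one term of the series of \<open>exp x\<close>, and above by
  replacing \<open>x div d\<close> by the exact quotient.\<close>

lemma mertens_lower: "x > 0 \<Longrightarrow> (\<Sum>d\<in>{0<..x}. mangoldt d / real d) \<ge> ln (real x) - 1"
proof -
  assume x: "x > 0"
  have lower: "ln (fact x) \<ge> real x * ln (real x) - real x"
  proof -
    have "real x ^ x / fact x \<le> exp (real x)"
    proof -
      have "real x ^ x / fact x = (\<Sum>k\<in>{x}. real x ^ k /\<^sub>R fact k)" by (simp add: divide_inverse mult.commute)
      also have "\<dots> \<le> suminf (\<lambda>k. real x ^ k /\<^sub>R fact k)"
        by (intro sum_le_suminf summable_exp_generic) (auto simp: mult_ac)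
      finally show ?thesis by (simp add: exp_def)
    qed
    then have "ln (real x ^ x / fact x) \<le> ln (exp (real x))" using x by (subst ln_le_cancel_iff) auto
    then show ?thesis using x by (simp add: ln_div ln_realpow)
  qed
  have "ln (fact x) \<le> (\<Sum>d\<in>{0<..x}. mangoldt d * (real x / real d))"
    unfolding ln_fact_mangoldt
  proof (rule sum_mono)
    fix d assume "d \<in> {0<..x}"
    have "real (x div d) \<le> real x / real d" by (rule of_nat_div_le_of_nat)
    then show "mangoldt d * real (x div d) \<le> mangoldt d * (real x / real d)"
      by (intro mult_left_mono) (auto simp: mangoldt_nonneg)
  qed
  also have "\<dots> = real x * (\<Sum>d\<in>{0<..x}. mangoldt d / real d)" by (simp add: sum_distrib_left mult_ac)
  finally have "real x * (ln (real x) - 1) \<le> real x * (\<Sum>d\<in>{0<..x}. mangoldt d / real d)"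
    using lower by (simp add: algebra_simps)
  then show ?thesis using x by simp
qed

lemma ln_over_antimono:
  assumes "n \<ge> 3"
  shows "ln (real (Suc n)) / real (Suc n) \<le> ln (real n) / real n"
proof -
  have n: "real n > 0" using assms by simp
  have "ln (1 + 1 / real n) \<le> 1 / real n" by (rule ln_add_one_self_le_self) simp
  moreover have "1 + 1 / real n = real (Suc n) / real n" using n by (simp add: field_simps)
  ultimately have "ln (real (Suc n)) - ln (real n) \<le> 1 / real n" using n by (simp add: ln_div)
  moreover have "1 \<le> ln (real n)"
  proof -
    have "exp (1 :: real) \<le> real n" using exp_le assms by simp
    then have "ln (exp (1 :: real)) \<le> ln (real n)" using n by (subst ln_le_cancel_iff) auto
    then show ?thesis by simp
  qed
  moreover have "real n * (1 / real n) = 1" using n by simp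
  ultimately have "real n * (ln (real (Suc n)) - ln (real n)) \<le> ln (real n)"
    using mult_left_mono[of "ln (real (Suc n)) - ln (real n)" "1 / real n" "real n"] by linarith
  then have "ln (real (Suc n)) * real n \<le> ln (real n) * real (Suc n)" by (simp add: algebra_simps)
  then show ?thesis using n by (simp add: divide_le_eq le_divide_eq del: of_nat_Suc)
qed

text \<open>Writing \<open>ln\<close> as a divisor sum turns the bounded sum of
  \<open>chi n * ln n / n\<close> into a sum over \<open>d\<close> in which the inner sums are close
  to \<open>L\<close>. The total error is at most \<open>psi x * 2 * M / x\<close>, hence bounded,
  and \<open>L_nonzero\<close> allows the division by \<open>L\<close>.\<close>

lemma (in real_character) mangoldt_bounded: "\<exists>C. \<forall>x. \<bar>\<Sum>d\<in>{0<..x}. mangoldt d * (chi d / real d)\<bar> \<le> C"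
proof -
  define f where "f n = ln (real n) / real n" for n
  \<comment> \<open>The first two terms are taken separately because \<open>ln n / n\<close>
    decreases only from 3 on.\<close>
  define K where "K = (\<Sum>n\<in>{0<..2::nat}. \<bar>chi n * f n\<bar>) + 2 * real M * f 3"
  define K' where "K' = K + 12 * real M"
  have "f 3 \<ge> 0" by (simp add: f_def)
  have left: "\<bar>\<Sum>n\<in>{0<..x}. chi n * f n\<bar> \<le> K" for x
  proof (cases "x \<le> 2")
    case True
    have "\<bar>\<Sum>n\<in>{0<..x}. chi n * f n\<bar> \<le> (\<Sum>n\<in>{0<..x}. \<bar>chi n * f n\<bar>)" by (rule sum_abs)
    also have "\<dots> \<le> (\<Sum>n\<in>{0<..2::nat}. \<bar>chi n * f n\<bar>)" using True by (intro sum_mono2) auto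
    finally show ?thesis using mult_nonneg_nonneg[OF _ \<open>f 3 \<ge> 0\<close>, of "2 * real M"] unfolding K_def by linarith
  next
    case False
    have "{0<..x} = {0<..2} \<union> {2<..x}" using False by auto
    moreover have "(\<Sum>n\<in>{0<..2} \<union> {2<..x}. chi n * f n) = (\<Sum>n\<in>{0<..2}. chi n * f n) + (\<Sum>n\<in>{2<..x}. chi n * f n)"
      by (intro sum.union_disjoint) auto
    ultimately have eq: "(\<Sum>n\<in>{0<..x}. chi n * f n) = (\<Sum>n\<in>{0<..2}. chi n * f n) + (\<Sum>n\<in>{2<..x}. chi n * f n)"
      by metis
    have "\<bar>\<Sum>n\<in>{0<..2}. chi n * f n\<bar> \<le> (\<Sum>n\<in>{0<..2}. \<bar>chi n * f n\<bar>)" by (rule sum_abs)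
    moreover have "\<bar>\<Sum>n\<in>{2<..x}. chi n * f n\<bar> \<le> 2 * real M * f 3"
    proof -
      have "\<bar>\<Sum>n\<in>{2<..x}. chi n * f n\<bar> \<le> 2 * real M * f (Suc 2)"
        using ln_over_antimono by (intro abs_weighted_sum_le) (auto simp: f_def)
      moreover have "Suc 2 = 3" by simp
      ultimately show ?thesis by metis
    qed
    ultimately show ?thesis
      using abs_triangle_ineq[of "\<Sum>n\<in>{0<..2}. chi n * f n" "\<Sum>n\<in>{2<..x}. chi n * f n"]
      unfolding eq K_def by linarith
  qed
  have main: "\<bar>L * (\<Sum>d\<in>{0<..x}. mangoldt d * (chi d / real d))\<bar> \<le> K'" for x
  proof -
    define s where "s y = (\<Sum>m\<in>{0<..y}. chi m / real m)" for y
    have "(\<Sum>n\<in>{0<..x}. chi n * f n) = (\<Sum>n\<in>{0<..x}. ln (real n) * (chi n / real n))"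
      by (simp add: f_def mult.commute)
    also have "\<dots> = (\<Sum>d\<in>{0<..x}. \<Sum>m\<in>{0<..x div d}. mangoldt d * (chi (d * m) / real (d * m)))"
      by (rule sum_ln_eq_mangoldt)
    also have "\<dots> = (\<Sum>d\<in>{0<..x}. mangoldt d * (chi d / real d) * s (x div d))"
      by (simp add: s_def sum_distrib_left mult mult.assoc)
    finally have eq: "(\<Sum>n\<in>{0<..x}. chi n * f n) = \<dots>" .
    have "\<bar>\<Sum>d\<in>{0<..x}. mangoldt d * (chi d / real d) * (s (x div d) - L)\<bar>
        \<le> (\<Sum>d\<in>{0<..x}. \<bar>mangoldt d * (chi d / real d) * (s (x div d) - L)\<bar>)" by (rule sum_abs)
    also have "\<dots> \<le> (\<Sum>d\<in>{0<..x}. mangoldt d * (2 * real M / real x))"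
    proof (rule sum_mono)
      fix d assume d: "d \<in> {0<..x}"
      have "x < d * Suc (x div d)" using d by (simp add: dividend_less_times_div)
      then have "real x \<le> real d * real (Suc (x div d))" by (metis less_imp_le of_nat_le_iff of_nat_mult)
      then have le: "1 / real (Suc (x div d)) \<le> real d / real x"
        using d by (simp add: divide_le_eq le_divide_eq del: of_nat_Suc)
      have "\<bar>s (x div d) - L\<bar> \<le> 2 * real M * (1 / real (Suc (x div d)))" using L_bound[of "x div d"] by (simp add: s_def)
      also have "\<dots> \<le> 2 * real M * (real d / real x)" by (rule mult_left_mono[OF le]) simp
      finally have 1: "\<bar>s (x div d) - L\<bar> \<le> 2 * real M * (real d / real x)" .
      have "\<bar>chi d / real d\<bar> \<le> 1 / real d" unfolding abs_divide using abs_chi_le[of d] by (intro divide_mono) (use d in auto)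
      then have "\<bar>chi d / real d\<bar> * \<bar>s (x div d) - L\<bar> \<le> 1 / real d * (2 * real M * (real d / real x))"
        using 1 by (intro mult_mono) auto
      also have "\<dots> = 2 * real M / real x" using d by simp
      finally show "\<bar>mangoldt d * (chi d / real d) * (s (x div d) - L)\<bar> \<le> mangoldt d * (2 * real M / real x)"
        unfolding abs_mult mult.assoc by (intro mult_mono) (auto simp: mangoldt_nonneg)
    qed
    also have "\<dots> = psi x * (2 * real M / real x)" by (simp only: psi_def sum_distrib_right)
    also have "\<dots> \<le> 6 * real x * (2 * real M / real x)" by (intro mult_right_mono psi_le) auto
    also have "\<dots> \<le> 12 * real M" by (cases "x = 0") auto
    finally have err: "\<bar>\<Sum>d\<in>{0<..x}. mangoldt d * (chi d / real d) * (s (x div d) - L)\<bar> \<le> 12 * real M" .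
    have "L * (\<Sum>d\<in>{0<..x}. mangoldt d * (chi d / real d))
      = (\<Sum>d\<in>{0<..x}. mangoldt d * (chi d / real d) * s (x div d))
        - (\<Sum>d\<in>{0<..x}. mangoldt d * (chi d / real d) * (s (x div d) - L))"
      by (simp only: right_diff_distrib sum_subtractf sum_distrib_left mult.commute[of L] diff_diff_eq2)
    then show ?thesis using left[of x] err unfolding eq K'_def by linarith
  qed
  have "\<bar>\<Sum>d\<in>{0<..x}. mangoldt d * (chi d / real d)\<bar> \<le> K' / \<bar>L\<bar>" for x
    using main[of x] L_nonzero by (simp add: abs_mult le_divide_eq mult.commute)
  then show ?thesis by blast
qed

lemma (in real_character) chi_nonzero_iff: "chi n \<noteq> 0 \<longleftrightarrow> coprime n M"
proof
  assume "coprime n M"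
  then have "[n ^ totient M = 1] (mod M)" by (rule euler_theorem)
  then have "chi (n ^ totient M) = chi 1" using chi_mod[of "n ^ totient M"] chi_mod[of 1] by (simp add: cong_def)
  moreover have "chi (n ^ k) = chi n ^ k" for k by (induction k) (auto simp: one mult simp flip: One_nat_def)
  ultimately have "chi n ^ totient M = 1" by (metis one)
  moreover have "totient M > 0" using M by simp
  ultimately show "chi n \<noteq> 0" by (metis zero_neq_one zero_power)
qed (rule cop)

lemma real_character_mult:
  assumes "real_character a M" "real_character b M" "\<exists>n. a n * b n = -1"
  shows "real_character (\<lambda>n. a n * b n) M"
proof -
  interpret a: real_character a M by fact
  interpret b: real_character b M by fact
  show ?thesis
  proof
    fix n
    show "a n * b n = 1 \<or> a n * b n = 0 \<or> a n * b n = - 1" using a.vals[of n] b.vals[of n] by auto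
  qed (use assms(3) a.M a.one b.one in \<open>auto simp: a.mult b.mult a.periodic b.periodic intro: a.cop\<close>)
qed

text \<open>Each of the finitely many primes dividing \<open>M\<close> contributes a geometric
  series of total at most \<open>ln p\<close>.\<close>

lemma mangoldt_not_coprime_bounded:
  assumes M: "M > 0"
  shows "\<exists>C. \<forall>x. (\<Sum>n | n \<in> {0<..x} \<and> \<not> coprime n M. mangoldt n / real n) \<le> C"
proof -
  define P where "P = {p. Factorial_Ring.prime p \<and> p dvd M}"
  have fin: "finite P" using finite_divisors_nat[OF M] by (auto simp: P_def intro: finite_subset)
  have "(\<Sum>n | n \<in> {0<..x} \<and> \<not> coprime n M. mangoldt n / real n) \<le> (\<Sum>p\<in>P. ln (real p))" for x
  proof -
    have "(\<Sum>n | n \<in> {0<..x} \<and> \<not> coprime n M. mangoldt n / real n)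
      = (\<Sum>n | n \<in> {0<..x} \<and> \<not> coprime n M \<and> primepow n. mangoldt n / real n)"
      by (intro sum.mono_neutral_right) (auto simp: mangoldt_def)
    also have "\<dots> \<le> (\<Sum>n\<in>(\<lambda>(p, k). p ^ k) ` (P \<times> {1..x}). mangoldt n / real n)"
    proof (rule sum_mono2)
      show "{n. n \<in> {0<..x} \<and> \<not> coprime n M \<and> primepow n} \<subseteq> (\<lambda>(p, k). p ^ k) ` (P \<times> {1..x})"
      proof safe
        fix n assume n: "n \<in> {0<..x}" "\<not> coprime n M" "primepow n"
        obtain p k where pk: "Factorial_Ring.prime p" "k > 0" "n = p ^ k" using n(3) by (auto simp: primepow_def)
        have "\<not> coprime p M" using n(2) pk(3) by auto
        then have "p \<in> P" using pk(1) prime_imp_coprime unfolding P_def by blast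
        moreover have "k < p ^ k" using power_gt_expt[of p k] prime_gt_1_nat[OF pk(1)] by simp
        ultimately show "n \<in> (\<lambda>(p, k). p ^ k) ` (P \<times> {1..x})"
          using pk n(1) by (intro image_eqI[of _ _ "(p, k)"]) auto
      qed
    qed (use fin in \<open>auto simp: mangoldt_nonneg\<close>)
    also have "\<dots> \<le> (\<Sum>y\<in>P \<times> {1..x}. mangoldt (case y of (p, k) \<Rightarrow> p ^ k) / real (case y of (p, k) \<Rightarrow> p ^ k))"
      using fin by (intro sum_image_le[unfolded o_def]) (auto simp: mangoldt_nonneg)
    also have "\<dots> = (\<Sum>p\<in>P. \<Sum>k\<in>{1..x}. mangoldt (p ^ k) / real (p ^ k))"
      by (simp add: sum.cartesian_product case_prod_unfold)
    also have "\<dots> \<le> (\<Sum>p\<in>P. ln (real p))"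
    proof (rule sum_mono)
      fix p assume "p \<in> P"
      then have p: "Factorial_Ring.prime p" by (simp add: P_def)
      then have p2: "real p \<ge> 2" using prime_ge_2_nat by fastforce
      have ln0: "ln (real p) \<ge> 0" using p2 by simp
      have half: "(\<Sum>k\<in>{1..x}. (1 / 2 :: real) ^ k) \<le> 1"
        using sum_gp[of "1 / 2 :: real" 1 x] by simp
      have "(\<Sum>k\<in>{1..x}. mangoldt (p ^ k) / real (p ^ k)) \<le> (\<Sum>k\<in>{1..x}. ln (real p) * (1 / 2) ^ k)"
      proof (rule sum_mono)
        fix k assume "k \<in> {1..x}"
        then have mg: "mangoldt (p ^ k) = ln (real p)" using p by simp
        have "1 / real (p ^ k) \<le> (1 / 2) ^ k" using p2
          by (simp add: power_one_over[symmetric] power_mono divide_left_mono)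
        from mult_left_mono[OF this ln0] show "mangoldt (p ^ k) / real (p ^ k) \<le> ln (real p) * (1 / 2) ^ k"
          unfolding mg by simp
      qed
      also have "\<dots> \<le> ln (real p)"
        using mult_left_mono[OF half ln0] by (simp only: sum_distrib_left[symmetric])
      finally show "(\<Sum>k\<in>{1..x}. mangoldt (p ^ k) / real (p ^ k)) \<le> ln (real p)" .
    qed
    finally show ?thesis .
  qed
  then show ?thesis by blast
qed

text \<open>If the weight \<open>(1 + a)(1 + b)(1 - c)\<close> vanished on all prime powers coprime to \<open>M\<close>, expanding the product
  would bound \<open>\<Sum> \<Lambda>(n) / n\<close>. A prime power with nonzero weight is an odd power of the wanted prime,
  because the characters are real.\<close>

lemma exists_prime_characters:
  assumes chars: "real_character a M" "real_character b M" "real_character c M"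
    and ind: "\<exists>n. a n = -1 \<and> b n = 1 \<and> c n = 1" "\<exists>n. a n = 1 \<and> b n = -1 \<and> c n = 1"
      "\<exists>n. a n = 1 \<and> b n = 1 \<and> c n = -1"
  shows "\<exists>p. Factorial_Ring.prime p \<and> coprime p M \<and> a p = 1 \<and> b p = 1 \<and> c p = -1"
proof (rule ccontr)
  assume none: "\<nexists>p. Factorial_Ring.prime p \<and> coprime p M \<and> a p = 1 \<and> b p = 1 \<and> c p = -1"
  interpret a: real_character a M by fact
  interpret b: real_character b M by fact
  interpret c: real_character c M by fact
  obtain n1 n2 n3 where n: "a n1 = -1" "b n1 = 1" "c n1 = 1" "a n2 = 1" "b n2 = -1" "c n2 = 1"
    "a n3 = 1" "b n3 = 1" "c n3 = -1" using ind by blast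
  \<comment> \<open>The independence hypotheses provide the value -1 for every product of the
    characters, so that all seven sums arising from the expansion are bounded.\<close>
  have ab: "real_character (\<lambda>n. a n * b n) M" by (rule real_character_mult[OF chars(1,2)]) (use n in \<open>auto intro: exI[of _ n1]\<close>)
  have ac: "real_character (\<lambda>n. a n * c n) M" by (rule real_character_mult[OF chars(1,3)]) (use n in \<open>auto intro: exI[of _ n1]\<close>)
  have bc: "real_character (\<lambda>n. b n * c n) M" by (rule real_character_mult[OF chars(2,3)]) (use n in \<open>auto intro: exI[of _ n2]\<close>)
  have abc: "real_character (\<lambda>n. a n * b n * c n) M"
    by (rule real_character_mult[OF ab chars(3)]) (use n in \<open>auto intro: exI[of _ n1]\<close>)
  define S where "S f x = (\<Sum>n\<in>{0<..x}. mangoldt n * (f n / real n))" for f :: "nat \<Rightarrow> real" and x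
  obtain C1 where C1: "\<And>x. \<bar>S a x\<bar> \<le> C1" using a.mangoldt_bounded unfolding S_def by blast
  obtain C2 where C2: "\<And>x. \<bar>S b x\<bar> \<le> C2" using b.mangoldt_bounded unfolding S_def by blast
  obtain C3 where C3: "\<And>x. \<bar>S c x\<bar> \<le> C3" using c.mangoldt_bounded unfolding S_def by blast
  obtain C4 where C4: "\<And>x. \<bar>S (\<lambda>n. a n * b n) x\<bar> \<le> C4" using real_character.mangoldt_bounded[OF ab] unfolding S_def by blast
  obtain C5 where C5: "\<And>x. \<bar>S (\<lambda>n. a n * c n) x\<bar> \<le> C5" using real_character.mangoldt_bounded[OF ac] unfolding S_def by blast
  obtain C6 where C6: "\<And>x. \<bar>S (\<lambda>n. b n * c n) x\<bar> \<le> C6" using real_character.mangoldt_bounded[OF bc] unfolding S_def by blast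
  obtain C7 where C7: "\<And>x. \<bar>S (\<lambda>n. a n * b n * c n) x\<bar> \<le> C7"
    using real_character.mangoldt_bounded[OF abc] unfolding S_def by blast
  obtain C where C: "\<And>x. (\<Sum>n | n \<in> {0<..x} \<and> \<not> coprime n M. mangoldt n / real n) \<le> C"
    using mangoldt_not_coprime_bounded[OF a.M] by blast
  have vanish: "mangoldt n * ((1 + a n) * (1 + b n) * (1 - c n) / real n) = (if coprime n M then 0 else mangoldt n / real n)" for n
  proof (cases "coprime n M \<and> primepow n")
    case True
    then obtain p k where pk: "Factorial_Ring.prime p" "k > 0" "n = p ^ k" by (auto simp: primepow_def)
    have cop: "coprime p M" using True pk by auto
    have pow: "a (p ^ j) = a p ^ j" "b (p ^ j) = b p ^ j" "c (p ^ j) = c p ^ j" for j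
      by (induction j) (auto simp: a.one b.one c.one a.mult b.mult c.mult simp flip: One_nat_def)
    have v: "a p = 1 \<or> a p = -1" "b p = 1 \<or> b p = -1" "c p = 1 \<or> c p = -1"
      using a.vals[of p] b.vals[of p] c.vals[of p] a.chi_nonzero_iff b.chi_nonzero_iff c.chi_nonzero_iff cop by blast+
    have "(1 + a n) * (1 + b n) * (1 - c n) = 0"
    proof (cases "even k")
      case True
      then show ?thesis using v(3) by (auto simp: pk pow)
    next
      case False
      then have "a n = a p" "b n = b p" "c n = c p" using v by (auto simp: pk pow)
      then show ?thesis using none pk(1) cop v by auto
    qed
    then show ?thesis using True by simp
  next
    case False
    then show ?thesis using a.chi_nonzero_iff[of n] b.chi_nonzero_iff[of n] c.chi_nonzero_iff[of n]
      by (auto simp: mangoldt_def)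
  qed
  define B where "B = C + 1 + C1 + C2 + C3 + C4 + C5 + C6 + C7"
  have bound: "ln (real x) \<le> B" if "x > 0" for x
  proof -
    have "(\<Sum>n\<in>{0<..x}. mangoldt n * ((1 + a n) * (1 + b n) * (1 - c n) / real n))
        = (\<Sum>n\<in>{0<..x}. if coprime n M then 0 else mangoldt n / real n)" by (simp only: vanish)
    also have "\<dots> = (\<Sum>n | n \<in> {0<..x} \<and> \<not> coprime n M. mangoldt n / real n)"
      by (intro sum.mono_neutral_cong_right) auto
    finally have "(\<Sum>n\<in>{0<..x}. mangoldt n * ((1 + a n) * (1 + b n) * (1 - c n) / real n)) \<le> C" using C by metis
    moreover have "mangoldt n * ((1 + a n) * (1 + b n) * (1 - c n) / real n)
      = mangoldt n / real n + mangoldt n * (a n / real n) + mangoldt n * (b n / real n) - mangoldt n * (c n / real n)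
        + mangoldt n * ((a n * b n) / real n) - mangoldt n * ((a n * c n) / real n) - mangoldt n * ((b n * c n) / real n)
        - mangoldt n * ((a n * b n * c n) / real n)" for n
      unfolding divide_inverse by (simp add: algebra_simps)
    ultimately have "(\<Sum>n\<in>{0<..x}. mangoldt n / real n) + S a x + S b x - S c x + S (\<lambda>n. a n * b n) x
      - S (\<lambda>n. a n * c n) x - S (\<lambda>n. b n * c n) x - S (\<lambda>n. a n * b n * c n) x \<le> C"
      by (simp only: S_def sum.distrib sum_subtractf)
    then show ?thesis
      using mertens_lower[OF that] C1[of x] C2[of x] C3[of x] C4[of x] C5[of x] C6[of x] C7[of x]
      unfolding B_def by linarith
  qed
  have "ln (real (nat \<lceil>exp (B + 1)\<rceil>)) \<ge> ln (exp (B + 1))"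
    by (subst ln_le_cancel_iff) (auto intro: real_nat_ceiling_ge less_le_trans[OF exp_gt_zero])
  moreover have "nat \<lceil>exp (B + 1)\<rceil> > 0" by simp
  ultimately show False using bound[of "nat \<lceil>exp (B + 1)\<rceil>"] by simp
qed

section \<open>Quadratic characters and splitting primes\<close>

lemma real_character_restrict:
  assumes M: "M > 0"
    and f: "\<And>m n. coprime m M \<Longrightarrow> coprime n M \<Longrightarrow> f (m * n) = f m * f n" "\<And>n. coprime n M \<Longrightarrow> f n = 1 \<or> f n = -1"
      "\<And>n. f (n + M) = f n" "f 1 = (1 :: real)" "\<exists>n. coprime n M \<and> f n = -1"
  shows "real_character (\<lambda>n. if coprime n M then f n else 0) M"
proof
  fix a b
  show "(if coprime (a * b) M then f (a * b) else 0) = (if coprime a M then f a else 0) * (if coprime b M then f b else 0)"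
    using f(1) by auto
  have "gcd (a + M) M = gcd a M" by simp
  then have "coprime (a + M) M = coprime a M" by (simp only: coprime_iff_gcd_eq_1)
  then show "(if coprime (a + M) M then f (a + M) else 0) = (if coprime a M then f a else 0)" by (simp add: f(3))
  show "(if coprime a M then f a else 0) = 1 \<or> (if coprime a M then f a else 0) = 0 \<or> (if coprime a M then f a else 0) = - 1"
    using f(2) by auto
  show "\<exists>n. (if coprime n M then f n else 0) = - 1" using f(5) by auto
qed (use M f(4) in \<open>auto split: if_splits\<close>)

lemma exists_Legendre_pattern:
  fixes Pr :: "int set"
  assumes fin: "finite Pr" and Pr: "\<And>q. q \<in> Pr \<Longrightarrow> Factorial_Ring.prime q \<and> q mod 4 = 3" and s: "s = 1 \<or> s = 3"
  shows "\<exists>n. coprime (int n) (8 * \<Prod>Pr) \<and> n mod 8 = s \<and> (\<forall>q\<in>Pr. Legendre (int n) q = (if q \<in> T then -1 else 1))"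
proof -
  have q2: "q > 2" if "q \<in> Pr" for q
    using Pr[OF that] prime_ge_2_int[of q] by (cases "q = 2") auto
  define u where "u x = (if x = 8 then s else if int x \<in> T then x - 1 else 1)" for x :: nat
  have "coprime x y" if "x \<in> insert 8 (nat ` Pr)" "y \<in> insert 8 (nat ` Pr)" "x \<noteq> y" for x y
  proof -
    have odd8: "coprime (nat q) 8" if q: "q \<in> Pr" for q
    proof -
      have "q mod 4 = 3" using Pr[OF q] by blast
      then have "odd q" by presburger
      then have "odd (nat q)" using q2[OF q] by (simp add: even_nat_iff)
      then have "coprime (nat q) (2 ^ 3)" by (subst coprime_power_right_iff) simp
      then show ?thesis by simp
    qed
    have "coprime (nat q) (nat q')" if "q \<in> Pr" "q' \<in> Pr" "nat q \<noteq> nat q'" for q q'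
      using that Pr by (intro primes_coprime) auto
    then show ?thesis using that odd8 by (auto simp: coprime_commute)
  qed
  then obtain n where n: "\<And>x. x \<in> insert 8 (nat ` Pr) \<Longrightarrow> [n = u x] (mod x)"
    using chinese_remainder_nat[of "insert 8 (nat ` Pr)" "\<lambda>x. x" u] fin by auto
  have n8: "n mod 8 = s" using n[of 8] s by (auto simp: cong_def u_def)
  have leg: "Legendre (int n) q = (if q \<in> T then -1 else 1)" if q: "q \<in> Pr" for q
  proof -
    have "q \<noteq> 8" using Pr[OF q] by auto
    then have ne: "nat q \<noteq> 8" "int (nat q) = q" using q2[OF q] by auto
    have "[n = u (nat q)] (mod (nat q))" using n q by blast
    then have c: "[int n = int (u (nat q))] (mod q)" using ne by (metis cong_int_iff)
    show ?thesis
    proof (cases "q \<in> T")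
      case True
      then have "int (u (nat q)) = q - 1" using ne q2[OF q] by (simp add: u_def)
      then have "q dvd int n - (q - 1)" using c by (simp add: cong_iff_dvd_diff)
      then have "q dvd int n - (q - 1) + q" by (rule dvd_add) simp
      then have "[int n = - 1] (mod q)" by (simp add: cong_iff_dvd_diff)
      then have "Legendre (int n) q = Legendre (-1) q" by (rule Legendre_cong)
      then show ?thesis using Legendre_minus_one Pr[OF q] q2[OF q] True by simp
    next
      case False
      then have "int (u (nat q)) = 1" using ne by (simp add: u_def)
      then have "Legendre (int n) q = Legendre 1 q" using c by (intro Legendre_cong) simp
      then show ?thesis using q2[OF q] False by simp
    qed
  qed
  have "coprime (int n) q" if q: "q \<in> Pr" for q
  proof -
    have "Legendre (int n) q \<noteq> 0" using leg[OF q] by simp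
    then have "\<not> q dvd int n" by (auto simp: Legendre_def cong_0_iff)
    then show ?thesis using prime_imp_coprime[of q "int n"] Pr[OF q] by (simp add: coprime_commute)
  qed
  then have "coprime (int n) (\<Prod>Pr)" by (intro prod_coprime_right) auto
  moreover have "coprime (int n) 8"
  proof -
    have "odd n" using n8 s by presburger
    then have "coprime (int n) (2 ^ 3)" by (subst coprime_power_right_iff) simp
    then show ?thesis by simp
  qed
  ultimately have "coprime (int n) (8 * \<Prod>Pr)" by simp
  then show ?thesis using n8 leg by blast
qed

text \<open>Three characters are prescribed: the symbol of 2, the product of the symbols at all of
  \<open>Pr\<close>, and the product at \<open>i\<close> and \<open>j\<close>. The third prime
  \<open>k\<close> makes them independent, and the even number of primes lets the product be
  inverted by reciprocity without a sign.\<close>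

lemma exists_splitting_prime:
  fixes Pr :: "int set"
  assumes fin: "finite Pr" "even (card Pr)" and Pr: "\<And>q. q \<in> Pr \<Longrightarrow> Factorial_Ring.prime q \<and> q mod 4 = 3"
    and ijk: "i \<in> Pr" "j \<in> Pr" "k \<in> Pr" "i \<noteq> j" "k \<noteq> i" "k \<noteq> j"
  shows "\<exists>r. Factorial_Ring.prime r \<and> r > 2 \<and> r \<notin> Pr \<and> Legendre 2 r = 1 \<and> Legendre (\<Prod>Pr) r = 1 \<and>
    Legendre r i = - Legendre r j"
proof -
  have q2: "q > 2" if "q \<in> Pr" for q
    using Pr[OF that] prime_ge_2_int[of q] by (cases "q = 2") auto
  define M where "M = nat (8 * \<Prod>Pr)"
  have pos: "\<Prod>Pr > 0" using q2 by (intro Groups_Big.prod_pos) force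
  then have intM: "int M = 8 * \<Prod>Pr" by (simp add: M_def)
  have M: "M > 0" using pos by (simp add: M_def)
  have dvdM: "q dvd int M" if "q \<in> Pr" for q
    unfolding intM using that fin by (intro dvd_mult dvd_prodI)
  have cop: "coprime n M \<longleftrightarrow> coprime (int n) (8 * \<Prod>Pr)" for n unfolding intM[symmetric] by simp
  have cop_odd: "odd n" if "coprime n M" for n
  proof -
    have "coprime (int n) 8" using that by (simp add: cop)
    then have "coprime (int n) (2 ^ 3)" by simp
    then show ?thesis by (simp only: coprime_power_right_iff) simp
  qed
  have leg: "Legendre (int n) q = 1 \<or> Legendre (int n) q = -1" if "coprime n M" "q \<in> Pr" for n q
  proof -
    have "coprime (int n) q" using that dvdM coprime_divisors[of "int n" "int n" q "int M"] by auto
    then have "\<not> q dvd int n" using q2[OF that(2)] coprime_common_divisor_int[of "int n" q q] by auto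
    then show ?thesis by (rule Legendre_values)
  qed
  define lg where "lg E n = (\<Prod>q\<in>E. real_of_int (Legendre (int n) q))" for E n
  define two where "two n = (if n mod 8 = 1 \<or> n mod 8 = 7 then 1 else -1 :: real)" for n :: nat
  have lg_char: "real_character (\<lambda>n. if coprime n M then lg E n else 0) M"
    if E: "E \<subseteq> Pr" and ne: "\<exists>n. coprime n M \<and> lg E n = -1" for E
  proof (rule real_character_restrict[OF M _ _ _ _ ne])
    show "lg E (m * n) = lg E m * lg E n" for m n
      unfolding lg_def prod.distrib[symmetric] using E Pr q2 by (intro prod.cong refl) (auto simp: Legendre_mult)
    show "lg E n = 1 \<or> lg E n = -1" if n: "coprime n M" for n
    proof -
      have "finite E" using E fin(1) finite_subset by blast
      then show ?thesis using E
      proof (induction E)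
        case (insert q E)
        then have "q \<in> Pr" by auto
        then show ?case using insert leg[OF n, of q] by (auto simp: lg_def)
      qed (simp add: lg_def)
    qed
    show "lg E (n + M) = lg E n" for n
      unfolding lg_def
    proof (rule prod.cong[OF refl])
      fix q assume "q \<in> E"
      then have "[int (n + M) = int n] (mod q)" using dvdM E by (auto simp: cong_iff_dvd_diff)
      then show "real_of_int (Legendre (int (n + M)) q) = real_of_int (Legendre (int n) q)" by (simp only: Legendre_cong)
    qed
    show "lg E 1 = 1" using E q2 unfolding lg_def by (intro prod.neutral) force
  qed
  have two_char: "real_character (\<lambda>n. if coprime n M then two n else 0) M"
    if ne: "\<exists>n. coprime n M \<and> two n = -1"
  proof (rule real_character_restrict[OF M _ _ _ _ ne])
    show "two (m * n) = two m * two n" if "coprime m M" "coprime n M" for m n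
    proof -
      have "odd (m mod 8)" "odd (n mod 8)" using that[THEN cop_odd] by presburger+
      moreover have "m mod 8 < 8" "n mod 8 < 8" by auto
      ultimately have "m mod 8 = 1 \<or> m mod 8 = 3 \<or> m mod 8 = 5 \<or> m mod 8 = 7"
        "n mod 8 = 1 \<or> n mod 8 = 3 \<or> n mod 8 = 5 \<or> n mod 8 = 7" by presburger+
      moreover have "(m * n) mod 8 = ((m mod 8) * (n mod 8)) mod 8" by (simp add: mod_simps)
      ultimately show ?thesis by (auto simp: two_def)
    qed
    show "two (n + M) = two n" for n
    proof -
      have "8 dvd int M" by (simp add: intM)
      then have "8 dvd M" by presburger
      then have "(n + M) mod 8 = n mod 8" by auto
      then show ?thesis by (simp add: two_def)
    qed
  qed (auto simp: two_def)
  have pattern: "\<exists>n. coprime n M \<and> n mod 8 = s \<and> (\<forall>q\<in>Pr. Legendre (int n) q = (if q \<in> T then -1 else 1))"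
    if "s = 1 \<or> s = 3" for s T
    using exists_Legendre_pattern[OF fin(1) Pr that, of T] by (simp add: cop)
  have lg_eq: "lg E n = (-1) ^ card (E \<inter> T)" if "\<forall>q\<in>Pr. Legendre (int n) q = (if q \<in> T then -1 else 1)" "E \<subseteq> Pr" for E T n
  proof -
    have "finite E" using that fin(1) finite_subset by blast
    have "lg E n = (\<Prod>q\<in>E. if q \<in> T then -1 else 1)" unfolding lg_def using that by (intro prod.cong refl) auto
    also have "\<dots> = (-1) ^ card (E \<inter> T)" using \<open>finite E\<close> by (simp add: prod.If_cases Int_def)
    finally show ?thesis .
  qed
  have sub: "{i, j} \<subseteq> Pr" using ijk by auto
  \<comment> \<open>Each witness makes exactly one character equal to -1: the residue 3 modulo 8
    affects only \<open>two\<close>, a sign change at \<open>k\<close> only the product over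
    \<open>Pr\<close>, and sign changes at \<open>i\<close> and \<open>k\<close> only the product
    over \<open>{i, j}\<close>.\<close>
  obtain n1 where n1: "coprime n1 M" "n1 mod 8 = 3" "\<forall>q\<in>Pr. Legendre (int n1) q = (if q \<in> {} then -1 else 1)"
    using pattern[of 3 "{}"] by blast
  obtain n2 where n2: "coprime n2 M" "n2 mod 8 = 1" "\<forall>q\<in>Pr. Legendre (int n2) q = (if q \<in> {k} then -1 else 1)"
    using pattern[of 1 "{k}"] by blast
  obtain n3 where n3: "coprime n3 M" "n3 mod 8 = 1" "\<forall>q\<in>Pr. Legendre (int n3) q = (if q \<in> {i, k} then -1 else 1)"
    using pattern[of 1 "{i, k}"] by blast
  have int: "Pr \<inter> {k} = {k}" "Pr \<inter> {i, k} = {i, k}" "{i, j} \<inter> {k} = {}" "{i, j} \<inter> {i, k} = {i}" using ijk by auto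
  have v: "two n1 = -1" "lg Pr n1 = 1" "lg {i, j} n1 = 1" "two n2 = 1" "lg Pr n2 = -1" "lg {i, j} n2 = 1"
    "two n3 = 1" "lg Pr n3 = 1" "lg {i, j} n3 = -1"
    using n1 n2 n3 ijk sub by (simp_all add: lg_eq[OF n1(3)] lg_eq[OF n2(3)] lg_eq[OF n3(3)] int two_def)
  have "\<exists>p. Factorial_Ring.prime p \<and> coprime p M \<and> (if coprime p M then two p else 0) = 1 \<and>
      (if coprime p M then lg Pr p else 0) = 1 \<and> (if coprime p M then lg {i, j} p else 0) = -1"
  proof (rule exists_prime_characters)
    show "real_character (\<lambda>n. if coprime n M then two n else 0) M" by (rule two_char) (use n1 v in blast)
    show "real_character (\<lambda>n. if coprime n M then lg Pr n else 0) M" by (rule lg_char) (use n2 v in auto)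
    show "real_character (\<lambda>n. if coprime n M then lg {i, j} n else 0) M" by (rule lg_char) (use n3 v sub in auto)
  qed (intro exI[of _ n1] exI[of _ n2] exI[of _ n3]; simp add: v n1 n2 n3)+
  then obtain p where p: "Factorial_Ring.prime p" "coprime p M" "two p = 1" "lg Pr p = 1" "lg {i, j} p = -1" by auto
  define r where "r = int p"
  have r: "Factorial_Ring.prime r" using p(1) by (simp add: r_def)
  have odd: "odd r" using cop_odd[OF p(2)] by (simp add: r_def)
  then have r2: "r > 2" using prime_ge_2_int[OF r] by (cases "r = 2") auto
  have "\<not> r dvd int M"
    using p(2) r2 coprime_common_divisor_int[of r "int M" r] by (auto simp: r_def)
  then have rPr: "r \<notin> Pr" using dvdM by auto
  have "Legendre 2 r = 1"
  proof -
    have "r mod 8 = int (p mod 8)" by (simp add: r_def of_nat_mod)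
    then show ?thesis using p(3) Legendre_two[OF r r2] by (auto simp: two_def split: if_splits)
  qed
  moreover have "Legendre (\<Prod>Pr) r = 1"
  proof -
    \<comment> \<open>The reciprocity sign is the same for all primes of \<open>Pr\<close>, as they
      are all 3 modulo 4.\<close>
    define e where "e = (if r mod 4 = 3 then -1 else 1 :: int)"
    have "Legendre q r = e * Legendre r q" if q: "q \<in> Pr" for q
    proof -
      have qr: "q \<noteq> r" using q rPr by blast
      have "Legendre q r * Legendre r q = e"
        using Legendre_reciprocity[of q r] Pr[OF q] q2[OF q] r r2 qr by (auto simp: e_def)
      then show ?thesis using leg[OF p(2) q] by (auto simp: r_def)
    qed
    then have "(\<Prod>q\<in>Pr. Legendre q r) = (\<Prod>q\<in>Pr. e * Legendre r q)" by (intro prod.cong) auto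
    also have "\<dots> = e ^ card Pr * (\<Prod>q\<in>Pr. Legendre r q)" by (simp add: prod.distrib)
    also have "e ^ card Pr = 1" using fin(2) by (simp add: e_def)
    also have "(\<Prod>q\<in>Pr. Legendre r q) = 1"
    proof -
      have "real_of_int (\<Prod>q\<in>Pr. Legendre r q) = lg Pr p" by (simp add: lg_def r_def)
      then show ?thesis using p(4) by linarith
    qed
    finally show ?thesis using Legendre_prod[OF r r2, of "\<lambda>q. q" Pr] by simp
  qed
  moreover have "Legendre r i = - Legendre r j"
  proof -
    have "real_of_int (Legendre r i * Legendre r j) = lg {i, j} p" using ijk(4) by (simp add: lg_def r_def)
    then have "Legendre r i * Legendre r j = -1" using p(5) by linarith
    then show ?thesis using leg[OF p(2) ijk(1)] leg[OF p(2) ijk(2)] by (auto simp: r_def)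
  qed
  ultimately show ?thesis using r r2 rPr by blast
qed

subsection \<open>Finite commutative groups\<close>

context comm_group
begin

lemma torsion_subgroup: "subgroup {c \<in> carrier G. \<exists>n. c [^] ((2::nat) ^ n) = \<one>} G"
proof (rule subgroupI)
  show "{c \<in> carrier G. \<exists>n. c [^] ((2::nat) ^ n) = \<one>} \<noteq> {}" using nat_pow_one by (auto intro: exI[of _ \<one>])
next
  fix a b assume "a \<in> {c \<in> carrier G. \<exists>n. c [^] ((2::nat) ^ n) = \<one>}" "b \<in> {c \<in> carrier G. \<exists>n. c [^] ((2::nat) ^ n) = \<one>}"
  then obtain k l where ab: "a \<in> carrier G" "b \<in> carrier G" "a [^] ((2::nat) ^ k) = \<one>" "b [^] ((2::nat) ^ l) = \<one>" by auto
  have "a [^] ((2::nat) ^ (k + l)) = \<one>" using ab by (simp add: power_add flip: nat_pow_pow)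
  moreover have "b [^] ((2::nat) ^ (k + l)) = \<one>"
    unfolding power_add mult.commute[of "2 ^ k"] using ab by (simp flip: nat_pow_pow)
  ultimately have "(a \<otimes> b) [^] ((2::nat) ^ (k + l)) = \<one>" using ab by (simp add: nat_pow_distrib)
  then show "a \<otimes> b \<in> {c \<in> carrier G. \<exists>n. c [^] ((2::nat) ^ n) = \<one>}" using ab by blast
qed (auto simp: nat_pow_inv)

lemma subgroup_comm_group: "subgroup H G \<Longrightarrow> comm_group (G\<lparr>carrier := H\<rparr>)"
  by (rule comm_group.intro[OF comm_monoid.intro])
    (auto simp: comm_monoid_axioms_def m_comm subgroup.mem_carrier subgroup.subgroup_is_group group.is_monoid is_group)

text \<open>A subgroup of order \<open>2 ^ k\<close> consists of torsion elements, and the order of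
  the torsion part is a power of 2 dividing the group order, so the two coincide by counting.
  Existence is Sylow's theorem.\<close>

lemma the_sylow_two:
  assumes fin: "finite (carrier G)" and card: "card {c \<in> carrier G. \<exists>n. c [^] ((2::nat) ^ n) = \<one>} = 2 ^ r"
  shows "(THE H. is_sylow_subgroup 2 G H) = {c \<in> carrier G. \<exists>n. c [^] ((2::nat) ^ n) = \<one>}" (is "_ = ?A")
proof -
  define k where "k = multiplicity 2 (Coset.order G)"
  have ord: "Coset.order G > 0" using fin by (simp add: order_gt_0_iff_finite)
  have eq: "H = ?A" if H: "subgroup H G" "card H = 2 ^ k" for H
  proof (rule card_subset_eq)
    show "finite ?A" using fin by simp
    show sub: "H \<subseteq> ?A"
    proof
      fix h assume h: "h \<in> H"
      interpret H: group "G\<lparr>carrier := H\<rparr>" using subgroup.subgroup_is_group[OF H(1) is_group] .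
      have "h [^]\<^bsub>G\<lparr>carrier := H\<rparr>\<^esub> Coset.order (G\<lparr>carrier := H\<rparr>) = \<one>\<^bsub>G\<lparr>carrier := H\<rparr>\<^esub>" using h by (intro H.pow_order_eq_1) simp
      then have "h [^] ((2::nat) ^ k) = \<one>" using nat_pow_consistent[of h "2 ^ k" H] H(2) by (simp add: Coset.order_def)
      then show "h \<in> ?A" using h subgroup.subset[OF H(1)] by blast
    qed
    have "2 ^ r dvd Coset.order G" unfolding lagrange[OF torsion_subgroup, symmetric] card by (rule dvd_triv_right)
    then have "r \<le> k" unfolding k_def using ord by (intro multiplicity_geI) auto
    then have "card ?A \<le> card H" by (simp add: card H(2))
    then show "card H = card ?A" using card_mono[OF \<open>finite ?A\<close> sub] by simp
  qed
  have "\<exists>H. subgroup H G \<and> card H = 2 ^ k"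
    using sylow_thm[of 2 G k] multiplicity_dvd[of 2 "Coset.order G"] fin is_group by (auto simp: k_def elim!: dvdE)
  then show ?thesis using eq unfolding is_sylow_subgroup_def k_def by (intro the_equality) auto
qed

text \<open>An element of order \<open>2 ^ n\<close> with \<open>n \<ge> 2\<close> would have a
  power of order four. So only one factor 2 is left in the exponent.\<close>

lemma odd_exponent:
  assumes fin: "finite (carrier G)" and no4: "\<And>c. c \<in> carrier G \<Longrightarrow> c [^] (4::nat) = \<one> \<Longrightarrow> c [^] (2::nat) = \<one>"
  shows "c \<in> carrier G \<Longrightarrow> c [^] ((2::nat) ^ n) = \<one> \<Longrightarrow> c [^] (2::nat) = \<one>"
    and "\<exists>m::nat. odd m \<and> (\<forall>c\<in>carrier G. c [^] (2 * m) = \<one>)"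
proof -
  show two: "c \<in> carrier G \<Longrightarrow> c [^] ((2::nat) ^ n) = \<one> \<Longrightarrow> c [^] (2::nat) = \<one>" for c n
  proof (induction n arbitrary: c)
    case (Suc n)
    have "(c [^] (2::nat)) [^] ((2::nat) ^ n) = \<one>" using Suc.prems by (simp add: nat_pow_pow)
    then have "(c [^] (2::nat)) [^] (2::nat) = \<one>" using Suc by simp
    then show ?case using no4 Suc.prems by (simp add: nat_pow_pow)
  qed (use nat_pow_eone in auto)
  obtain k m where km: "Coset.order G = 2 ^ k * m" "odd m"
  proof -
    have "Coset.order G \<noteq> 0" "\<not> is_unit (2::nat)" using order_gt_0_iff_finite fin by auto
    then show ?thesis using multiplicity_decompose'[of "Coset.order G" 2] that by metis
  qed
  have "c [^] (2 * m) = \<one>" if c: "c \<in> carrier G" for c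
  proof -
    have "(c [^] m) [^] ((2::nat) ^ k) = \<one>" using pow_order_eq_1[OF c] unfolding nat_pow_pow[OF c] km(1) mult.commute[of m] .
    then have "(c [^] m) [^] (2::nat) = \<one>" by (rule two[OF nat_pow_closed[OF c]])
    then show ?thesis unfolding nat_pow_pow[OF c] mult.commute[of m] .
  qed
  then show "\<exists>m::nat. odd m \<and> (\<forall>c\<in>carrier G. c [^] (2 * m) = \<one>)" using km(2) by (intro exI[of _ m] conjI ballI)
qed

section \<open>Recognising small abelian 2-groups\<close>

lemma iso_of_inj_hom:
  assumes "h \<in> hom H G" "inj_on h (carrier H)" "card (carrier H) = card (carrier G)" "finite (carrier G)" "group H"
  shows "G \<cong> H"
proof -
  have "h ` carrier H = carrier G"
    using assms by (intro card_subset_eq) (auto simp: card_image hom_def)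
  then have "h \<in> iso H G" using assms by (simp add: iso_def bij_betw_def)
  then show ?thesis using group.iso_sym[OF assms(5)] by (auto simp: is_iso_def)
qed

lemma hom_integer_mod:
  assumes "x \<in> carrier G" "x [^] n = \<one>" "n > 0"
  shows "(\<lambda>a. x [^] a) \<in> hom (integer_mod_group n) G"
proof (rule homI)
  fix a b :: int
  have "x [^] (int n * ((a + b) div int n)) = \<one>" using assms by (simp add: int_pow_pow[symmetric] int_pow_int)
  moreover have "x [^] (a + b) = x [^] (int n * ((a + b) div int n)) \<otimes> x [^] ((a + b) mod int n)"
    using assms by (simp add: int_pow_mult[symmetric])
  ultimately have "x [^] (a + b) = x [^] ((a + b) mod int n)" using assms by simp
  then show "x [^] (a \<otimes>\<^bsub>integer_mod_group n\<^esub> b) = x [^] a \<otimes> x [^] b" using assms by (simp add: int_pow_mult)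
qed (use assms in auto)

lemma carrier_Z2: "carrier (integer_mod_group 2) = {0, 1}"
  by (auto simp: carrier_integer_mod_group)

text \<open>An involution outside the image adds one direct factor; the isomorphisms below are built
  by repeating this.\<close>

lemma hom_Z2_extend:
  assumes h: "h \<in> hom H G" "inj_on h (carrier H)" "group H"
    and y: "y \<in> carrier G" "y \<otimes> y = \<one>" "y \<notin> h ` carrier H"
  shows "(\<lambda>(a, b). y [^] (a :: int) \<otimes> h b) \<in> hom (integer_mod_group 2 \<times>\<times> H) G"
    and "inj_on (\<lambda>(a, b). y [^] (a :: int) \<otimes> h b) (carrier (integer_mod_group 2 \<times>\<times> H))"
proof -
  interpret h: group_hom H G h using h is_group by (simp add: group_hom_def group_hom_axioms_def)
  have y2: "y [^] (2::nat) = \<one>" using y by (simp add: numeral_2_eq_2)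
  have hy: "(\<lambda>a. y [^] a) \<in> hom (integer_mod_group 2) G" using hom_integer_mod[OF y(1) y2] by simp
  show hom: "(\<lambda>(a, b). y [^] (a :: int) \<otimes> h b) \<in> hom (integer_mod_group 2 \<times>\<times> H) G"
  proof (rule homI)
    fix u v assume uv: "u \<in> carrier (integer_mod_group 2 \<times>\<times> H)" "v \<in> carrier (integer_mod_group 2 \<times>\<times> H)"
    obtain a b a' b' where e: "u = (a, b)" "v = (a', b')" by (cases u; cases v)
    have c: "b \<in> carrier H" "b' \<in> carrier H" using uv e by auto
    have ha: "y [^] (a \<otimes>\<^bsub>integer_mod_group 2\<^esub> a') = y [^] a \<otimes> y [^] a'" using hy uv e by (auto simp: hom_def)
    show "(case u \<otimes>\<^bsub>integer_mod_group 2 \<times>\<times> H\<^esub> v of (a, b) \<Rightarrow> y [^] a \<otimes> h b)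
        = (case u of (a, b) \<Rightarrow> y [^] a \<otimes> h b) \<otimes> (case v of (a, b) \<Rightarrow> y [^] a \<otimes> h b)"
      using c y(1) by (simp add: e ha[simplified] m_ac)
  qed (use y in auto)
  have "group (integer_mod_group 2 \<times>\<times> H)" using h(3) by (intro DirProd_group) auto
  then interpret f: group_hom "integer_mod_group 2 \<times>\<times> H" G "\<lambda>(a, b). y [^] (a :: int) \<otimes> h b"
    using hom is_group by (simp add: group_hom_def group_hom_axioms_def)
  show "inj_on (\<lambda>(a, b). y [^] (a :: int) \<otimes> h b) (carrier (integer_mod_group 2 \<times>\<times> H))"
  proof (rule f.trivial_ker_imp_inj)
    have "a = 0 \<and> b = \<one>\<^bsub>H\<^esub>" if ab: "a \<in> {0, 1}" "b \<in> carrier H" "y [^] (a :: int) \<otimes> h b = \<one>" for a b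
    proof (cases "a = 0")
      case True
      then have "h b = h \<one>\<^bsub>H\<^esub>" using ab by simp
      then show ?thesis using True inj_onD[OF h(2) _ ab(2) h.G.one_closed] by simp
    next
      case False
      then have "y \<otimes> h b = \<one>" using ab y by simp
      then have "y = inv (h b)" using ab(2) y(1) by (metis h.hom_closed inv_equality)
      also have "\<dots> = h (inv\<^bsub>H\<^esub> b)" using ab(2) by simp
      finally show ?thesis using y(3) ab(2) by blast
    qed
    then show "kernel (integer_mod_group 2 \<times>\<times> H) G (\<lambda>(a, b). y [^] a \<otimes> h b) = {\<one>\<^bsub>integer_mod_group 2 \<times>\<times> H\<^esub>}"
      unfolding kernel_def carrier_DirProd carrier_Z2 by auto
  qed
qed

lemma hom_Z2:
  assumes "x \<in> carrier G" "x \<otimes> x = \<one>" "x \<noteq> \<one>"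
  shows "(\<lambda>a. x [^] (a :: int)) \<in> hom (integer_mod_group 2) G" "inj_on (\<lambda>a. x [^] (a :: int)) (carrier (integer_mod_group 2))"
proof -
  have "x [^] (2::nat) = \<one>" using assms by (simp add: numeral_2_eq_2)
  then show "(\<lambda>a. x [^] (a :: int)) \<in> hom (integer_mod_group 2) G" using hom_integer_mod assms by simp
  show "inj_on (\<lambda>a. x [^] (a :: int)) (carrier (integer_mod_group 2))"
    unfolding carrier_Z2 using assms by (auto simp: inj_on_def)
qed

lemma exists_not_mem: "finite (carrier G) \<Longrightarrow> finite S \<Longrightarrow> card S < card (carrier G) \<Longrightarrow> \<exists>x\<in>carrier G. x \<notin> S"
  by (meson card_mono leD subsetI)

lemma iso_Z2_Z2:
  assumes exp: "\<And>c. c \<in> carrier G \<Longrightarrow> c \<otimes> c = \<one>" and card: "card (carrier G) = 4"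
  shows "G \<cong> integer_mod_group 2 \<times>\<times> integer_mod_group 2"
proof -
  have fin: "finite (carrier G)" using card card.infinite by force
  obtain x where x: "x \<in> carrier G" "x \<noteq> \<one>" using exists_not_mem[OF fin, of "{\<one>}"] card by auto
  have "card ((\<lambda>a. x [^] (a :: int)) ` carrier (integer_mod_group 2)) \<le> 2"
    using card_image_le[of "{0, 1}" "\<lambda>a. x [^] (a :: int)"] by (simp add: carrier_Z2)
  then obtain y where y: "y \<in> carrier G" "y \<notin> (\<lambda>a. x [^] (a :: int)) ` carrier (integer_mod_group 2)"
    using exists_not_mem[OF fin, of "(\<lambda>a. x [^] (a :: int)) ` carrier (integer_mod_group 2)"] card by (auto simp: carrier_Z2)
  show ?thesis
    by (rule iso_of_inj_hom[OF hom_Z2_extend[OF hom_Z2 _ y(1) exp y(2)]])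
      (use x y exp fin card in \<open>auto simp: card_cartesian_product carrier_Z2 intro: DirProd_group\<close>)
qed

lemma iso_Z2_Z2_Z2:
  assumes exp: "\<And>c. c \<in> carrier G \<Longrightarrow> c \<otimes> c = \<one>" and card: "card (carrier G) = 8"
  shows "G \<cong> integer_mod_group 2 \<times>\<times> integer_mod_group 2 \<times>\<times> integer_mod_group 2"
proof -
  have fin: "finite (carrier G)" using card card.infinite by force
  obtain x where x: "x \<in> carrier G" "x \<noteq> \<one>" using exists_not_mem[OF fin, of "{\<one>}"] card by auto
  define f where "f = (\<lambda>a. x [^] (a :: int))"
  have f: "f \<in> hom (integer_mod_group 2) G" "inj_on f (carrier (integer_mod_group 2))" "group (integer_mod_group 2)"
    using hom_Z2[OF x(1) exp[OF x(1)] x(2)] by (auto simp: f_def)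
  have "card (f ` carrier (integer_mod_group 2)) = 2" using f(2) by (simp add: card_image carrier_Z2)
  then obtain y where y: "y \<in> carrier G" "y \<notin> f ` carrier (integer_mod_group 2)"
    using exists_not_mem[OF fin, of "f ` carrier (integer_mod_group 2)"] card by (auto simp: carrier_Z2)
  define g where "g = (\<lambda>(a, b). y [^] (a :: int) \<otimes> f b)"
  have g: "g \<in> hom (integer_mod_group 2 \<times>\<times> integer_mod_group 2) G"
    "inj_on g (carrier (integer_mod_group 2 \<times>\<times> integer_mod_group 2))" "group (integer_mod_group 2 \<times>\<times> integer_mod_group 2)"
    using hom_Z2_extend[OF f y(1) exp[OF y(1)] y(2)] f(3) by (auto simp: g_def intro: DirProd_group)
  have c4: "card (g ` carrier (integer_mod_group 2 \<times>\<times> integer_mod_group 2)) = 4"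
    using g(2) by (simp add: card_image carrier_Z2 card_cartesian_product)
  obtain z where z: "z \<in> carrier G" "z \<notin> g ` carrier (integer_mod_group 2 \<times>\<times> integer_mod_group 2)"
    using exists_not_mem[OF fin _, of "g ` carrier (integer_mod_group 2 \<times>\<times> integer_mod_group 2)"] card
    unfolding c4 by (auto simp: carrier_Z2)
  show ?thesis
    by (rule iso_of_inj_hom[OF hom_Z2_extend[OF g z(1) exp z(2)]])
      (use z g fin card in \<open>auto simp: card_cartesian_product carrier_Z2 intro: DirProd_group\<close>)
qed

text \<open>With \<open>t = x \<otimes> x\<close> the involutions are exhausted by \<open>t\<close>,
  \<open>y\<close> and \<open>y \<otimes> t\<close>. A square is 1 or \<open>t\<close>: it is not
  \<open>y\<close>, and if \<open>c\<close> had square \<open>y \<otimes> t\<close> then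
  \<open>c \<otimes> x\<close> would have square \<open>y\<close>. So the group is the union of the
  two cosets of its 2-torsion given by 1 and \<open>x\<close>.\<close>

lemma iso_Z2_Z4:
  assumes exp: "\<And>c. c \<in> carrier G \<Longrightarrow> c [^] (4::nat) = \<one>"
    and fin: "finite {c \<in> carrier G. c \<otimes> c = \<one>}" and card: "card {c \<in> carrier G. c \<otimes> c = \<one>} \<le> 4"
    and y: "y \<in> carrier G" "y \<otimes> y = \<one>" "\<And>c. c \<in> carrier G \<Longrightarrow> c \<otimes> c \<noteq> y"
    and x: "x \<in> carrier G" "x \<otimes> x \<noteq> \<one>"
  shows "card (carrier G) = 8" "G \<cong> integer_mod_group 2 \<times>\<times> integer_mod_group 4"
proof -
  define t where "t = x \<otimes> x"
  define T where "T = {c \<in> carrier G. c \<otimes> c = \<one>}"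
  have pow4: "c [^] (4::nat) = (c \<otimes> c) \<otimes> (c \<otimes> c)" if "c \<in> carrier G" for c
    using that by (simp add: numeral_eq_Suc m_assoc)
  have sq: "(c \<otimes> c) \<otimes> (c \<otimes> c) = \<one>" if "c \<in> carrier G" for c using exp[OF that] pow4[OF that] by simp
  have t: "t \<in> carrier G" "t \<otimes> t = \<one>" "t \<noteq> \<one>" "t \<noteq> y" using x sq y(3) by (auto simp: t_def)
  have y1: "y \<noteq> \<one>" using y(3)[of \<one>] by auto
  have yt: "y \<otimes> t \<noteq> \<one>" "y \<otimes> t \<noteq> y" "y \<otimes> t \<noteq> t"
  proof -
    show "y \<otimes> t \<noteq> \<one>"
    proof
      assume "y \<otimes> t = \<one>"
      then have "y \<otimes> t = t \<otimes> t" using t by simp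
      then show False using y(1) t r_cancel by metis
    qed
    show "y \<otimes> t \<noteq> y" using y(1) t by simp
    show "y \<otimes> t \<noteq> t" using y(1) t y1 by simp
  qed
  have "card {\<one>, t, y, y \<otimes> t} = 4" using t y1 yt by auto
  moreover have "{\<one>, t, y, y \<otimes> t} \<subseteq> T" using t y by (auto simp: T_def m_ac)
  ultimately have T: "T = {\<one>, t, y, y \<otimes> t}" using card fin unfolding T_def[symmetric] by (metis card_seteq)
  have sqT: "c \<otimes> c = \<one> \<or> c \<otimes> c = t" if c: "c \<in> carrier G" for c
  proof -
    have "c \<otimes> c \<in> T" using c sq by (simp add: T_def)
    moreover have "c \<otimes> c \<noteq> y \<otimes> t"
    proof
      assume "c \<otimes> c = y \<otimes> t"
      moreover have "(c \<otimes> x) \<otimes> (c \<otimes> x) = (c \<otimes> c) \<otimes> t" using c x by (simp add: t_def m_ac)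
      ultimately have "(c \<otimes> x) \<otimes> (c \<otimes> x) = y" using y t by (simp add: m_assoc)
      then show False using y(3) c x by blast
    qed
    ultimately show ?thesis using T y(3)[OF c] by auto
  qed
  have car: "carrier G = T \<union> (\<lambda>c. x \<otimes> c) ` T"
  proof
    show "carrier G \<subseteq> T \<union> (\<lambda>c. x \<otimes> c) ` T"
    proof
      fix c assume c: "c \<in> carrier G"
      show "c \<in> T \<union> (\<lambda>c. x \<otimes> c) ` T"
      proof (cases "c \<otimes> c = \<one>")
        case False
        then have "c \<otimes> c = t" using sqT c by blast
        define u where "u = x \<otimes> t \<otimes> c"
        have "u \<otimes> u = (x \<otimes> x) \<otimes> (t \<otimes> t) \<otimes> (c \<otimes> c)" unfolding u_def using x(1) t(1) c by (simp only: m_ac m_closed)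
        then have "u \<otimes> u = \<one>" using \<open>c \<otimes> c = t\<close> t by (simp add: t_def[symmetric])
        moreover have "x \<otimes> u = c"
        proof -
          have "x \<otimes> u = (x \<otimes> x) \<otimes> t \<otimes> c" using x t c by (simp add: u_def m_ac)
          then show ?thesis using t c by (simp add: t_def[symmetric])
        qed
        moreover have "u \<in> carrier G" using x t c by (simp add: u_def)
        ultimately show ?thesis by (auto simp: T_def)
      qed (use c in \<open>auto simp: T_def\<close>)
    qed
  qed (use x in \<open>auto simp: T_def\<close>)
  have "T \<inter> (\<lambda>c. x \<otimes> c) ` T = {}"
  proof -
    have False if c: "c \<in> carrier G" "c \<otimes> c = \<one>" "(x \<otimes> c) \<otimes> (x \<otimes> c) = \<one>" for c
    proof -
      have "(x \<otimes> c) \<otimes> (x \<otimes> c) = t \<otimes> (c \<otimes> c)" unfolding t_def using c(1) x(1) by (simp only: m_ac m_closed)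
      then show False using c(2,3) t by simp
    qed
    then show ?thesis by (auto simp: T_def)
  qed
  moreover have "card T = 4" using T \<open>card {\<one>, t, y, y \<otimes> t} = 4\<close> by simp
  moreover have "card ((\<lambda>c. x \<otimes> c) ` T) = card T" using x by (intro card_image inj_onI) (auto simp: T_def)
  moreover have "finite T" using fin by (simp add: T_def)
  ultimately show card8: "card (carrier G) = 8" unfolding car by (subst card_Un_disjoint) auto
  have finG: "finite (carrier G)" using card8 card.infinite by force
  define g where "g = (\<lambda>a. x [^] (a :: int))"
  have carrier4: "carrier (integer_mod_group 4) = {0, 1, 2, 3}" by (auto simp: carrier_integer_mod_group)
  have "x [^] (2::int) = t" "x [^] (3::int) = x \<otimes> t"
  proof -
    have "x [^] (2::int) = x [^] (2::nat)" "x [^] (3::int) = x [^] (3::nat)"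
      using int_pow_int[of G x 2] int_pow_int[of G x 3] by auto
    then show "x [^] (2::int) = t" "x [^] (3::int) = x \<otimes> t" using x by (auto simp: numeral_eq_Suc t_def m_assoc)
  qed
  then have gv: "g 0 = \<one>" "g 1 = x" "g 2 = t" "g 3 = x \<otimes> t" using x by (auto simp: g_def)
  have ne: "x \<noteq> \<one>" "x \<noteq> t" "x \<otimes> t \<noteq> \<one>" "x \<otimes> t \<noteq> x" "x \<otimes> t \<noteq> t"
  proof -
    show "x \<noteq> \<one>" "x \<noteq> t" using x t by (auto simp: t_def)
    show "x \<otimes> t \<noteq> x" "x \<otimes> t \<noteq> t" using x(1) t \<open>x \<noteq> \<one>\<close> by simp_all
    show "x \<otimes> t \<noteq> \<one>"
    proof
      assume "x \<otimes> t = \<one>"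
      then have "x \<otimes> t = t \<otimes> t" using t by simp
      then show False using x t \<open>x \<noteq> t\<close> r_cancel by metis
    qed
  qed
  have g: "g \<in> hom (integer_mod_group 4) G" unfolding g_def using hom_integer_mod[OF x(1) exp[OF x(1)]] by simp
  have inj: "inj_on g (carrier (integer_mod_group 4))"
    unfolding carrier4 using ne t(3) ne[symmetric] t(3)[symmetric] by (auto simp: inj_on_def gv)
  have "y \<notin> g ` carrier (integer_mod_group 4)"
  proof -
    have "y \<noteq> x" using y x by auto
    moreover have "y \<noteq> x \<otimes> t"
    proof
      assume "y = x \<otimes> t"
      then have "y \<otimes> y = (x \<otimes> x) \<otimes> (t \<otimes> t)" using x(1) t(1) by (simp only: m_ac m_closed)
      then show False using y(2) t by (simp add: t_def[symmetric])
    qed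
    ultimately show ?thesis using y1 t(4) by (auto simp: carrier4 gv)
  qed
  from hom_Z2_extend[OF g inj group_integer_mod_group y(1,2) this]
  show "G \<cong> integer_mod_group 2 \<times>\<times> integer_mod_group 4"
    by (rule iso_of_inj_hom) (use finG card8 in \<open>auto simp: card_cartesian_product carrier_Z2 carrier4 intro: DirProd_group\<close>)
qed

end

subsection \<open>The fields \<open>\<rat>(\<surd>d)\<close> and \<open>\<rat>(\<surd>(2d))\<close>\<close>

text \<open>The truth value \<open>a\<^sub>i\<^sub>j\<close> says that \<open>q\<^sub>i\<close> is a square modulo \<open>q\<^sub>j\<close>, and \<open>s\<^sub>i\<close> that \<open>q\<^sub>i\<close>
  belongs to a given set \<open>S\<close> of ramified primes, with \<open>s\<^sub>0\<close> for the prime \<open>2\<close>, which is ramified iff \<open>r\<close>. Then \<open>norm_bits\<close> is the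
  condition modulo each \<open>q\<^sub>i\<close> for \<open>\<Prod>S\<close> (if \<open>e\<close>) or \<open>-\<Prod>S\<close> (otherwise) to be a norm.\<close>

definition four_bits :: "bool \<Rightarrow> bool \<Rightarrow> bool \<Rightarrow> bool \<Rightarrow> bool \<Rightarrow> bool \<Rightarrow> bool" where
  "four_bits a12 a13 a14 a23 a24 a34 \<longleftrightarrow>
     (a13 \<and> a23 \<and> \<not> a24 \<and> \<not> a14 \<and> a34) \<or>
     (\<not> a13 \<and> \<not> a23 \<and> a24 \<and> a14 \<and> \<not> a34) \<or>
     (a13 \<noteq> a23 \<and> a14 \<noteq> a24 \<and> a23 = a14 \<and> a14 = a34) \<or>
     (a13 = a23 \<and> a14 \<noteq> a24 \<and> a23 = a24 \<and> a12 \<noteq> a34) \<or>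
     (a13 \<noteq> a23 \<and> a14 = a24 \<and> a23 = a14 \<and> a12 = a34) \<or>
     (a13 \<and> a23 \<and> a14 \<and> \<not> a24 \<and> \<not> a12) \<or>
     (\<not> a13 \<and> \<not> a23 \<and> \<not> a14 \<and> a24 \<and> a12 \<and> a34) \<or>
     (a13 \<and> \<not> a23 \<and> a14 \<and> a24 \<and> \<not> a12) \<or>
     (\<not> a13 \<and> a23 \<and> \<not> a14 \<and> \<not> a24 \<and> a12 \<and> \<not> a34)"

definition norm_bits ::
  "bool \<Rightarrow> bool \<Rightarrow> bool \<Rightarrow> bool \<Rightarrow> bool \<Rightarrow> bool \<Rightarrow> bool \<Rightarrow> bool \<Rightarrow> bool \<Rightarrow> bool \<Rightarrow> bool \<Rightarrow> bool \<Rightarrow> bool \<Rightarrow> bool" where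
  "norm_bits r a12 a13 a14 a23 a24 a34 e s0 s1 s2 s3 s4 \<longleftrightarrow>
     ((e \<noteq> s1) = ((s2 \<noteq> s1 \<longrightarrow> \<not> a12) = ((s3 \<noteq> s1 \<longrightarrow> \<not> a13) = (s4 \<noteq> s1 \<longrightarrow> \<not> a14)))) \<and>
     ((e \<noteq> s2) = (\<not> (r \<and> s0 \<noteq> s2) = ((s1 \<noteq> s2 \<longrightarrow> a12) = ((s3 \<noteq> s2 \<longrightarrow> \<not> a23) = (s4 \<noteq> s2 \<longrightarrow> \<not> a24))))) \<and>
     ((e \<noteq> s3) = (\<not> (r \<and> s0 \<noteq> s3) = ((s1 \<noteq> s3 \<longrightarrow> a13) = ((s2 \<noteq> s3 \<longrightarrow> a23) = (s4 \<noteq> s3 \<longrightarrow> \<not> a34))))) \<and>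
     ((e \<noteq> s4) = (\<not> (r \<and> s0 \<noteq> s4) = ((s1 \<noteq> s4 \<longrightarrow> a14) = ((s2 \<noteq> s4 \<longrightarrow> a24) = (s3 \<noteq> s4 \<longrightarrow> a34)))))"

text \<open>In every configuration there is, besides the empty and the full set, at most one norm
  set up to complement; the conclusion says that \<open>s\<close> and \<open>t\<close> agree
  everywhere or nowhere. The nine cases enter the argument only through this and the next three
  propositional facts.\<close>

lemma norm_bits_rank:
  assumes "four_bits a12 a13 a14 a23 a24 a34"
    and "norm_bits False a12 a13 a14 a23 a24 a34 e False s1 s2 s3 s4" "norm_bits False a12 a13 a14 a23 a24 a34 e' False t1 t2 t3 t4"
    and "\<not> (s1 = s2 \<and> s2 = s3 \<and> s3 = s4)" "\<not> (t1 = t2 \<and> t2 = t3 \<and> t3 = t4)"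
  shows "(s1 = t1) = (s2 = t2) \<and> (s2 = t2) = (s3 = t3) \<and> (s3 = t3) = (s4 = t4)"
  using assms unfolding four_bits_def norm_bits_def by argo

lemma norm_bits_rank_2:
  assumes "four_bits a12 a13 a14 a23 a24 a34"
    and "norm_bits True a12 a13 a14 a23 a24 a34 e s0 s1 s2 s3 s4" "norm_bits True a12 a13 a14 a23 a24 a34 e' t0 t1 t2 t3 t4"
    and "\<not> (s0 = s1 \<and> s1 = s2 \<and> s2 = s3 \<and> s3 = s4)" "\<not> (t0 = t1 \<and> t1 = t2 \<and> t2 = t3 \<and> t3 = t4)"
  shows "(s0 = t0) = (s1 = t1) \<and> (s1 = t1) = (s2 = t2) \<and> (s2 = t2) = (s3 = t3) \<and> (s3 = t3) = (s4 = t4)"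
  using assms unfolding four_bits_def norm_bits_def by argo

text \<open>Needed in the biquadratic field: after the prime 2 is dropped, a relation from
  \<open>Q(sqrt (2 d))\<close> must be new modulo the relations from
  \<open>Q(sqrt d)\<close>.\<close>

lemma norm_bits_independent:
  assumes "four_bits a12 a13 a14 a23 a24 a34"
    and "norm_bits False a12 a13 a14 a23 a24 a34 e False s1 s2 s3 s4" "norm_bits True a12 a13 a14 a23 a24 a34 e' t0 t1 t2 t3 t4"
    and "\<not> (s1 = s2 \<and> s2 = s3 \<and> s3 = s4)" "\<not> (t0 = t1 \<and> t1 = t2 \<and> t2 = t3 \<and> t3 = t4)"
  shows "\<not> (t1 = t2 \<and> t2 = t3 \<and> t3 = t4)" "\<not> ((s1 = t1) = (s2 = t2) \<and> (s2 = t2) = (s3 = t3) \<and> (s3 = t3) = (s4 = t4))"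
  using assms unfolding four_bits_def norm_bits_def by argo+

lemma norm_bits_q1: "four_bits a12 a13 a14 a23 a24 a34 \<Longrightarrow> \<not> norm_bits False a12 a13 a14 a23 a24 a34 e False True False False False"
  unfolding four_bits_def norm_bits_def by argo

section \<open>From Legendre symbols to truth values\<close>

lemma prod_if_subset:
  assumes "finite P" "T \<subseteq> P"
  shows "\<Prod>T = (\<Prod>p\<in>P. if p \<in> T then p else (1 :: int))"
proof -
  have "(\<Prod>p\<in>P. if p \<in> T then p else (1 :: int)) = \<Prod>(P \<inter> T)" by (rule prod.inter_restrict[OF assms(1), symmetric])
  then show ?thesis using assms(2) by (simp add: Int_absorb1)
qed

text \<open>Gives both cases of \<open>norm_set_Legendre\<close> one shape: at \<open>q\<close>
  exactly the primes on the other side of \<open>S\<close> count, and the sign changes when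
  \<open>q\<close> is in \<open>S\<close>.\<close>

lemma (in ramified_quadratic) norm_set_bits:
  assumes S: "S \<subseteq> Pr" and norm: "norm_set S"
  shows "\<exists>e\<in>{1, -1}. \<forall>q\<in>Pr. Legendre ((if q \<in> S then - e else e) * (\<Prod>p\<in>Pr - {q}. if (p \<in> S) \<noteq> (q \<in> S) then p else 1)) q = 1"
proof -
  obtain e where e: "e \<in> {1, -1}"
    "\<And>q. q \<in> Pr \<Longrightarrow> (q \<notin> S \<longrightarrow> Legendre (e * \<Prod>S) q = 1) \<and> (q \<in> S \<longrightarrow> Legendre (- e * \<Prod>(Pr - S)) q = 1)"
    using norm_set_Legendre[OF S norm] by blast
  have "Legendre ((if q \<in> S then - e else e) * (\<Prod>p\<in>Pr - {q}. if (p \<in> S) \<noteq> (q \<in> S) then p else 1)) q = 1"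
    if q: "q \<in> Pr" for q
  proof (cases "q \<in> S")
    case True
    have "\<Prod>(Pr - S) = (\<Prod>p\<in>Pr - {q}. if p \<in> Pr - S then p else 1)"
      using fin True by (intro prod_if_subset) auto
    also have "\<dots> = (\<Prod>p\<in>Pr - {q}. if (p \<in> S) \<noteq> (q \<in> S) then p else 1)" using True by (intro prod.cong) auto
    finally show ?thesis using e(2)[OF q] True by simp
  next
    case False
    have "\<Prod>S = (\<Prod>p\<in>Pr - {q}. if p \<in> S then p else 1)"
      using fin False S by (intro prod_if_subset) auto
    also have "\<dots> = (\<Prod>p\<in>Pr - {q}. if (p \<in> S) \<noteq> (q \<in> S) then p else 1)" using False by (intro prod.cong) auto
    finally show ?thesis using e(2)[OF q] False by simp
  qed
  then show ?thesis using e(1) by blast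
qed

text \<open>A product of signs is 1 iff the nested equivalence of their truth values holds. The sign
  \<open>e\<close> is its own symbol because -1 is a nonresidue.\<close>

lemma Legendre_product_bits:
  fixes p :: int
  assumes p: "Factorial_Ring.prime p" "p > 2" "p mod 4 = 3" and e: "e = 1 \<or> e = -1"
    and x: "\<not> p dvd x0" "\<not> p dvd x1" "\<not> p dvd x2" "\<not> p dvd x3"
  shows "Legendre (e * ((if b0 then x0 else 1) * ((if b1 then x1 else 1) * ((if b2 then x2 else 1) * (if b3 then x3 else 1))))) p = 1
    \<longleftrightarrow> (e = 1) = ((b0 \<longrightarrow> Legendre x0 p = 1) = ((b1 \<longrightarrow> Legendre x1 p = 1) = ((b2 \<longrightarrow> Legendre x2 p = 1) = (b3 \<longrightarrow> Legendre x3 p = 1))))"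
proof -
  have five_signs: "v * (w0 * (w1 * (w2 * w3))) = 1 \<longleftrightarrow> (v = 1) = ((w0 = 1) = ((w1 = 1) = ((w2 = 1) = (w3 = 1))))"
    if "v = 1 \<or> v = -1" "w0 = 1 \<or> w0 = -1" "w1 = 1 \<or> w1 = -1" "w2 = 1 \<or> w2 = -1" "w3 = 1 \<or> w3 = -1" for v w0 w1 w2 w3 :: int
    using that by (elim disjE; simp)
  have v: "Legendre (if b then x else 1) p = 1 \<longleftrightarrow> (b \<longrightarrow> Legendre x p = 1)"
    "Legendre (if b then x else 1) p = 1 \<or> Legendre (if b then x else 1) p = -1" if "\<not> p dvd x" for b x
    using Legendre_values[OF that] p(2) by auto
  have ve: "Legendre e p = 1 \<longleftrightarrow> e = 1" "Legendre e p = 1 \<or> Legendre e p = -1"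
    using e p(2) Legendre_minus_one[OF p] by auto
  show ?thesis
    unfolding Legendre_mult[OF p(1,2)] five_signs[OF ve(2) v(2)[OF x(1)] v(2)[OF x(2)] v(2)[OF x(3)] v(2)[OF x(4)]]
      v(1)[OF x(1)] v(1)[OF x(2)] v(1)[OF x(3)] v(1)[OF x(4)] ve(1) ..
qed

lemma (in real_quadratic) norm_not_minus_one_of_prime:
  assumes q: "Factorial_Ring.prime q" "q > 2" "q mod 4 = 3" and D: "D = q * D'" "\<not> q dvd D'" and x: "x \<in> L"
  shows "nm x \<noteq> - 1"
proof
  assume "nm x = -1"
  then obtain xx yy zz where eq: "zz \<noteq> 0" "xx ^ 2 - D * yy ^ 2 = - 1 * zz ^ 2" using norm_integers[OF x, of "-1"] by auto
  have "\<not> q dvd - 1" using q(2) zdvd_not_zless[of 1 q] by auto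
  then have "Legendre (- 1) q = 1" by (rule norm_form_Legendre[OF q(1) D(2) _ eq(2)[unfolded D(1)] eq(1)])
  then show False using Legendre_minus_one[OF q] by simp
qed

lemma nonsquare_of_prime:
  fixes q :: int
  assumes "Factorial_Ring.prime q" "D = q * D'" "\<not> q dvd D'"
  shows "D \<noteq> n ^ 2"
proof
  assume *: "D = n ^ 2"
  then have "q dvd n ^ 2" using assms(2) by (metis dvd_triv_left)
  then have "q dvd n" using assms(1) prime_dvd_power_int by blast
  then obtain m where "n = q * m" by (elim dvdE)
  then have "q * D' = q * (q * m ^ 2)" using * assms(2) by (simp add: power2_eq_square mult_ac)
  then have "D' = q * m ^ 2" using assms(1) by simp
  then show False using assms(3) by simp
qed

locale four_primes =
  fixes q1 q2 q3 q4 d :: int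
  assumes primes: "Factorial_Ring.prime q1" "Factorial_Ring.prime q2" "Factorial_Ring.prime q3" "Factorial_Ring.prime q4"
    and dist: "q1 \<noteq> q2" "q1 \<noteq> q3" "q1 \<noteq> q4" "q2 \<noteq> q3" "q2 \<noteq> q4" "q3 \<noteq> q4"
    and cong: "[q1 = 7] (mod 8)" "[q2 = 3] (mod 8)" "[q3 = 3] (mod 8)" "[q4 = 3] (mod 8)"
    and d: "d = q1 * q2 * q3 * q4"
begin

lemma mod8: "q1 mod 8 = 7" "q2 mod 8 = 3" "q3 mod 8 = 3" "q4 mod 8 = 3"
  using cong by (auto simp: cong_def)

lemma mod4: "q1 mod 4 = 3" "q2 mod 4 = 3" "q3 mod 4 = 3" "q4 mod 4 = 3"
  using mod8 by presburger+

lemma gt_2: "q1 > 2" "q2 > 2" "q3 > 2" "q4 > 2"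
  using primes[THEN prime_ge_2_int] mod8 by (auto simp: order_le_less)

lemma q_ne: "q1 \<noteq> 2" "q2 \<noteq> 2" "q3 \<noteq> 2" "q4 \<noteq> 2" "2 \<noteq> q1" "2 \<noteq> q2" "2 \<noteq> q3" "2 \<noteq> q4" using gt_2 by auto

lemma not_dvd: "p \<in> {2, q1, q2, q3, q4} \<Longrightarrow> q \<in> {2, q1, q2, q3, q4} \<Longrightarrow> p \<noteq> q \<Longrightarrow> \<not> p dvd q"
  using primes_dvd_imp_eq[of p q] primes by auto

lemma Legendre_pm:
  "p \<in> {q1, q2, q3, q4} \<Longrightarrow> q \<in> {q1, q2, q3, q4} \<Longrightarrow> p \<noteq> q \<Longrightarrow> Legendre q p = 1 \<or> Legendre q p = -1"
  by (rule Legendre_values) (use not_dvd in auto)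

lemma flips:
  "Legendre q2 q1 = - Legendre q1 q2" "Legendre q3 q1 = - Legendre q1 q3" "Legendre q4 q1 = - Legendre q1 q4"
  "Legendre q3 q2 = - Legendre q2 q3" "Legendre q4 q2 = - Legendre q2 q4" "Legendre q4 q3 = - Legendre q3 q4"
  by (rule Legendre_flip; fact primes gt_2 mod4 dist)+

lemma pm: "Legendre q1 q2 = 1 \<or> Legendre q1 q2 = -1" "Legendre q1 q3 = 1 \<or> Legendre q1 q3 = -1" "Legendre q1 q4 = 1 \<or> Legendre q1 q4 = -1"
    "Legendre q2 q3 = 1 \<or> Legendre q2 q3 = -1" "Legendre q2 q4 = 1 \<or> Legendre q2 q4 = -1" "Legendre q3 q4 = 1 \<or> Legendre q3 q4 = -1"
  by (rule Legendre_pm[OF _ _ dist(1)[symmetric]] Legendre_pm[OF _ _ dist(2)[symmetric]] Legendre_pm[OF _ _ dist(3)[symmetric]]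
      Legendre_pm[OF _ _ dist(4)[symmetric]] Legendre_pm[OF _ _ dist(5)[symmetric]] Legendre_pm[OF _ _ dist(6)[symmetric]]; blast)+

lemma flip_bits:
  "Legendre q2 q1 = 1 \<longleftrightarrow> \<not> Legendre q1 q2 = 1" "Legendre q3 q1 = 1 \<longleftrightarrow> \<not> Legendre q1 q3 = 1"
  "Legendre q4 q1 = 1 \<longleftrightarrow> \<not> Legendre q1 q4 = 1" "Legendre q3 q2 = 1 \<longleftrightarrow> \<not> Legendre q2 q3 = 1"
  "Legendre q4 q2 = 1 \<longleftrightarrow> \<not> Legendre q2 q4 = 1" "Legendre q4 q3 = 1 \<longleftrightarrow> \<not> Legendre q3 q4 = 1"
proof -
  have *: "y = 1 \<longleftrightarrow> \<not> x = 1" if "x = 1 \<or> x = -1" "y = - x" for x y :: int using that by auto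
  show "Legendre q2 q1 = 1 \<longleftrightarrow> \<not> Legendre q1 q2 = 1" by (rule *[OF pm(1) flips(1)])
  show "Legendre q3 q1 = 1 \<longleftrightarrow> \<not> Legendre q1 q3 = 1" by (rule *[OF pm(2) flips(2)])
  show "Legendre q4 q1 = 1 \<longleftrightarrow> \<not> Legendre q1 q4 = 1" by (rule *[OF pm(3) flips(3)])
  show "Legendre q3 q2 = 1 \<longleftrightarrow> \<not> Legendre q2 q3 = 1" by (rule *[OF pm(4) flips(4)])
  show "Legendre q4 q2 = 1 \<longleftrightarrow> \<not> Legendre q2 q4 = 1" by (rule *[OF pm(5) flips(5)])
  show "Legendre q4 q3 = 1 \<longleftrightarrow> \<not> Legendre q3 q4 = 1" by (rule *[OF pm(6) flips(6)])
qed

lemma Legendre_2: "Legendre 2 q1 = 1" "Legendre 2 q2 = -1" "Legendre 2 q3 = -1" "Legendre 2 q4 = -1"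
  using Legendre_two[OF primes(1) gt_2(1)] Legendre_two[OF primes(2) gt_2(2)] Legendre_two[OF primes(3) gt_2(3)]
    Legendre_two[OF primes(4) gt_2(4)] mod8 by auto

definition sd :: complex where "sd = complex_of_real (sqrt (real_of_int d))"
definition sd' :: complex where "sd' = complex_of_real (sqrt (real_of_int (2 * d)))"

lemma sd'_eq: "sd' = sqrt2 * sd" by (simp add: sd_def sd'_def sqrt2_def real_sqrt_mult)

abbreviation Pr :: "int set" where "Pr \<equiv> {q1, q2, q3, q4}"
abbreviation Pr' :: "int set" where "Pr' \<equiv> {2, q1, q2, q3, q4}"

lemma d_split: "d = q1 * (q2 * q3 * q4)" "\<not> q1 dvd q2 * q3 * q4" "2 * d = q1 * (2 * (q2 * q3 * q4))"
  "\<not> q1 dvd 2 * (q2 * q3 * q4)"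
  using primes(1) not_dvd[of q1] dist q_ne by (auto simp: d prime_dvd_mult_iff)

lemma d_pos: "d > 0" using gt_2 by (simp add: d)

sublocale K: real_quadratic d sd
  by unfold_locales (use d_pos nonsquare_of_prime[OF primes(1) d_split(1,2)] in \<open>simp_all add: sd_def\<close>)

sublocale K': real_quadratic "2 * d" sd'
  by unfold_locales (use d_pos nonsquare_of_prime[OF primes(1) d_split(3,4)] in \<open>simp_all add: sd'_def\<close>)

lemma Pr_prime: "p \<in> Pr' \<Longrightarrow> Factorial_Ring.prime p" using primes by auto

lemma d_mod4: "d mod 4 = 1"
proof -
  have "[d = 3 * 3 * 3 * 3] (mod 4)" unfolding d by (intro cong_mult) (simp_all add: cong_def mod4)
  then show ?thesis by (simp add: cong_def)
qed

lemma half_int: "algebraic_int ((1 + sd) / 2)"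
proof -
  obtain m where m: "d = 4 * m + 1" using d_mod4 by (metis mult_div_mod_eq)
  have "((1 + sd) / 2) ^ 2 = of_int 1 * ((1 + sd) / 2) + of_int m"
    using K.rt_square by (simp add: power2_eq_square m field_simps)
  then show ?thesis by (rule algebraic_int_monic_quadratic[rotated 2]) simp_all
qed

text \<open>As \<open>d\<close> is 1 modulo 4, the integer \<open>(1 + sd) / 2\<close> is available
  and the discriminant is \<open>d\<close> itself; with \<open>sd\<close> it would be
  \<open>4 * d\<close>, and the prime 2 could not be excluded.\<close>

sublocale K: ramified_quadratic d sd Pr "(1 + sd) / 2" d
proof
  show "d = \<Prod>Pr" using dist by (simp add: d)
  have mem: "sd \<in> K.L" by (simp add: K.L.ints_mem)
  have "(1 + sd) / 2 \<in> K.L" using mem by (intro K.L.divide_mem K.L.add_mem) auto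
  then show "(1 + sd) / 2 \<in> K.L.ints" using half_int by (simp add: K.L.ints_iff)
  show "(1 + sd) / 2 \<notin> \<rat>"
  proof
    assume "(1 + sd) / 2 \<in> \<rat>"
    then have "2 * ((1 + sd) / 2) - 1 \<in> \<rat>" by (intro Rats_diff Rats_mult) auto
    then show False using K.rt_irrational by simp
  qed
  have g: "K.gal ((1 + sd) / 2) = (1 - sd) / 2" using K.gal_eq[of "1/2" "1/2"] by (simp add: field_simps)
  have "(1 + sd) / 2 - K.gal ((1 + sd) / 2) = sd" unfolding g by (simp add: field_simps)
  then show "((1 + sd) / 2 - K.gal ((1 + sd) / 2)) ^ 2 = of_int d" using K.rt_square by simp
  show "K.nm x \<noteq> -1" if "x \<in> K.L" for x
    by (rule K.norm_not_minus_one_of_prime[OF primes(1) gt_2(1) mod4(1) d_split(1,2) that])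
qed (use Pr_prime in auto)

text \<open>Here 2 is ramified and joins the set of primes, so \<open>sd'\<close> itself serves as
  \<open>w\<close>.\<close>

sublocale K': ramified_quadratic "2 * d" sd' Pr' sd' "8 * d"
proof
  show "2 * d = \<Prod>Pr'" using dist q_ne by (simp add: d)
  show "sd' \<in> K'.L.ints" by simp
  show "sd' \<notin> \<rat>" by (rule K'.rt_irrational)
  have "K'.gal sd' = - sd'" using K'.gal_eq[of 0 1] by simp
  then show "(sd' - K'.gal sd') ^ 2 = of_int (8 * d)"
    using K'.rt_square by (simp add: power2_eq_square)
  show "8 * d dvd (2 * d) ^ 4" by (rule dvdI[of _ _ "2 * d ^ 3"]) (simp add: power4_eq_xxxx power3_eq_cube)
  show "K'.nm x \<noteq> -1" if "x \<in> K'.L" for x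
    by (rule K'.norm_not_minus_one_of_prime[OF primes(1) gt_2(1) mod4(1) d_split(3,4) that])
qed (use Pr_prime in auto)

abbreviation nbits where
  "nbits r \<equiv> norm_bits r (Legendre q1 q2 = 1) (Legendre q1 q3 = 1) (Legendre q1 q4 = 1) (Legendre q2 q3 = 1)
     (Legendre q2 q4 = 1) (Legendre q3 q4 = 1)"

lemma not_dvds:
  "\<not> q1 dvd 1" "\<not> q2 dvd 1" "\<not> q3 dvd 1" "\<not> q4 dvd 1" "\<not> q1 dvd 2" "\<not> q2 dvd 2" "\<not> q3 dvd 2" "\<not> q4 dvd 2"
  "\<not> q1 dvd q2" "\<not> q1 dvd q3" "\<not> q1 dvd q4" "\<not> q2 dvd q1" "\<not> q2 dvd q3" "\<not> q2 dvd q4"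
  "\<not> q3 dvd q1" "\<not> q3 dvd q2" "\<not> q3 dvd q4" "\<not> q4 dvd q1" "\<not> q4 dvd q2" "\<not> q4 dvd q3"
  using gt_2 zdvd_not_zless[of 1] zdvd_not_zless[of 2] not_dvd dist by auto

text \<open>For \<open>\<rat>(\<surd>d)\<close> the slot of the prime \<open>2\<close> is filled with the factor \<open>1\<close>.\<close>

lemma bit_conditions:
  assumes e: "e = 1 \<or> e = -1" and t: "t = 1 \<and> \<not> r \<or> t = 2 \<and> r"
    and 1: "Legendre ((if s1 then - e else e) * ((if s0 \<noteq> s1 then t else 1) * ((if s2 \<noteq> s1 then q2 else 1) *
        ((if s3 \<noteq> s1 then q3 else 1) * (if s4 \<noteq> s1 then q4 else 1))))) q1 = 1"
    and 2: "Legendre ((if s2 then - e else e) * ((if s0 \<noteq> s2 then t else 1) * ((if s1 \<noteq> s2 then q1 else 1) *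
        ((if s3 \<noteq> s2 then q3 else 1) * (if s4 \<noteq> s2 then q4 else 1))))) q2 = 1"
    and 3: "Legendre ((if s3 then - e else e) * ((if s0 \<noteq> s3 then t else 1) * ((if s1 \<noteq> s3 then q1 else 1) *
        ((if s2 \<noteq> s3 then q2 else 1) * (if s4 \<noteq> s3 then q4 else 1))))) q3 = 1"
    and 4: "Legendre ((if s4 then - e else e) * ((if s0 \<noteq> s4 then t else 1) * ((if s1 \<noteq> s4 then q1 else 1) *
        ((if s2 \<noteq> s4 then q2 else 1) * (if s3 \<noteq> s4 then q3 else 1))))) q4 = 1"
  shows "nbits r (e = 1) s0 s1 s2 s3 s4"
proof -
  have sgn: "(if b then - e else e) = 1 \<or> (if b then - e else e) = -1" for b using e by auto
  have sgn1: "(if b then - e else e) = 1 \<longleftrightarrow> (e = 1) \<noteq> b" for b using e by auto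
  have t': "\<not> q1 dvd t" "\<not> q2 dvd t" "\<not> q3 dvd t" "\<not> q4 dvd t" using t not_dvds by auto
  have t1: "Legendre t q1 = 1 \<longleftrightarrow> True" "Legendre t q2 = 1 \<longleftrightarrow> \<not> r" "Legendre t q3 = 1 \<longleftrightarrow> \<not> r" "Legendre t q4 = 1 \<longleftrightarrow> \<not> r"
    using t gt_2 by (auto simp: Legendre_2)
  show ?thesis
    using 1[unfolded Legendre_product_bits[OF primes(1) gt_2(1) mod4(1) sgn t'(1) not_dvds(9,10,11)]]
      2[unfolded Legendre_product_bits[OF primes(2) gt_2(2) mod4(2) sgn t'(2) not_dvds(12,13,14)]]
      3[unfolded Legendre_product_bits[OF primes(3) gt_2(3) mod4(3) sgn t'(3) not_dvds(15,16,17)]]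
      4[unfolded Legendre_product_bits[OF primes(4) gt_2(4) mod4(4) sgn t'(4) not_dvds(18,19,20)]]
    unfolding sgn1 t1 flip_bits norm_bits_def by argo
qed

lemma Pr_Diff: "Pr - {q1} = {q2, q3, q4}" "Pr - {q2} = {q1, q3, q4}" "Pr - {q3} = {q1, q2, q4}" "Pr - {q4} = {q1, q2, q3}"
  "Pr' - {q1} = {2, q2, q3, q4}" "Pr' - {q2} = {2, q1, q3, q4}" "Pr' - {q3} = {2, q1, q2, q4}" "Pr' - {q4} = {2, q1, q2, q3}"
  using dist q_ne by auto

lemma Pr_prods:
  fixes f :: "int \<Rightarrow> int"
  shows "prod f (Pr - {q1}) = f q2 * (f q3 * f q4)" "prod f (Pr - {q2}) = f q1 * (f q3 * f q4)"
    "prod f (Pr - {q3}) = f q1 * (f q2 * f q4)" "prod f (Pr - {q4}) = f q1 * (f q2 * f q3)"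
    "prod f (Pr' - {q1}) = f 2 * (f q2 * (f q3 * f q4))" "prod f (Pr' - {q2}) = f 2 * (f q1 * (f q3 * f q4))"
    "prod f (Pr' - {q3}) = f 2 * (f q1 * (f q2 * f q4))" "prod f (Pr' - {q4}) = f 2 * (f q1 * (f q2 * f q3))"
  unfolding Pr_Diff using dist q_ne by simp_all

end

lemma (in monoid) pow_2_4: "c \<in> carrier G \<Longrightarrow> c [^] (2::nat) = c \<otimes> c" "c \<in> carrier G \<Longrightarrow> c [^] (4::nat) = (c \<otimes> c) \<otimes> (c \<otimes> c)"
  by (simp_all add: numeral_eq_Suc m_assoc)

lemma (in comm_group) torsion_elementary:
  assumes fin: "finite (carrier G)" and no4: "\<And>c. c \<in> carrier G \<Longrightarrow> (c \<otimes> c) \<otimes> (c \<otimes> c) = \<one> \<Longrightarrow> c \<otimes> c = \<one>"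
  shows "{c \<in> carrier G. \<exists>n. c [^] ((2::nat) ^ n) = \<one>} = {c \<in> carrier G. c \<otimes> c = \<one>}"
    and "\<exists>m::nat. odd m \<and> (\<forall>c\<in>carrier G. c [^] (2 * m) = \<one>)"
proof -
  have *: "c [^] (2::nat) = \<one>" if "c \<in> carrier G" "c [^] (4::nat) = \<one>" for c
    using no4[OF that(1)] that by (simp add: pow_2_4)
  show "\<exists>m::nat. odd m \<and> (\<forall>c\<in>carrier G. c [^] (2 * m) = \<one>)" using odd_exponent(2)[OF fin *] by blast
  show "{c \<in> carrier G. \<exists>n. c [^] ((2::nat) ^ n) = \<one>} = {c \<in> carrier G. c \<otimes> c = \<one>}"
  proof safe
    fix c n assume "c \<in> carrier G" "c [^] ((2::nat) ^ n) = \<one>"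
    then show "c \<otimes> c = \<one>" using odd_exponent(1)[OF fin *] pow_2_4(1) by metis
  next
    fix c assume "c \<in> carrier G" "c \<otimes> c = \<one>"
    then show "\<exists>n. c [^] ((2::nat) ^ n) = \<one>" by (intro exI[of _ 1]) (simp add: pow_2_4)
  qed
qed

lemma (in invertible_subfield) two_class_group_eq:
  assumes "finite (carrier C)" and T: "{c \<in> carrier C. \<exists>n. c [^]\<^bsub>C\<^esub> ((2::nat) ^ n) = \<one>\<^bsub>C\<^esub>} = T" and "card T = 2 ^ r"
  shows "two_class_group F = C\<lparr>carrier := T\<rparr>" "comm_group (two_class_group F)"
proof -
  show eq: "two_class_group F = C\<lparr>carrier := T\<rparr>"
    using C.the_sylow_two[of r] assms by (simp add: two_class_group_def)
  show "comm_group (two_class_group F)"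
    unfolding eq T[symmetric] by (rule C.subgroup_comm_group[OF C.torsion_subgroup])
qed

locale four_primes_bits = four_primes +
  assumes bits: "four_bits (Legendre q1 q2 = 1) (Legendre q1 q3 = 1) (Legendre q1 q4 = 1) (Legendre q2 q3 = 1) (Legendre q2 q4 = 1)
      (Legendre q3 q4 = 1)"
begin

lemma K_norm_bits:
  assumes "S \<subseteq> Pr" "K.norm_set S"
  shows "\<exists>e. nbits False e False (q1 \<in> S) (q2 \<in> S) (q3 \<in> S) (q4 \<in> S)"
proof -
  obtain e where e: "e \<in> {1, -1}" and *: "\<And>q. q \<in> Pr \<Longrightarrow>
      Legendre ((if q \<in> S then - e else e) * (\<Prod>p\<in>Pr - {q}. if (p \<in> S) \<noteq> (q \<in> S) then p else 1)) q = 1"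
    using K.norm_set_bits[OF assms] by blast
  have n: "q1 \<in> Pr" "q2 \<in> Pr" "q3 \<in> Pr" "q4 \<in> Pr" by blast+
  have "nbits False (e = 1) False (q1 \<in> S) (q2 \<in> S) (q3 \<in> S) (q4 \<in> S)"
    by (rule bit_conditions[where t = 1, unfolded if_cancel mult_1_left])
      (use e in blast, blast, rule *[OF n(1), unfolded Pr_prods], rule *[OF n(2), unfolded Pr_prods],
        rule *[OF n(3), unfolded Pr_prods], rule *[OF n(4), unfolded Pr_prods])
  then show ?thesis ..
qed

lemma K'_norm_bits:
  assumes "S \<subseteq> Pr'" "K'.norm_set S"
  shows "\<exists>e. nbits True e (2 \<in> S) (q1 \<in> S) (q2 \<in> S) (q3 \<in> S) (q4 \<in> S)"
proof -
  obtain e where e: "e \<in> {1, -1}" and *: "\<And>q. q \<in> Pr' \<Longrightarrow>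
      Legendre ((if q \<in> S then - e else e) * (\<Prod>p\<in>Pr' - {q}. if (p \<in> S) \<noteq> (q \<in> S) then p else 1)) q = 1"
    using K'.norm_set_bits[OF assms] by blast
  have n: "q1 \<in> Pr'" "q2 \<in> Pr'" "q3 \<in> Pr'" "q4 \<in> Pr'" by blast+
  have "nbits True (e = 1) (2 \<in> S) (q1 \<in> S) (q2 \<in> S) (q3 \<in> S) (q4 \<in> S)"
    by (rule bit_conditions[where t = 2])
      (use e in blast, blast, rule *[OF n(1), unfolded Pr_prods], rule *[OF n(2), unfolded Pr_prods],
        rule *[OF n(3), unfolded Pr_prods], rule *[OF n(4), unfolded Pr_prods])
  then show ?thesis ..
qed

lemma Pr_nontrivial: "S \<subseteq> Pr \<Longrightarrow> S \<noteq> {} \<Longrightarrow> S \<noteq> Pr \<Longrightarrow>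
    \<not> ((q1 \<in> S) = (q2 \<in> S) \<and> (q2 \<in> S) = (q3 \<in> S) \<and> (q3 \<in> S) = (q4 \<in> S))"
  by blast

lemma Pr'_nontrivial: "S \<subseteq> Pr' \<Longrightarrow> S \<noteq> {} \<Longrightarrow> S \<noteq> Pr' \<Longrightarrow>
    \<not> ((2 \<in> S) = (q1 \<in> S) \<and> (q1 \<in> S) = (q2 \<in> S) \<and> (q2 \<in> S) = (q3 \<in> S) \<and> (q3 \<in> S) = (q4 \<in> S))"
  by blast

lemma K_rank:
  assumes S: "S \<subseteq> Pr" "S \<noteq> {}" "S \<noteq> Pr" "K.norm_set S" and T: "T \<subseteq> Pr" "T \<noteq> {}" "T \<noteq> Pr" "K.norm_set T"
  shows "T = S \<or> T = Pr - S"
proof -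
  obtain e where e: "nbits False e False (q1 \<in> S) (q2 \<in> S) (q3 \<in> S) (q4 \<in> S)" using K_norm_bits[OF S(1,4)] ..
  obtain e' where e': "nbits False e' False (q1 \<in> T) (q2 \<in> T) (q3 \<in> T) (q4 \<in> T)" using K_norm_bits[OF T(1,4)] ..
  have r: "((q1 \<in> S) = (q1 \<in> T)) = ((q2 \<in> S) = (q2 \<in> T)) \<and> ((q2 \<in> S) = (q2 \<in> T)) = ((q3 \<in> S) = (q3 \<in> T)) \<and>
      ((q3 \<in> S) = (q3 \<in> T)) = ((q4 \<in> S) = (q4 \<in> T))"
    by (rule norm_bits_rank[OF bits e e' Pr_nontrivial[OF S(1-3)] Pr_nontrivial[OF T(1-3)]])
  show ?thesis
  proof (cases "(q1 \<in> S) = (q1 \<in> T)")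
    case True
    then have "\<forall>q\<in>Pr. q \<in> S \<longleftrightarrow> q \<in> T" using r by blast
    then show ?thesis using S(1) T(1) by blast
  next
    case False
    then have "\<forall>q\<in>Pr. q \<in> S \<longleftrightarrow> q \<notin> T" using r by blast
    then show ?thesis using S(1) T(1) by blast
  qed
qed

lemma K'_rank:
  assumes S: "S \<subseteq> Pr'" "S \<noteq> {}" "S \<noteq> Pr'" "K'.norm_set S" and T: "T \<subseteq> Pr'" "T \<noteq> {}" "T \<noteq> Pr'" "K'.norm_set T"
  shows "T = S \<or> T = Pr' - S"
proof -
  obtain e where e: "nbits True e (2 \<in> S) (q1 \<in> S) (q2 \<in> S) (q3 \<in> S) (q4 \<in> S)" using K'_norm_bits[OF S(1,4)] ..
  obtain e' where e': "nbits True e' (2 \<in> T) (q1 \<in> T) (q2 \<in> T) (q3 \<in> T) (q4 \<in> T)" using K'_norm_bits[OF T(1,4)] ..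
  have r: "((2 \<in> S) = (2 \<in> T)) = ((q1 \<in> S) = (q1 \<in> T)) \<and> ((q1 \<in> S) = (q1 \<in> T)) = ((q2 \<in> S) = (q2 \<in> T)) \<and>
      ((q2 \<in> S) = (q2 \<in> T)) = ((q3 \<in> S) = (q3 \<in> T)) \<and> ((q3 \<in> S) = (q3 \<in> T)) = ((q4 \<in> S) = (q4 \<in> T))"
    by (rule norm_bits_rank_2[OF bits e e' Pr'_nontrivial[OF S(1-3)] Pr'_nontrivial[OF T(1-3)]])
  show ?thesis
  proof (cases "(2 \<in> S) = (2 \<in> T)")
    case True
    then have "\<forall>q\<in>Pr'. q \<in> S \<longleftrightarrow> q \<in> T" using r by blast
    then show ?thesis using S(1) T(1) by blast
  next
    case False
    then have "\<forall>q\<in>Pr'. q \<in> S \<longleftrightarrow> q \<notin> T" using r by blast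
    then show ?thesis using S(1) T(1) by blast
  qed
qed

lemma norm_sets_independent:
  assumes S: "S \<subseteq> Pr" "S \<noteq> {}" "S \<noteq> Pr" "K.norm_set S" and T: "T \<subseteq> Pr'" "T \<noteq> {}" "T \<noteq> Pr'" "K'.norm_set T"
  shows "T - {2} \<notin> {{}, Pr, S, Pr - S}"
proof -
  obtain e where e: "nbits False e False (q1 \<in> S) (q2 \<in> S) (q3 \<in> S) (q4 \<in> S)" using K_norm_bits[OF S(1,4)] ..
  obtain e' where e': "nbits True e' (2 \<in> T) (q1 \<in> T) (q2 \<in> T) (q3 \<in> T) (q4 \<in> T)" using K'_norm_bits[OF T(1,4)] ..
  have iff: "q \<in> T - {2} \<longleftrightarrow> q \<in> T" if "q \<in> Pr" for q using that q_ne by auto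
  note ind = norm_bits_independent[OF bits e e' Pr_nontrivial[OF S(1-3)] Pr'_nontrivial[OF T(1-3)]]
  have "T - {2} \<noteq> {}" "T - {2} \<noteq> Pr" using ind(1) iff by blast+
  moreover have "T - {2} \<noteq> S" "T - {2} \<noteq> Pr - S" using ind(2) iff by blast+
  ultimately show ?thesis by blast
qed

lemma q1_not_norm: "\<not> K.norm_set {q1}"
proof
  assume "K.norm_set {q1}"
  then obtain e where "nbits False e False (q1 \<in> {q1}) (q2 \<in> {q1}) (q3 \<in> {q1}) (q4 \<in> {q1})" using K_norm_bits[of "{q1}"] by blast
  then have "nbits False e False True False False False" using dist by simp
  then show False using norm_bits_q1[OF bits] by blast
qed

lemmas K_two_torsion = K.two_torsion_count[OF K_rank]
lemmas K'_two_torsion = K'.two_torsion_count[OF K'_rank]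

lemma K_two_class_group: "two_class_group K.L \<cong> integer_mod_group 2 \<times>\<times> integer_mod_group 2"
proof -
  define T where "T = {c \<in> carrier K.L.C. c \<otimes>\<^bsub>K.L.C\<^esub> c = \<one>\<^bsub>K.L.C\<^esub>}"
  \<comment> \<open>Sixteen sets of ramified primes fall into fibres of four. In the other field the
    prime 2 doubles this count.\<close>
  have card: "card T = 4" using K_two_torsion(1) dist by (simp add: T_def)
  have tor: "{c \<in> carrier K.L.C. \<exists>n. c [^]\<^bsub>K.L.C\<^esub> ((2::nat) ^ n) = \<one>\<^bsub>K.L.C\<^esub>} = T"
    unfolding T_def using K_two_torsion(3) by (intro K.L.C.torsion_elementary(1)[OF K.finite_class_group])
  have eq: "two_class_group K.L = K.L.C\<lparr>carrier := T\<rparr>" "comm_group (two_class_group K.L)"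
    using K.L.two_class_group_eq[OF K.finite_class_group tor, of 2] card by simp_all
  interpret A: comm_group "two_class_group K.L" by (rule eq(2))
  show ?thesis by (rule A.iso_Z2_Z2) (simp_all add: eq(1) card, simp add: T_def)
qed

lemma K'_two_class_group: "two_class_group K'.L \<cong> integer_mod_group 2 \<times>\<times> integer_mod_group 2 \<times>\<times> integer_mod_group 2"
proof -
  define T where "T = {c \<in> carrier K'.L.C. c \<otimes>\<^bsub>K'.L.C\<^esub> c = \<one>\<^bsub>K'.L.C\<^esub>}"
  have card: "card T = 8" using K'_two_torsion(1) dist q_ne by (simp add: T_def)
  have tor: "{c \<in> carrier K'.L.C. \<exists>n. c [^]\<^bsub>K'.L.C\<^esub> ((2::nat) ^ n) = \<one>\<^bsub>K'.L.C\<^esub>} = T"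
    unfolding T_def using K'_two_torsion(3) by (intro K'.L.C.torsion_elementary(1)[OF K'.finite_class_group])
  have eq: "two_class_group K'.L = K'.L.C\<lparr>carrier := T\<rparr>" "comm_group (two_class_group K'.L)"
    using K'.L.two_class_group_eq[OF K'.finite_class_group tor, of 3] card by simp_all
  interpret A: comm_group "two_class_group K'.L" by (rule eq(2))
  show ?thesis by (rule A.iso_Z2_Z2_Z2) (simp_all add: eq(1) card, simp add: T_def)
qed

lemma adjoin_sd: "complex_adjoin {sd} = K.L" by (rule K.adjoin_eq_L[OF adjoin_empty[symmetric]])
lemma adjoin_sd': "complex_adjoin {sd'} = K'.L" by (rule K'.adjoin_eq_L[OF adjoin_empty[symmetric]])

end

subsection \<open>Class groups in a tower\<close>

context inv_sqrt_ext
begin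

lemma ext_cl_cong:
  assumes J: "fractional_ideal F J" "fractional_ideal F J'" and eq: "F.cl J = F.cl J'"
  shows "L.cl (ext J) = L.cl (ext J')"
proof -
  obtain b where b: "b \<in> F" "b \<noteq> 0" "J = F.pideal b \<star> J'" using F.cl_eqD[OF J eq] by blast
  have "ext J = L.pideal b \<star> ext J'" using b by (simp add: ext_iprod ext_pideal)
  then show ?thesis using L.cl_eqI[of "ext J'" b] J b by (simp add: ext_frac F_mem_L)
qed

lemma finite_ext_classes:
  assumes "finite (carrier F.C)"
  shows "finite {L.cl (ext J) | J. fractional_ideal F J}"
proof (rule finite_subset)
  define f where "f c = L.cl (ext (SOME J. fractional_ideal F J \<and> c = F.cl J))" for c
  show "{L.cl (ext J) | J. fractional_ideal F J} \<subseteq> f ` carrier F.C"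
  proof safe
    fix J assume J: "fractional_ideal F J"
    define J' where "J' = (SOME J'. fractional_ideal F J' \<and> F.cl J = F.cl J')"
    have "\<exists>J'. fractional_ideal F J' \<and> F.cl J = F.cl J'" using J by blast
    then have J': "fractional_ideal F J' \<and> F.cl J = F.cl J'" unfolding J'_def by (rule someI_ex)
    have "L.cl (ext J) = L.cl (ext J')" using J J' by (intro ext_cl_cong) auto
    also have "\<dots> = f (F.cl J)" by (simp add: f_def J'_def)
    finally show "L.cl (ext J) \<in> f ` carrier F.C" using J by blast
  qed
  show "finite (f ` carrier F.C)" using assms by simp
qed

text \<open>The class of \<open>ext J\<close> depends only on the class of \<open>J\<close>, so an
  exponent of the class group of the base field kills it.\<close>

lemma ext_class_pow:
  assumes n: "\<And>c. c \<in> carrier F.C \<Longrightarrow> c [^]\<^bsub>F.C\<^esub> (n :: nat) = \<one>\<^bsub>F.C\<^esub>" and J: "fractional_ideal F J"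
  shows "L.cl (ext J) [^]\<^bsub>L.C\<^esub> n = \<one>\<^bsub>L.C\<^esub>"
proof -
  interpret h: group_hom F.G L.C "\<lambda>J. L.cl (ext J)"
    using cl_ext_hom F.G.is_group L.C.is_group by (simp add: group_hom_def group_hom_axioms_def)
  have JG: "J \<in> carrier F.G" using J by simp
  have Jn: "fractional_ideal F (J [^]\<^bsub>F.G\<^esub> n)" using F.G.nat_pow_closed[OF JG, of n] by simp
  have "F.cl (J [^]\<^bsub>F.G\<^esub> n) = F.cl J [^]\<^bsub>F.C\<^esub> n" by (rule F.cl.hom_nat_pow[OF JG])
  then have "F.cl (J [^]\<^bsub>F.G\<^esub> n) = F.cl (ring_of_integers F)"
    using n J F.cl.hom_one by simp
  then have "L.cl (ext (J [^]\<^bsub>F.G\<^esub> n)) = L.cl (ext (ring_of_integers F))" using Jn by (intro ext_cl_cong) auto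
  also have "\<dots> = \<one>\<^bsub>L.C\<^esub>" using L.cl.hom_one by simp
  finally show ?thesis using h.hom_nat_pow[OF JG] by simp
qed

end

subsection \<open>Primes and units of \<open>\<rat>(\<surd>2)\<close>\<close>

text \<open>The greatest common divisor of \<open>p\<close> and \<open>x\<close> has the size of a
  unit or of \<open>p\<close>; in the second case it is associated to \<open>p\<close>.\<close>

lemma (in normed_pid_subfield) prime_peel:
  assumes p: "p \<in> ring_of_integers F" "p \<noteq> 0" and dvds: "\<And>h. h \<in> ring_of_integers F \<Longrightarrow> h idvd p \<Longrightarrow> sz h = 1 \<or> sz h = sz p"
    and x: "x \<in> ring_of_integers F"
  shows "p idvd x \<or> (\<exists>u\<in>ring_of_integers F. \<exists>v\<in>ring_of_integers F. u * p + v * x = 1)"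
proof -
  obtain h u v where h: "h \<in> ring_of_integers F" "h \<noteq> 0" "h idvd p" "h idvd x"
    and uv: "u \<in> ring_of_integers F" "v \<in> ring_of_integers F" "h = u * p + v * x"
    using gcd_exists[OF p(1) x p(2)] by blast
  show ?thesis
  proof (cases "sz h = 1")
    case True
    then have "inverse h \<in> ring_of_integers F" using sz_unit h by blast
    moreover have "inverse h * u * p + inverse h * v * x = 1"
    proof -
      have "inverse h * u * p + inverse h * v * x = inverse h * h" unfolding uv(3) by (simp only: distrib_left mult.assoc)
      then show ?thesis using h(2) by simp
    qed
    ultimately show ?thesis using uv by blast
  next
    case False
    then have sz: "sz h = sz p" using dvds h by blast
    obtain c where c: "c \<in> ring_of_integers F" "p = h * c" using h(3) by (auto simp: idvd_def)
    have "sz h * sz c = sz h" using sz_mult[OF h(1) c(1)] sz unfolding c(2)[symmetric] by metis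
    then have "sz c = 1" using sz_pos[OF h(1,2)] by (metis mult_cancel1 mult.right_neutral neq0_conv)
    then have ic: "inverse c \<in> ring_of_integers F" using sz_unit c by blast
    have "c \<noteq> 0" using c p by auto
    then have "h = p * inverse c" using c by simp
    then have "p idvd h" using ic by blast
    then show ?thesis using idvd_trans h(4) by blast
  qed
qed

text \<open>If \<open>q\<close> did not divide \<open>y\<close>, then \<open>x / y\<close> would be
  a square root of \<open>- c\<close> modulo \<open>q\<close>.\<close>

lemma anisotropic_mod:
  fixes q x y c :: int
  assumes q: "Factorial_Ring.prime q" and c: "Legendre (- c) q = -1" and dvd: "q dvd x ^ 2 + c * y ^ 2"
  shows "q dvd x \<and> q dvd y"
proof -
  have y: "q dvd y"
  proof (rule ccontr)
    assume "\<not> q dvd y"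
    then have "coprime y q" using prime_imp_coprime[OF q] coprime_commute by blast
    then obtain W where W: "[y * W = 1] (mod q)" using cong_solve_coprime_int by blast
    have "[x ^ 2 = - c * y ^ 2] (mod q)" using dvd by (simp add: cong_iff_dvd_diff)
    then have "[x ^ 2 * W ^ 2 = - c * y ^ 2 * W ^ 2] (mod q)" by (rule cong_scalar_right)
    moreover have "[- c * (y * W) ^ 2 = - c * 1 ^ 2] (mod q)" using W by (intro cong_scalar_left cong_pow)
    ultimately have "[(x * W) ^ 2 = - c] (mod q)"
      by (simp add: power_mult_distrib mult_ac) (metis cong_trans)
    then have "QuadRes q (- c)" unfolding QuadRes_def by blast
    then show False using c by (simp add: Legendre_def split: if_splits)
  qed
  then have "q dvd c * y ^ 2" by (simp add: power2_eq_square)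
  then have "q dvd x ^ 2" using dvd by (metis dvd_add_left_iff)
  then show ?thesis using y q prime_dvd_power_int by blast
qed

text \<open>As 2 is a nonresidue, \<open>q\<close> divides \<open>xx\<close> and \<open>yy\<close>,
  then \<open>zz\<close>, and dividing all three by \<open>q\<close> gives an infinite
  descent.\<close>

lemma inert_not_norm:
  fixes q :: int
  assumes q: "Factorial_Ring.prime q" "Legendre 2 q = -1" and e: "e = 1 \<or> e = -1" and eq: "xx ^ 2 - 2 * yy ^ 2 = e * q * zz ^ 2"
  shows "zz = 0"
  using eq
proof (induction "nat \<bar>zz\<bar>" arbitrary: xx yy zz rule: less_induct)
  case less
  have q1: "q > 1" using q(1) prime_gt_1_int by blast
  have "xx ^ 2 + (- 2) * yy ^ 2 = q * (e * zz ^ 2)" using less.prems by simp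
  then have "q dvd xx ^ 2 + (- 2) * yy ^ 2" by simp
  then have "q dvd xx \<and> q dvd yy" using anisotropic_mod[OF q(1), of "-2" xx yy] q(2) by simp
  then obtain x1 y1 where xy: "xx = q * x1" "yy = q * y1" unfolding dvd_def by blast
  have "q * (q * (x1 ^ 2 - 2 * y1 ^ 2)) = q * (e * zz ^ 2)" using less.prems xy by (simp add: power2_eq_square algebra_simps)
  then have *: "q * (x1 ^ 2 - 2 * y1 ^ 2) = e * zz ^ 2" using q1 by simp
  then have "q dvd zz ^ 2" using e by (metis dvd_triv_left dvd_minus_iff mult_1 mult_minus1)
  then have "q dvd zz" using q(1) prime_dvd_power_int by blast
  then obtain z1 where z1: "zz = q * z1" by (elim dvdE)
  have "q * (x1 ^ 2 - 2 * y1 ^ 2) = q * (e * q * z1 ^ 2)" using * z1 by (simp add: power2_eq_square algebra_simps)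
  then have eq1: "x1 ^ 2 - 2 * y1 ^ 2 = e * q * z1 ^ 2" using q1 by simp
  show ?case
  proof (rule ccontr)
    assume "zz \<noteq> 0"
    then have "z1 \<noteq> 0" using z1 by simp
    then have "nat \<bar>z1\<bar> < nat \<bar>zz\<bar>" using q1 by (simp add: z1 abs_mult)
    then show False using less.hyps eq1 \<open>z1 \<noteq> 0\<close> by blast
  qed
qed

text \<open>The two equations say that \<open>(x + u\<surd>2)\<^sup>2 - D (y + v\<surd>2)\<^sup>2 = -z\<^sup>2\<close>.\<close>

lemma minus_one_descent:
  fixes q :: int
  assumes q: "Factorial_Ring.prime q" "q mod 8 = 7" and D: "D = q * D'" "\<not> q dvd D'"
    and eq: "x ^ 2 + 2 * u ^ 2 + z ^ 2 = D * (y ^ 2 + 2 * v ^ 2)" "x * u = D * (y * v)"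
  shows "z = 0"
  using eq
proof (induction "nat \<bar>z\<bar>" arbitrary: x u y v z rule: less_induct)
  case less
  have q1: "q > 1" using q(1) prime_gt_1_int by blast
  then have q2: "q > 2" using q(2) by (cases "q = 2") auto
  have m4: "q mod 4 = 3" using q(2) by presburger
  have L1: "Legendre (-1) q = -1" by (rule Legendre_minus_one[OF q(1) q2 m4])
  have "Legendre (2 * -1) q = -1" unfolding Legendre_mult[OF q(1) q2] using L1 Legendre_two[OF q(1) q2] q(2) by simp
  then have L2: "Legendre (-2) q = -1" by simp
  \<comment> \<open>Whichever factor is divisible by \<open>q\<close>, one of
    \<open>z ^ 2 + 2 * u ^ 2\<close> and \<open>x ^ 2 + z ^ 2\<close> is divisible by
    \<open>q\<close>. Both forms are anisotropic modulo \<open>q\<close>, since -1 and -2 are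
    nonresidues for \<open>q\<close> congruent to 7 modulo 8.\<close>
  have "q dvd x * u" using less.prems(2) D by simp
  then have xu: "q dvd x \<or> q dvd u" using q(1) by (simp add: prime_dvd_mult_iff)
  have sum: "q dvd x ^ 2 + 2 * u ^ 2 + z ^ 2" using less.prems(1) D by simp
  have "q dvd x \<and> q dvd u \<and> q dvd z"
  proof (cases "q dvd x")
    case True
    then have "q dvd x ^ 2" by (simp add: power2_eq_square)
    then have "q dvd z ^ 2 + 2 * u ^ 2" using sum by (metis add.assoc add.commute dvd_add_right_iff)
    then show ?thesis using anisotropic_mod[OF q(1) L2, of z u] True by simp
  next
    case False
    then have "q dvd 2 * u ^ 2" using xu by (simp add: power2_eq_square)
    then have "q dvd x ^ 2 + 1 * z ^ 2" using sum by (metis add.assoc add.commute dvd_add_right_iff mult_1)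
    then show ?thesis using anisotropic_mod[OF q(1), of 1 x z] L1 False by simp
  qed
  then obtain x1 u1 z1 where d1: "x = q * x1" "u = q * u1" "z = q * z1" unfolding dvd_def by blast
  have "q * (q * (x1 ^ 2 + 2 * u1 ^ 2 + z1 ^ 2)) = q * (D' * (y ^ 2 + 2 * v ^ 2))"
    using less.prems(1) D d1 by (simp add: power2_eq_square algebra_simps)
  then have s1: "q * (x1 ^ 2 + 2 * u1 ^ 2 + z1 ^ 2) = D' * (y ^ 2 + 2 * v ^ 2)" using q1 by simp
  then have "q dvd D' * (y ^ 2 + 2 * v ^ 2)" by (metis dvd_triv_left)
  then have "q dvd y ^ 2 + 2 * v ^ 2" using q(1) D(2) by (simp add: prime_dvd_mult_iff)
  then have "q dvd y \<and> q dvd v" by (rule anisotropic_mod[OF q(1) L2])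
  then obtain y1 v1 where d2: "y = q * y1" "v = q * v1" unfolding dvd_def by blast
  have "q * (x1 ^ 2 + 2 * u1 ^ 2 + z1 ^ 2) = q * (D * (y1 ^ 2 + 2 * v1 ^ 2))"
    using s1 d2 D by (simp add: power2_eq_square algebra_simps)
  then have e1: "x1 ^ 2 + 2 * u1 ^ 2 + z1 ^ 2 = D * (y1 ^ 2 + 2 * v1 ^ 2)" using q1 by simp
  have "q * (q * (x1 * u1)) = q * (q * (D * (y1 * v1)))" using less.prems(2) d1 d2 by (simp add: algebra_simps)
  then have e2: "x1 * u1 = D * (y1 * v1)" using q1 by simp
  show ?case
  proof (rule ccontr)
    assume "z \<noteq> 0"
    then have "z1 \<noteq> 0" using d1 by simp
    then have "nat \<bar>z1\<bar> < nat \<bar>z\<bar>" using q1 by (simp add: d1 abs_mult)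
    then show False using less.hyps e1 e2 \<open>z1 \<noteq> 0\<close> by blast
  qed
qed

lemma k_size: "k.nm x = of_int n \<Longrightarrow> k.size_nm x = nat \<bar>n\<bar>"
  by (simp add: k.size_nm_def)

lemma k_size_dvd:
  assumes "h \<in> k.L.ints" "x \<in> k.L.ints" "k.L.idvd h x"
  shows "k.size_nm h dvd k.size_nm x"
  using assms by (auto simp: k.L.idvd_def k.size_nm_mult)

lemma k_split_peel:
  assumes q: "Factorial_Ring.prime q" and p: "p \<in> k.L.ints" "k.size_nm p = nat q" and x: "x \<in> k.L.ints"
  shows "k.L.idvd p x \<or> (\<exists>u\<in>ring_of_integers k.L. \<exists>v\<in>ring_of_integers k.L. u * p + v * x = 1)"
proof (rule kk.prime_peel[OF p(1) _ _ x])
  have qn: "Factorial_Ring.prime (nat q)" using q by simp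
  show "p \<noteq> 0"
  proof
    assume "p = 0"
    then have "k.size_nm p = 0" by (simp add: k.size_nm_def k.nm_def rat_size_def)
    then show False using p(2) qn by simp
  qed
  fix h assume "h \<in> k.L.ints" "k.L.idvd h p"
  then have "k.size_nm h dvd nat q" using k_size_dvd p by metis
  then show "k.size_nm h = 1 \<or> k.size_nm h = k.size_nm p" using qn p(2) by (metis prime_nat_iff)
qed

text \<open>A divisor of \<open>q\<close> has size 1, \<open>q\<close> or \<open>q ^ 2\<close>, and
  size \<open>q\<close> is impossible because \<open>q\<close> and \<open>- q\<close> are not
  norms.\<close>

lemma k_inert_peel:
  assumes q: "Factorial_Ring.prime q" "Legendre 2 q = -1" and x: "x \<in> k.L.ints"
  shows "k.L.idvd (of_int q) x \<or> (\<exists>u\<in>ring_of_integers k.L. \<exists>v\<in>ring_of_integers k.L. u * of_int q + v * x = 1)"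
proof (rule kk.prime_peel[OF _ _ _ x])
  have q0: "q > 0" using q(1) prime_gt_0_int by blast
  show "of_int q \<noteq> (0 :: complex)" using q0 by simp
  fix h assume h: "h \<in> k.L.ints" "k.L.idvd h (of_int q)"
  have "k.nm (of_int q) = of_int (q ^ 2)" using k.nm_F[of "of_int q"] by simp
  then have szq: "k.size_nm (of_int q) = nat q ^ 2" using k_size q0 by (simp add: nat_power_eq)
  then have "k.size_nm h dvd nat q ^ 2" using k_size_dvd[OF h(1) _ h(2)] by simp
  moreover have "Factorial_Ring.prime (nat q)" using q(1) by simp
  ultimately obtain i where i: "i \<le> 2" "k.size_nm h = nat q ^ i" using divides_primepow_nat by blast
  have "i \<noteq> 1"
  proof
    assume "i = 1"
    obtain n where n: "k.nm h = of_int n" using k.nm_int[OF h(1)] by blast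
    then have "nat \<bar>n\<bar> = nat q" using i \<open>i = 1\<close> k_size by simp
    then have "n = q \<or> n = - q" using q0 by linarith
    then obtain e where e: "e = 1 \<or> e = -1" "n = e * q" by (metis mult_1 mult_minus1)
    obtain xx yy zz where "zz \<noteq> 0" "xx ^ 2 - 2 * yy ^ 2 = n * zz ^ 2"
      using k.norm_integers[OF k.L.ints_mem[OF h(1)] n] by blast
    then show False using inert_not_norm[OF q e(1)] e(2) by blast
  qed
  then have "i = 0 \<or> i = 2" using i(1) by linarith
  then show "k.size_nm h = 1 \<or> k.size_nm h = k.size_nm (of_int q)" using i(2) szq by auto
qed simp

lemma k_idvd_trace:
  assumes "k.L.idvd (of_int q) x" "x \<in> k.L.ints" "k.tr x = of_int t"
  shows "q dvd t"
proof -
  obtain c where c: "c \<in> k.L.ints" "x = of_int q * c" using assms(1) by (auto simp: k.L.idvd_def)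
  have "k.tr c \<in> ring_of_integers \<rat>" using c(1) by (rule k.tr_ints)
  then obtain m where m: "k.tr c = of_int m" by (auto simp: ints_Rats elim!: Ints_cases)
  have "k.tr x = of_int q * k.tr c" using c by (simp add: k.tr_def k.gal_mult k.L.ints_mem distrib_left)
  then have "of_int t = (of_int (q * m) :: complex)" using assms(3) m by simp
  then show ?thesis by (simp only: of_int_eq_iff) simp
qed

text \<open>With \<open>s\<close> a square root of 2 modulo \<open>q\<close>, the prime is the
  greatest common divisor \<open>h\<close> of \<open>q\<close> and \<open>s - sqrt2\<close>. Size 1
  would make \<open>q\<close> divide the conjugate of \<open>s - sqrt2\<close>, size
  \<open>q ^ 2\<close> would make it divide \<open>s - sqrt2\<close>; both contradict the trace
  \<open>2 * s\<close>.\<close>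

lemma k_split_prime:
  assumes q: "Factorial_Ring.prime q" "q > 2" "Legendre 2 q = 1"
  shows "\<exists>p e. p \<in> k.L.ints \<and> (e = 1 \<or> e = -1) \<and> k.nm p = of_int (e * q) \<and> \<not> k.L.idvd p (k.gal p)"
proof -
  have "QuadRes q 2" using q(3) by (simp add: Legendre_def split: if_splits)
  then obtain s where s: "[s ^ 2 = 2] (mod q)" by (auto simp: QuadRes_def)
  have ns: "\<not> q dvd s"
  proof
    assume "q dvd s"
    then have "q dvd s ^ 2" by (simp add: power2_eq_square)
    then have "q dvd 2" using s by (metis cong_dvd_iff)
    then show False using q(2) zdvd_imp_le by fastforce
  qed
  have n2: "\<not> q dvd 2" using q(2) zdvd_imp_le by fastforce
  define a where "a = of_int s - sqrt2"
  have aO: "a \<in> k.L.ints" unfolding a_def by (intro k.L.ints_diff k.L.ints_of_int k.D_ints)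
  have ga: "k.gal a = of_int s + sqrt2" by (simp add: a_def k.gal_diff)
  have aa: "a * k.gal a = of_int (s ^ 2 - 2)"
    unfolding ga unfolding a_def using k.rt_square by (simp add: power2_eq_square algebra_simps)
  have tra: "k.tr a = of_int (2 * s)" "k.tr (k.gal a) = of_int (2 * s)"
  proof -
    have "k.gal (k.gal a) = a" by (rule k.gal_gal[OF k.L.ints_mem[OF aO]])
    moreover have "a + k.gal a = of_int (2 * s)" unfolding ga by (simp add: a_def)
    ultimately show "k.tr a = of_int (2 * s)" "k.tr (k.gal a) = of_int (2 * s)" by (simp_all add: k.tr_def add.commute)
  qed
  have n2s: "\<not> q dvd 2 * s" using ns n2 q(1) by (simp add: prime_dvd_mult_iff)
  have not_a: "\<not> k.L.idvd (of_int q) a" using k_idvd_trace[OF _ aO tra(1)] n2s by blast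
  have not_ga: "\<not> k.L.idvd (of_int q) (k.gal a)" using k_idvd_trace[OF _ _ tra(2)] n2s aO by blast
  have q0: "(of_int q :: complex) \<noteq> 0" using q(2) by simp
  obtain h u v where h: "h \<in> k.L.ints" "h \<noteq> 0" "k.L.idvd h (of_int q)" "k.L.idvd h a"
    and uv: "u \<in> k.L.ints" "v \<in> k.L.ints" "h = u * of_int q + v * a"
    using kk.gcd_exists[OF _ aO q0] by auto
  have "k.nm (of_int q) = of_int (q ^ 2)" using k.nm_F[of "of_int q"] by simp
  then have szq: "k.size_nm (of_int q) = nat q ^ 2" using k_size q(2) by (simp add: nat_power_eq)
  then have "k.size_nm h dvd nat q ^ 2" using k_size_dvd[OF h(1) _ h(3)] by simp
  moreover have "Factorial_Ring.prime (nat q)" using q(1) by simp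
  ultimately obtain i where i: "i \<le> 2" "k.size_nm h = nat q ^ i" using divides_primepow_nat by blast
  have "i \<noteq> 0"
  proof
    assume "i = 0"
    then have ih: "inverse h \<in> k.L.ints" using i k.size_nm_unit h(1) by simp
    obtain m where m: "s ^ 2 - 2 = q * m" using s by (auto simp: cong_iff_dvd_diff elim: dvdE)
    have "h * k.gal a = u * of_int q * k.gal a + v * (a * k.gal a)" unfolding uv(3) by (simp add: algebra_simps)
    also have "\<dots> = of_int q * (u * k.gal a + v * of_int m)" unfolding aa m by (simp add: algebra_simps)
    finally have eq: "h * k.gal a = of_int q * (u * k.gal a + v * of_int m)" .
    have "k.gal a = inverse h * (h * k.gal a)" using h(2) by simp
    also have "\<dots> = of_int q * (inverse h * (u * k.gal a + v * of_int m))" unfolding eq by (simp only: mult.left_commute)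
    finally have "k.L.idvd (of_int q) (k.gal a)"
      using ih uv aO by (intro k.L.idvdI[of "inverse h * (u * k.gal a + v * of_int m)"]) auto
    then show False using not_ga by blast
  qed
  moreover have "i \<noteq> 2"
  proof
    assume "i = 2"
    obtain c where c: "c \<in> k.L.ints" "of_int q = h * c" using h(3) by (auto simp: k.L.idvd_def)
    have "nat q ^ 2 = nat q ^ 2 * k.size_nm c" 
      using k.size_nm_mult[OF h(1) c(1)] szq i(2) unfolding \<open>i = 2\<close> c(2)[symmetric] by metis
    then have "k.size_nm c = 1" using q(2) by simp
    then have ic: "inverse c \<in> k.L.ints" using k.size_nm_unit c(1) by blast
    have "c \<noteq> 0" using c q0 by auto
    then have "h = of_int q * inverse c" using c by simp
    then have "k.L.idvd (of_int q) h" using ic by blast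
    then show False using not_a k.L.idvd_trans h(4) by blast
  qed
  ultimately have "i = 1" using i(1) by linarith
  obtain n where n: "k.nm h = of_int n" using k.nm_int[OF h(1)] by blast
  have "nat \<bar>n\<bar> = nat q" using i \<open>i = 1\<close> k_size[OF n] by simp
  then have "n = q \<or> n = - q" using q(2) by linarith
  then obtain e where e: "e = 1 \<or> e = -1" "n = e * q" by (metis mult_1 mult_minus1)
  \<comment> \<open>Otherwise \<open>h\<close> would divide both \<open>a\<close> and its conjugate,
    hence the trace \<open>2 * s\<close>, and \<open>q\<close> would divide the norm of the
    latter.\<close>
  have "\<not> k.L.idvd h (k.gal h)"
  proof
    assume hg: "k.L.idvd h (k.gal h)"
    obtain c where c: "c \<in> k.L.ints" "a = h * c" using h(4) by (auto simp: k.L.idvd_def)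
    have "k.gal a = k.gal h * k.gal c" using c h by (simp add: k.gal_mult k.L.ints_mem)
    then have "k.L.idvd (k.gal h) (k.gal a)" using c by blast
    then have "k.L.idvd h (a + k.gal a)" by (rule k.L.idvd_add[OF h(4) k.L.idvd_trans[OF hg]])
    then have d: "k.L.idvd h (of_int (2 * s))" using tra(1) by (simp add: k.tr_def)
    have "k.nm (of_int (2 * s)) = of_int ((2 * s) ^ 2)" using k.nm_F[of "of_int (2 * s)"] by (simp only: Rats_of_int of_int_power)
    then have "k.size_nm (of_int (2 * s)) = nat \<bar>(2 * s) ^ 2\<bar>" by (rule k_size)
    then have "k.size_nm (of_int (2 * s)) = nat ((2 * s) ^ 2)" by (simp only: abs_of_nonneg zero_le_power2)
    then have "nat q ^ 1 dvd nat ((2 * s) ^ 2)" using k_size_dvd[OF h(1) k.L.ints_of_int d] i(2) \<open>i = 1\<close> by metis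
    then have "int (nat q) dvd int (nat ((2 * s) ^ 2))" by (simp only: of_nat_dvd_iff power_one_right)
    then have "q dvd (2 * s) ^ 2" using q(2) by (simp only: int_nat_eq) simp
    then show False using n2s q(1) prime_dvd_power_int by blast
  qed
  then show ?thesis using h(1) e n by blast
qed

text \<open>With \<open>b = 1 + x\<close> one has \<open>b ^ 2 = x * k.nm b\<close>, so (b) is an
  ambiguous ideal. Up to rational squares \<open>k.nm b\<close> is a squarefree divisor of the
  discriminant 8, and 2 is the square of \<open>sqrt2\<close>.\<close>

lemma k_unit_norm_one:
  assumes x: "x \<in> k.L.ints" and nm: "k.nm x = 1"
  shows "\<exists>v\<in>k.L. x = v ^ 2 \<or> x = - (v ^ 2)"
proof (cases "x = -1")
  case True
  then show ?thesis by (intro bexI[of _ 1]) auto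
next
  case False
  define b where "b = 1 + x"
  have b0: "b \<noteq> 0" using False by (auto simp: b_def add_eq_0_iff)
  have bO: "b \<in> k.L.ints" unfolding b_def by (intro k.L.ints_add x k.L.ints_1)
  have bL: "b \<in> k.L" using bO by (rule k.L.ints_mem)
  have xg: "x * k.gal x = 1" using nm by (simp add: k.nm_def)
  have n0: "k.nm b \<noteq> 0" using b0 bL by simp
  have nb: "k.nm b \<in> \<rat>" using bL by (rule k.nm_mem)
  have "k.gal b = 1 + k.gal x" using x by (simp add: b_def k.gal_add k.L.ints_mem)
  then have "x * k.nm b = b * (x + x * k.gal x)" by (simp add: k.nm_def algebra_simps)
  then have xb: "x * k.nm b = b ^ 2" unfolding xg by (simp add: b_def power2_eq_square add.commute)
  have "k.L.pideal (b * b) = k.L.pideal (k.nm b)"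
  proof (subst k.L.pideal_eq_iff)
    have "b * b / k.nm b = x" using xb n0 by (simp add: field_simps power2_eq_square)
    moreover have "k.nm b / (b * b) = k.gal x"
    proof -
      have "k.gal x * (b * b) = (x * k.gal x) * k.nm b" using xb by (simp add: power2_eq_square mult_ac)
      then show ?thesis using b0 xg by (simp add: field_simps)
    qed
    ultimately show "b * b / k.nm b \<in> k.L.ints \<and> k.nm b / (b * b) \<in> k.L.ints" using x by auto
  qed (use bL b0 n0 nb in \<open>auto intro: k.F_mem_L\<close>)
  then have sq: "k.sq_ideal (k.L.pideal b) (k.nm b)"
    using bL b0 n0 nb by (auto simp: k.sq_ideal_def k.L.pideal_mult)
  obtain c where c: "c \<in> \<rat>" "c \<noteq> 0" "Rat.radical (c ^ 2 * k.nm b)" using Rat.radical_multiple[OF nb n0] by blast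
  have "Rat.idvd (c ^ 2 * k.nm b) ((sqrt2 - k.gal sqrt2) ^ 2)"
    by (rule k.sq_ideal_dvd_discriminant[OF k.sq_ideal_scale[OF sq c(1,2)] c(3) k.D_ints k.rt_irrational])
  moreover have "(sqrt2 - k.gal sqrt2) ^ 2 = of_int 8" using k.rt_square by (simp add: power2_eq_square)
  moreover obtain m where m: "c ^ 2 * k.nm b = of_int m" using c(3) by (auto simp: Rat.radical_def ints_Rats elim!: Ints_cases)
  ultimately have m8: "m dvd 8" using Rat_idvd_of_int[of m 8] by simp
  have rad: "m dvd t" if "m dvd t ^ 2" for t
  proof -
    have "Rat.idvd (of_int m) (of_int t ^ 2)" using that Rat_idvd_of_int[of m "t ^ 2"] by simp
    then have "Rat.idvd (of_int m) (of_int t)" using c(3) unfolding m Rat.radical_def by auto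
    then show ?thesis by (simp add: Rat_idvd_of_int)
  qed
  have "m \<noteq> 0" using m c n0 by auto
  \<comment> \<open>If 4 divided \<open>m\<close>, then \<open>m\<close> would divide
    \<open>4 ^ 2\<close>, hence 4, and again by radicality 2.\<close>
  have "m \<in> {1, -1, 2, -2}"
  proof -
    have "nat \<bar>m\<bar> dvd 2 ^ 3" using m8 by (simp add: nat_abs_dvd_iff)
    then obtain i where i: "i \<le> 3" "nat \<bar>m\<bar> = 2 ^ i" using divides_primepow_nat[OF two_is_prime_nat] by blast
    have "\<not> 4 dvd m"
    proof
      assume "4 dvd m"
      have "m dvd 4" using rad[of 4] m8 dvd_trans[of m 8 16] by simp
      then have "m dvd 2 ^ 2" by simp
      then have "m dvd 2" by (rule rad)
      then show False using \<open>4 dvd m\<close> dvd_trans[of 4 m 2] by simp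
    qed
    then have "i < 2"
    proof (rule contrapos_np)
      assume "\<not> i < 2"
      then have "(4::nat) dvd nat \<bar>m\<bar>" unfolding i(2) using le_imp_power_dvd[of 2 i "2::nat"] by simp
      then have "int 4 dvd int (nat \<bar>m\<bar>)" by (simp only: of_nat_dvd_iff)
      then show "4 dvd m" by simp
    qed
    then have "i = 0 \<or> i = 1" by linarith
    then show ?thesis using i(2) by auto
  qed
  have cb: "of_int m * x = (c * b) ^ 2"
  proof -
    have "of_int m * x = c ^ 2 * (x * k.nm b)" using m by (simp add: mult_ac)
    then show ?thesis unfolding xb by (simp add: power_mult_distrib)
  qed
  have cbL: "c * b \<in> k.L" "c * b / sqrt2 \<in> k.L" using c(1) bL by auto
  have half: "(c * b / sqrt2) ^ 2 = (c * b) ^ 2 / 2" using k.rt_square by (simp add: power_divide)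
  from \<open>m \<in> {1, -1, 2, -2}\<close> consider "m = 1" | "m = -1" | "m = 2" | "m = -2" by blast
  then show ?thesis
  proof cases
    case 1
    then have "x = (c * b) ^ 2" using cb by simp
    then show ?thesis using cbL(1) by blast
  next
    case 2
    then have "- x = (c * b) ^ 2" using cb by simp
    then have "x = - ((c * b) ^ 2)" by (metis minus_minus)
    then show ?thesis using cbL(1) by blast
  next
    case 3
    then have "2 * x = (c * b) ^ 2" using cb by simp
    then have "x = (c * b / sqrt2) ^ 2" unfolding half by (metis nonzero_mult_div_cancel_left zero_neq_numeral)
    then show ?thesis using cbL(2) by blast
  next
    case 4
    then have "2 * (- x) = (c * b) ^ 2" using cb by simp
    then have "- x = (c * b / sqrt2) ^ 2" unfolding half by (metis nonzero_mult_div_cancel_left zero_neq_numeral)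
    then have "x = - ((c * b / sqrt2) ^ 2)" by (metis minus_minus)
    then show ?thesis using cbL(2) by blast
  qed
qed

subsection \<open>The biquadratic field\<close>

lemma (in real_quadratic) rational_square:
  assumes x: "x \<in> L" "x ^ 2 \<in> \<rat>"
  shows "x \<in> \<rat> \<or> x * rt \<in> \<rat>"
proof -
  have "gal x ^ 2 = gal (x ^ 2)" using x(1) by (simp add: gal_power)
  also have "\<dots> = x ^ 2" using x(2) by (rule gal_F)
  finally have "gal x = x \<or> gal x = - x" by (simp add: power2_eq_iff)
  then show ?thesis
  proof
    assume "gal x = x"
    then show ?thesis using gal_fixed_iff x(1) by blast
  next
    assume "gal x = - x"
    then have "gal (x * rt) = x * rt" using x(1) by (simp add: gal_mult)
    then show ?thesis using gal_fixed_iff[of "x * rt"] x(1) by blast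
  qed
qed

context four_primes_bits
begin

lemma sqrt2_sd: "sqrt2 * sd \<notin> \<rat>" using K'.rt_irrational by (simp add: sd'_eq)

lemma sd_notin_k: "sd \<notin> k.L"
proof
  assume "sd \<in> k.L"
  moreover have "sd ^ 2 \<in> \<rat>" by (simp only: K.rt_square Rats_of_int)
  ultimately show False using k.rational_square K.rt_irrational sqrt2_sd by (metis mult.commute)
qed

lemma sqrt2_square: "sqrt2 ^ 2 = 2" using k.rt_square by simp

lemma sqrt2_notin_K: "sqrt2 \<notin> K.L"
proof
  assume "sqrt2 \<in> K.L"
  moreover have "sqrt2 ^ 2 \<in> \<rat>" unfolding sqrt2_square by simp
  ultimately show False using K.rational_square k.rt_irrational sqrt2_sd by blast
qed

lemma sqrt2_notin_K': "sqrt2 \<notin> K'.L"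
proof
  assume "sqrt2 \<in> K'.L"
  moreover have "sqrt2 ^ 2 \<in> \<rat>" unfolding sqrt2_square by simp
  ultimately have "sqrt2 * sd' \<in> \<rat>" using K'.rational_square k.rt_irrational by blast
  moreover have "sqrt2 * sd' = 2 * sd" using sqrt2_square by (simp add: sd'_eq power2_eq_square)
  ultimately have "2 * sd / 2 \<in> \<rat>" by (metis Rats_divide Rats_number_of)
  then show False using K.rt_irrational by simp
qed

section \<open>The biquadratic field over its three quadratic subfields\<close>

sublocale K1: pid_sqrt_ext k.L sd k.size_nm
proof (intro pid_sqrt_ext.intro inv_sqrt_ext.intro k.L.invertible_subfield_axioms kk.normed_pid_subfield_axioms)
  show "sqrt_ext k.L sd"
  proof
    show "sd ^ 2 \<in> k.L" by (simp only: K.rt_square k.L.of_int_mem)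
  qed (rule sd_notin_k)
qed

sublocale M: inv_sqrt_ext K.L sqrt2
proof (intro inv_sqrt_ext.intro K.L.invertible_subfield_axioms)
  show "sqrt_ext K.L sqrt2" by unfold_locales (simp_all add: sqrt2_square sqrt2_notin_K)
qed

sublocale M': inv_sqrt_ext K'.L sqrt2
proof (intro inv_sqrt_ext.intro K'.L.invertible_subfield_axioms)
  show "sqrt_ext K'.L sqrt2" by unfold_locales (simp_all add: sqrt2_square sqrt2_notin_K')
qed

lemma sqrt2_mem [simp]: "sqrt2 \<in> K1.L" "sqrt2 \<in> k.L" by auto

lemma M_L: "M.L = K1.L"
proof
  have "a \<in> K1.L" if "a \<in> K.L" for a
    using that
  proof (rule K.L_cases)
    fix u v assume "u \<in> \<rat>" "v \<in> \<rat>" "a = u + v * sd"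
    then show "a \<in> K1.L" by (auto intro!: K1.L.add_mem K1.L.mult_mem)
  qed
  then show "M.L \<subseteq> K1.L" by (auto simp: M.L_def intro!: K1.L.add_mem K1.L.mult_mem)
  have "a \<in> M.L" if "a \<in> k.L" for a
    using that
  proof (rule k.L_cases)
    fix u v assume "u \<in> \<rat>" "v \<in> \<rat>" "a = u + v * sqrt2"
    then show "a \<in> M.L" by (auto intro!: M.L.add_mem M.L.mult_mem)
  qed
  moreover have "sd \<in> M.L" by (rule M.F_mem_L) simp
  ultimately show "K1.L \<subseteq> M.L" by (auto simp: K1.L_def intro!: M.L.add_mem M.L.mult_mem)
qed

lemma M'_L: "M'.L = K1.L"
proof
  have sd': "sd' \<in> K1.L" unfolding sd'_eq by (rule K1.L.mult_mem) simp_all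
  have "a \<in> K1.L" if "a \<in> K'.L" for a
    using that
  proof (rule K'.L_cases)
    fix u v assume "u \<in> \<rat>" "v \<in> \<rat>" "a = u + v * sd'"
    then show "a \<in> K1.L" using sd' by (auto intro!: K1.L.add_mem K1.L.mult_mem)
  qed
  then show "M'.L \<subseteq> K1.L" by (auto simp: M'.L_def intro!: K1.L.add_mem K1.L.mult_mem)
  have "a \<in> M'.L" if "a \<in> k.L" for a
    using that
  proof (rule k.L_cases)
    fix u v assume "u \<in> \<rat>" "v \<in> \<rat>" "a = u + v * sqrt2"
    then show "a \<in> M'.L" by (auto intro!: M'.L.add_mem M'.L.mult_mem)
  qed
  moreover have "sd \<in> M'.L"
  proof -
    have "sqrt2 * sd' = 2 * sd" using sqrt2_square by (simp add: sd'_eq power2_eq_square)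
    then have "sd = sqrt2 * sd' / 2" by simp
    moreover have "sd' \<in> M'.L" by (rule M'.F_mem_L) simp
    ultimately show ?thesis by (metis M'.L.divide_mem M'.L.mult_mem M'.L.numeral_mem M'.s_mem_L)
  qed
  ultimately show "K1.L \<subseteq> M'.L" by (auto simp: K1.L_def intro!: M'.L.add_mem M'.L.mult_mem)
qed

lemma adjoin_sqrt2_sd: "complex_adjoin {sqrt2, sd} = K1.L"
  using K1.adjoin_eq_L[of "{sqrt2}"] k.adjoin_eq_L[OF adjoin_empty[symmetric]] by (simp add: insert_commute)

lemma M_gal_k: "x \<in> k.L \<Longrightarrow> M.gal x = k.gal x"
proof (elim k.L_cases)
  fix a b assume ab: "a \<in> \<rat>" "b \<in> \<rat>" "x = a + b * sqrt2"
  then show ?thesis using M.gal_eq[of a b] k.gal_eq[of a b] by (simp add: K.F_mem_L)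
qed

lemma K1_gal_K: "x \<in> K.L \<Longrightarrow> K1.gal x = K.gal x"
proof (elim K.L_cases)
  fix a b assume ab: "a \<in> \<rat>" "b \<in> \<rat>" "x = a + b * sd"
  then show ?thesis using K1.gal_eq[of a b] K.gal_eq[of a b] by (simp add: k.F_mem_L)
qed

lemma M_gal_coords: "a \<in> k.L \<Longrightarrow> b \<in> k.L \<Longrightarrow> M.gal (a + b * sd) = k.gal a + k.gal b * sd"
proof -
  assume ab: "a \<in> k.L" "b \<in> k.L"
  then have mem: "a \<in> M.L" "b \<in> M.L" "sd \<in> M.L" unfolding M_L by auto
  have "M.gal sd = sd" by (rule M.gal_F) simp
  then show ?thesis using mem ab by (simp add: M.gal_add M.gal_mult M.L.mult_mem M_gal_k)
qed

lemma gal_commute: "x \<in> K1.L \<Longrightarrow> M.gal (K1.gal x) = K1.gal (M.gal x)"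
proof (elim K1.L_cases)
  fix a b assume ab: "a \<in> k.L" "b \<in> k.L" "x = a + b * sd"
  have "K1.gal x = a + (- b) * sd" using K1.gal_eq ab by simp
  then have "M.gal (K1.gal x) = k.gal a + k.gal (- b) * sd" using M_gal_coords[of a "- b"] ab k.L.uminus_mem[of b] by metis
  also have "\<dots> = k.gal a - k.gal b * sd" using ab by (simp add: k.gal_uminus)
  also have "\<dots> = K1.gal (k.gal a + k.gal b * sd)" using ab by (intro K1.gal_eq[symmetric]) auto
  finally show ?thesis using M_gal_coords[OF ab(1,2)] ab(3) by simp
qed

text \<open>The automorphism that fixes \<open>sqrt2 * sd\<close> and moves \<open>sqrt2\<close>
  must also move \<open>sd\<close>; it is the product of the other two.\<close>

lemma M'_gal: "x \<in> K1.L \<Longrightarrow> M'.gal x = K1.gal (M.gal x)"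
proof -
  assume "x \<in> K1.L"
  then have "x \<in> M'.L" by (simp add: M'_L)
  then show ?thesis
  proof (rule M'.L_cases)
    fix a b assume ab: "a \<in> K'.L" "b \<in> K'.L" "x = a + b * sqrt2"
    have mem: "y \<in> K1.L" if "y \<in> K'.L" for y using M'.F_mem_L[OF that] by (simp add: M'_L)
    have Mmem: "M.gal y \<in> K1.L" if "y \<in> K1.L" for y using M.gal_mem[of y] that by (simp add: M_L)
    have fix': "K1.gal (M.gal y) = y" if "y \<in> K'.L" for y
      using that
    proof (rule K'.L_cases)
      fix u v assume uv: "u \<in> \<rat>" "v \<in> \<rat>" "y = u + v * sd'"
      then have "y = u + (v * sqrt2) * sd" by (simp add: sd'_eq)
      moreover have "u \<in> k.L" "v * sqrt2 \<in> k.L" using uv by auto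
      ultimately have "M.gal y = k.gal u + k.gal (v * sqrt2) * sd" using M_gal_coords by simp
      also have "\<dots> = u + (- (v * sqrt2)) * sd" using uv by (simp add: k.gal_mult k.F_mem_L)
      also have "K1.gal \<dots> = u - (- (v * sqrt2)) * sd" using uv by (intro K1.gal_eq) auto
      finally show ?thesis using uv by (simp add: sd'_eq)
    qed
    have "M.gal x = M.gal a - M.gal b * sqrt2"
      using mem[OF ab(1)] mem[OF ab(2)] ab(3) by (simp add: M.gal_add M.gal_mult M_L[symmetric] M.L.mult_mem)
    then have "K1.gal (M.gal x) = K1.gal (M.gal a) - K1.gal (M.gal b) * sqrt2"
      using Mmem[OF mem[OF ab(1)]] Mmem[OF mem[OF ab(2)]] by (simp add: K1.gal_diff K1.gal_mult K1.L.mult_mem)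
    also have "\<dots> = a - b * sqrt2" using fix' ab by simp
    finally show ?thesis using M'.gal_eq[OF ab(1,2)] ab(3) by simp
  qed
qed

text \<open>Both sides are the product of the four conjugates of \<open>x\<close>.\<close>

lemma norm_transitivity:
  assumes x: "x \<in> K1.L"
  shows "k.nm (K1.nm x) = K.nm (M.nm x)" "M.nm x \<in> K.L"
proof -
  have xM: "x \<in> M.L" using x by (simp add: M_L)
  show MK: "M.nm x \<in> K.L" using M.nm_mem[OF xM] .
  have s: "K1.gal x \<in> K1.L" "M.gal x \<in> K1.L" using K1.gal_mem[OF x] M.gal_mem[OF xM] by (simp_all add: M_L)
  have "k.nm (K1.nm x) = K1.nm x * M.gal (K1.nm x)" using K1.nm_mem[OF x] by (simp add: k.nm_def M_gal_k)
  also have "M.gal (K1.nm x) = M.gal x * M.gal (K1.gal x)"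
    unfolding K1.nm_def using s(1) xM by (intro M.gal_mult) (simp_all add: M_L)
  finally have 1: "k.nm (K1.nm x) = (x * K1.gal x) * (M.gal x * K1.gal (M.gal x))"
    by (simp add: K1.nm_def gal_commute[OF x])
  have "K.nm (M.nm x) = M.nm x * K1.gal (M.nm x)" using MK by (simp add: K.nm_def K1_gal_K)
  also have "K1.gal (M.nm x) = K1.gal x * K1.gal (M.gal x)" unfolding M.nm_def using s x by (intro K1.gal_mult)
  finally show "k.nm (K1.nm x) = K.nm (M.nm x)" unfolding 1 by (simp add: M.nm_def)
qed

text \<open>Comparing the coefficients of 1 and \<open>sqrt2\<close> gives two rational equations,
  and a common denominator makes them those of \<open>minus_one_descent\<close>.\<close>

lemma K1_norm_not_minus_one:
  assumes y: "y \<in> K1.L"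
  shows "K1.nm y \<noteq> -1"
proof
  assume nm: "K1.nm y = -1"
  from y show False
  proof (rule K1.L_cases)
    fix a b assume ab: "a \<in> k.L" "b \<in> k.L" "y = a + b * sd"
    obtain a1 a2 where a: "a1 \<in> \<rat>" "a2 \<in> \<rat>" "a = a1 + a2 * sqrt2" using ab(1) by (rule k.L_cases)
    obtain b1 b2 where b: "b1 \<in> \<rat>" "b2 \<in> \<rat>" "b = b1 + b2 * sqrt2" using ab(2) by (rule k.L_cases)
    have sq: "(x + u * sqrt2) ^ 2 = (x ^ 2 + 2 * u ^ 2) + (2 * (x * u)) * sqrt2" for x u
      using sqrt2_square by (simp add: power2_eq_square algebra_simps)
    have "a ^ 2 - of_int d * b ^ 2 = -1" using K1.nm_coords[OF ab(1,2)] ab(3) nm K.rt_square by simp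
    then have "((a1 ^ 2 + 2 * a2 ^ 2) - of_int d * (b1 ^ 2 + 2 * b2 ^ 2)) + (2 * (a1 * a2) - of_int d * (2 * (b1 * b2))) * sqrt2
        = (-1) + 0 * sqrt2"
      unfolding a(3) b(3) sq by (simp add: algebra_simps)
    then have "a1 ^ 2 + 2 * a2 ^ 2 - of_int d * (b1 ^ 2 + 2 * b2 ^ 2) = -1 \<and> 2 * (a1 * a2) - of_int d * (2 * (b1 * b2)) = 0"
      by (intro k.coords_unique) (use a b in auto)
    then have eq: "a1 ^ 2 + 2 * a2 ^ 2 + 1 = of_int d * (b1 ^ 2 + 2 * b2 ^ 2)" "a1 * a2 = of_int d * (b1 * b2)"
      by (simp_all add: algebra_simps add_eq_0_iff)
    obtain k1 l1 where 1: "l1 > 0" "a1 = of_int k1 / of_int l1" using a(1) by (elim Rats_cases') auto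
    obtain k2 l2 where 2: "l2 > 0" "a2 = of_int k2 / of_int l2" using a(2) by (elim Rats_cases') auto
    obtain k3 l3 where 3: "l3 > 0" "b1 = of_int k3 / of_int l3" using b(1) by (elim Rats_cases') auto
    obtain k4 l4 where 4: "l4 > 0" "b2 = of_int k4 / of_int l4" using b(2) by (elim Rats_cases') auto
    define z where "z = l1 * l2 * l3 * l4"
    define x where "x = k1 * l2 * l3 * l4"
    define u where "u = k2 * l1 * l3 * l4"
    define yy where "yy = k3 * l1 * l2 * l4"
    define v where "v = k4 * l1 * l2 * l3"
    have c: "of_int x = of_int z * a1" "of_int u = of_int z * a2" "of_int yy = of_int z * b1" "of_int v = of_int z * b2"
      using 1 2 3 4 by (simp_all add: x_def u_def yy_def v_def z_def)
    have z: "z \<noteq> 0" using 1 2 3 4 by (simp add: z_def)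
    have "(of_int (x ^ 2 + 2 * u ^ 2 + z ^ 2) :: complex) = of_int z ^ 2 * (a1 ^ 2 + 2 * a2 ^ 2 + 1)"
      using c by (simp add: power_mult_distrib algebra_simps)
    also have "\<dots> = of_int (d * (yy ^ 2 + 2 * v ^ 2))"
      unfolding eq using c by (simp add: power_mult_distrib algebra_simps)
    finally have e1: "x ^ 2 + 2 * u ^ 2 + z ^ 2 = d * (yy ^ 2 + 2 * v ^ 2)" by (simp only: of_int_eq_iff)
    have "(of_int (x * u) :: complex) = of_int z ^ 2 * (a1 * a2)" using c by (simp add: power2_eq_square)
    also have "\<dots> = of_int (d * (yy * v))" unfolding eq using c by (simp add: power2_eq_square)
    finally have e2: "x * u = d * (yy * v)" by (simp only: of_int_eq_iff)
    show False using minus_one_descent[OF primes(1) mod8(1) d_split(1,2) e1 e2] z by simp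
  qed
qed

text \<open>The norm of this unit to the rationals is also a norm from \<open>K\<close>, so it is 1
  and not -1. Then the unit is a square up to sign, and the negative sign would make -1 a relative
  norm.\<close>

lemma K1_unit_norms:
  assumes x: "x \<in> K1.L" and u: "K1.nm x \<in> k.L.ints" "inverse (K1.nm x) \<in> k.L.ints"
  shows "\<exists>v\<in>k.L. K1.nm x = v ^ 2"
proof -
  obtain n m where nm: "k.nm (K1.nm x) = of_int n" "k.nm (inverse (K1.nm x)) = of_int m" using k.nm_int u by blast
  have kx: "K1.nm x \<in> k.L" using K1.nm_mem[OF x] .
  show ?thesis
  proof (cases "K1.nm x = 0")
    case True
    then show ?thesis by (intro bexI[of _ 0]) auto
  next
    case False
    have "K1.nm x * inverse (K1.nm x) = 1" using False by simp
    then have "k.nm (K1.nm x) * k.nm (inverse (K1.nm x)) = k.nm 1" using k.nm_mult[OF kx k.L.inverse_mem[OF kx]] by metis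
    then have "of_int (n * m) = (1 :: complex)" using nm by (simp add: k.nm_def)
    then have "n * m = 1" by (simp only: of_int_eq_1_iff)
    then have "n = 1 \<or> n = -1" using zmult_eq_1_iff by blast
    moreover have "n \<noteq> -1"
      using K.norm_not_minus_one[OF norm_transitivity(2)[OF x]] norm_transitivity(1)[OF x] nm(1) by auto
    ultimately have "k.nm (K1.nm x) = 1" using nm(1) by simp
    then obtain v where v: "v \<in> k.L" "K1.nm x = v ^ 2 \<or> K1.nm x = - (v ^ 2)" using k_unit_norm_one[OF u(1)] by blast
    moreover have "K1.nm x \<noteq> - (v ^ 2)"
    proof
      assume *: "K1.nm x = - (v ^ 2)"
      have v0: "v \<noteq> 0" using False * by auto
      have "K1.nm (x / v) = K1.nm x / K1.nm v" using x v(1) by (intro K1.nm_divide) auto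
      also have "\<dots> = -1" using * v0 K1.nm_F[OF v(1)] by simp
      finally show False using K1_norm_not_minus_one[of "x / v"] x v(1) by auto
    qed
    ultimately show ?thesis by blast
  qed
qed

end

text \<open>The fibres of squaring are cosets of the 2-torsion.\<close>

lemma (in comm_group) finite_of_finite_squares:
  assumes T: "finite {c \<in> carrier G. c \<otimes> c = \<one>}" and S: "finite ((\<lambda>c. c \<otimes> c) ` carrier G)"
  shows "finite (carrier G)"
proof -
  have fib: "finite {c \<in> carrier G. c \<otimes> c = b \<otimes> b}" if b: "b \<in> carrier G" for b
  proof (rule finite_subset)
    show "{c \<in> carrier G. c \<otimes> c = b \<otimes> b} \<subseteq> (\<lambda>c. b \<otimes> c) ` {c \<in> carrier G. c \<otimes> c = \<one>}"
    proof
      fix c assume "c \<in> {c \<in> carrier G. c \<otimes> c = b \<otimes> b}"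
      then have c: "c \<in> carrier G" "c \<otimes> c = b \<otimes> b" by auto
      have "(inv b \<otimes> c) \<otimes> (inv b \<otimes> c) = inv (b \<otimes> b) \<otimes> (c \<otimes> c)" using b c(1) by (simp add: inv_mult m_ac)
      then have "(inv b \<otimes> c) \<otimes> (inv b \<otimes> c) = \<one>" using b c(2) by simp
      moreover have "c = b \<otimes> (inv b \<otimes> c)" using b c(1) by (simp flip: m_assoc)
      ultimately show "c \<in> (\<lambda>c. b \<otimes> c) ` {c \<in> carrier G. c \<otimes> c = \<one>}" using b c(1) by blast
    qed
  qed (use T in simp)
  have "carrier G \<subseteq> (\<Union>s\<in>(\<lambda>c. c \<otimes> c) ` carrier G. {c \<in> carrier G. c \<otimes> c = s})" by auto
  moreover have "finite \<dots>" using fib by (intro finite_UN_I[OF S]) auto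
  ultimately show ?thesis by (rule finite_subset)
qed

lemma (in complex_subfield) idvd_peel_cases:
  assumes p: "p \<in> \<O>" "p \<noteq> 0" "\<And>x. x \<in> \<O> \<Longrightarrow> p idvd x \<or> (\<exists>u\<in>\<O>. \<exists>v\<in>\<O>. u * p + v * x = 1)"
    and g: "g \<in> \<O>" and h: "h \<in> \<O>" and dvd: "g idvd p * h"
  shows "\<exists>b. \<exists>g'\<in>\<O>. g = (if b then p else 1) * g' \<and> g' idvd h"
proof -
  have "g idvd h \<or> (\<exists>g'\<in>\<O>. g = p * g' \<and> g' idvd h)" by (rule idvd_peel[OF p(1,2) _ g h dvd]) (rule p(3))
  then show ?thesis
  proof (elim disjE bexE conjE)
    assume "g idvd h"
    then show ?thesis using g by (intro exI[of _ False] bexI[of _ g]) auto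
  next
    fix g' assume "g' \<in> \<O>" "g = p * g'" "g' idvd h"
    then show ?thesis by (intro exI[of _ True] bexI[of _ g']) auto
  qed
qed

lemma sdiff_four:
  assumes S: "S \<subseteq> P" "S \<noteq> {}" "S \<noteq> P"
  shows "card {{}, P, S, P - S} = 4"
    and "\<And>T U. T \<in> {{}, P, S, P - S} \<Longrightarrow> U \<in> {{}, P, S, P - S} \<Longrightarrow> sdiff T U \<in> {{}, P, S, P - S}"
    and "sdiff P S = P - S"
proof -
  have "P - S \<noteq> {}" "P - S \<noteq> P" "P - S \<noteq> S" "P \<noteq> {}" using S by auto
  then show "card {{}, P, S, P - S} = 4" using S(2,3) by auto
  show compl: "sdiff P S = P - S" using S(1) by (auto simp: sdiff_def)
  have "sdiff S P = P - S" "sdiff P (P - S) = S" "sdiff (P - S) P = S" "sdiff S (P - S) = P" "sdiff (P - S) S = P"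
    using S(1) by (auto simp: sdiff_def)
  then show "\<And>T U. T \<in> {{}, P, S, P - S} \<Longrightarrow> U \<in> {{}, P, S, P - S} \<Longrightarrow> sdiff T U \<in> {{}, P, S, P - S}"
    using compl by (elim insertE emptyE) simp_all
qed

section \<open>Finiteness and exponent of the class group\<close>

context four_primes_bits
begin

abbreviation C1 where "C1 \<equiv> ideal_class_group K1.L"

lemma M_ext_frac: "fractional_ideal K.L J \<Longrightarrow> fractional_ideal K1.L (M.ext J)"
  using M.ext_frac by (simp add: M_L)

lemma M'_ext_frac: "fractional_ideal K'.L J \<Longrightarrow> fractional_ideal K1.L (M'.ext J)"
  using M'.ext_frac by (simp add: M'_L)

text \<open>\<open>I\<^sup>2 \<tau>(I \<sigma>I) = (I \<tau>I)(I \<sigma>\<tau>I)\<close>, where \<open>I \<sigma>I\<close> is principal because \<open>\<rat>(\<surd>2)\<close> has class number one.\<close>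

lemma class_square:
  assumes I: "fractional_ideal K1.L I"
  shows "\<exists>b b'. fractional_ideal K.L b \<and> fractional_ideal K'.L b' \<and>
    K1.L.cl I \<otimes>\<^bsub>C1\<^esub> K1.L.cl I = K1.L.cl (M.ext b) \<otimes>\<^bsub>C1\<^esub> K1.L.cl (M'.ext b')"
proof -
  have sub: "I \<subseteq> K1.L" using K1.L.frac_mem[OF I] by auto
  obtain b where b: "fractional_ideal K.L b" "I \<star> M.gal ` I = M.ext b"
    using M.relative_norm_ideal[of I] I by (auto simp: M_L)
  obtain b' where b': "fractional_ideal K'.L b'" "I \<star> M'.gal ` I = M'.ext b'"
    using M'.relative_norm_ideal[of I] I by (auto simp: M'_L)
  obtain g where g: "g \<in> k.L" "g \<noteq> 0" "I \<star> K1.gal ` I = K1.L.pideal g" using K1.relative_norm_principal[OF I] by blast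
  have gL: "g \<in> K1.L" using g(1) by (rule K1.F_mem_L)
  have "M'.gal ` I = M.gal ` K1.gal ` I"
    unfolding image_image using sub by (intro image_cong) (auto simp: M'_gal gal_commute)
  moreover have "K1.gal ` I \<subseteq> K1.L" using sub by auto
  ultimately have "M.gal ` (I \<star> K1.gal ` I) = M.gal ` I \<star> M'.gal ` I"
    using sub M.gal_image_iprod[of I "K1.gal ` I"] by (simp add: M_L)
  then have eq: "M.gal ` I \<star> M'.gal ` I = K1.L.pideal (M.gal g)"
    using M.gal_image_pideal[of g] gL g(3) by (simp add: M_L)
  have "M.ext b \<star> M'.ext b' = (M.gal ` I \<star> M'.gal ` I) \<star> (I \<star> I)"
    unfolding b(2)[symmetric] b'(2)[symmetric] by (simp only: iprod_ac)
  then have "K1.L.cl (M.ext b \<star> M'.ext b') = K1.L.cl (K1.L.pideal (M.gal g) \<star> (I \<star> I))" unfolding eq by simp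
  also have "\<dots> = K1.L.cl (I \<star> I)"
    using gL g(2) M.gal_mem[of g] M.gal_eq_0_iff[of g] I by (intro K1.L.cl_eqI) (auto simp: M_L)
  finally show ?thesis
    using b(1) b'(1) I by (intro exI[of _ b] exI[of _ b']) (simp add: K1.L.cl_mult M_ext_frac M'_ext_frac)
qed

lemma finite_squares: "finite ((\<lambda>c. c \<otimes>\<^bsub>C1\<^esub> c) ` carrier C1)"
proof (rule finite_subset)
  define E where "E = {K1.L.cl (M.ext J) | J. fractional_ideal K.L J}"
  define E' where "E' = {K1.L.cl (M'.ext J) | J. fractional_ideal K'.L J}"
  have "finite E" using M.finite_ext_classes[OF K.finite_class_group] by (simp add: E_def M_L)
  moreover have "finite E'" using M'.finite_ext_classes[OF K'.finite_class_group] by (simp add: E'_def M'_L)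
  ultimately show "finite ((\<lambda>(u, v). u \<otimes>\<^bsub>C1\<^esub> v) ` (E \<times> E'))" by simp
  show "(\<lambda>c. c \<otimes>\<^bsub>C1\<^esub> c) ` carrier C1 \<subseteq> (\<lambda>(u, v). u \<otimes>\<^bsub>C1\<^esub> v) ` (E \<times> E')"
  proof clarify
    fix c assume "c \<in> carrier C1"
    then obtain I where I: "fractional_ideal K1.L I" "c = K1.L.cl I" using K1.L.cl_surj by blast
    then obtain b b' where "fractional_ideal K.L b" "fractional_ideal K'.L b'"
      "c \<otimes>\<^bsub>C1\<^esub> c = K1.L.cl (M.ext b) \<otimes>\<^bsub>C1\<^esub> K1.L.cl (M'.ext b')" using class_square by blast
    then show "c \<otimes>\<^bsub>C1\<^esub> c \<in> (\<lambda>(u, v). u \<otimes>\<^bsub>C1\<^esub> v) ` (E \<times> E')"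
      by (intro image_eqI[of _ _ "(K1.L.cl (M.ext b), K1.L.cl (M'.ext b'))"]) (auto simp: E_def E'_def)
  qed
qed

text \<open>The square of a class is a product of two classes extended from quadratic fields whose
  class groups have exponent twice an odd number.\<close>

lemma class_exponent: "\<exists>n::nat. odd n \<and> (\<forall>c\<in>carrier C1. c [^]\<^bsub>C1\<^esub> (4 * n) = \<one>\<^bsub>C1\<^esub>)"
proof -
  have "\<exists>m::nat. odd m \<and> (\<forall>c\<in>carrier K.L.C. c [^]\<^bsub>K.L.C\<^esub> (2 * m) = \<one>\<^bsub>K.L.C\<^esub>)"
    using K_two_torsion(3) by (intro K.L.C.torsion_elementary(2)[OF K.finite_class_group])
  then obtain m :: nat where "odd m \<and> (\<forall>c\<in>carrier K.L.C. c [^]\<^bsub>K.L.C\<^esub> (2 * m) = \<one>\<^bsub>K.L.C\<^esub>)" by (rule exE)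
  then have m: "odd m" "\<And>c. c \<in> carrier K.L.C \<Longrightarrow> c [^]\<^bsub>K.L.C\<^esub> (2 * m) = \<one>\<^bsub>K.L.C\<^esub>" by simp_all
  have "\<exists>m::nat. odd m \<and> (\<forall>c\<in>carrier K'.L.C. c [^]\<^bsub>K'.L.C\<^esub> (2 * m) = \<one>\<^bsub>K'.L.C\<^esub>)"
    using K'_two_torsion(3) by (intro K'.L.C.torsion_elementary(2)[OF K'.finite_class_group])
  then obtain m' :: nat where "odd m' \<and> (\<forall>c\<in>carrier K'.L.C. c [^]\<^bsub>K'.L.C\<^esub> (2 * m') = \<one>\<^bsub>K'.L.C\<^esub>)" by (rule exE)
  then have m': "odd m'" "\<And>c. c \<in> carrier K'.L.C \<Longrightarrow> c [^]\<^bsub>K'.L.C\<^esub> (2 * m') = \<one>\<^bsub>K'.L.C\<^esub>" by simp_all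
  have "c [^]\<^bsub>C1\<^esub> (4 * (m * m')) = \<one>\<^bsub>C1\<^esub>" if c: "c \<in> carrier C1" for c
  proof -
    obtain I where I: "fractional_ideal K1.L I" "c = K1.L.cl I" using K1.L.cl_surj[OF c] by blast
    then obtain b b' where b: "fractional_ideal K.L b" "fractional_ideal K'.L b'"
      "c \<otimes>\<^bsub>C1\<^esub> c = K1.L.cl (M.ext b) \<otimes>\<^bsub>C1\<^esub> K1.L.cl (M'.ext b')" using class_square by blast
    define u where "u = K1.L.cl (M.ext b)"
    define v where "v = K1.L.cl (M'.ext b')"
    have uv: "u \<in> carrier C1" "v \<in> carrier C1" using b by (auto simp: u_def v_def M_ext_frac M'_ext_frac)
    have "u [^]\<^bsub>C1\<^esub> (2 * m) = \<one>\<^bsub>C1\<^esub>" using M.ext_class_pow[OF m(2) b(1)] by (simp add: u_def M_L)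
    then have u1: "u [^]\<^bsub>C1\<^esub> (2 * m * m') = \<one>\<^bsub>C1\<^esub>"
      using K1.L.C.nat_pow_pow[OF uv(1), of "2 * m" m'] by simp
    have "v [^]\<^bsub>C1\<^esub> (2 * m') = \<one>\<^bsub>C1\<^esub>" using M'.ext_class_pow[OF m'(2) b(2)] by (simp add: v_def M'_L)
    then have v1: "v [^]\<^bsub>C1\<^esub> (2 * m' * m) = \<one>\<^bsub>C1\<^esub>"
      using K1.L.C.nat_pow_pow[OF uv(2), of "2 * m'" m] by simp
    have "c [^]\<^bsub>C1\<^esub> (4 * (m * m')) = (c [^]\<^bsub>C1\<^esub> (2::nat)) [^]\<^bsub>C1\<^esub> (2 * m * m')"
      unfolding K1.L.C.nat_pow_pow[OF c] by (simp add: mult_ac)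
    also have "c [^]\<^bsub>C1\<^esub> (2::nat) = u \<otimes>\<^bsub>C1\<^esub> v"
      unfolding K1.L.C.pow_2_4(1)[OF c] b(3) u_def v_def ..
    also have "(u \<otimes>\<^bsub>C1\<^esub> v) [^]\<^bsub>C1\<^esub> (2 * m * m') = \<one>\<^bsub>C1\<^esub>"
      using u1 v1 uv by (simp add: K1.L.C.nat_pow_distrib mult_ac)
    finally show ?thesis .
  qed
  then show ?thesis using m(1) m'(1) by (intro exI[of _ "m * m'"]) auto
qed

section \<open>Ambiguous classes from rational integers\<close>

definition xid :: "int set \<Rightarrow> complex set" where "xid S = M.ext (K.am S)"
definition xcl :: "int set \<Rightarrow> complex set set" where "xcl S = K1.L.cl (xid S)"

lemma K_am_frac: "S \<subseteq> Pr \<Longrightarrow> fractional_ideal K.L (K.am S)"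
  using K.sq_idealD(1)[OF K.sq_ideal_am] .

lemma sq_ideal_xid: "S \<subseteq> Pr \<Longrightarrow> K1.sq_ideal (xid S) (of_int (\<Prod>S))"
proof -
  assume S: "S \<subseteq> Pr"
  have nz: "(of_int (\<Prod>S) :: complex) \<noteq> 0" using K.prod_pos[OF S] by (simp only: of_int_eq_0_iff)
  have "xid S \<star> xid S = M.ext (K.am S \<star> K.am S)" by (simp add: xid_def M.ext_iprod)
  also have "\<dots> = M.ext (K.L.pideal (of_int (\<Prod>S)))" using K.sq_idealD(4)[OF K.sq_ideal_am[OF S]] by simp
  also have "\<dots> = K1.L.pideal (of_int (\<Prod>S))" using M.ext_pideal[OF K.L.of_int_mem nz] by (simp only: M_L)
  finally show ?thesis
    unfolding K1.sq_ideal_def using nz M_ext_frac[OF K_am_frac[OF S]] by (simp only: xid_def k.L.of_int_mem) simp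
qed

lemma xid_frac: "S \<subseteq> Pr \<Longrightarrow> fractional_ideal K1.L (xid S)" using K1.sq_idealD(1)[OF sq_ideal_xid] .

lemma xcl_mem: "S \<subseteq> Pr \<Longrightarrow> xcl S \<in> carrier C1" by (simp add: xcl_def xid_frac)

lemma xcl_mult:
  assumes S: "S \<subseteq> Pr" and T: "T \<subseteq> Pr"
  shows "xcl (sdiff S T) = xcl S \<otimes>\<^bsub>C1\<^esub> xcl T"
proof -
  have f: "fractional_ideal K.L (K.am (sdiff S T))" "fractional_ideal K.L (K.am S \<star> K.am T)"
    using K_am_frac[OF sdiff_subset[OF S T]] K_am_frac[OF S] K_am_frac[OF T] by auto
  have "K.L.cl (K.am (sdiff S T)) = K.L.cl (K.am S \<star> K.am T)"
    using K.cls_mult[OF S T] K_am_frac[OF S] K_am_frac[OF T] by (simp add: K.cls_def K.L.cl_mult)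
  then have "xcl (sdiff S T) = K1.L.cl (M.ext (K.am S \<star> K.am T))"
    using M.ext_cl_cong[OF f] by (simp add: xcl_def xid_def M_L)
  then show ?thesis using xid_frac[OF S] xid_frac[OF T] by (simp add: xcl_def xid_def M.ext_iprod K1.L.cl_mult)
qed

lemma K1_cl_ints: "K1.L.cl (K1.L.ints) = \<one>\<^bsub>C1\<^esub>"
  using K1.L.cl.hom_one by simp

lemma xcl_one_K:
  assumes S: "S \<subseteq> Pr" and one: "K.cls S = \<one>\<^bsub>K.L.C\<^esub>"
  shows "xcl S = \<one>\<^bsub>C1\<^esub>"
proof -
  have "K.L.cl (K.am S) = K.L.cl (K.L.ints)" using one K.L.cl.hom_one by (simp add: K.cls_def)
  then have "xcl S = K1.L.cl (M.ext (K.L.ints))"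
    using M.ext_cl_cong[OF K_am_frac[OF S] K.L.frac_ints] by (simp add: xcl_def xid_def M_L)
  then show ?thesis using K1_cl_ints by (simp add: M_L)
qed

lemma sqrt2_nz: "sqrt2 \<noteq> 0" by (simp add: sqrt2_def)

lemma xcl_one_K':
  assumes T: "T \<subseteq> Pr'" and one: "K'.cls T = \<one>\<^bsub>K'.L.C\<^esub>"
  shows "xcl (T - {2}) = \<one>\<^bsub>C1\<^esub>"
proof -
  have sub: "T - {2} \<subseteq> Pr" using T by auto
  have fin: "finite T" using T finite_subset by blast
  have fT: "fractional_ideal K'.L (K'.am T)" using K'.sq_idealD(1)[OF K'.sq_ideal_am[OF T]] .
  have nz: "(of_int (\<Prod>T) :: complex) \<noteq> 0" using K'.prod_pos[OF T] by (simp only: of_int_eq_0_iff)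
  define J where "J = M'.ext (K'.am T)"
  have "J \<star> J = M'.ext (K'.L.pideal (of_int (\<Prod>T)))"
    using K'.sq_idealD(4)[OF K'.sq_ideal_am[OF T]] by (simp add: J_def M'.ext_iprod[symmetric])
  also have "\<dots> = K1.L.pideal (of_int (\<Prod>T))" using M'.ext_pideal[OF K'.L.of_int_mem nz] by (simp only: M'_L)
  finally have J: "K1.sq_ideal J (of_int (\<Prod>T))"
    unfolding K1.sq_ideal_def using nz M'_ext_frac[OF fT] by (simp only: J_def k.L.of_int_mem) simp
  have "K'.L.cl (K'.am T) = K'.L.cl (K'.L.ints)" using one K'.L.cl.hom_one by (simp add: K'.cls_def)
  then have "K1.L.cl J = K1.L.cl (M'.ext (K'.L.ints))"
    using M'.ext_cl_cong[OF fT K'.L.frac_ints] by (simp add: J_def M'_L)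
  then have J1: "K1.L.cl J = \<one>\<^bsub>C1\<^esub>" using K1_cl_ints by (simp add: M'_L)
  show ?thesis
  proof (cases "2 \<in> T")
    case False
    then have "T - {2} = T" by simp
    then show ?thesis using K1.sq_ideal_unique[OF J] sq_ideal_xid[OF sub] J1 by (simp only: xcl_def)
  next
    case True
    have "\<Prod>T = 2 * \<Prod>(T - {2})" using prod.remove[OF fin True, of "\<lambda>x. x"] by simp
    then have eq: "sqrt2 ^ 2 * of_int (\<Prod>(T - {2})) = (of_int (\<Prod>T) :: complex)" unfolding sqrt2_square by simp
    have "K1.sq_ideal (K1.L.pideal sqrt2 \<star> xid (T - {2})) (of_int (\<Prod>T))"
      using K1.sq_ideal_scale[OF sq_ideal_xid[OF sub] sqrt2_mem(2) sqrt2_nz] unfolding eq .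
    then have "J = K1.L.pideal sqrt2 \<star> xid (T - {2})" by (rule K1.sq_ideal_unique[OF J])
    then show ?thesis using J1 K1.L.cl_eqI[OF xid_frac[OF sub] sqrt2_mem(1) sqrt2_nz] by (simp only: xcl_def)
  qed
qed

text \<open>Among the sixteen sets at least eight are relations: four from \<open>Q(sqrt d)\<close>,
  and their translates by the set \<open>T0\<close> that comes from \<open>Q(sqrt (2 d))\<close> and
  is independent of them. All fibres have the size of the set of relations.\<close>

lemma card_xcl: "card (xcl ` Pow Pr) \<le> 2"
proof -
  define N where "N = {S \<in> Pow Pr. xcl S = \<one>\<^bsub>C1\<^esub>}"
  obtain S1 where S1: "S1 \<subseteq> Pr" "S1 \<noteq> {}" "S1 \<noteq> Pr" "K.cls S1 = \<one>\<^bsub>K.L.C\<^esub>" using K.nontrivial_relation by blast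
  obtain T1 where T1: "T1 \<subseteq> Pr'" "T1 \<noteq> {}" "T1 \<noteq> Pr'" "K'.cls T1 = \<one>\<^bsub>K'.L.C\<^esub>" using K'.nontrivial_relation by blast
  define T0 where "T0 = T1 - {2}"
  define A where "A = {{}, Pr, S1, Pr - S1}"
  have T0: "T0 \<subseteq> Pr" "T0 \<notin> A" "xcl T0 = \<one>\<^bsub>C1\<^esub>"
    using T1(1) norm_sets_independent[OF S1(1-3) K.cls_one_norm_set[OF S1(1,4)] T1(1-3) K'.cls_one_norm_set[OF T1(1,4)]]
      xcl_one_K'[OF T1(1,4)] by (auto simp: T0_def A_def)
  have sub: "S \<subseteq> Pr" if "S \<in> A" for S using that S1(1) by (auto simp: A_def)
  note A_sdiff = sdiff_four[OF S1(1-3), folded A_def]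
  have one: "xcl S = \<one>\<^bsub>C1\<^esub>" if "S \<in> A" for S
  proof -
    have "xcl {} = \<one>\<^bsub>C1\<^esub>" "xcl Pr = \<one>\<^bsub>C1\<^esub>" "xcl S1 = \<one>\<^bsub>C1\<^esub>"
      using xcl_one_K[OF _ K.cls_empty] xcl_one_K[OF _ K.cls_Pr] xcl_one_K[OF S1(1,4)] by auto
    moreover have "xcl (Pr - S1) = \<one>\<^bsub>C1\<^esub>" using xcl_mult[OF subset_refl S1(1)] calculation xcl_mem by (simp add: A_sdiff(3))
    ultimately show ?thesis using that by (auto simp: A_def)
  qed
  have inj: "inj (sdiff S)" for S :: "int set" by (rule inj_on_inverseI[of _ "sdiff S"]) simp
  have finA: "finite A" by (simp add: A_def)
  have disj: "A \<inter> sdiff T0 ` A = {}"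
  proof -
    have "T0 \<in> A" if "sdiff T0 S \<in> A" "S \<in> A" for S
    proof -
      have "sdiff S (sdiff T0 S) = T0" by (auto simp: sdiff_def)
      then show ?thesis using A_sdiff(2)[OF that(2,1)] by simp
    qed
    then show ?thesis using T0(2) by blast
  qed
  have "A \<union> sdiff T0 ` A \<subseteq> N"
  proof -
    have "S \<in> N" if "S \<in> A" for S unfolding N_def using sub[OF that] one[OF that] by blast
    moreover have "sdiff T0 S \<in> N" if "S \<in> A" for S
    proof -
      have "xcl (sdiff T0 S) = \<one>\<^bsub>C1\<^esub>" using xcl_mult[OF T0(1) sub[OF that]] T0(3) one[OF that] by simp
      then show ?thesis unfolding N_def using sdiff_subset[OF T0(1) sub[OF that]] by blast
    qed
    ultimately show ?thesis by blast
  qed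
  then have "card (A \<union> sdiff T0 ` A) \<le> card N" by (intro card_mono) (auto simp: N_def)
  moreover have "card (A \<union> sdiff T0 ` A) = 8"
    using disj A_sdiff(1) card_image[OF inj_on_subset[OF inj subset_UNIV], of T0 A] finA
    by (subst card_Un_disjoint) simp_all
  ultimately have N8: "card N \<ge> 8" by simp
  have "card {T \<in> Pow Pr. xcl T = xcl S} = card N" if "S \<in> Pow Pr" for S
  proof -
    have S: "S \<subseteq> Pr" using that by simp
    have sq: "xcl S \<otimes>\<^bsub>C1\<^esub> xcl S = \<one>\<^bsub>C1\<^esub>" using xcl_mult[OF S S] one[of "{}"] by (simp add: A_def)
    have "{T \<in> Pow Pr. xcl T = xcl S} = sdiff S ` N"
    proof (intro equalityI subsetI)
      fix T assume "T \<in> {T \<in> Pow Pr. xcl T = xcl S}"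
      then have T: "T \<subseteq> Pr" "xcl T = xcl S" by auto
      have "sdiff S T \<in> N" using xcl_mult[OF S T(1)] T(2) sq sdiff_subset[OF S T(1)] by (simp add: N_def)
      then show "T \<in> sdiff S ` N" by (intro image_eqI[of _ _ "sdiff S T"]) simp_all
    next
      fix T assume "T \<in> sdiff S ` N"
      then obtain R where R: "R \<subseteq> Pr" "xcl R = \<one>\<^bsub>C1\<^esub>" "T = sdiff S R" by (auto simp: N_def)
      have "xcl T = xcl S" using xcl_mult[OF S R(1)] R xcl_mem[OF S] by simp
      then show "T \<in> {T \<in> Pow Pr. xcl T = xcl S}" using R(3) sdiff_subset[OF S R(1)] by simp
    qed
    then show ?thesis by (simp only: card_image[OF inj_on_subset[OF inj subset_UNIV]])
  qed
  then have "card (Pow Pr) = card N * card (xcl ` Pow Pr)" by (intro card_fibres) auto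
  moreover have "card (Pow Pr) = 16" using dist by (simp add: card_Pow)
  ultimately have "8 * card (xcl ` Pow Pr) \<le> 16" using N8 by (metis mult_le_mono1)
  then show ?thesis by simp
qed

end

lemma k_idvd_int:
  assumes q: "Factorial_Ring.prime q" and x: "x \<in> k.L.ints" "k.nm x = of_int (e * q)" "e = 1 \<or> e = -1"
    and dvd: "k.L.idvd x (of_int n)"
  shows "q dvd n"
proof -
  have q0: "q > 0" using q prime_gt_0_int by blast
  have "k.size_nm x = nat \<bar>e * q\<bar>" using x(2) by (rule k_size)
  then have sx: "k.size_nm x = nat q" using x(3) q0 by auto
  have "k.nm (of_int n) = of_int (n ^ 2)" using k.nm_F[of "of_int n"] by (simp only: Rats_of_int of_int_power)
  then have "k.size_nm (of_int n) = nat \<bar>n ^ 2\<bar>" by (rule k_size)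
  then have "nat q dvd nat (n ^ 2)" using k_size_dvd[OF x(1) k.L.ints_of_int dvd] sx by simp
  then have "int (nat q) dvd int (nat (n ^ 2))" by (simp only: of_nat_dvd_iff)
  then have "q dvd n ^ 2" using q0 by (simp only: int_nat_eq) simp
  then show ?thesis using q prime_dvd_power_int by blast
qed

lemma (in sqrt_ext) gal_image_gen2:
  assumes "a \<in> L" "b \<in> L"
  shows "gal ` L.gen2 a b = L.gen2 (gal a) (gal b)"
proof -
  have sub: "gal ` L.gen2 a b \<subseteq> L.gen2 (gal a) (gal b)" if "a \<in> L" "b \<in> L" for a b
  proof
    fix y assume "y \<in> gal ` L.gen2 a b"
    then obtain u v where uv: "u \<in> L.ints" "v \<in> L.ints" "y = gal (u * a + v * b)"
      by (auto simp: L.gen2_def)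
    then have "y = gal u * gal a + gal v * gal b" using that by (simp add: gal_add gal_mult L.mult_mem L.ints_mem)
    then show "y \<in> L.gen2 (gal a) (gal b)" using uv by (simp add: L.gen2_I gal_ints)
  qed
  show ?thesis
  proof
    show "gal ` L.gen2 a b \<subseteq> L.gen2 (gal a) (gal b)" by (rule sub[OF assms])
    have "gal ` L.gen2 (gal a) (gal b) \<subseteq> L.gen2 a b" using sub[of "gal a" "gal b"] assms by (simp add: gal_mem)
    moreover have "L.gen2 (gal a) (gal b) \<subseteq> L"
      using assms by (auto simp: L.gen2_def L.add_mem L.mult_mem gal_mem L.ints_mem)
    ultimately show "L.gen2 (gal a) (gal b) \<subseteq> gal ` L.gen2 a b"
      using gal_image_gal[of "L.gen2 (gal a) (gal b)"] image_mono[of "gal ` L.gen2 (gal a) (gal b)" "L.gen2 a b" gal] by simp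
  qed
qed

lemma (in pid_sqrt_ext) sq_ideal_unit_cong:
  assumes "sq_ideal J h" "h = g * u" "u \<in> ring_of_integers F" "inverse u \<in> ring_of_integers F" "g \<in> F" "g \<noteq> 0" "u \<noteq> 0"
  shows "sq_ideal J g"
proof (rule sq_ideal_cong[OF assms(1,5,6)])
  have "h / g = u" "g / h = inverse u" using assms(2,6,7) by (simp_all add: field_simps)
  then show "h / g \<in> L.ints" "g / h \<in> L.ints" using assms(3,4) by auto
qed

context four_primes_bits
begin

section \<open>The prime above \<open>q1\<close> and the classes of order two\<close>

definition pi1 :: complex where
  "pi1 = (SOME p. p \<in> k.L.ints \<and> (\<exists>e. (e = 1 \<or> e = -1) \<and> k.nm p = of_int (e * q1)) \<and> \<not> k.L.idvd p (k.gal p))"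

lemma pi1: "pi1 \<in> k.L.ints" "\<exists>e. (e = 1 \<or> e = -1) \<and> k.nm pi1 = of_int (e * q1)" "\<not> k.L.idvd pi1 (k.gal pi1)"
proof -
  have "\<exists>p. p \<in> k.L.ints \<and> (\<exists>e. (e = 1 \<or> e = -1) \<and> k.nm p = of_int (e * q1)) \<and> \<not> k.L.idvd p (k.gal p)"
    using k_split_prime[OF primes(1) gt_2(1) Legendre_2(1)] by blast
  then have "pi1 \<in> k.L.ints \<and> (\<exists>e. (e = 1 \<or> e = -1) \<and> k.nm pi1 = of_int (e * q1)) \<and> \<not> k.L.idvd pi1 (k.gal pi1)"
    unfolding pi1_def by (rule someI_ex)
  then show "pi1 \<in> k.L.ints" "\<exists>e. (e = 1 \<or> e = -1) \<and> k.nm pi1 = of_int (e * q1)" "\<not> k.L.idvd pi1 (k.gal pi1)"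
    by blast+
qed

lemma pi1_size: "k.size_nm pi1 = nat q1" "k.size_nm (k.gal pi1) = nat q1"
proof -
  obtain e :: int where e: "e = 1 \<or> e = -1" "k.nm pi1 = of_int (e * q1)" using pi1(2) by blast
  have "nat \<bar>e * q1\<bar> = nat q1" using e(1) gt_2(1) by auto
  then show "k.size_nm pi1 = nat q1" using k_size[OF e(2)] by simp
  then show "k.size_nm (k.gal pi1) = nat q1" using k.nm_gal[OF k.L.ints_mem[OF pi1(1)]] by (simp add: k.size_nm_def)
qed

lemma pi1_nz: "pi1 \<noteq> 0" "k.gal pi1 \<noteq> 0"
proof -
  obtain e :: int where e: "e = 1 \<or> e = -1" "k.nm pi1 = of_int (e * q1)" using pi1(2) by blast
  then have "k.nm pi1 \<noteq> 0" using gt_2(1) by auto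
  then show "pi1 \<noteq> 0" "k.gal pi1 \<noteq> 0" by (auto simp: k.nm_def)
qed

lemmas pi1_peel = k_split_peel[OF primes(1) pi1(1) pi1_size(1)]
lemmas pi1'_peel = k_split_peel[OF primes(1) k.gal_ints[OF pi1(1)] pi1_size(2)]

definition Yid :: "complex set" where "Yid = K1.L.gen2 pi1 sd"

lemma sq_ideal_Yid: "K1.sq_ideal Yid pi1"
proof -
  obtain e :: int where e: "e = 1 \<or> e = -1" "k.nm pi1 = of_int (e * q1)" using pi1(2) by blast
  define n where "n = e * (q2 * q3 * q4)"
  define m where "m = k.gal pi1 * of_int n"
  have mO: "m \<in> k.L.ints" unfolding m_def by (intro k.L.ints_mult k.L.ints_of_int k.gal_ints pi1(1))
  have ee: "e * e = 1" using e(1) by auto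
  have "pi1 * m = k.nm pi1 * of_int n" by (simp add: m_def k.nm_def)
  also have "\<dots> = of_int ((e * q1) * n)" by (simp only: e(2) of_int_mult)
  also have "(e * q1) * n = (e * e) * (q1 * (q2 * q3 * q4))" by (simp add: n_def)
  also have "\<dots> = d" unfolding ee by (simp add: d)
  finally have pm: "pi1 * m = of_int d" .
  \<comment> \<open>The prime \<open>pi1\<close> divides \<open>d\<close> exactly once: it is
    coprime to its conjugate, and \<open>q1\<close> does not divide the product of the other
    primes.\<close>
  have "\<not> k.L.idvd pi1 m"
  proof
    assume dvd: "k.L.idvd pi1 m"
    obtain u v where uv: "u \<in> k.L.ints" "v \<in> k.L.ints" "u * pi1 + v * k.gal pi1 = 1"
      using pi1_peel[OF k.gal_ints[OF pi1(1)]] pi1(3) by blast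
    have "of_int n = of_int n * (u * pi1 + v * k.gal pi1)" unfolding uv(3) by simp
    also have "\<dots> = (u * of_int n) * pi1 + v * m" by (simp add: m_def algebra_simps)
    finally have "of_int n = (u * of_int n) * pi1 + v * m" .
    moreover have "k.L.idvd pi1 ((u * of_int n) * pi1 + v * m)"
      using dvd uv by (intro k.L.idvd_add k.L.idvd_mult k.L.ints_mult k.L.ints_of_int) auto
    ultimately have "k.L.idvd pi1 (of_int n)" by simp
    then have "q1 dvd n" using k_idvd_int[OF primes(1) pi1(1) e(2,1)] by blast
    then show False using e(1) d_split(2) by (auto simp: n_def)
  qed
  then obtain u v where uv: "u \<in> k.L.ints" "v \<in> k.L.ints" "u * pi1 + v * m = 1"
    using pi1_peel[OF mO] by blast
  have sdO: "sd \<in> K1.L.ints" using K.D_ints by (simp add: K1.L.ints_iff K.L.ints_iff)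
  have "Yid \<star> Yid = K1.L.pideal pi1"
    unfolding Yid_def
    by (rule K1.L.gen2_square[OF K1.ints_F_L[OF pi1(1)] pi1_nz(1) sdO K1.ints_F_L[OF mO] K1.ints_F_L[OF uv(1)] K1.ints_F_L[OF uv(2)] _ uv(3)])
      (simp only: pm K.rt_square)
  moreover have "pi1 \<in> k.L" using pi1(1) by (rule k.L.ints_mem)
  moreover have "fractional_ideal K1.L Yid"
    unfolding Yid_def using pi1_nz(1) calculation(2) by (intro K1.L.frac_gen2) auto
  ultimately show ?thesis unfolding K1.sq_ideal_def using pi1_nz(1) by simp
qed

definition Ycl where "Ycl = K1.L.cl Yid"

lemma Yid_frac: "fractional_ideal K1.L Yid" using K1.sq_idealD(1)[OF sq_ideal_Yid] .

lemma Ycl_mem: "Ycl \<in> carrier C1" by (simp add: Ycl_def Yid_frac)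

lemma Ycl_square: "Ycl \<otimes>\<^bsub>C1\<^esub> Ycl = \<one>\<^bsub>C1\<^esub>"
proof -
  have "Ycl \<otimes>\<^bsub>C1\<^esub> Ycl = K1.L.cl (Yid \<star> Yid)" using Yid_frac by (simp add: Ycl_def K1.L.cl_mult)
  also have "\<dots> = \<one>\<^bsub>C1\<^esub>" using K1.sq_idealD[OF sq_ideal_Yid] K1.L.cl_pideal by simp
  finally show ?thesis .
qed

lemma prime_product_set:
  "(if b2 then of_int q2 else 1) * ((if b3 then of_int q3 else 1) * (if b4 then of_int q4 else 1)) =
    (of_int (\<Prod>({q. b2 \<and> q = q2} \<union> {q. b3 \<and> q = q3} \<union> {q. b4 \<and> q = q4})) :: complex)"
proof -
  have "{q. b2 \<and> q = q2} = (if b2 then {q2} else {})" "{q. b3 \<and> q = q3} = (if b3 then {q3} else {})"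
    "{q. b4 \<and> q = q4} = (if b4 then {q4} else {})" by auto
  then show ?thesis using dist by (cases b2; cases b3; cases b4) simp_all
qed

text \<open>The generator divides \<open>d\<close>, which in \<open>Q(sqrt 2)\<close> is up to sign
  the product of \<open>pi1\<close>, its conjugate and the inert primes \<open>q2\<close>,
  \<open>q3\<close>, \<open>q4\<close>. Peeling these off leaves a unit, so the generator is known
  up to the presence of each factor.\<close>

lemma two_torsion_classes:
  assumes c: "c \<in> carrier C1" "c \<otimes>\<^bsub>C1\<^esub> c = \<one>\<^bsub>C1\<^esub>"
  shows "\<exists>S\<subseteq>Pr. c = xcl S \<or> c = Ycl \<otimes>\<^bsub>C1\<^esub> xcl S"
proof -
  obtain I where I: "fractional_ideal K1.L I" "c = K1.L.cl I" using K1.L.cl_surj[OF c(1)] by blast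
  obtain J0 g0 where J0: "K1.sq_ideal J0 g0" "K1.L.cl J0 = c"
    using K1.two_torsion_sq_ideal[OF I(1) _ K1_unit_norms] c(2) I(2) by auto
  obtain J h where J: "K1.sq_ideal J h" "kk.radical h" "K1.L.cl J = c"
    using K1.sq_ideal_radical[OF J0(1)] J0(2) by auto
  have hO: "h \<in> k.L.ints" using J(2) by (simp add: kk.radical_def)
  define w where "w = (1 + sd) / 2"
  have wL: "w \<in> K1.L" unfolding w_def by (intro K1.L.divide_mem K1.L.add_mem) auto
  then have wO: "w \<in> K1.L.ints" using half_int by (simp add: w_def K1.L.ints_iff)
  have wk: "w \<notin> k.L"
  proof
    assume "w \<in> k.L"
    then have "2 * w - 1 \<in> k.L" by (intro k.L.diff_mem k.L.mult_mem) auto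
    then show False using sd_notin_k by (simp add: w_def)
  qed
  have gw: "K1.gal w = (1 - sd) / 2" using K1.gal_eq[of "1/2" "1/2"] by (simp add: w_def k.F_mem_L field_simps)
  have "w - K1.gal w = sd" unfolding gw by (simp add: w_def field_simps)
  then have dvd: "k.L.idvd h (of_int d)"
    using K1.sq_ideal_dvd_discriminant[OF J(1,2) wO wk] K.rt_square by simp
  obtain e :: int where e: "e = 1 \<or> e = -1" "k.nm pi1 = of_int (e * q1)" using pi1(2) by blast
  have ee: "e * e = 1" using e(1) by auto
  have pp: "pi1 * k.gal pi1 = of_int (e * q1)" using e(2) by (simp only: k.nm_def)
  have "(of_int d :: complex) = of_int ((e * q1) * (q2 * (q3 * (q4 * e))))"
  proof -
    have "(e * q1) * (q2 * (q3 * (q4 * e))) = (e * e) * d" by (simp add: d)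
    then show ?thesis unfolding ee by simp
  qed
  also have "\<dots> = pi1 * (k.gal pi1 * (of_int q2 * (of_int q3 * (of_int q4 * of_int e))))"
    unfolding of_int_mult[of "e * q1"] pp[symmetric] by (simp add: mult.assoc)
  finally have dvd1: "k.L.idvd h (pi1 * (k.gal pi1 * (of_int q2 * (of_int q3 * (of_int q4 * of_int e)))))" using dvd by simp
  have q0: "(of_int q2 :: complex) \<noteq> 0" "(of_int q3 :: complex) \<noteq> 0" "(of_int q4 :: complex) \<noteq> 0" using gt_2 by auto
  have g1O: "k.gal pi1 \<in> k.L.ints" by (rule k.gal_ints[OF pi1(1)])
  have "\<exists>b. \<exists>g'\<in>ring_of_integers k.L. h = (if b then pi1 else 1) * g' \<and>
      k.L.idvd g' (k.gal pi1 * (of_int q2 * (of_int q3 * (of_int q4 * of_int e))))"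
    by (rule k.L.idvd_peel_cases[OF pi1(1) pi1_nz(1) pi1_peel hO _ dvd1])
      (assumption, intro k.L.ints_mult k.L.ints_of_int g1O)
  then obtain b1 h1 where h1: "h1 \<in> k.L.ints" "h = (if b1 then pi1 else 1) * h1"
    "k.L.idvd h1 (k.gal pi1 * (of_int q2 * (of_int q3 * (of_int q4 * of_int e))))" by blast
  have "\<exists>b. \<exists>g'\<in>ring_of_integers k.L. h1 = (if b then k.gal pi1 else 1) * g' \<and>
      k.L.idvd g' (of_int q2 * (of_int q3 * (of_int q4 * of_int e)))"
    by (rule k.L.idvd_peel_cases[OF g1O pi1_nz(2) pi1'_peel h1(1) _ h1(3)])
      (assumption, intro k.L.ints_mult k.L.ints_of_int)
  then obtain b1' h1' where h1': "h1' \<in> k.L.ints" "h1 = (if b1' then k.gal pi1 else 1) * h1'"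
    "k.L.idvd h1' (of_int q2 * (of_int q3 * (of_int q4 * of_int e)))" by blast
  have "\<exists>b. \<exists>g'\<in>ring_of_integers k.L. h1' = (if b then of_int q2 else 1) * g' \<and> k.L.idvd g' (of_int q3 * (of_int q4 * of_int e))"
    by (rule k.L.idvd_peel_cases[OF k.L.ints_of_int q0(1) k_inert_peel[OF primes(2) Legendre_2(2)] h1'(1) _ h1'(3)])
      (assumption, intro k.L.ints_mult k.L.ints_of_int)
  then obtain b2 h2 where h2: "h2 \<in> k.L.ints" "h1' = (if b2 then of_int q2 else 1) * h2"
    "k.L.idvd h2 (of_int q3 * (of_int q4 * of_int e))" by blast
  have "\<exists>b. \<exists>g'\<in>ring_of_integers k.L. h2 = (if b then of_int q3 else 1) * g' \<and> k.L.idvd g' (of_int q4 * of_int e)"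
    by (rule k.L.idvd_peel_cases[OF k.L.ints_of_int q0(2) k_inert_peel[OF primes(3) Legendre_2(3)] h2(1) _ h2(3)])
      (assumption, intro k.L.ints_mult k.L.ints_of_int)
  then obtain b3 h3 where h3: "h3 \<in> k.L.ints" "h2 = (if b3 then of_int q3 else 1) * h3"
    "k.L.idvd h3 (of_int q4 * of_int e)" by blast
  have "\<exists>b. \<exists>g'\<in>ring_of_integers k.L. h3 = (if b then of_int q4 else 1) * g' \<and> k.L.idvd g' (of_int e)"
    by (rule k.L.idvd_peel_cases[OF k.L.ints_of_int q0(3) k_inert_peel[OF primes(4) Legendre_2(4)] h3(1) _ h3(3)])
      (assumption, intro k.L.ints_of_int)
  then obtain b4 u where u: "u \<in> k.L.ints" "h3 = (if b4 then of_int q4 else 1) * u" "k.L.idvd u (of_int e)" by blast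
  obtain u' where u': "u' \<in> k.L.ints" "of_int e = u * u'" using u(3) by (auto simp: k.L.idvd_def)
  have "u * (u' * of_int e) = of_int (e * e)" using u'(2) by (simp add: mult.assoc[symmetric])
  then have uu: "u * (u' * of_int e) = 1" unfolding ee by simp
  then have u0: "u \<noteq> 0" by auto
  have "inverse u = u' * of_int e" using uu by (rule inverse_unique)
  then have iu: "inverse u \<in> k.L.ints" using u'(1) by (simp add: k.L.ints_mult)
  define S where "S = {q. b2 \<and> q = q2} \<union> {q. b3 \<and> q = q3} \<union> {q. b4 \<and> q = q4}"
  have S: "S \<subseteq> Pr" "q1 \<notin> S" using dist by (auto simp: S_def)
  have insS: "insert q1 S \<subseteq> Pr" "\<Prod>(insert q1 S) = q1 * \<Prod>S"
    using S finite_subset[OF S(1)] by auto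
  have hS: "h = ((if b1 then pi1 else 1) * (if b1' then k.gal pi1 else 1) * of_int (\<Prod>S)) * u"
    unfolding h1(2) h1'(2) h2(2) h3(2) u(2) S_def prime_product_set[symmetric] by (simp only: mult.assoc)
  have S0: "(of_int (\<Prod>S) :: complex) \<noteq> 0" using K.prod_pos[OF S(1)] by (simp only: of_int_eq_0_iff)
  have pk: "pi1 \<in> k.L" "k.gal pi1 \<in> k.L" using pi1(1) g1O by (auto simp: k.L.ints_mem)
  have J1: "K1.sq_ideal J ((if b1 then pi1 else 1) * (if b1' then k.gal pi1 else 1) * of_int (\<Prod>S))"
    by (rule K1.sq_ideal_unit_cong[OF J(1) hS u(1) iu _ _ u0])
      (use pk pi1_nz S0 in \<open>cases b1; cases b1'; simp only: if_True if_False k.L.of_int_mem k.L.mult_mem k.L.one_mem mult_eq_0_iff simp_thms zero_neq_one[symmetric]\<close>)+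
  have eu: "of_int e \<in> k.L.ints" "inverse (of_int e) \<in> k.L.ints" "(of_int e :: complex) \<noteq> 0"
  proof -
    have "inverse (of_int e) = (of_int e :: complex)" using e(1) by auto
    then show "of_int e \<in> k.L.ints" "inverse (of_int e) \<in> k.L.ints" by (simp_all only: k.L.ints_of_int)
    show "(of_int e :: complex) \<noteq> 0" using e(1) by auto
  qed
  have fr: "fractional_ideal K1.L (Yid \<star> xid S)" "fractional_ideal K1.L (Yid \<star> xid (insert q1 S))"
    using Yid_frac xid_frac[OF S(1)] xid_frac[OF insS(1)] by auto
  consider "\<not> b1" "\<not> b1'" | "b1" "b1'" | "b1" "\<not> b1'" | "\<not> b1" "b1'" by blast
  then show ?thesis
  proof cases
    case 1
    then have "K1.sq_ideal J (of_int (\<Prod>S))" using J1 by (simp only: if_False mult_1_left)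
    then have "J = xid S" using sq_ideal_xid[OF S(1)] by (rule K1.sq_ideal_unique)
    then have "c = xcl S" using J(3) by (simp only: xcl_def)
    then show ?thesis using S(1) by blast
  next
    case 2
    have "pi1 * k.gal pi1 * of_int (\<Prod>S) = of_int (\<Prod>(insert q1 S)) * of_int e"
      unfolding pp insS(2) by (simp only: of_int_mult mult_ac)
    moreover have "K1.sq_ideal J (pi1 * k.gal pi1 * of_int (\<Prod>S))" using J1 2 by (simp only: if_True)
    moreover have "(of_int (\<Prod>(insert q1 S)) :: complex) \<noteq> 0" using K.prod_pos[OF insS(1)] by (simp only: of_int_eq_0_iff)
    ultimately have "K1.sq_ideal J (of_int (\<Prod>(insert q1 S)))"
      using K1.sq_ideal_unit_cong eu k.L.of_int_mem by blast
    then have "J = xid (insert q1 S)" using sq_ideal_xid[OF insS(1)] by (rule K1.sq_ideal_unique)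
    then have "c = xcl (insert q1 S)" using J(3) by (simp only: xcl_def)
    then show ?thesis using insS(1) by blast
  next
    case 3
    then have "K1.sq_ideal J (pi1 * of_int (\<Prod>S))" using J1 by (simp only: if_True if_False mult_1_right)
    then have "J = Yid \<star> xid S" using K1.sq_ideal_mult[OF sq_ideal_Yid sq_ideal_xid[OF S(1)]] by (rule K1.sq_ideal_unique)
    then have "c = Ycl \<otimes>\<^bsub>C1\<^esub> xcl S" using J(3) Yid_frac xid_frac[OF S(1)] by (simp add: xcl_def Ycl_def K1.L.cl_mult)
    then show ?thesis using S(1) by blast
  next
    case 4
    \<comment> \<open>Up to sign the conjugate of \<open>pi1\<close> is \<open>q1 / pi1\<close>, so
      its ideal comes from that of \<open>pi1\<close> and the set with \<open>q1\<close> added,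
      after division by \<open>pi1\<close>.\<close>
    have "K1.sq_ideal (K1.L.pideal (inverse pi1) \<star> (Yid \<star> xid (insert q1 S))) ((inverse pi1) ^ 2 * (pi1 * of_int (\<Prod>(insert q1 S))))"
      using pk pi1_nz by (intro K1.sq_ideal_scale K1.sq_ideal_mult sq_ideal_Yid sq_ideal_xid insS(1)) auto
    moreover have "(inverse pi1) ^ 2 * (pi1 * of_int (\<Prod>(insert q1 S))) = (k.gal pi1 * of_int (\<Prod>S)) * of_int e"
    proof -
      have "of_int q1 = of_int (e * e) * (of_int q1 :: complex)" unfolding ee by simp
      also have "\<dots> = of_int (e * q1) * of_int e" by simp
      finally have "of_int q1 = pi1 * k.gal pi1 * of_int e" unfolding pp .
      then show ?thesis unfolding insS(2) of_int_mult using pi1_nz(1) by (simp add: power2_eq_square field_simps del: of_int_prod)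
    qed
    ultimately have "K1.sq_ideal (K1.L.pideal (inverse pi1) \<star> (Yid \<star> xid (insert q1 S))) (k.gal pi1 * of_int (\<Prod>S))"
      using K1.sq_ideal_unit_cong eu k.L.mult_mem[OF pk(2) k.L.of_int_mem] no_zero_divisors[OF pi1_nz(2) S0] by blast
    moreover have "K1.sq_ideal J (k.gal pi1 * of_int (\<Prod>S))" using J1 4 by (simp only: if_True if_False mult_1_left)
    ultimately have "J = K1.L.pideal (inverse pi1) \<star> (Yid \<star> xid (insert q1 S))" by (intro K1.sq_ideal_unique)
    then have "c = K1.L.cl (Yid \<star> xid (insert q1 S))"
      using J(3) K1.L.cl_eqI[OF fr(2), of "inverse pi1"] pk pi1_nz by (simp add: K1.F_mem_L k.L.inverse_mem)
    then have "c = Ycl \<otimes>\<^bsub>C1\<^esub> xcl (insert q1 S)" using Yid_frac xid_frac[OF insS(1)] by (simp add: xcl_def Ycl_def K1.L.cl_mult)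
    then show ?thesis using insS(1) by blast
  qed
qed

lemma card_two_torsion:
  "finite {c \<in> carrier C1. c \<otimes>\<^bsub>C1\<^esub> c = \<one>\<^bsub>C1\<^esub>}" "card {c \<in> carrier C1. c \<otimes>\<^bsub>C1\<^esub> c = \<one>\<^bsub>C1\<^esub>} \<le> 4"
proof -
  define X' where "X' = xcl ` Pow Pr"
  have sub: "{c \<in> carrier C1. c \<otimes>\<^bsub>C1\<^esub> c = \<one>\<^bsub>C1\<^esub>} \<subseteq> X' \<union> (\<lambda>s. Ycl \<otimes>\<^bsub>C1\<^esub> s) ` X'"
  proof
    fix c assume "c \<in> {c \<in> carrier C1. c \<otimes>\<^bsub>C1\<^esub> c = \<one>\<^bsub>C1\<^esub>}"
    then obtain S where S: "S \<subseteq> Pr" "c = xcl S \<or> c = Ycl \<otimes>\<^bsub>C1\<^esub> xcl S" using two_torsion_classes by blast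
    then have "xcl S \<in> X'" unfolding X'_def by blast
    then show "c \<in> X' \<union> (\<lambda>s. Ycl \<otimes>\<^bsub>C1\<^esub> s) ` X'" using S(2) by blast
  qed
  have fin: "finite X'" by (simp add: X'_def)
  show "finite {c \<in> carrier C1. c \<otimes>\<^bsub>C1\<^esub> c = \<one>\<^bsub>C1\<^esub>}" by (rule finite_subset[OF sub]) (simp add: fin)
  have "card {c \<in> carrier C1. c \<otimes>\<^bsub>C1\<^esub> c = \<one>\<^bsub>C1\<^esub>} \<le> card (X' \<union> (\<lambda>s. Ycl \<otimes>\<^bsub>C1\<^esub> s) ` X')"
    by (rule card_mono[OF _ sub]) (simp add: fin)
  also have "\<dots> \<le> card X' + card ((\<lambda>s. Ycl \<otimes>\<^bsub>C1\<^esub> s) ` X')" by (rule card_Un_le)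
  also have "\<dots> \<le> card X' + card X'" using card_image_le[OF fin] by simp
  also have "\<dots> \<le> 4" using card_xcl by (simp add: X'_def)
  finally show "card {c \<in> carrier C1. c \<otimes>\<^bsub>C1\<^esub> c = \<one>\<^bsub>C1\<^esub>} \<le> 4" .
qed

lemma finite_class_group_K1: "finite (carrier C1)"
  by (rule K1.L.C.finite_of_finite_squares[OF card_two_torsion(1) finite_squares])

end

subsection \<open>The invariant of a class in \<open>\<rat>\<close> modulo norms\<close>

context four_primes_bits
begin

text \<open>The value is the rational norm of an ideal in the class, taken through
  \<open>Q(sqrt 2)\<close>, where the relative norm has a generator. It is a relation because
  generator and ideal are free: the value is determined up to sign and norms from
  \<open>K\<close>.\<close>

definition NC :: "complex set set \<Rightarrow> complex \<Rightarrow> bool" where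
  "NC c g \<longleftrightarrow> (\<exists>I a. fractional_ideal K1.L I \<and> c = K1.L.cl I \<and> a \<in> k.L \<and> a \<noteq> 0 \<and>
     I \<star> K1.gal ` I = K1.L.pideal a \<and> g = k.nm a)"

lemma NC_exists: "c \<in> carrier C1 \<Longrightarrow> \<exists>g. NC c g"
proof -
  assume "c \<in> carrier C1"
  then obtain I where I: "fractional_ideal K1.L I" "c = K1.L.cl I" using K1.L.cl_surj by blast
  then obtain a where "a \<in> k.L" "a \<noteq> 0" "I \<star> K1.gal ` I = K1.L.pideal a" using K1.relative_norm_principal by blast
  then show ?thesis using I unfolding NC_def by blast
qed

lemma NC_rat: "NC c g \<Longrightarrow> g \<in> \<rat> \<and> g \<noteq> 0"
  by (auto simp: NC_def)

lemma NC_mult: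
  assumes "NC c g" "NC c' g'"
  shows "NC (c \<otimes>\<^bsub>C1\<^esub> c') (g * g')"
proof -
  obtain I a where I: "fractional_ideal K1.L I" "c = K1.L.cl I" "a \<in> k.L" "a \<noteq> 0" "I \<star> K1.gal ` I = K1.L.pideal a" "g = k.nm a"
    using assms(1) by (auto simp: NC_def)
  obtain I' a' where I': "fractional_ideal K1.L I'" "c' = K1.L.cl I'" "a' \<in> k.L" "a' \<noteq> 0"
    "I' \<star> K1.gal ` I' = K1.L.pideal a'" "g' = k.nm a'"
    using assms(2) by (auto simp: NC_def)
  have sub: "I \<subseteq> K1.L" "I' \<subseteq> K1.L" using K1.L.frac_mem I(1) I'(1) by auto
  have "(I \<star> I') \<star> K1.gal ` (I \<star> I') = (I \<star> K1.gal ` I) \<star> (I' \<star> K1.gal ` I')"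
    unfolding K1.gal_image_iprod[OF sub] by (simp only: iprod_ac)
  also have "\<dots> = K1.L.pideal (a * a')"
    unfolding I(5) I'(5) using I(3) I'(3) by (intro K1.L.pideal_mult) auto
  finally have "(I \<star> I') \<star> K1.gal ` (I \<star> I') = K1.L.pideal (a * a')" .
  moreover have "c \<otimes>\<^bsub>C1\<^esub> c' = K1.L.cl (I \<star> I')" using I I' by (simp add: K1.L.cl_mult)
  moreover have "g * g' = k.nm (a * a')" using I I' by (simp add: k.nm_mult)
  moreover have "fractional_ideal K1.L (I \<star> I')" using I(1) I'(1) by auto
  ultimately show ?thesis
    unfolding NC_def using I(3,4) I'(3,4) by (intro exI[of _ "I \<star> I'"] exI[of _ "a * a'"]) auto
qed

lemma NC_sq_ideal:
  assumes "K1.sq_ideal J g"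
  shows "NC (K1.L.cl J) (k.nm g)"
  using K1.sq_idealD[OF assms] K1.sq_ideal_gal[OF assms] unfolding NC_def
  by (intro exI[of _ J] exI[of _ g]) simp

lemma NC_one: "NC \<one>\<^bsub>C1\<^esub> 1"
  unfolding NC_def
  by (intro exI[of _ "K1.L.ints"] exI[of _ 1]) (simp add: K1_cl_ints k.nm_def)

lemma NC_pow: "NC c g \<Longrightarrow> c \<in> carrier C1 \<Longrightarrow> NC (c [^]\<^bsub>C1\<^esub> (n :: nat)) (g ^ n)"
proof (induction n)
  case 0
  then show ?case using NC_one by simp
next
  case (Suc n)
  then show ?case using NC_mult[of "c [^]\<^bsub>C1\<^esub> n" "g ^ n" c g] by (simp add: mult.commute)
qed

text \<open>Changing the ideal by a factor \<open>b\<close> multiplies the value by the norm of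
  \<open>b\<close> to the rationals, which can equally be taken through \<open>K\<close>; changing
  the generator by a unit changes only the sign.\<close>

lemma NC_unique:
  assumes "NC c g" "NC c g'"
  shows "\<exists>z\<in>K.L. z \<noteq> 0 \<and> (g = g' * K.nm z \<or> g = - (g' * K.nm z))"
proof -
  obtain I a where I: "fractional_ideal K1.L I" "c = K1.L.cl I" "a \<in> k.L" "a \<noteq> 0" "I \<star> K1.gal ` I = K1.L.pideal a" "g = k.nm a"
    using assms(1) by (auto simp: NC_def)
  obtain I' a' where I': "fractional_ideal K1.L I'" "c = K1.L.cl I'" "a' \<in> k.L" "a' \<noteq> 0"
    "I' \<star> K1.gal ` I' = K1.L.pideal a'" "g' = k.nm a'"
    using assms(2) by (auto simp: NC_def)
  obtain b where b: "b \<in> K1.L" "b \<noteq> 0" "I = K1.L.pideal b \<star> I'"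
    using K1.L.cl_eqD[OF I(1) I'(1)] I(2) I'(2) by auto
  have fb: "fractional_ideal K1.L (K1.L.pideal b)" using b by auto
  have sub: "K1.L.pideal b \<subseteq> K1.L" "I' \<subseteq> K1.L" using K1.L.frac_mem fb I'(1) by auto
  have nb: "K1.nm b \<in> k.L" "K1.nm b \<noteq> 0" using b K1.nm_mem[OF b(1)] by auto
  have "I \<star> K1.gal ` I = (K1.L.pideal b \<star> K1.gal ` K1.L.pideal b) \<star> (I' \<star> K1.gal ` I')"
    unfolding b(3) K1.gal_image_iprod[OF sub] by (simp only: iprod_ac)
  also have "K1.L.pideal b \<star> K1.gal ` K1.L.pideal b = K1.L.pideal (K1.nm b)"
    unfolding K1.gal_image_pideal[OF b(1)] K1.nm_def using b(1) by (intro K1.L.pideal_mult) auto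
  also have "K1.L.pideal (K1.nm b) \<star> (I' \<star> K1.gal ` I') = K1.L.pideal (K1.nm b * a')"
    unfolding I'(5) using nb(1) I'(3) by (intro K1.L.pideal_mult) auto
  finally have "K1.L.pideal a = K1.L.pideal (K1.nm b * a')" unfolding I(5) .
  moreover have mem: "K1.nm b * a' \<in> k.L" "K1.nm b * a' \<noteq> 0" using nb I'(3,4) by auto
  ultimately have "k.L.pideal a = k.L.pideal (K1.nm b * a')" using K1.pideal_L_eq_iff I(3,4) by blast
  then have u: "a / (K1.nm b * a') \<in> k.L.ints" "(K1.nm b * a') / a \<in> k.L.ints"
    using k.L.pideal_eq_iff[OF I(3,4) mem] by auto
  then obtain n m where nm: "k.nm (a / (K1.nm b * a')) = of_int n" "k.nm ((K1.nm b * a') / a) = of_int m"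
    using k.nm_int by blast
  have ratio: "k.nm (a / (K1.nm b * a')) = g / (k.nm (K1.nm b) * g')" "k.nm ((K1.nm b * a') / a) = (k.nm (K1.nm b) * g') / g"
    using I(3) mem(1) nb(1) I'(3) by (simp_all add: k.nm_divide k.nm_mult I(6) I'(6))
  have nz: "g \<noteq> 0" "g' \<noteq> 0" "k.nm (K1.nm b) \<noteq> 0" using NC_rat assms nb by auto
  have "of_int (n * m) = g / (k.nm (K1.nm b) * g') * ((k.nm (K1.nm b) * g') / g)"
    unfolding of_int_mult nm[symmetric] ratio ..
  also have "\<dots> = 1" using nz by simp
  finally have "of_int (n * m) = (1 :: complex)" .
  then have "n * m = 1" by (simp only: of_int_eq_1_iff)
  then have n1: "n = 1 \<or> n = -1" using zmult_eq_1_iff by blast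
  have tr: "k.nm (K1.nm b) = K.nm (M.nm b)" "M.nm b \<in> K.L" using norm_transitivity[OF b(1)] by auto
  have "g = of_int n * (k.nm (K1.nm b) * g')" using nm(1) ratio(1) nz by (simp add: field_simps)
  then have "g = g' * K.nm (M.nm b) \<or> g = - (g' * K.nm (M.nm b))" using n1 tr(1) by auto
  moreover have "M.nm b \<noteq> 0" using nz(3) tr by auto
  ultimately show ?thesis using tr(2) by blast
qed

lemma NC_xcl: "S \<subseteq> Pr \<Longrightarrow> NC (xcl S) (of_int (\<Prod>S) ^ 2)"
proof -
  assume S: "S \<subseteq> Pr"
  have "k.nm (of_int (\<Prod>S)) = of_int (\<Prod>S) ^ 2" by (rule k.nm_F[OF Rats_of_int])
  then show ?thesis using NC_sq_ideal[OF sq_ideal_xid[OF S]] by (simp only: xcl_def)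
qed

lemma NC_Ycl: "\<exists>e. (e = 1 \<or> e = -1) \<and> NC Ycl (of_int (e * q1))"
  using pi1(2) NC_sq_ideal[OF sq_ideal_Yid] by (auto simp: Ycl_def)

lemma K_norm_scale: "z \<in> K.L \<Longrightarrow> r \<in> \<rat> \<Longrightarrow> r * z \<in> K.L \<and> K.nm (r * z) = r ^ 2 * K.nm z"
  by (auto simp: K.nm_mult K.F_mem_L K.nm_F)

text \<open>The invariant of a square is a rational square, hence a norm from \<open>K\<close>,
  while that of \<open>Ycl\<close> is \<open>q1\<close> up to sign.\<close>

lemma Ycl_not_square:
  assumes c: "c \<in> carrier C1"
  shows "c \<otimes>\<^bsub>C1\<^esub> c \<noteq> Ycl"
proof
  assume sq: "c \<otimes>\<^bsub>C1\<^esub> c = Ycl"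
  obtain e :: int where e: "e = 1 \<or> e = -1" "NC Ycl (of_int (e * q1))" using NC_Ycl by blast
  obtain g where g: "NC c g" using NC_exists[OF c] by blast
  have "NC Ycl (g * g)" using NC_mult[OF g g] sq by simp
  then obtain z where z: "z \<in> K.L" "of_int (e * q1) = g * g * K.nm z \<or> of_int (e * q1) = - (g * g * K.nm z)"
    using NC_unique[OF e(2)] by blast
  have gz: "g * z \<in> K.L" "K.nm (g * z) = g * g * K.nm z"
    using K_norm_scale[OF z(1)] NC_rat[OF g] by (auto simp: power2_eq_square)
  have "K.nm (g * z) = of_int q1 \<or> K.nm (g * z) = - of_int q1" using z(2) e(1) gz(2) by (auto simp: minus_equation_iff)
  then have "K.norm_set {q1}" unfolding K.norm_set_def using gz(1) by (intro bexI[of _ "g * z"]) auto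
  then show False using q1_not_norm by blast
qed

text \<open>An ideal of \<open>K\<^sub>1\<close> above \<open>r\<close> has a class whose odd powers cannot lie in the group generated by the
  ambiguous classes, by comparing norms.\<close>

lemma auxiliary_prime:
  "\<exists>r t. Factorial_Ring.prime r \<and> r > 2 \<and> Legendre 2 r = 1 \<and> \<not> r dvd t \<and> [t ^ 2 = d] (mod r) \<and>
    (\<forall>e z. (e = 1 \<or> e = -1) \<longrightarrow> z \<in> K.L \<longrightarrow> K.nm z \<noteq> of_int (e * r) \<and> K.nm z \<noteq> of_int (e * (r * q1)))"
proof -
  \<comment> \<open>Two of three signs agree; this provides the primes \<open>i\<close> and
    \<open>j\<close> that \<open>q1\<close> cannot distinguish.\<close>
  have "Legendre q1 q2 = Legendre q1 q3 \<or> Legendre q1 q2 = Legendre q1 q4 \<or> Legendre q1 q3 = Legendre q1 q4"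
    using pm(1) pm(2) pm(3) by linarith
  then obtain i j where ij: "i \<in> {q2, q3, q4}" "j \<in> {q2, q3, q4}" "i \<noteq> j" "Legendre q1 i = Legendre q1 j"
    using dist(4-6) by blast
  have mem: "i \<in> Pr" "j \<in> Pr" using ij by auto
  have ne: "q1 \<noteq> i" "q1 \<noteq> j" using ij(1,2) dist by auto
  have prq: "Factorial_Ring.prime q \<and> q mod 4 = 3" if "q \<in> Pr" for q using that primes mod4 by auto
  have big: "q > 2" if "q \<in> Pr" for q using that gt_2 by auto
  have "card Pr = 4" using dist by simp
  then obtain r where r: "Factorial_Ring.prime r" "r > 2" "r \<notin> Pr" "Legendre 2 r = 1" "Legendre (\<Prod>Pr) r = 1"
    "Legendre r i = - Legendre r j"
    using exists_splitting_prime[of Pr i j q1] prq mem ij(3) ne by auto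
  have "\<Prod>Pr = d" using K.D_eq by simp
  then have Ld: "Legendre d r = 1" using r(5) by simp
  then have "QuadRes r d" "\<not> r dvd d" by (auto simp: Legendre_def cong_0_iff split: if_splits)
  then obtain t where t: "[t ^ 2 = d] (mod r)" by (auto simp: QuadRes_def)
  have "\<not> r dvd t"
  proof
    assume "r dvd t"
    then have "r dvd t ^ 2" by (simp add: power2_eq_square)
    then show False using t \<open>\<not> r dvd d\<close> by (metis cong_dvd_iff)
  qed
  moreover have "K.nm z \<noteq> of_int (e * r) \<and> K.nm z \<noteq> of_int (e * (r * q1))" if e: "e = 1 \<or> e = -1" and z: "z \<in> K.L" for e z
  proof -
    have nd: "\<not> q dvd r" if "q \<in> Pr" for q
      using primes_dvd_imp_eq[of q r] prq[OF that] r(1,3) that by auto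
    have nq1: "\<not> i dvd q1" "\<not> j dvd q1" using primes_dvd_imp_eq[of _ q1] prq mem ne primes(1) by metis+
    have pi: "Factorial_Ring.prime i" "i > 2" "i mod 4 = 3" and pj: "Factorial_Ring.prime j" "j > 2" "j mod 4 = 3"
      using prq big mem by auto
    \<comment> \<open>Signs and \<open>q1\<close> have equal symbols at \<open>i\<close> and
      \<open>j\<close>, whereas those of \<open>r\<close> are opposite. So neither
      \<open>e * r\<close> nor \<open>e * (r * q1)\<close> has symbol 1 at both, as a norm
      would.\<close>
    have Le: "Legendre e i = e" "Legendre e j = e"
      using e Legendre_minus_one[OF pi] Legendre_minus_one[OF pj] pi(2) pj(2) by auto
    have v: "Legendre r j = 1 \<or> Legendre r j = -1" "Legendre q1 j = 1 \<or> Legendre q1 j = -1"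
      using Legendre_values nd[OF mem(2)] nq1(2) by auto
    have ndr: "\<not> i dvd e * r" "\<not> j dvd e * r" "\<not> i dvd e * (r * q1)" "\<not> j dvd e * (r * q1)"
    proof -
      have "\<not> i dvd e" "\<not> j dvd e" using e pi(2) pj(2) zdvd_not_zless[of 1 i] zdvd_not_zless[of 1 j] by auto
      then show "\<not> i dvd e * r" "\<not> j dvd e * r" "\<not> i dvd e * (r * q1)" "\<not> j dvd e * (r * q1)"
        unfolding prime_dvd_mult_iff[OF pi(1)] prime_dvd_mult_iff[OF pj(1)]
        using nd[OF mem(1)] nd[OF mem(2)] nq1 by blast+
    qed
    have "False" if "K.nm z = of_int (e * r)"
      using K.norm_Legendre[OF mem(1) z that ndr(1)] K.norm_Legendre[OF mem(2) z that ndr(2)] v e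
      unfolding Legendre_mult[OF pi(1,2)] Legendre_mult[OF pj(1,2)] Le r(6) by auto
    moreover have "False" if "K.nm z = of_int (e * (r * q1))"
      using K.norm_Legendre[OF mem(1) z that ndr(3)] K.norm_Legendre[OF mem(2) z that ndr(4)] v e
      unfolding Legendre_mult[OF pi(1,2)] Legendre_mult[OF pj(1,2)] Le r(6) ij(4) by auto
    ultimately show ?thesis by blast
  qed
  ultimately show ?thesis using r(1,2,4) t by blast
qed

text \<open>If the 2-part were elementary, the class \<open>x\<close> would be one of the listed
  ambiguous ones. These have invariant 1 or \<open>q1\<close> up to sign, squares and norms, so
  \<open>r\<close> or \<open>r * q1\<close> would be a norm up to sign.\<close>

lemma exists_order_four:
  "\<exists>c\<in>carrier C1. c [^]\<^bsub>C1\<^esub> (4 :: nat) = \<one>\<^bsub>C1\<^esub> \<and> c \<otimes>\<^bsub>C1\<^esub> c \<noteq> \<one>\<^bsub>C1\<^esub>"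
proof (rule ccontr)
  assume "\<not> ?thesis"
  then have none: "c \<otimes>\<^bsub>C1\<^esub> c = \<one>\<^bsub>C1\<^esub>"
    if "c \<in> carrier C1" "c [^]\<^bsub>C1\<^esub> (4 :: nat) = \<one>\<^bsub>C1\<^esub>" for c using that by blast
  obtain r t where r: "Factorial_Ring.prime r" "r > 2" "Legendre 2 r = 1" "\<not> r dvd t" "[t ^ 2 = d] (mod r)"
    and not_norm: "\<And>e z. e = 1 \<or> e = -1 \<Longrightarrow> z \<in> K.L \<Longrightarrow> K.nm z \<noteq> of_int (e * r) \<and> K.nm z \<noteq> of_int (e * (r * q1))"
    using auxiliary_prime by metis
  obtain rho e where rho: "rho \<in> k.L.ints" "e = 1 \<or> e = -1" "k.nm rho = of_int (e * r)"
    using k_split_prime[OF r(1-3)] by blast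
  have ee: "e * e = 1" using rho(2) by auto
  have rg: "rho * k.gal rho = of_int (e * r)" using rho(3) by (simp only: k.nm_def)
  have rho0: "rho \<noteq> 0"
  proof
    assume "rho = 0"
    then have "(of_int (e * r) :: complex) = 0" using rg by simp
    then show False using rho(2) r(2) by (simp only: of_int_eq_0_iff) auto
  qed
  \<comment> \<open>As \<open>t ^ 2\<close> is congruent to \<open>d\<close> modulo
    \<open>r\<close>, the product of \<open>b\<close> with its conjugate \<open>b'\<close> is
    divisible by \<open>rho\<close>, while \<open>b + b' = 2 * t\<close> is prime to
    \<open>r\<close>. So the ideal (rho, b) has relative norm (rho).\<close>
  define b where "b = of_int t - sd"
  define b' where "b' = of_int t + sd"
  have sdO: "sd \<in> K1.L.ints" using K.D_ints by (simp add: K1.L.ints_iff K.L.ints_iff)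
  have bO: "b \<in> K1.L.ints" "b' \<in> K1.L.ints"
    unfolding b_def b'_def by (intro K1.L.ints_diff K1.L.ints_add K1.L.ints_of_int sdO)+
  have rhoO: "rho \<in> K1.L.ints" "k.gal rho \<in> K1.L.ints" using rho(1) by auto
  have gal: "K1.gal rho = rho" "K1.gal b = b'"
    using K1.gal_F[OF k.L.ints_mem[OF rho(1)]] sdO by (simp_all add: b_def b'_def K1.gal_diff K1.L.ints_mem)
  obtain m where m: "t ^ 2 - d = r * m" using r(5) by (auto simp: cong_iff_dvd_diff elim: dvdE)
  have "b * b' = of_int (t ^ 2 - d)" using K.rt_square by (simp add: b_def b'_def power2_eq_square algebra_simps)
  also have "\<dots> = of_int ((e * r) * (e * m))"
  proof -
    have "(e * r) * (e * m) = (e * e) * (r * m)" by simp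
    also have "\<dots> = t ^ 2 - d" unfolding m ee by simp
    finally show ?thesis by (simp only:)
  qed
  also have "\<dots> = rho * (k.gal rho * of_int (e * m))" unfolding of_int_mult[of "e * r"] rg[symmetric] by (simp only: mult.assoc)
  finally have bb: "b * b' = rho * (k.gal rho * of_int (e * m))" .
  have "K1.L.idvd rho (b * b')" by (rule K1.L.idvdI[OF _ bb]) (intro K1.L.ints_mult rhoO K1.L.ints_of_int)
  moreover obtain u v where uv: "u * r + v * (2 * t) = 1"
  proof -
    have "\<not> r dvd 2" using r(2) zdvd_imp_le by fastforce
    then have "\<not> r dvd 2 * t" using r(1,4) by (simp add: prime_dvd_mult_iff)
    then have "coprime r (2 * t)" using prime_imp_coprime r(1) by blast
    then show ?thesis using that bezout_int[of r "2 * t"] by auto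
  qed
  moreover have "(of_int (u * e) * k.gal rho) * rho + of_int v * (b + b') = 1"
  proof -
    have "(of_int (u * e) * k.gal rho) * rho + of_int v * (b + b') = of_int (u * e) * (rho * k.gal rho) + of_int v * of_int (2 * t)"
      by (simp add: b_def b'_def mult_ac)
    also have "\<dots> = of_int (u * (e * e) * r + v * (2 * t))" unfolding rg by (simp add: mult_ac)
    also have "u * (e * e) * r + v * (2 * t) = 1" unfolding ee using uv by simp
    finally show ?thesis by simp
  qed
  ultimately have "K1.L.gen2 rho b \<star> K1.L.gen2 rho b' = K1.L.pideal rho"
    by (intro K1.L.gen2_conjugate[OF rhoO(1) rho0 bO, of "of_int (u * e) * k.gal rho" "of_int v"])
      (auto intro: rhoO K1.L.ints_mult)
  define I where "I = K1.L.gen2 rho b"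
  have I: "fractional_ideal K1.L I"
    unfolding I_def using rhoO(1) bO(1) rho0 by (intro K1.L.frac_gen2) (auto simp: K1.L.ints_mem)
  have "K1.gal ` I = K1.L.gen2 rho b'"
    unfolding I_def using K1.gal_image_gen2[of rho b] rhoO(1) bO(1) by (simp add: gal K1.L.ints_mem)
  then have "I \<star> K1.gal ` I = K1.L.pideal rho"
    using \<open>K1.L.gen2 rho b \<star> K1.L.gen2 rho b' = K1.L.pideal rho\<close> by (simp add: I_def)
  then have NCI: "NC (K1.L.cl I) (of_int (e * r))"
    unfolding NC_def using I rho0 k.L.ints_mem[OF rho(1)] rho(3) by (intro exI[of _ I] exI[of _ rho]) auto
  obtain n :: nat where n: "odd n" "\<forall>c\<in>carrier C1. c [^]\<^bsub>C1\<^esub> (4 * n) = \<one>\<^bsub>C1\<^esub>"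
    using class_exponent by blast
  obtain l where l: "n = 2 * l + 1" using n(1) by (elim oddE)
  have cI: "K1.L.cl I \<in> carrier C1" using I by simp
  \<comment> \<open>The power \<open>n\<close> kills the odd part of the class. As \<open>n\<close>
    is odd, the invariant is still \<open>e * r\<close> up to a rational square.\<close>
  define x where "x = K1.L.cl I [^]\<^bsub>C1\<^esub> n"
  have xC: "x \<in> carrier C1" using cI by (simp add: x_def)
  have "x [^]\<^bsub>C1\<^esub> (4 :: nat) = K1.L.cl I [^]\<^bsub>C1\<^esub> (4 * n)"
    unfolding x_def K1.L.C.nat_pow_pow[OF cI] by (simp only: mult.commute)
  then have "x [^]\<^bsub>C1\<^esub> (4 :: nat) = \<one>\<^bsub>C1\<^esub>" using n(2) cI by simp
  then have "x \<otimes>\<^bsub>C1\<^esub> x = \<one>\<^bsub>C1\<^esub>" by (rule none[OF xC])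
  then obtain S where S: "S \<subseteq> Pr" "x = xcl S \<or> x = Ycl \<otimes>\<^bsub>C1\<^esub> xcl S" using two_torsion_classes[OF xC] by blast
  define W where "W = (of_int r :: complex) ^ l"
  define A where "A = (of_int (e * r) :: complex)"
  define P where "P = (of_int (\<Prod>S) :: complex)"
  have W: "W \<noteq> 0" "W \<in> \<rat>" using r(2) by (simp_all add: W_def)
  have PQ: "P \<in> \<rat>" unfolding P_def by (rule Rats_of_int)
  have "A ^ n = A * W ^ 2"
  proof -
    have "(A ^ 2) ^ l = (of_int ((e * e) * r ^ 2)) ^ l" by (simp add: A_def power2_eq_square mult_ac)
    then have "(A ^ 2) ^ l = W ^ 2" unfolding ee by (simp add: W_def power_mult[symmetric] mult.commute)
    then show ?thesis by (simp add: l power_mult)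
  qed
  then have NCx: "NC x (A * W ^ 2)" using NC_pow[OF NCI cI, of n] by (simp add: x_def A_def)
  have NCS: "NC (xcl S) (P ^ 2)" using NC_xcl[OF S(1)] by (simp only: P_def)
  from S(2) show False
  proof
    assume "x = xcl S"
    then obtain z where z: "z \<in> K.L" "A * W ^ 2 = P ^ 2 * K.nm z \<or> A * W ^ 2 = - (P ^ 2 * K.nm z)"
      using NC_unique[OF NCx] NCS by blast
    have y: "(P / W) * z \<in> K.L" "K.nm ((P / W) * z) = (P / W) ^ 2 * K.nm z"
      using K_norm_scale[OF z(1), of "P / W"] PQ W by auto
    have "(P / W) ^ 2 * K.nm z = A \<or> (P / W) ^ 2 * K.nm z = - A"
      using z(2) W(1) by (auto simp: power_divide field_simps)
    then have "K.nm ((P / W) * z) = of_int (e * r) \<or> K.nm ((P / W) * z) = of_int (- e * r)"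
      unfolding y(2) A_def by simp
    then show False using not_norm[OF _ y(1), of e] not_norm[OF _ y(1), of "- e"] rho(2) by auto
  next
    assume x: "x = Ycl \<otimes>\<^bsub>C1\<^esub> xcl S"
    obtain e1 :: int where e1: "e1 = 1 \<or> e1 = -1" "NC Ycl (of_int (e1 * q1))" using NC_Ycl by blast
    define B where "B = (of_int (e1 * q1) :: complex)"
    have "NC x (B * P ^ 2)" using NC_mult[OF e1(2) NCS] x by (simp only: B_def)
    then obtain z where z: "z \<in> K.L" "A * W ^ 2 = B * P ^ 2 * K.nm z \<or> A * W ^ 2 = - (B * P ^ 2 * K.nm z)"
      using NC_unique[OF NCx] by blast
    have BQ: "B \<in> \<rat>" unfolding B_def by (rule Rats_of_int)
    have y: "(B * P / W) * z \<in> K.L" "K.nm ((B * P / W) * z) = (B * P / W) ^ 2 * K.nm z"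
      using K_norm_scale[OF z(1), of "B * P / W"] BQ PQ W by auto
    have "(B * P / W) ^ 2 * K.nm z = B * (B * P ^ 2 * K.nm z) / W ^ 2"
      by (simp add: power2_eq_square)
    moreover have "B * (A * W ^ 2) / W ^ 2 = B * A" using W(1) by simp
    moreover have "B * (- (A * W ^ 2)) / W ^ 2 = - (B * A)" using W(1) by simp
    ultimately have "K.nm ((B * P / W) * z) = B * A \<or> K.nm ((B * P / W) * z) = - (B * A)"
      using z(2) unfolding y(2) by (metis minus_minus)
    moreover have "B * A = of_int ((e1 * e) * (r * q1))" "- (B * A) = of_int ((- (e1 * e)) * (r * q1))"
      by (simp_all add: A_def B_def mult_ac)
    ultimately show False
      using not_norm[OF _ y(1), of "e1 * e"] not_norm[OF _ y(1), of "- (e1 * e)"] rho(2) e1(1) by auto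
  qed
qed

lemma K1_two_class_group: "two_class_group K1.L \<cong> integer_mod_group 2 \<times>\<times> integer_mod_group 4"
proof -
  define A where "A = {c \<in> carrier C1. \<exists>n. c [^]\<^bsub>C1\<^esub> ((2::nat) ^ n) = \<one>\<^bsub>C1\<^esub>}"
  have sub: "subgroup A C1" unfolding A_def by (rule K1.L.C.torsion_subgroup)
  interpret A: comm_group "C1\<lparr>carrier := A\<rparr>" by (rule K1.L.C.subgroup_comm_group[OF sub])
  have pow: "c [^]\<^bsub>C1\<lparr>carrier := A\<rparr>\<^esub> n = c [^]\<^bsub>C1\<^esub> n" for c and n :: nat
    by (rule K1.L.C.nat_pow_consistent[symmetric])
  obtain n :: nat where n: "odd n" "\<forall>c\<in>carrier C1. c [^]\<^bsub>C1\<^esub> (4 * n) = \<one>\<^bsub>C1\<^esub>"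
    using class_exponent by blast
  \<comment> \<open>The order of the fourth power divides the odd number \<open>n\<close> as well as
    a power of 2.\<close>
  have exp: "c [^]\<^bsub>C1\<^esub> (4::nat) = \<one>\<^bsub>C1\<^esub>" if "c \<in> A" for c
  proof -
    obtain j where c: "c \<in> carrier C1" and j: "c [^]\<^bsub>C1\<^esub> ((2::nat) ^ j) = \<one>\<^bsub>C1\<^esub>" using \<open>c \<in> A\<close> by (auto simp: A_def)
    define y where "y = c [^]\<^bsub>C1\<^esub> (4::nat)"
    have y: "y \<in> carrier C1" using c by (simp add: y_def)
    have "y [^]\<^bsub>C1\<^esub> n = \<one>\<^bsub>C1\<^esub>" using n(2) c by (simp add: y_def K1.L.C.nat_pow_pow)
    then have 1: "K1.L.C.ord y dvd n" using K1.L.C.pow_eq_id[OF y] by blast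
    have "y [^]\<^bsub>C1\<^esub> ((2::nat) ^ j) = (c [^]\<^bsub>C1\<^esub> ((2::nat) ^ j)) [^]\<^bsub>C1\<^esub> (4::nat)"
      unfolding y_def K1.L.C.nat_pow_pow[OF c] by (simp only: mult.commute)
    then have "y [^]\<^bsub>C1\<^esub> ((2::nat) ^ j) = \<one>\<^bsub>C1\<^esub>" using j by simp
    then have 2: "K1.L.C.ord y dvd 2 ^ j" using K1.L.C.pow_eq_id[OF y] by blast
    have "coprime n (2 ^ j)" using n(1) by simp
    then have "K1.L.C.ord y = 1" using 1 2 coprime_common_divisor_nat by blast
    then show ?thesis using K1.L.C.pow_ord_eq_1[OF y] y unfolding y_def by simp
  qed
  have mem: "c \<in> A" if "c \<in> carrier C1" "c [^]\<^bsub>C1\<^esub> (4::nat) = \<one>\<^bsub>C1\<^esub>" for c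
  proof -
    have "c [^]\<^bsub>C1\<^esub> ((2::nat) ^ 2) = \<one>\<^bsub>C1\<^esub>" using that(2) by simp
    then show ?thesis unfolding A_def using that(1) by blast
  qed
  have sqA: "{c \<in> A. c \<otimes>\<^bsub>C1\<^esub> c = \<one>\<^bsub>C1\<^esub>} = {c \<in> carrier C1. c \<otimes>\<^bsub>C1\<^esub> c = \<one>\<^bsub>C1\<^esub>}"
    using mem by (auto simp: K1.L.C.pow_2_4 A_def)
  have YA: "Ycl \<in> A" using mem[OF Ycl_mem] Ycl_square by (simp add: K1.L.C.pow_2_4 Ycl_mem)
  obtain x where x: "x \<in> carrier C1" "x [^]\<^bsub>C1\<^esub> (4 :: nat) = \<one>\<^bsub>C1\<^esub>" "x \<otimes>\<^bsub>C1\<^esub> x \<noteq> \<one>\<^bsub>C1\<^esub>"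
    using exists_order_four by blast
  have AC: "A \<subseteq> carrier C1" by (auto simp: A_def)
  have hyps: "\<And>c. c \<in> carrier (C1\<lparr>carrier := A\<rparr>) \<Longrightarrow> c [^]\<^bsub>C1\<lparr>carrier := A\<rparr>\<^esub> (4::nat) = \<one>\<^bsub>C1\<lparr>carrier := A\<rparr>\<^esub>"
    "finite {c \<in> carrier (C1\<lparr>carrier := A\<rparr>). c \<otimes>\<^bsub>C1\<lparr>carrier := A\<rparr>\<^esub> c = \<one>\<^bsub>C1\<lparr>carrier := A\<rparr>\<^esub>}"
    "card {c \<in> carrier (C1\<lparr>carrier := A\<rparr>). c \<otimes>\<^bsub>C1\<lparr>carrier := A\<rparr>\<^esub> c = \<one>\<^bsub>C1\<lparr>carrier := A\<rparr>\<^esub>} \<le> 4"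
    "Ycl \<in> carrier (C1\<lparr>carrier := A\<rparr>)" "Ycl \<otimes>\<^bsub>C1\<lparr>carrier := A\<rparr>\<^esub> Ycl = \<one>\<^bsub>C1\<lparr>carrier := A\<rparr>\<^esub>"
    "\<And>c. c \<in> carrier (C1\<lparr>carrier := A\<rparr>) \<Longrightarrow> c \<otimes>\<^bsub>C1\<lparr>carrier := A\<rparr>\<^esub> c \<noteq> Ycl"
    "x \<in> carrier (C1\<lparr>carrier := A\<rparr>)" "x \<otimes>\<^bsub>C1\<lparr>carrier := A\<rparr>\<^esub> x \<noteq> \<one>\<^bsub>C1\<lparr>carrier := A\<rparr>\<^esub>"
    using exp card_two_torsion YA Ycl_square Ycl_not_square AC mem[OF x(1,2)] x(3)
    by (simp_all add: pow sqA subset_iff)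
  have card: "card A = 2 ^ 3" using A.iso_Z2_Z4(1)[OF hyps] by simp
  have "two_class_group K1.L = C1\<lparr>carrier := A\<rparr>"
    by (rule K1.L.two_class_group_eq(1)[OF finite_class_group_K1 A_def[symmetric] card])
  then show ?thesis using A.iso_Z2_Z4(2)[OF hyps] by simp
qed

end

theorem theorem1p3:
  fixes q1 q2 q3 q4 d :: int and K K' K1 :: "complex set"
  assumes primes: "Factorial_Ring.prime q1" "Factorial_Ring.prime q2" "Factorial_Ring.prime q3" "Factorial_Ring.prime q4"
    and dist: "q1 \<noteq> q2" "q1 \<noteq> q3" "q1 \<noteq> q4" "q2 \<noteq> q3" "q2 \<noteq> q4" "q3 \<noteq> q4"
    and cong: "[q1 = 7] (mod 8)" "[q2 = 3] (mod 8)" "[q3 = 3] (mod 8)" "[q4 = 3] (mod 8)"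
    and d: "d = q1 * q2 * q3 * q4"
    and K: "K = complex_adjoin {complex_of_real (sqrt (real_of_int d))}"
    and K': "K' = complex_adjoin {complex_of_real (sqrt (real_of_int (2 * d)))}"
    and K1: "K1 = complex_adjoin {complex_of_real (sqrt 2), complex_of_real (sqrt (real_of_int d))}"
    and symbols:
      "(Legendre q1 q3 = 1 \<and> Legendre q2 q3 = 1 \<and> Legendre q4 q2 = 1 \<and> Legendre q4 q1 = 1 \<and>
          Legendre q4 q3 = -1) \<or>
       (Legendre q1 q3 = -1 \<and> Legendre q2 q3 = -1 \<and> Legendre q4 q2 = -1 \<and> Legendre q4 q1 = -1 \<and>
          Legendre q4 q3 = 1) \<or>
       (Legendre (q1 * q2) q3 = -1 \<and> Legendre (q1 * q2) q4 = -1 \<and>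
          Legendre q2 q3 = Legendre q1 q4 \<and> Legendre q1 q4 = Legendre q3 q4) \<or>
       (Legendre (q1 * q2) q3 = 1 \<and> Legendre (q1 * q2) q4 = -1 \<and>
          Legendre q2 q3 = Legendre q2 q4 \<and> Legendre q1 q2 = Legendre q4 q3) \<or>
       (Legendre (q1 * q2) q3 = -1 \<and> Legendre (q1 * q2) q4 = 1 \<and>
          Legendre q2 q3 = Legendre q1 q4 \<and> Legendre q1 q2 = Legendre q3 q4) \<or>
       (Legendre q1 q3 = 1 \<and> Legendre q2 q3 = 1 \<and> Legendre q1 q4 = 1 \<and> Legendre q2 q4 = -1 \<and>
          Legendre q1 q2 = -1) \<or>
       (Legendre q1 q3 = -1 \<and> Legendre q2 q3 = -1 \<and> Legendre q1 q4 = -1 \<and> Legendre q2 q4 = 1 \<and>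
          Legendre q1 q2 = 1 \<and> Legendre q3 q4 = 1) \<or>
       (Legendre q1 q3 = 1 \<and> Legendre q2 q3 = -1 \<and> Legendre q1 q4 = 1 \<and> Legendre q2 q4 = 1 \<and>
          Legendre q1 q2 = -1) \<or>
       (Legendre q1 q3 = -1 \<and> Legendre q2 q3 = 1 \<and> Legendre q1 q4 = -1 \<and> Legendre q2 q4 = -1 \<and>
          Legendre q1 q2 = 1 \<and> Legendre q3 q4 = -1)"
  shows "two_class_group K \<cong> integer_mod_group 2 \<times>\<times> integer_mod_group 2 \<and>
         two_class_group K' \<cong> integer_mod_group 2 \<times>\<times> integer_mod_group 2 \<times>\<times> integer_mod_group 2 \<and>
         two_class_group K1 \<cong> integer_mod_group 2 \<times>\<times> integer_mod_group 4"
proof -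
  \<comment> \<open>All four primes are 3 modulo 4, so reciprocity negates every symbol on
    exchanging its entries. Each case can thus be expressed by the symbols of \<open>qi\<close> over
    \<open>qj\<close> with i < j, and becomes one disjunct of \<open>four_bits\<close>.\<close>
  have bits: "four_bits (Legendre q1 q2 = 1) (Legendre q1 q3 = 1) (Legendre q1 q4 = 1) (Legendre q2 q3 = 1) (Legendre q2 q4 = 1)
      (Legendre q3 q4 = 1)"
  proof -
    interpret four_primes q1 q2 q3 q4 d by (rule four_primes.intro[OF primes dist cong d])
    have sg: "x = -1 \<longleftrightarrow> \<not> x = 1" "- x = 1 \<longleftrightarrow> \<not> x = 1" "- x = - 1 \<longleftrightarrow> x = 1" if "x = 1 \<or> x = -1" for x :: int
      using that by auto
    have ml: "x * y = 1 \<longleftrightarrow> (x = 1) = (y = 1)" "x * y = -1 \<longleftrightarrow> (x = 1) \<noteq> (y = 1)" "x = y \<longleftrightarrow> (x = 1) = (y = 1)"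
      "x = - y \<longleftrightarrow> (x = 1) \<noteq> (y = 1)" if "x = 1 \<or> x = -1" "y = 1 \<or> y = -1" for x y :: int
      using that by auto
    show ?thesis
      using symbols
      unfolding flips Legendre_mult[OF primes(3) gt_2(3)] Legendre_mult[OF primes(4) gt_2(4)]
        ml(1,2)[OF pm(2) pm(4)] ml(1,2)[OF pm(3) pm(5)] ml(3)[OF pm(4) pm(3)] ml(3)[OF pm(3) pm(6)] ml(3)[OF pm(4) pm(5)]
        ml(4)[OF pm(1) pm(6)] ml(3)[OF pm(1) pm(6)] pm(1)[THEN sg(1)] pm(2)[THEN sg(1)] pm(3)[THEN sg(1)]
        pm(4)[THEN sg(1)] pm(5)[THEN sg(1)] pm(6)[THEN sg(1)] pm(3)[THEN sg(2)] pm(5)[THEN sg(2)] pm(6)[THEN sg(2)]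
        pm(3)[THEN sg(3)] pm(5)[THEN sg(3)] pm(6)[THEN sg(3)] four_bits_def
      by argo
  qed
  interpret S: four_primes_bits q1 q2 q3 q4 d
    by (rule four_primes_bits.intro[OF four_primes.intro[OF primes dist cong d] four_primes_bits_axioms.intro[OF bits]])
  have "K = S.K.L" using S.adjoin_sd by (simp add: K S.sd_def)
  moreover have "K' = S.K'.L" using S.adjoin_sd' by (simp add: K' S.sd'_def)
  moreover have "K1 = S.K1.L" using S.adjoin_sqrt2_sd by (simp add: K1 S.sd_def sqrt2_def)
  ultimately show ?thesis using S.K_two_class_group S.K'_two_class_group S.K1_two_class_group by simp
qed

end
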